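(* Let $0<t\le\pi$ and let $\delta$ be a real number. The function $\theta\mapsto(t-\theta)_+^\delta$ on $[0,\pi]$ is strictly positive definite on each of the following compact two-point homogeneous spaces, under the stated condition on $\delta$: (1) the real projective space $\mathbb{P}^d(\mathbb{R})$, $d=3,4,5,\dots$, if $\delta\ge\lceil\frac{d+1}{2}\rceil$; (2) the complex projective space $\mathbb{P}^d(\mathbb{C})$, $d=4,6,8,\dots$, if $\delta\ge\lceil\frac{d+1}{2}\rceil$; (3) the quaternionic projective space $\mathbb{P}^d(\mathbb{H})$, $d=8,12,16,\dots$, if $\delta\ge\lceil\frac{d+1}{2}\rceil$; (4) the Cayley projective plane $\mathbb{P}^{16}(\mathrm{Cay})$, if $\delta\ge 9$.
   Context: The superscript $d$ is the real dimension of the space: $\mathbb{P}^d(\mathbb{R})$, $\mathbb{P}^d(\mathbb{C})$, $\mathbb{P}^d(\mathbb{H})$ are the spaces of lines in $\mathbb{R}^{d+1}$, $\mathbb{C}^{d/2+1}$, $\mathbb{H}^{d/4+1}$ respectively. Each space $M$ carries its invariant geodesic distance $\mathrm{dist}$, normalized so that the diameter is $\pi$: for the first three families, $\mathrm{dist}([x],[y])=2\arccos|\langle x,y\rangle|$ for unit representatives $x,y$; for the Cayley plane, viewed as the set of trace-one idempotents $P$ in the Jordan algebra of $3\times3$ Hermitian octonionic matrices, $\cos^2(\mathrm{dist}(P,Q)/2)=\mathrm{tr}(P\circ Q)$. A continuous function $g:[0,\pi]\to\mathbb{R}$ is strictly positive definite on $M$ if for every $N\in\mathbb{N}$ and all distinct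 points $x_1,\dots,x_N\in M$ the $N\times N$ matrix $[g(\mathrm{dist}(x_i,x_j))]_{i,j=1}^N$ is positive definite. Here $(t-\theta)_+^\delta=(t-\theta)^\delta$ if $\theta\le t$ and $0$ if $\theta>t$. *)

theory Defs
  imports "HOL-Analysis.Analysis"
begin

section \<open>Quaternions and octonions\<close>

text \<open>
  Both algebras are obtained by Cayley--Dickson doubling with the convention
  \<open>(a, b) (c, d) = (a c - d\<^sup>* b, d a + b c\<^sup>*)\<close> and \<open>(a, b)\<^sup>* = (a\<^sup>*, - b)\<close>.  Addition, real scaling
  and the (Euclidean) norm are those of the product types.
\<close>

type_synonym quat = "complex \<times> complex"

definition qmul :: "quat \<Rightarrow> quat \<Rightarrow> quat" where
  "qmul p q = (fst p * fst q - cnj (snd q) * snd p, snd q * fst p + snd p * cnj (fst q))"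

definition qcnj :: "quat \<Rightarrow> quat" where
  "qcnj p = (cnj (fst p), - snd p)"

type_synonym oct = "quat \<times> quat"

definition omul :: "oct \<Rightarrow> oct \<Rightarrow> oct" where
  "omul a b = (qmul (fst a) (fst b) - qmul (qcnj (snd b)) (snd a),
               qmul (snd b) (fst a) + qmul (snd a) (qcnj (fst b)))"

definition ocnj :: "oct \<Rightarrow> oct" where
  "ocnj a = (qcnj (fst a), - snd a)"

definition oct_of_real :: "real \<Rightarrow> oct" where
  "oct_of_real r = ((complex_of_real r, 0), (0, 0))"

definition ore :: "oct \<Rightarrow> real" where
  "ore a = Re (fst (fst a))"


section \<open>Projective spaces over the reals, the complex numbers and the quaternions\<close>

text \<open>
  The parameters \<open>mul\<close> and \<open>cj\<close> are the multiplication and the conjugation of the scalars.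
  Over the noncommutative quaternions, lines are left lines \<open>{c x | c}\<close>; correspondingly the
  Hermitian product is \<open>\<langle>x, y\<rangle> = \<Sum>\<^sub>i x\<^sub>i y\<^sub>i\<^sup>*\<close>, which satisfies \<open>\<langle>c x, d y\<rangle> = c \<langle>x, y\<rangle> d\<^sup>*\<close>.
\<close>

definition line :: "('a \<Rightarrow> 'a \<Rightarrow> 'a) \<Rightarrow> 'a ^ 'n \<Rightarrow> ('a ^ 'n) set" where
  "line mul x = range (\<lambda>c. \<chi> i. mul c (x $ i))"

definition herm :: "('a \<Rightarrow> 'a \<Rightarrow> 'a) \<Rightarrow> ('a \<Rightarrow> 'a) \<Rightarrow> 'a ^ 'n \<Rightarrow> 'a ^ 'n \<Rightarrow> 'a::comm_monoid_add" where
  "herm mul cj x y = (\<Sum>i\<in>UNIV. mul (x $ i) (cj (y $ i)))"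

definition proj_space :: "('a \<Rightarrow> 'a \<Rightarrow> 'a) \<Rightarrow> ('a::zero ^ 'n) set set" where
  "proj_space mul = {line mul x | x. x \<noteq> 0}"

text \<open>The choice of unit representatives is immaterial, see \<open>proj_dist_line\<close> below.\<close>

definition proj_dist ::
  "('a \<Rightarrow> 'a \<Rightarrow> 'a) \<Rightarrow> ('a \<Rightarrow> 'a) \<Rightarrow> ('a::real_normed_vector ^ 'n) set \<Rightarrow> ('a ^ 'n) set \<Rightarrow> real" where
  "proj_dist mul cj L M =
     (let x = (SOME x. x \<in> L \<and> norm x = 1); y = (SOME y. y \<in> M \<and> norm y = 1)
      in 2 * arccos (norm (herm mul cj x y)))"

abbreviation real_proj_space :: "(real ^ 'n) set set" where
  "real_proj_space \<equiv> proj_space (*)"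

abbreviation real_proj_dist :: "(real ^ 'n) set \<Rightarrow> (real ^ 'n) set \<Rightarrow> real" where
  "real_proj_dist \<equiv> proj_dist (*) (\<lambda>a. a)"

abbreviation complex_proj_space :: "(complex ^ 'n) set set" where
  "complex_proj_space \<equiv> proj_space (*)"

abbreviation complex_proj_dist :: "(complex ^ 'n) set \<Rightarrow> (complex ^ 'n) set \<Rightarrow> real" where
  "complex_proj_dist \<equiv> proj_dist (*) cnj"

abbreviation quat_proj_space :: "(quat ^ 'n) set set" where
  "quat_proj_space \<equiv> proj_space qmul"

abbreviation quat_proj_dist :: "(quat ^ 'n) set \<Rightarrow> (quat ^ 'n) set \<Rightarrow> real" where
  "quat_proj_dist \<equiv> proj_dist qmul qcnj"


section \<open>The Cayley projective plane\<close>

definition oct_hermitian :: "oct ^ 3 ^ 3 \<Rightarrow> bool" where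
  "oct_hermitian A \<longleftrightarrow> (\<forall>i j. A $ i $ j = ocnj (A $ j $ i))"

definition oct_matrix_mul :: "oct ^ 3 ^ 3 \<Rightarrow> oct ^ 3 ^ 3 \<Rightarrow> oct ^ 3 ^ 3" where
  "oct_matrix_mul A B = (\<chi> i j. \<Sum>k\<in>UNIV. omul (A $ i $ k) (B $ k $ j))"

definition jordan_mul :: "oct ^ 3 ^ 3 \<Rightarrow> oct ^ 3 ^ 3 \<Rightarrow> oct ^ 3 ^ 3" where
  "jordan_mul A B = (1 / 2) *\<^sub>R (oct_matrix_mul A B + oct_matrix_mul B A)"

definition oct_trace :: "oct ^ 3 ^ 3 \<Rightarrow> oct" where
  "oct_trace A = (\<Sum>i\<in>UNIV. A $ i $ i)"

definition cayley_plane :: "(oct ^ 3 ^ 3) set" where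
  "cayley_plane = {P. oct_hermitian P \<and> jordan_mul P P = P \<and> oct_trace P = oct_of_real 1}"

text \<open>
  The Jordan product of Hermitian matrices is Hermitian, so its trace is real
  (\<open>oct_trace_jordan_mul\<close> below) and \<open>ore\<close> only changes the type.  The definition solves
  \<open>cos\<^sup>2 (dist P Q / 2) = tr (P \<circ> Q)\<close> for \<open>dist P Q\<close> in \<open>[0, \<pi>]\<close>.
\<close>

definition cayley_dist :: "oct ^ 3 ^ 3 \<Rightarrow> oct ^ 3 ^ 3 \<Rightarrow> real" where
  "cayley_dist P Q = 2 * arccos (sqrt (ore (oct_trace (jordan_mul P Q))))"


section \<open>Strictly positive definite functions\<close>

definition pos_def_matrix :: "nat \<Rightarrow> (nat \<Rightarrow> nat \<Rightarrow> real) \<Rightarrow> bool" where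
  "pos_def_matrix N A \<longleftrightarrow>
     (\<forall>i<N. \<forall>j<N. A i j = A j i) \<and>
     (\<forall>c. (\<exists>i<N. c i \<noteq> 0) \<longrightarrow> (\<Sum>i<N. \<Sum>j<N. c i * A i j * c j) > 0)"

definition strictly_pos_def_on :: "'p set \<Rightarrow> ('p \<Rightarrow> 'p \<Rightarrow> real) \<Rightarrow> (real \<Rightarrow> real) \<Rightarrow> bool" where
  "strictly_pos_def_on M d g \<longleftrightarrow>
     continuous_on {0..pi} g \<and>
     (\<forall>N x. x ` {..<N} \<subseteq> M \<and> inj_on x {..<N} \<longrightarrow> pos_def_matrix N (\<lambda>i j. g (d (x i) (x j))))"

text \<open>\<open>0 powr \<delta> = 0\<close>, which agrees with \<open>0\<^sup>\<delta>\<close> for the positive exponents of interest.\<close>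

definition trunc_power :: "real \<Rightarrow> real \<Rightarrow> real \<Rightarrow> real" where
  "trunc_power t \<delta> \<theta> = (if \<theta> \<le> t then (t - \<theta>) powr \<delta> else 0)"


section \<open>Well-definedness of the distances\<close>

lemma bounded_bilinear_qmul: "bounded_bilinear qmul"
proof -
  have "bilinear qmul"
    unfolding bilinear_def linear_iff
    by (simp add: qmul_def algebra_simps)
  then show ?thesis by (simp add: bilinear_conv_bounded_bilinear)
qed

lemma qmul_assoc: "qmul (qmul a b) c = qmul a (qmul b c)"
  by (simp add: qmul_def algebra_simps)

lemma qcnj_qmul: "qcnj (qmul a b) = qmul (qcnj b) (qcnj a)"
  by (simp add: qmul_def qcnj_def algebra_simps)

lemma norm_qcnj [simp]: "norm (qcnj a) = norm a"
  by (simp add: qcnj_def norm_prod_def)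

lemma qmul_qcnj: "qmul a (qcnj a) = (complex_of_real ((norm a)\<^sup>2), 0)"
  by (simp add: qmul_def qcnj_def norm_prod_def mult.commute flip: complex_norm_square)

lemma norm_qmul: "norm (qmul a b) = norm a * norm b"
proof -
  have "qmul (qmul a b) (qcnj (qmul a b)) = qmul a (qmul (qmul b (qcnj b)) (qcnj a))"
    by (simp add: qcnj_qmul qmul_assoc)
  also have "\<dots> = qmul (complex_of_real ((norm b)\<^sup>2), 0) (qmul a (qcnj a))"
    unfolding qmul_qcnj[of b] by (simp add: qmul_def qcnj_def algebra_simps)
  finally have "(norm (qmul a b))\<^sup>2 = (norm a * norm b)\<^sup>2"
    unfolding qmul_qcnj
    by (simp add: qmul_def power_mult_distrib mult.commute flip: of_real_power of_real_mult)
  then show ?thesis by (simp add: power2_eq_iff_nonneg)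
qed

lemma proj_dist_line_aux:
  fixes x y :: "'a::real_normed_vector ^ 'n"
  assumes bil: "bounded_bilinear mul"
    and assoc: "\<And>a b c. mul (mul a b) c = mul a (mul b c)"
    and one: "\<And>a. mul e a = a"
    and cj_mul: "\<And>a b. cj (mul a b) = mul (cj b) (cj a)"
    and norm_mul: "\<And>a b. norm (mul a b) = norm a * norm b"
    and norm_cj: "\<And>a. norm (cj a) = norm a"
    and unit: "norm x = 1" "norm y = 1"
  shows "proj_dist mul cj (line mul x) (line mul y) = 2 * arccos (norm (herm mul cj x y))"
    and "norm (herm mul cj x y) \<le> 1"
proof -
  interpret bounded_bilinear mul by (rule bil)
  have norm_scale: "norm (\<chi> i. mul c (z $ i)) = norm c * norm z" for c and z :: "'a ^ 'n"
    by (simp add: norm_vec_def norm_mul L2_set_right_distrib)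
  have rep: "\<exists>c. (SOME u. u \<in> line mul z \<and> norm u = 1) = (\<chi> i. mul c (z $ i)) \<and> norm c = 1"
    if "norm z = 1" for z :: "'a ^ 'n"
  proof -
    have "z = (\<chi> i. mul e (z $ i))" by (simp add: one)
    then have "z \<in> line mul z" unfolding line_def by (rule image_eqI) simp
    with that have "\<exists>u. u \<in> line mul z \<and> norm u = 1" by blast
    from someI_ex[OF this] show ?thesis
      using that unfolding line_def by (auto simp: norm_scale)
  qed
  obtain c where c: "(SOME u. u \<in> line mul x \<and> norm u = 1) = (\<chi> i. mul c (x $ i))" "norm c = 1"
    using rep[OF unit(1)] by blast
  obtain d where d: "(SOME u. u \<in> line mul y \<and> norm u = 1) = (\<chi> i. mul d (y $ i))" "norm d = 1"
    using rep[OF unit(2)] by blast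
  have "herm mul cj (\<chi> i. mul c (x $ i)) (\<chi> i. mul d (y $ i)) = mul c (mul (herm mul cj x y) (cj d))"
    by (simp add: herm_def assoc cj_mul sum_left sum_right)
  then show "proj_dist mul cj (line mul x) (line mul y) = 2 * arccos (norm (herm mul cj x y))"
    by (simp add: proj_dist_def Let_def c d norm_mul norm_cj)
  have "norm (herm mul cj x y) \<le> (\<Sum>i\<in>UNIV. norm (x $ i) * norm (y $ i))"
    unfolding herm_def by (rule order_trans[OF norm_sum]) (simp add: norm_mul norm_cj)
  also have "\<dots> \<le> norm x * norm y"
    using L2_set_mult_ineq[of "\<lambda>i. norm (x $ i)" "\<lambda>i. norm (y $ i)" UNIV]
    by (simp add: norm_vec_def)
  finally show "norm (herm mul cj x y) \<le> 1" by (simp add: unit)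
qed

lemma proj_dist_line:
  fixes x y :: "real ^ 'n" and z w :: "complex ^ 'n" and p q :: "quat ^ 'n"
  shows "norm x = 1 \<Longrightarrow> norm y = 1 \<Longrightarrow>
      real_proj_dist (line (*) x) (line (*) y) = 2 * arccos \<bar>inner x y\<bar>"
    and "norm z = 1 \<Longrightarrow> norm w = 1 \<Longrightarrow>
      complex_proj_dist (line (*) z) (line (*) w) = 2 * arccos (cmod (\<Sum>i\<in>UNIV. z $ i * cnj (w $ i)))"
    and "norm p = 1 \<Longrightarrow> norm q = 1 \<Longrightarrow>
      quat_proj_dist (line qmul p) (line qmul q) = 2 * arccos (norm (herm qmul qcnj p q))"
proof -
  show "real_proj_dist (line (*) x) (line (*) y) = 2 * arccos \<bar>inner x y\<bar>"
    if "norm x = 1" "norm y = 1"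
    by (subst proj_dist_line_aux(1)[where e = 1])
      (use that in \<open>simp_all add: bounded_bilinear_mult abs_mult herm_def inner_vec_def\<close>)
  show "complex_proj_dist (line (*) z) (line (*) w) = 2 * arccos (cmod (\<Sum>i\<in>UNIV. z $ i * cnj (w $ i)))"
    if "norm z = 1" "norm w = 1"
    by (subst proj_dist_line_aux(1)[where e = 1])
      (use that in \<open>simp_all add: bounded_bilinear_mult norm_mult herm_def\<close>)
  have one: "qmul (1, 0) a = a" for a by (simp add: qmul_def)
  show "quat_proj_dist (line qmul p) (line qmul q) = 2 * arccos (norm (herm qmul qcnj p q))"
    if "norm p = 1" "norm q = 1"
    by (rule proj_dist_line_aux(1)[where e = "(1, 0)"])
      (fact bounded_bilinear_qmul qmul_assoc one qcnj_qmul norm_qmul norm_qcnj that)+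
qed

lemma oct_trace_jordan_mul:
  assumes "oct_hermitian P" "oct_hermitian Q"
  shows "oct_trace (jordan_mul P Q) = oct_of_real (ore (oct_trace (jordan_mul P Q)))"
proof -
  have ocnj_omul: "ocnj (omul a b) = omul (ocnj b) (ocnj a)" for a b
    by (simp add: omul_def ocnj_def qmul_def qcnj_def algebra_simps)
  have sum_ocnj: "ocnj (sum f UNIV) = (\<Sum>k\<in>UNIV. ocnj (f k))" for f :: "3 \<Rightarrow> oct"
    by (simp add: sum_3 ocnj_def qcnj_def)
  have herm: "ocnj (P $ i $ j) = P $ j $ i" "ocnj (Q $ i $ j) = Q $ j $ i" for i j
    using assms unfolding oct_hermitian_def by metis+
  have prod: "ocnj (oct_matrix_mul P Q $ i $ i) = oct_matrix_mul Q P $ i $ i"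
       "ocnj (oct_matrix_mul Q P $ i $ i) = oct_matrix_mul P Q $ i $ i" for i
    by (simp_all add: oct_matrix_mul_def sum_ocnj ocnj_omul herm)
  have lin: "ocnj ((1 / 2) *\<^sub>R (a + b)) = (1 / 2) *\<^sub>R (ocnj a + ocnj b)" for a b
    by (simp add: ocnj_def qcnj_def scaleR_add_right scaleR_diff_right)
  have "ocnj (oct_trace (jordan_mul P Q)) = oct_trace (jordan_mul P Q)"
    unfolding oct_trace_def jordan_mul_def sum_ocnj
    by (simp only: vector_scaleR_component vector_add_component lin prod add.commute)
  then show ?thesis
    by (auto simp: ocnj_def qcnj_def oct_of_real_def ore_def prod_eq_iff complex_eq_iff)
qed

end

theory Submission
  imports Defs "HOL-Probability.Distributions" "HOL-Computational_Algebra.Polynomial"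
begin

text \<open>
  Each of the spaces carries functions \<open>0 \<le> Q x \<le> T\<close> on an auxiliary measure space whose joint
  Laplace transform depends only on \<open>u x y = cos\<^sup>2 (dist x y / 2)\<close>: for projective spaces over
  \<open>K\<close> of real dimension \<open>\<kappa>\<close> take a Gaussian vector \<open>z\<close>, \<open>T = |z|\<^sup>2\<close> and \<open>Q x = |\<langle>x, z\<rangle>|\<^sup>2\<close>; the
  Cayley plane has an octonionic analogue.  With \<open>U x = Q x / T\<close> and nondecreasing \<open>N \<ge> 0\<close>, the matrix
  of the expectations of \<open>N (min (U x) (U y)) = min (N (U x)) (N (U y))\<close> is positive semidefinite.
  Since the Laplace transform determines the joint law, \<open>U x\<close> and \<open>U y\<close> are distributed like
  \<open>R (1 + \<rho> cos (\<omega> \<plusminus> \<theta> / 2)) / 2\<close>, where \<open>\<theta> = dist x y\<close> and \<open>\<omega>\<close> is a uniform angle, and the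
  expectation becomes the integral over \<open>[\<theta>, \<pi>]\<close> of an average of \<open>N (R (1 + \<rho> cos (\<phi> / 2)) / 2)\<close>.
  The averages over \<open>R\<close> and \<open>\<rho>\<close> are inverted by Euler operators \<open>w d/dw + c\<close>, which preserve
  nonnegative coefficients in powers of \<open>w - a\<close>.  Hence \<open>\<theta> \<mapsto> \<integral>\<^bsub>[\<theta>,\<pi>]\<^esub> (cos (\<phi> / 2) - a)\<^sub>+\<^sup>l d\<phi>\<close> is
  positive semidefinite for \<open>l \<ge> k - 1\<close>, where \<open>k\<close> is the critical exponent.

  Now \<open>(t - \<theta>)\<^sub>+\<^sup>k\<close> is a multiple of the integral over \<open>[\<theta>, \<pi>]\<close> of \<open>(arcsin w - arcsin a)\<^sub>+\<close> to the power
  \<open>k - 1\<close>, with \<open>w = cos (\<phi> / 2)\<close> and \<open>a = cos (t / 2)\<close>; this is a limit of polynomials in \<open>w - a\<close> with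
  nonnegative coefficients.  Strictness comes from their term of degree \<open>k + 1\<close>: it is a
  mixture of \<open>(w - x)\<^sub>+\<close> to the power \<open>k - 1\<close> over \<open>a < x < 1\<close>, and for \<open>x\<close> close to \<open>1\<close> the
  corresponding matrices are diagonal.  Exponents \<open>\<delta> > k\<close> are mixtures over \<open>t\<close> of the exponent \<open>k\<close>.
\<close>

section \<open>Uniqueness from moments and Laplace transforms\<close>

text \<open>The threshold counts derivatives. The joint Laplace transform is proportional to
  \<Lambda>^(-q) ((\<Lambda> - a) (\<Lambda> - b) - a b u)^(-\<kappa>/2), which is matched by taking
  R with a Beta (\<kappa>, q) law and \<rho> cos \<omega> as a coordinate of a uniform point on the
  sphere of dimension \<kappa>, the projective line. Undoing the average over R costs q derivatives.
  For even \<kappa> the law of \<rho> alone has a half-integer exponent, and a fractional inversion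
  would not visibly keep coefficients nonnegative. Therefore N is made to depend on a further
  independent angle s: then \<rho> cos s is again a sphere coordinate, of density (1 -
  v^2)^(\<kappa>/2 - 1), and r = \<kappa>/2 more derivatives undo its average. Over the reals \<rho>
  = 1 and r = 0. The last derivative may leave a jump, which a nondecreasing N tolerates. With the
  final integration over [\<theta>, \<pi>] the critical exponent becomes k = q + r + 1. For a
  Gaussian vector in K^n, q = (n - 2) \<kappa> / 2.\<close>

inductive poly3 :: "(real \<times> real \<times> real \<Rightarrow> real) \<Rightarrow> bool" where
  mono: "poly3 (\<lambda>(x, y, z). x ^ i * y ^ j * z ^ k)"
| add: "poly3 f \<Longrightarrow> poly3 g \<Longrightarrow> poly3 (\<lambda>v. f v + g v)"
| scale: "poly3 f \<Longrightarrow> poly3 (\<lambda>v. c * f v)"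

lemma poly3_const: "poly3 (\<lambda>v. c)"
  using poly3.scale[OF poly3.mono[of 0 0 0], of c] by (simp add: case_prod_unfold)

text \<open>The inductive definition has no product rule, so that equality of integrals passes from
  monomials to all of \<open>poly3\<close> by a linear induction. Stone-Weierstrass asks for an
  algebra, and this supplies the products.\<close>

lemma poly3_mult:
  assumes "poly3 f" "poly3 g"
  shows "poly3 (\<lambda>v. f v * g v)"
  using assms(1)
proof induction
  case (mono i j k)
  from assms(2) show ?case
  proof induction
    case (mono i' j' k')
    have eq: "(\<lambda>v. (case v of (x, y, z) \<Rightarrow> x ^ i * y ^ j * z ^ k) * (case v of (x, y, z) \<Rightarrow> x ^ i' * y ^ j' * z ^ k'))
      = (\<lambda>(x, y, z). x ^ (i + i') * y ^ (j + j') * z ^ (k + k') :: real)"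
      by (auto simp: power_add mult_ac)
    show ?case unfolding eq by (rule poly3.mono)
  next
    case (add f g)
    then show ?case using poly3.add by (simp add: distrib_left)
  next
    case (scale f c)
    from poly3.scale[OF scale.IH, of c] show ?case by (simp add: mult_ac)
  qed
next
  case (add f h)
  then show ?case using poly3.add by (simp add: distrib_right)
next
  case (scale f c)
  from poly3.scale[OF scale.IH, of c] show ?case by (simp add: mult_ac)
qed

lemma poly3_continuous: "poly3 f \<Longrightarrow> continuous_on S f"
proof (induction rule: poly3.induct)
  case (mono i j k)
  then show ?case by (auto simp: case_prod_unfold intro!: continuous_intros)
qed (auto intro!: continuous_intros)

lemma poly3_separates:
  assumes "v \<noteq> w"
  shows "\<exists>f. poly3 f \<and> f v \<noteq> f w"
proof -
  have "poly3 (\<lambda>v. fst v)" "poly3 (\<lambda>v. fst (snd v))" "poly3 (\<lambda>v. snd (snd v))"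
    using poly3.mono[of 1 0 0] poly3.mono[of 0 1 0] poly3.mono[of 0 0 1]
    by (simp_all add: case_prod_unfold)
  with assms show ?thesis by (metis prod.expand)
qed

abbreviation cube :: "(real \<times> real \<times> real) set" where "cube \<equiv> {-1..1} \<times> {-1..1} \<times> {-1..1}"

text \<open>A finite measure on a cube is determined by its moments: by Stone--Weierstrass the integrals
  of continuous functions agree, hence so do the measures of closed sets.\<close>

lemma measure_eqI_moments:
  fixes M N :: "(real \<times> real \<times> real) measure"
  assumes sets: "sets M = sets borel" "sets N = sets borel"
    and fin: "finite_measure M" "finite_measure N"
    and supp: "AE v in M. v \<in> cube" "AE v in N. v \<in> cube"
    and eq: "\<And>i j k. (\<integral>(x, y, z). x ^ i * y ^ j * z ^ k \<partial>M) = (\<integral>(x, y, z). x ^ i * y ^ j * z ^ k \<partial>N)"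
  shows "M = N"
proof -
  interpret M: finite_measure M by fact
  interpret N: finite_measure N by fact
  note [measurable_cong] = sets
  have compact: "compact cube" by (intro compact_Times compact_Icc)
  have int: "integrable K f" if "continuous_on UNIV f" "K = M \<or> K = N" for f :: "_ \<Rightarrow> real" and K
  proof -
    have "bounded (f ` cube)"
      using that by (intro compact_imp_bounded compact_continuous_image compact) (auto intro: continuous_on_subset)
    then obtain B where B: "\<And>v. v \<in> cube \<Longrightarrow> \<bar>f v\<bar> \<le> B" unfolding bounded_iff by auto
    have [measurable]: "f \<in> borel_measurable borel" using that by (intro borel_measurable_continuous_onI)
    have ae: "AE v in K. norm (f v) \<le> B" 
    proof -
      have "AE v in K. v \<in> cube" using that(2) supp by blast
      then show ?thesis by (rule eventually_mono) (use B in auto)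
    qed
    from that(2) show ?thesis
    proof
      assume K: "K = M"
      show ?thesis using ae unfolding K by (auto intro!: M.integrable_const_bound[of f B])
    next
      assume K: "K = N"
      show ?thesis using ae unfolding K by (auto intro!: N.integrable_const_bound[of f B])
    qed
  qed
  have p: "integral\<^sup>L M f = integral\<^sup>L N f" if "poly3 f" for f
    using that
  proof induction
    case (mono i j k)
    then show ?case using eq by simp
  next
    case (add f g)
    have "integrable K f" "integrable K g" if "K = M \<or> K = N" for K
      using add(1,2) that by (auto intro!: int poly3_continuous)
    with add show ?case by simp
  qed simp
  have c: "integral\<^sup>L M f = integral\<^sup>L N f" if f: "continuous_on UNIV f" for f :: "_ \<Rightarrow> real"
  proof (rule ccontr)
    assume ne: "integral\<^sup>L M f \<noteq> integral\<^sup>L N f"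
    \<comment> \<open>The summand 1 makes \<open>m\<close> positive and the last estimate strict: an
      approximation within \<open>e\<close> moves the two integrals by less than the assumed gap
      \<open>e * m\<close>.\<close>
    define m where "m = measure M (space M) + measure N (space N) + 1"
    define e where "e = \<bar>integral\<^sup>L M f - integral\<^sup>L N f\<bar> / m"
    have m: "m > 0" unfolding m_def by (simp add: add_nonneg_pos)
    have e: "e > 0" using ne m by (simp add: e_def)
    have "\<exists>g. poly3 g \<and> (\<forall>x\<in>cube. \<bar>f x - g x\<bar> < e)"
    proof (rule Stone_Weierstrass_HOL[OF compact _ _ _ _ _ _ e])
      show "continuous_on cube f" using f by (rule continuous_on_subset) simp
      show "poly3 (\<lambda>v. c)" for c by (rule poly3_const)
      show "continuous_on cube g" if "poly3 g" for g using that by (rule poly3_continuous)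
      show "poly3 (\<lambda>v. g v + h v)" if "poly3 g \<and> poly3 h" for g h using that by (auto intro: poly3.add)
      show "poly3 (\<lambda>v. g v * h v)" if "poly3 g \<and> poly3 h" for g h using that by (auto intro: poly3_mult)
      show "\<exists>g. poly3 g \<and> g v \<noteq> g w" if "v \<in> cube \<and> w \<in> cube \<and> v \<noteq> w" for v w
        using that by (intro poly3_separates) simp
    qed
    then obtain g where g: "poly3 g" "\<And>x. x \<in> cube \<Longrightarrow> \<bar>f x - g x\<bar> < e" by blast
    have bd: "\<bar>integral\<^sup>L K f - integral\<^sup>L K g\<bar> \<le> e * measure K (space K)" if K: "K = M \<or> K = N" for K
    proof -
      have ig: "integrable K f" "integrable K g" using K f g poly3_continuous by (auto intro: int)
      have "finite_measure K" using K fin by auto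
      then interpret K: finite_measure K .
      have ae: "AE v in K. v \<in> cube" using K supp by auto
      have "\<bar>integral\<^sup>L K f - integral\<^sup>L K g\<bar> = \<bar>\<integral>v. f v - g v \<partial>K\<bar>" using ig by simp
      also have "\<dots> \<le> (\<integral>v. \<bar>f v - g v\<bar> \<partial>K)" by (rule integral_abs_bound)
      also have "\<dots> \<le> (\<integral>v. e \<partial>K)"
        using ig ae g(2) by (intro integral_mono_AE) (auto elim!: eventually_mono intro!: less_imp_le)
      finally show ?thesis by (simp add: mult.commute)
    qed
    have "\<bar>integral\<^sup>L M f - integral\<^sup>L N f\<bar> \<le> e * measure M (space M) + e * measure N (space N)"
      using bd[of M] bd[of N] p[OF g(1)] by simp
    also have "\<dots> < e * m" using e by (simp add: m_def algebra_simps)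
    finally show False using m by (simp add: e_def)
  qed
  have cl: "emeasure M S = emeasure N S" if S: "closed S" for S
  proof (cases "S = {}")
    case False
    \<comment> \<open>Continuous functions decreasing to the indicator of the closed set
      \<open>S\<close>, so its measure is a limit of integrals already known to agree.\<close>
    define h where "h n v = max 0 (1 - real n * infdist v S)" for n v
    have hc: "continuous_on UNIV (h n)" for n unfolding h_def by (intro continuous_intros)
    have h1: "h n v \<le> 1" "0 \<le> h n v" for n v using infdist_nonneg[of v S] by (auto simp: h_def)
    have lim: "(\<lambda>n. h n v) \<longlonglongrightarrow> indicator S v" for v
    proof (cases "v \<in> S")
      case True
      then show ?thesis by (simp add: h_def)
    next
      case F: False
      then have d: "infdist v S > 0" using S False by (metis in_closed_iff_infdist_zero infdist_nonneg less_eq_real_def)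
      obtain n0 where n0: "real n0 * infdist v S > 1" using reals_Archimedean3[OF d] by auto
      have "\<forall>\<^sub>F n in sequentially. h n v = 0"
      proof (rule eventually_sequentiallyI[of n0])
        fix n assume "n \<ge> n0"
        then have "real n0 * infdist v S \<le> real n * infdist v S" using d by (intro mult_right_mono) auto
        with n0 show "h n v = 0" by (simp add: h_def)
      qed
      then show ?thesis using F by (simp add: tendsto_eventually)
    qed
    have [measurable]: "S \<in> sets borel" using S by simp
    have [measurable]: "h n \<in> borel_measurable borel" for n using hc by (intro borel_measurable_continuous_onI)
    have Mlim: "(\<lambda>n. integral\<^sup>L M (h n)) \<longlonglongrightarrow> integral\<^sup>L M (indicator S)"
      by (rule integral_dominated_convergence[where w = "\<lambda>_. 1"]) (use lim h1 in \<open>auto intro!: M.integrable_const\<close>)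
    have Nlim: "(\<lambda>n. integral\<^sup>L N (h n)) \<longlonglongrightarrow> integral\<^sup>L N (indicator S)"
      by (rule integral_dominated_convergence[where w = "\<lambda>_. 1"]) (use lim h1 in \<open>auto intro!: N.integrable_const\<close>)
    have "integral\<^sup>L M (indicator S) = integral\<^sup>L N (indicator S :: _ \<Rightarrow> real)"
      using Mlim Nlim c[OF hc] by (simp add: LIMSEQ_unique)
    moreover have "space M = UNIV" "space N = UNIV" using sets_eq_imp_space_eq[OF sets(1)] sets_eq_imp_space_eq[OF sets(2)] by auto
    ultimately have "measure M S = measure N S" by simp
    then show ?thesis by (simp add: M.emeasure_eq_measure N.emeasure_eq_measure)
  qed simp
  show ?thesis
  proof (rule measure_eqI_generator_eq[where E = "Collect closed" and \<Omega> = UNIV and A = "\<lambda>_. UNIV"])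
    show "Int_stable (Collect closed :: (real \<times> real \<times> real) set set)"
      by (auto simp: Int_stable_def)
    show "sets M = sigma_sets UNIV (Collect closed)" "sets N = sigma_sets UNIV (Collect closed)"
      using sets by (simp_all add: borel_eq_closed)
  qed (use cl in auto)
qed

text \<open>The substitution \<open>x = e\<^sup>-\<^sup>t\<close> turns integer values of a Laplace transform into moments.\<close>

lemma nn_integral_eqI_laplace:
  fixes T A B :: "'a \<Rightarrow> real" and T' A' B' :: "'b \<Rightarrow> real"
  assumes fin: "finite_measure M" "finite_measure N"
    and meas: "T \<in> borel_measurable M" "A \<in> borel_measurable M" "B \<in> borel_measurable M"
      "T' \<in> borel_measurable N" "A' \<in> borel_measurable N" "B' \<in> borel_measurable N"
    and nonneg: "AE z in M. 0 \<le> T z \<and> 0 \<le> A z \<and> 0 \<le> B z" "AE z in N. 0 \<le> T' z \<and> 0 \<le> A' z \<and> 0 \<le> B' z"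
    and eq: "\<And>i j k :: nat. (\<integral>\<^sup>+z. ennreal (exp (- (real i * T z + real j * A z + real k * B z))) \<partial>M)
      = (\<integral>\<^sup>+z. ennreal (exp (- (real i * T' z + real j * A' z + real k * B' z))) \<partial>N)"
    and g: "g \<in> borel_measurable borel"
  shows "(\<integral>\<^sup>+z. g (T z, A z, B z) \<partial>M) = (\<integral>\<^sup>+z. g (T' z, A' z, B' z) \<partial>N)"
proof -
  interpret M: finite_measure M by fact
  interpret N: finite_measure N by fact
  note [measurable] = meas g
  define \<Phi> where "\<Phi> z = (exp (- T z), exp (- A z), exp (- B z))" for z
  define \<Phi>' where "\<Phi>' z = (exp (- T' z), exp (- A' z), exp (- B' z))" for z
  have [measurable]: "\<Phi> \<in> borel_measurable M" "\<Phi>' \<in> borel_measurable N"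
    unfolding \<Phi>_def[abs_def] \<Phi>'_def[abs_def] by measurable
  have "(\<lambda>v :: real \<times> real \<times> real. (- ln (fst v), - ln (fst (snd v)), - ln (snd (snd v)))) \<in> borel_measurable borel"
  proof (intro borel_measurable_Pair)
    have [measurable]: "(\<lambda>v :: real \<times> real \<times> real. fst v) \<in> borel_measurable borel"
      "(\<lambda>v :: real \<times> real \<times> real. fst (snd v)) \<in> borel_measurable borel"
      "(\<lambda>v :: real \<times> real \<times> real. snd (snd v)) \<in> borel_measurable borel"
      by (intro borel_measurable_continuous_onI continuous_intros)+
    show "(\<lambda>v :: real \<times> real \<times> real. - ln (fst v)) \<in> borel_measurable borel"
      "(\<lambda>v :: real \<times> real \<times> real. - ln (fst (snd v))) \<in> borel_measurable borel"
      "(\<lambda>v :: real \<times> real \<times> real. - ln (snd (snd v))) \<in> borel_measurable borel"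
      by measurable
  qed
  then have [measurable]: "(\<lambda>v :: real \<times> real \<times> real. case v of (x, y, w) \<Rightarrow> (- ln x, - ln y, - ln w)) \<in> borel_measurable borel"
    by (simp add: case_prod_unfold)
  have ln: "(T z, A z, B z) = (case \<Phi> z of (x, y, w) \<Rightarrow> (- ln x, - ln y, - ln w))" for z
    by (simp add: \<Phi>_def)
  have ln': "(T' z, A' z, B' z) = (case \<Phi>' z of (x, y, w) \<Rightarrow> (- ln x, - ln y, - ln w))" for z
    by (simp add: \<Phi>'_def)
  have *: "distr M borel \<Phi> = distr N borel \<Phi>'"
  proof (rule measure_eqI_moments)
    show "finite_measure (distr M borel \<Phi>)" "finite_measure (distr N borel \<Phi>')"
      by (simp_all add: M.finite_measure_distr N.finite_measure_distr)
    have [measurable]: "cube \<in> sets borel" by (intro borel_closed closed_Times closed_atLeastAtMost)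
    have le: "- 1 \<le> exp x" for x :: real by (rule order_trans[OF _ exp_ge_zero]) simp
    show "AE v in distr M borel \<Phi>. v \<in> cube" "AE v in distr N borel \<Phi>'. v \<in> cube"
      using nonneg by (subst AE_distr_iff; (auto simp: \<Phi>_def \<Phi>'_def le elim!: eventually_mono)[1] | simp)+
    fix i j k :: nat
    have e: "(exp (- t)) ^ i * (exp (- a)) ^ j * (exp (- b)) ^ k = exp (- (real i * t + real j * a + real k * b))" for t a b :: real
      by (simp add: exp_of_nat_mult[symmetric] exp_add[symmetric] mult_ac)
    have "(\<integral>z. exp (- (real i * T z + real j * A z + real k * B z)) \<partial>M) = (\<integral>z. exp (- (real i * T' z + real j * A' z + real k * B' z)) \<partial>N)"
      by (subst (1 2) integral_eq_nn_integral) (simp_all only: eq, auto)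
    then show "(\<integral>(x, y, z). x ^ i * y ^ j * z ^ k \<partial>distr M borel \<Phi>) = (\<integral>(x, y, z). x ^ i * y ^ j * z ^ k \<partial>distr N borel \<Phi>')"
      by (subst (1 2) integral_distr) (auto simp: \<Phi>_def \<Phi>'_def e intro!: borel_measurable_continuous_onI poly3_continuous poly3.mono)
  qed simp_all
  have "(\<integral>\<^sup>+z. g (T z, A z, B z) \<partial>M) = (\<integral>\<^sup>+v. g (case v of (x, y, w) \<Rightarrow> (- ln x, - ln y, - ln w)) \<partial>distr M borel \<Phi>)"
    by (subst nn_integral_distr) (simp_all add: ln)
  also have "\<dots> = (\<integral>\<^sup>+z. g (T' z, A' z, B' z) \<partial>N)"
    unfolding * by (subst nn_integral_distr) (simp_all add: ln')
  finally show ?thesis .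
qed

section \<open>Truncated polynomials and Euler operators\<close>

text \<open>A constant term of \<open>E\<close> is allowed. It contributes an upward jump at
  \<open>a\<close>, which does not disturb monotonicity; this is how the borderline degree is
  reached.\<close>

definition tr :: "real \<Rightarrow> real poly \<Rightarrow> real \<Rightarrow> real" where
  "tr a E x = (if a < x then poly E (x - a) else 0)"

definition nonneg_poly :: "real poly \<Rightarrow> bool" where
  "nonneg_poly E \<longleftrightarrow> (\<forall>i. 0 \<le> coeff E i)"

definition vanishes :: "nat \<Rightarrow> real poly \<Rightarrow> bool" where
  "vanishes p E \<longleftrightarrow> (\<forall>i<p. coeff E i = 0)"

text \<open>The operator x d/dx + c, expressed in the variable h = x - a, where x = a + h.\<close>

definition euler :: "real \<Rightarrow> real \<Rightarrow> real poly \<Rightarrow> real poly" where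
  "euler a c E = [:a, 1:] * pderiv E + smult c E"

text \<open>For nonnegative \<open>a\<close> and \<open>c\<close> both weights are nonnegative, and
  the shift from \<open>Suc l\<close> to \<open>l\<close> costs one order of vanishing at the
  truncation point. These two facts govern all later uses of the operator.\<close>

lemma coeff_euler: "coeff (euler a c E) l = (real l + c) * coeff E l + a * real (Suc l) * coeff E (Suc l)"
proof -
  have "[:a, 1:] * pderiv E = smult a (pderiv E) + pCons 0 (pderiv E)"
    by simp
  moreover have "coeff (pCons 0 (pderiv E)) l = real l * coeff E l"
    by (cases l) (simp_all add: coeff_pderiv)
  ultimately show ?thesis
    by (simp add: euler_def coeff_pderiv algebra_simps)
qed

lemma nonneg_euler: "nonneg_poly E \<Longrightarrow> 0 \<le> a \<Longrightarrow> 0 \<le> c \<Longrightarrow> nonneg_poly (euler a c E)"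
  by (simp add: nonneg_poly_def coeff_euler)

lemma vanishes_euler: "vanishes (Suc p) E \<Longrightarrow> vanishes p (euler a c E)"
  by (simp add: vanishes_def coeff_euler)

lemma degree_euler: "degree (euler a c E) \<le> degree E"
  by (rule degree_le) (simp add: coeff_euler coeff_eq_0)

lemma tr_euler: "tr a (euler a c E) x = x * tr a (pderiv E) x + c * tr a E x"
  by (simp add: tr_def euler_def algebra_simps)

lemma nonneg_poly_poly_mono:
  assumes "nonneg_poly E" "0 \<le> x" "x \<le> y"
  shows "poly E x \<le> poly E y"
  unfolding poly_altdef
  using assms by (intro sum_mono mult_left_mono power_mono) (auto simp: nonneg_poly_def)

lemma nonneg_poly_poly_nonneg: "nonneg_poly E \<Longrightarrow> 0 \<le> x \<Longrightarrow> 0 \<le> poly E x"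
  unfolding poly_altdef by (intro sum_nonneg mult_nonneg_nonneg) (auto simp: nonneg_poly_def)

lemma tr_nonneg: "nonneg_poly E \<Longrightarrow> 0 \<le> tr a E x"
  by (simp add: tr_def nonneg_poly_poly_nonneg)

lemma tr_mono: "nonneg_poly E \<Longrightarrow> x \<le> y \<Longrightarrow> tr a E x \<le> tr a E y"
  by (auto simp: tr_def nonneg_poly_poly_mono nonneg_poly_poly_nonneg)

lemma continuous_tr:
  assumes "vanishes (Suc 0) E"
  shows "continuous_on S (tr a E)"
proof -
  have "poly E 0 = 0" using assms by (simp add: vanishes_def poly_0_coeff_0)
  then have "tr a E = (\<lambda>x. poly E (max 0 (x - a)))"
    by (auto simp: tr_def fun_eq_iff max_def)
  then show ?thesis by (auto intro!: continuous_intros)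
qed

lemma has_field_derivative_tr:
  assumes "x \<noteq> a"
  shows "(tr a E has_real_derivative tr a (pderiv E) x) (at x)"
proof (cases "a < x")
  case True
  have "((\<lambda>x. poly E (x - a)) has_real_derivative poly (pderiv E) (x - a)) (at x)"
    by (auto intro!: derivative_eq_intros poly_DERIV[THEN DERIV_chain2])
  then have "(tr a E has_real_derivative poly (pderiv E) (x - a)) (at x)"
    by (rule has_field_derivative_transform_within_open[of _ _ _ "{a<..}"])
      (use True in \<open>auto simp: tr_def\<close>)
  with True show ?thesis by (simp add: tr_def)
next
  case False
  have "((\<lambda>x. 0) has_real_derivative 0) (at x)" by simp
  then have "(tr a E has_real_derivative 0) (at x)"
    by (rule has_field_derivative_transform_within_open[of _ _ _ "{..<a}"])
      (use False assms in \<open>auto simp: tr_def\<close>)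
  with False show ?thesis by (simp add: tr_def)
qed

lemma has_field_derivative_tr_scaled:
  assumes "x * y \<noteq> a"
  shows "((\<lambda>x. tr a E (x * y)) has_real_derivative y * tr a (pderiv E) (x * y)) (at x)"
proof -
  have "((\<lambda>x. x * y) has_real_derivative y) (at x)" by (auto intro!: derivative_eq_intros)
  from DERIV_chain2[where f = "tr a E" and g = "\<lambda>x. x * y", OF has_field_derivative_tr[OF assms] this]
  show ?thesis by (simp add: mult.commute)
qed

text \<open>Integrate the derivative of R^(A+1) (1-R)^i \<open>tr b E (R * y)\<close>, rewriting
  R^(A+1) (1-R)^(i-1) as R^A (1-R)^(i-1) - R^A (1-R)^i. The second summand raises the Euler constant
  from A + 1 to A + 1 + i, the first one gives the integral \<open>I\<close> for i - 1. The boundary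
  term at R = 1 survives only for i = 0.\<close>

lemma beta_average_step:
  fixes A i :: nat and b y :: real
  assumes E: "vanishes (Suc 0) E" and y: "0 < y"
    and I: "0 < i \<Longrightarrow> ((\<lambda>R. R ^ A * (1 - R) ^ (i - 1) * tr b E (R * y)) has_integral I) {0..1}"
  shows "((\<lambda>R. R ^ A * (1 - R) ^ i * tr b (euler b (real (A + 1 + i)) E) (R * y)) has_integral
      (if i = 0 then tr b E y else real i * I)) {0..1}"
proof -
  define \<Phi> where "\<Phi> R = R ^ (A + 1) * (1 - R) ^ i * tr b E (R * y)" for R
  define \<phi> where "\<phi> R = real (A + 1) * R ^ A * (1 - R) ^ i * tr b E (R * y)
     - (real i * (1 - R) ^ (i - 1)) * R ^ (A + 1) * tr b E (R * y)
     + R ^ (A + 1) * (1 - R) ^ i * (y * tr b (pderiv E) (R * y))" for R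
  have "(\<phi> has_integral \<Phi> 1 - \<Phi> 0) {0..1}"
  \<comment> \<open>The only kink of the truncated function is at R = b / y; it is continuous there
    because \<open>E\<close> has no constant term.\<close>
  proof (rule fundamental_theorem_of_calculus_interior_strong[of "{b / y}"])
    show "continuous_on {0..1} \<Phi>"
      unfolding \<Phi>_def
      by (intro continuous_intros continuous_on_compose2[OF continuous_tr[OF E, of UNIV b]]) auto
    show "(\<Phi> has_vector_derivative \<phi> R) (at R)" if "R \<in> {0<..<1} - {b / y}" for R
    proof -
      have "R * y \<noteq> b" using that y by (auto simp: field_simps)
      note d = has_field_derivative_tr_scaled[OF this, of E]
      show ?thesis
        unfolding has_real_derivative_iff_has_vector_derivative[symmetric] \<Phi>_def \<phi>_def
        by (rule derivative_eq_intros d refl)+ (simp add: algebra_simps)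
    qed
  qed auto
  then have *: "(\<phi> has_integral (if i = 0 then tr b E y else 0)) {0..1}"
    by (simp add: \<Phi>_def power_0_left split: if_splits)
  show ?thesis
  proof (cases "i = 0")
    case True
    then have "\<phi> = (\<lambda>R. R ^ A * (1 - R) ^ i * tr b (euler b (real (A + 1 + i)) E) (R * y))"
      by (simp add: fun_eq_iff \<phi>_def tr_euler algebra_simps)
    with * True show ?thesis by (metis (full_types))
  next
    case False
    then obtain j where i: "i = Suc j" by (cases i) auto
    from has_integral_add[OF * has_integral_mult_right[OF I, of "real i"]] False
    have "((\<lambda>R. \<phi> R + real i * (R ^ A * (1 - R) ^ (i - 1) * tr b E (R * y))) has_integral (real i * I)) {0..1}"
      by simp
    moreover have "\<phi> R + real i * (R ^ A * (1 - R) ^ (i - 1) * tr b E (R * y))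
      = R ^ A * (1 - R) ^ i * tr b (euler b (real (A + 1 + i)) E) (R * y)" for R
      unfolding \<phi>_def tr_euler i by (simp add: algebra_simps)
    ultimately show ?thesis using False by simp
  qed
qed

text \<open>The same integration by parts with v (1-v^2)^i \<open>tr a E (v * w)\<close>; here v^2 =
  1 - (1-v^2) produces the constant 2 i + 1.\<close>

lemma sphere_average_step:
  fixes i :: nat and a w :: real
  assumes E: "vanishes (Suc 0) E" and w: "0 < w"
    and I: "0 < i \<Longrightarrow> ((\<lambda>v. (1 - v\<^sup>2) ^ (i - 1) * tr a E (v * w)) has_integral I) {0..1}"
  shows "((\<lambda>v. (1 - v\<^sup>2) ^ i * tr a (euler a (real (2 * i + 1)) E) (v * w)) has_integral
      (if i = 0 then tr a E w else 2 * real i * I)) {0..1}"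
proof -
  define \<Phi> where "\<Phi> v = v * (1 - v\<^sup>2) ^ i * tr a E (v * w)" for v
  define \<phi> where "\<phi> v = (1 - v\<^sup>2) ^ i * tr a E (v * w)
     - (real i * (1 - v\<^sup>2) ^ (i - 1) * (2 * v)) * v * tr a E (v * w)
     + v * (1 - v\<^sup>2) ^ i * (w * tr a (pderiv E) (v * w))" for v
  have "(\<phi> has_integral \<Phi> 1 - \<Phi> 0) {0..1}"
  proof (rule fundamental_theorem_of_calculus_interior_strong[of "{a / w}"])
    show "continuous_on {0..1} \<Phi>"
      unfolding \<Phi>_def
      by (intro continuous_intros continuous_on_compose2[OF continuous_tr[OF E, of UNIV a]]) auto
    show "(\<Phi> has_vector_derivative \<phi> v) (at v)" if "v \<in> {0<..<1} - {a / w}" for v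
    proof -
      have "v * w \<noteq> a" using that w by (auto simp: field_simps)
      note d = has_field_derivative_tr_scaled[OF this, of E]
      show ?thesis
        unfolding has_real_derivative_iff_has_vector_derivative[symmetric] \<Phi>_def \<phi>_def
        by (rule derivative_eq_intros d refl)+ (simp add: algebra_simps)
    qed
  qed auto
  then have *: "(\<phi> has_integral (if i = 0 then tr a E w else 0)) {0..1}"
    by (simp add: \<Phi>_def power_0_left split: if_splits)
  show ?thesis
  proof (cases "i = 0")
    case True
    then have "\<phi> = (\<lambda>v. (1 - v\<^sup>2) ^ i * tr a (euler a (real (2 * i + 1)) E) (v * w))"
      by (simp add: fun_eq_iff \<phi>_def tr_euler algebra_simps)
    with * True show ?thesis by (metis (full_types))
  next
    case False
    then obtain j where i: "i = Suc j" by (cases i) auto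
    from has_integral_add[OF * has_integral_mult_right[OF I, of "2 * real i"]] False
    have "((\<lambda>v. \<phi> v + 2 * real i * ((1 - v\<^sup>2) ^ (i - 1) * tr a E (v * w))) has_integral (2 * real i * I)) {0..1}"
      by simp
    moreover have "\<phi> v + 2 * real i * ((1 - v\<^sup>2) ^ (i - 1) * tr a E (v * w))
      = (1 - v\<^sup>2) ^ i * tr a (euler a (real (2 * i + 1)) E) (v * w)" for v
      unfolding \<phi>_def tr_euler i by (simp add: algebra_simps power2_eq_square)
    ultimately show ?thesis using False by simp
  qed
qed

primrec beta_inv :: "nat \<Rightarrow> real \<Rightarrow> real poly \<Rightarrow> nat \<Rightarrow> real poly" where
  "beta_inv A b E 0 = E"
| "beta_inv A b E (Suc i) = euler b (real (A + 1 + i)) (beta_inv A b E i)"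

primrec sphere_inv :: "real \<Rightarrow> real poly \<Rightarrow> nat \<Rightarrow> real poly" where
  "sphere_inv a E 0 = E"
| "sphere_inv a E (Suc i) = euler a (real (2 * i + 1)) (sphere_inv a E i)"

lemma vanishes_beta_inv: "vanishes (p + i) E \<Longrightarrow> vanishes p (beta_inv A b E i)"
  by (induction i arbitrary: p) (auto intro!: vanishes_euler)

lemma vanishes_sphere_inv: "vanishes (p + i) E \<Longrightarrow> vanishes p (sphere_inv a E i)"
  by (induction i arbitrary: p) (auto intro!: vanishes_euler)

lemma nonneg_beta_inv: "nonneg_poly E \<Longrightarrow> 0 \<le> b \<Longrightarrow> nonneg_poly (beta_inv A b E i)"
  by (induction i) (auto intro!: nonneg_euler)

lemma nonneg_sphere_inv: "nonneg_poly E \<Longrightarrow> 0 \<le> a \<Longrightarrow> nonneg_poly (sphere_inv a E i)"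
  by (induction i) (auto intro!: nonneg_euler)

text \<open>Each power of 1 - R is paid for by one Euler operator, so i + 1 of them undo the average
  against the Beta (A+1, i+1) weight. The orders of vanishing assumed of \<open>E\<close> keep every
  intermediate function continuous.\<close>

lemma beta_average:
  assumes "vanishes (Suc i) E" "0 < y"
  shows "((\<lambda>R. R ^ A * (1 - R) ^ i * tr b (beta_inv A b E (Suc i)) (R * y)) has_integral fact i * tr b E y) {0..1}"
  using assms(1)
proof (induction i)
  case 0
  then show ?case using beta_average_step[of E y 0 A b] assms(2) by simp
next
  case (Suc i)
  from Suc.prems have "vanishes (Suc i) E" by (simp add: vanishes_def)
  from beta_average_step[of "beta_inv A b E (Suc i)" y "Suc i" A b, OF vanishes_beta_inv assms(2)] Suc.IH[OF this] Suc.prems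
  show ?case by (simp add: mult.assoc)
qed

lemma sphere_average:
  assumes "vanishes (Suc i) E" "0 < w"
  shows "((\<lambda>v. (1 - v\<^sup>2) ^ i * tr a (sphere_inv a E (Suc i)) (v * w)) has_integral 2 ^ i * fact i * tr a E w) {0..1}"
  using assms(1)
proof (induction i)
  case 0
  then show ?case using sphere_average_step[of E w 0 a] assms(2) by simp
next
  case (Suc i)
  from Suc.prems have "vanishes (Suc i) E" by (simp add: vanishes_def)
  from sphere_average_step[of "sphere_inv a E (Suc i)" w "Suc i" a, OF vanishes_sphere_inv assms(2)] Suc.IH[OF this] Suc.prems
  have "((\<lambda>v. (1 - v\<^sup>2) ^ Suc i * tr a (sphere_inv a E (Suc (Suc i))) (v * w)) has_integral
    2 * real (Suc i) * (2 ^ i * fact i * tr a E w)) {0..1}" by simp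
  moreover have "2 * real (Suc i) * (2 ^ i * fact i * tr a E w) = 2 ^ Suc i * fact (Suc i) * tr a E w"
    by simp
  ultimately show ?case by metis
qed

section \<open>Gaussian vectors over division algebras\<close>

definition gauss_const :: "'a::euclidean_space itself \<Rightarrow> ennreal" where
  "gauss_const _ = (\<integral>\<^sup>+z. ennreal (exp (- (norm (z :: 'a))\<^sup>2)) \<partial>lborel)"

lemma nn_integral_lborel_shift:
  fixes f :: "'a::euclidean_space \<Rightarrow> ennreal"
  assumes [measurable]: "f \<in> borel_measurable borel"
  shows "(\<integral>\<^sup>+z. f (c + z) \<partial>lborel) = (\<integral>\<^sup>+z. f z \<partial>lborel)"
proof -
  have "(\<integral>\<^sup>+z. f z \<partial>lborel) = (\<integral>\<^sup>+z. f z \<partial>distr lborel borel ((+) c))"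
    by (simp add: lborel_distr_plus)
  then show ?thesis by (simp add: nn_integral_distr)
qed

lemma nn_integral_lborel_scale:
  fixes f :: "'a::euclidean_space \<Rightarrow> ennreal"
  assumes [measurable]: "f \<in> borel_measurable borel" and c: "0 < c"
  shows "(\<integral>\<^sup>+z. f (c *\<^sub>R z) \<partial>lborel) = ennreal ((1 / c) ^ DIM('a)) * (\<integral>\<^sup>+z. f z \<partial>lborel)"
proof -
  have "(\<integral>\<^sup>+z. f z \<partial>lborel) = (\<integral>\<^sup>+z. f z \<partial>density (distr lborel borel (\<lambda>x. 0 + c *\<^sub>R x)) (\<lambda>_. \<bar>c\<bar> ^ DIM('a)))"
    using lborel_affine[of c "0 :: 'a"] c by simp
  also have "\<dots> = ennreal (c ^ DIM('a)) * (\<integral>\<^sup>+z. f (c *\<^sub>R z) \<partial>lborel)"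
    using c by (simp add: nn_integral_density nn_integral_distr nn_integral_cmult)
  finally have "ennreal ((1 / c) ^ DIM('a)) * (\<integral>\<^sup>+z. f z \<partial>lborel)
    = ennreal ((1 / c) ^ DIM('a) * c ^ DIM('a)) * (\<integral>\<^sup>+z. f (c *\<^sub>R z) \<partial>lborel)"
    using c by (simp add: ennreal_mult mult.assoc)
  also have "(1 / c) ^ DIM('a) * c ^ DIM('a) = 1"
    using c by (simp add: power_mult_distrib[symmetric])
  finally show ?thesis by simp
qed

text \<open>Complete the square and translate.\<close>

lemma nn_integral_gauss:
  fixes v :: "'a::euclidean_space"
  assumes c: "0 < c"
  shows "(\<integral>\<^sup>+z. ennreal (exp (- c * (norm z)\<^sup>2 + 2 * inner v z)) \<partial>lborel)
    = ennreal ((1 / sqrt c) ^ DIM('a) * exp ((norm v)\<^sup>2 / c)) * gauss_const TYPE('a)"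
proof -
  have sq: "- c * (norm z)\<^sup>2 + 2 * inner v z = - (norm (sqrt c *\<^sub>R (- (1 / c) *\<^sub>R v + z)))\<^sup>2 + (norm v)\<^sup>2 / c" for z
  proof -
    have "sqrt c *\<^sub>R (- (1 / c) *\<^sub>R v + z) = sqrt c *\<^sub>R z - (sqrt c / c) *\<^sub>R v"
      by (simp add: algebra_simps)
    moreover have "(norm (sqrt c *\<^sub>R z - (sqrt c / c) *\<^sub>R v))\<^sup>2 = c * inner z z - 2 * inner v z + inner v v / c"
    proof -
      define r where "r = sqrt c"
      have "c = r * r" "0 < r" using c by (simp_all add: r_def)
      then show ?thesis
        unfolding r_def[symmetric]
        by (simp add: power2_norm_eq_inner inner_diff_left inner_diff_right inner_commute field_simps)
    qed
    ultimately show ?thesis by (simp add: power2_norm_eq_inner)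
  qed
  have "(\<integral>\<^sup>+z. ennreal (exp (- c * (norm z)\<^sup>2 + 2 * inner v z)) \<partial>lborel)
    = (\<integral>\<^sup>+z. ennreal (exp ((norm v)\<^sup>2 / c)) * ennreal (exp (- (norm (sqrt c *\<^sub>R (- (1 / c) *\<^sub>R v + z)))\<^sup>2)) \<partial>lborel)"
  proof -
    have "exp (- c * (norm z)\<^sup>2 + 2 * inner v z) = exp ((norm v)\<^sup>2 / c) * exp (- (norm (sqrt c *\<^sub>R (- (1 / c) *\<^sub>R v + z)))\<^sup>2)" for z
      unfolding sq by (simp only: exp_add mult.commute)
    then show ?thesis by (simp only: ennreal_mult'[OF exp_ge_zero])
  qed
  also have "\<dots> = ennreal (exp ((norm v)\<^sup>2 / c)) * (\<integral>\<^sup>+z. ennreal (exp (- (norm (sqrt c *\<^sub>R (- (1 / c) *\<^sub>R v + z)))\<^sup>2)) \<partial>lborel)"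
    by (rule nn_integral_cmult) simp
  also have "(\<integral>\<^sup>+z. ennreal (exp (- (norm (sqrt c *\<^sub>R (- (1 / c) *\<^sub>R v + z)))\<^sup>2)) \<partial>lborel)
     = (\<integral>\<^sup>+z. ennreal (exp (- (norm (sqrt c *\<^sub>R (z :: 'a)))\<^sup>2)) \<partial>lborel)"
    by (rule nn_integral_lborel_shift[of "\<lambda>z :: 'a. ennreal (exp (- (norm (sqrt c *\<^sub>R z))\<^sup>2))"]) simp
  also have "\<dots> = ennreal ((1 / sqrt c) ^ DIM('a)) * gauss_const TYPE('a)"
    unfolding gauss_const_def
    by (rule nn_integral_lborel_scale[of "\<lambda>z :: 'a. ennreal (exp (- (norm z)\<^sup>2))"]) (use c in auto)
  finally show ?thesis
    using c by (simp add: ennreal_mult' mult_ac)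
qed

lemma gauss_const_eq: "gauss_const TYPE('a::euclidean_space) = ennreal (sqrt pi ^ DIM('a))"
proof -
  have real: "(\<integral>\<^sup>+x. ennreal (exp (- (x :: real)\<^sup>2)) \<partial>lborel) = ennreal (sqrt pi)"
  proof -
    interpret prob_space "density lborel (normal_density 0 (1 / sqrt 2))"
      by (rule prob_space_normal_density) simp
    have "ennreal (sqrt pi) * (\<integral>\<^sup>+x. normal_density 0 (1 / sqrt 2) x \<partial>lborel) = ennreal (sqrt pi)"
      using emeasure_space_1 by (simp add: emeasure_density)
    then show ?thesis
      by (subst (asm) nn_integral_cmult[symmetric]) (simp_all add: ennreal_mult'[symmetric] normal_density_def power_divide real_sqrt_mult[symmetric])
  qed
  have "gauss_const TYPE('a) = (\<integral>\<^sup>+z. (\<Prod>b\<in>Basis. ennreal (exp (- ((z :: 'a) \<bullet> b)\<^sup>2))) \<partial>lborel)"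
    unfolding gauss_const_def
  proof (intro nn_integral_cong)
    fix z :: 'a
    have "(norm z)\<^sup>2 = (\<Sum>b\<in>Basis. (z \<bullet> b)\<^sup>2)"
      unfolding power2_norm_eq_inner by (subst euclidean_inner) (simp add: power2_eq_square)
    then show "ennreal (exp (- (norm z)\<^sup>2)) = (\<Prod>b\<in>Basis. ennreal (exp (- (z \<bullet> b)\<^sup>2)))"
      by (simp add: prod_ennreal exp_sum[symmetric] sum_negf)
  qed
  also have "\<dots> = (\<Prod>b\<in>(Basis :: 'a set). \<integral>\<^sup>+x. ennreal (exp (- x\<^sup>2)) \<partial>lborel)"
    by (rule nn_integral_lborel_prod) simp_all
  finally show ?thesis by (simp add: real ennreal_power)
qed

text \<open>Treats the real, complex and quaternionic scalars at once. Since the inner product is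
  the real part of p times the conjugate of q, \<open>adj\<close> expresses the cyclicity of the
  real part of a product. Octonions fail \<open>assoc\<close> and get their own
  construction.\<close>

locale hermitian_scalars =
  fixes mul :: "'a::euclidean_space \<Rightarrow> 'a \<Rightarrow> 'a" and cj :: "'a \<Rightarrow> 'a" and e :: 'a
  assumes bil: "bounded_bilinear mul"
    and assoc: "mul (mul a b) c = mul a (mul b c)"
    and one: "mul e a = a"
    and lin_cj: "bounded_linear cj"
    and cj_mul: "cj (mul a b) = mul (cj b) (cj a)"
    and cj_cj: "cj (cj a) = a"
    and norm_mul: "norm (mul a b) = norm a * norm b"
    and norm_cj: "norm (cj a) = norm a"
    and adj: "inner a (mul b (cj c)) = inner (mul (cj a) b) c"
begin

interpretation mul: bounded_bilinear mul by (rule bil)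
interpretation cj: bounded_linear cj by (rule lin_cj)

definition lmul :: "'a \<Rightarrow> 'a ^ 'n \<Rightarrow> 'a ^ 'n" where "lmul c x = (\<chi> i. mul c (x $ i))"

text \<open>Turns a scalar paired with a Hermitian product into a real linear functional of
  \<open>z\<close>, which is the form in which a square can be completed.\<close>

lemma inner_herm: "inner g (herm mul cj x z) = inner (lmul (cj g) x) z"
  by (simp add: herm_def lmul_def inner_vec_def inner_sum_right adj)

lemma norm_lmul: "norm (lmul c x) = norm c * norm x"
  by (simp add: lmul_def norm_vec_def norm_mul L2_set_right_distrib)

lemma herm_lmul: "herm mul cj x (lmul c y) = mul (herm mul cj x y) (cj c)"
  by (simp add: herm_def lmul_def cj_mul mul.sum_left flip: assoc)

lemma inner_lmul_lmul: "inner (lmul (cj g) x) (lmul (cj h) y) = inner g (mul (herm mul cj x y) h)"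
  by (simp add: inner_herm[symmetric] herm_lmul cj_cj)

lemma continuous_herm [continuous_intros]:
  assumes "continuous_on S f"
  shows "continuous_on S (\<lambda>v. herm mul cj x (f v))"
  unfolding herm_def
  by (intro continuous_on_sum mul.continuous_on cj.continuous_on continuous_on_const continuous_on_component assms)

text \<open>On the span of x and y the form in the exponent has determinant (\<Lambda> - a)
  (\<Lambda> - b) - a b u, counted \<kappa>/2 times. To avoid determinants over noncommutative
  scalars, each squared modulus is linearised by an auxiliary Gaussian scalar
  (Hubbard-Stratonovich), and \<open>z\<close> is integrated out first.\<close>

lemma gaussian_law:
  fixes x y :: "'a ^ 'n"
  assumes x: "norm x = 1" "norm y = 1" and ab: "0 \<le> a" "0 \<le> b" "a + b < \<Lambda>"
  defines "u \<equiv> (norm (herm mul cj x y))\<^sup>2"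
  shows "(\<integral>\<^sup>+z. ennreal (exp (- \<Lambda> * (norm z)\<^sup>2 + a * (norm (herm mul cj x z))\<^sup>2 + b * (norm (herm mul cj y z))\<^sup>2)) \<partial>lborel)
    = ennreal ((1 / sqrt \<Lambda>) ^ DIM('a ^ 'n) * (\<Lambda> / sqrt ((\<Lambda> - a) * (\<Lambda> - b) - a * b * u)) ^ DIM('a))
      * gauss_const TYPE('a ^ 'n)"
proof -
  define H where "H = herm mul cj x y"
  define \<Gamma> where "\<Gamma> = gauss_const TYPE('a)"
  have \<Gamma>: "\<Gamma> \<noteq> 0" "\<Gamma> \<noteq> top" by (simp_all add: \<Gamma>_def gauss_const_eq)
  define Hx where "Hx z = herm mul cj x z" for z
  define Hy where "Hy z = herm mul cj y z" for z
  have [continuous_intros]: "continuous_on S (\<lambda>v. Hx (f v))" "continuous_on S (\<lambda>v. Hy (f v))" if "continuous_on S f" for S and f :: "'c::topological_space \<Rightarrow> _"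
    unfolding Hx_def Hy_def by (intro continuous_intros that)+
  have \<Lambda>: "0 < \<Lambda>" using ab by simp
  have u1: "0 \<le> u" by (simp add: u_def)
  have u2: "u \<le> 1"
  proof -
    have "(norm H)\<^sup>2 = inner (lmul (cj H) x) y" unfolding H_def by (simp add: inner_herm[symmetric] power2_norm_eq_inner)
    also have "\<dots> \<le> norm (lmul (cj H) x) * norm y" by (rule norm_cauchy_schwarz)
    finally have "(norm H)\<^sup>2 \<le> norm H" by (simp add: norm_lmul x norm_cj)
    then have "norm H \<le> 1"
    proof (rule contrapos_pp)
      assume "\<not> norm H \<le> 1"
      then have "norm H * 1 < norm H * norm H" by (intro mult_strict_left_mono) auto
      then show "\<not> (norm H)\<^sup>2 \<le> norm H" by (simp add: power2_eq_square)
    qed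
    then show ?thesis by (simp add: u_def H_def[symmetric] power_le_one)
  qed
  \<comment> \<open>The coefficient of |g|^2 that remains once \<open>z\<close> has been integrated
    out, and, in \<open>c2\<close>, that of |h|^2 once \<open>g\<close> is integrated out
    too.\<close>
  define c1 where "c1 = 1 - a / \<Lambda>"
  define c2 where "c2 = 1 - b / \<Lambda> - (sqrt (a * b) / \<Lambda>)\<^sup>2 * u / c1"
  have c1: "0 < c1" using ab \<Lambda> by (simp add: c1_def)
  have c12: "c1 * c2 = ((\<Lambda> - a) * (\<Lambda> - b) - a * b * u) / \<Lambda>\<^sup>2"
  proof -
    have "c1 * c2 = c1 * (1 - b / \<Lambda>) - (sqrt (a * b) / \<Lambda>)\<^sup>2 * u"
      using c1 by (simp add: c2_def right_diff_distrib)
    also have "\<dots> = ((\<Lambda> - a) * (\<Lambda> - b) - a * b * u) / \<Lambda>\<^sup>2"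
      using \<Lambda> ab by (simp add: c1_def power_divide field_simps power2_eq_square)
    finally show ?thesis .
  qed
  have pos: "0 < (\<Lambda> - a) * (\<Lambda> - b) - a * b * u"
  proof -
    have "a * b * u \<le> a * b" using ab u2 by (simp add: mult_left_le)
    moreover have "0 < \<Lambda> * (\<Lambda> - (a + b))" using ab \<Lambda> by simp
    ultimately show ?thesis by (simp add: algebra_simps)
  qed
  have c2: "0 < c2" using c12 pos c1 \<Lambda> by (metis zero_less_divide_iff zero_less_mult_pos zero_less_power)
  let ?I = "\<integral>\<^sup>+z. ennreal (exp (- \<Lambda> * (norm z)\<^sup>2 + a * (norm (Hx z))\<^sup>2 + b * (norm (Hy z))\<^sup>2)) \<partial>lborel"
  \<comment> \<open>The Gaussian integral read backwards: s |w|^2 becomes linear in w at the price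
    of a factor \<Gamma>. It is used with \<open>h\<close> for y and then with \<open>g\<close> for
    x; both factors cancel at the end because \<Gamma> is positive and finite.\<close>
  have lin: "\<Gamma> * ennreal (exp (t + s * (norm w)\<^sup>2)) = (\<integral>\<^sup>+g. ennreal (exp (t - (norm g)\<^sup>2 + 2 * inner (sqrt s *\<^sub>R w) g)) \<partial>lborel)"
    if "0 \<le> s" for t s and w :: 'a
  proof -
    have "(\<integral>\<^sup>+g. ennreal (exp (t - (norm g)\<^sup>2 + 2 * inner (sqrt s *\<^sub>R w) g)) \<partial>lborel)
      = (\<integral>\<^sup>+g. ennreal (exp t) * ennreal (exp (- 1 * (norm g)\<^sup>2 + 2 * inner (sqrt s *\<^sub>R w) g)) \<partial>lborel)"
      by (simp add: ennreal_mult'[symmetric] exp_add[symmetric] algebra_simps)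
    also have "\<dots> = ennreal (exp t) * (\<integral>\<^sup>+g. ennreal (exp (- 1 * (norm g)\<^sup>2 + 2 * inner (sqrt s *\<^sub>R w) g)) \<partial>lborel)"
      by (rule nn_integral_cmult) simp
    also have "\<dots> = \<Gamma> * ennreal (exp (t + s * (norm w)\<^sup>2))"
      by (subst nn_integral_gauss) (use that in \<open>simp_all add: \<Gamma>_def power_mult_distrib exp_add ennreal_mult' mult_ac\<close>)
    finally show ?thesis by simp
  qed
  have meas: "(\<lambda>v. ennreal (f v)) \<in> borel_measurable (lborel \<Otimes>\<^sub>M lborel)" if "continuous_on UNIV f" for f :: "'c::euclidean_space \<times> 'd::euclidean_space \<Rightarrow> real"
    unfolding lborel_prod using borel_measurable_continuous_onI[OF that] by simp
  have "\<Gamma> * ?I = (\<integral>\<^sup>+z. \<Gamma> * ennreal (exp (- \<Lambda> * (norm z)\<^sup>2 + a * (norm (Hx z))\<^sup>2 + b * (norm (Hy z))\<^sup>2)) \<partial>lborel)"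
    by (rule nn_integral_cmult[symmetric]) (auto intro!: borel_measurable_continuous_onI continuous_intros)
  also have "\<dots> = (\<integral>\<^sup>+z. \<integral>\<^sup>+h. ennreal (exp (- \<Lambda> * (norm z)\<^sup>2 + a * (norm (Hx z))\<^sup>2 - (norm h)\<^sup>2 + 2 * inner (sqrt b *\<^sub>R Hy z) h)) \<partial>lborel \<partial>lborel)"
    by (subst lin) (use ab in auto)
  also have "\<dots> = (\<integral>\<^sup>+h. \<integral>\<^sup>+z. ennreal (exp (- \<Lambda> * (norm z)\<^sup>2 + a * (norm (Hx z))\<^sup>2 - (norm h)\<^sup>2 + 2 * inner (sqrt b *\<^sub>R Hy z) h)) \<partial>lborel \<partial>lborel)"
    by (rule lborel_pair.Fubini', unfold case_prod_unfold, rule meas) (intro continuous_intros)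
  finally have 1: "\<Gamma> * ?I = \<dots>" .
  have inner_z: "(\<integral>\<^sup>+z. ennreal (exp (- \<Lambda> * (norm z)\<^sup>2 + a * (norm (Hx z))\<^sup>2 - (norm h)\<^sup>2 + 2 * inner (sqrt b *\<^sub>R Hy z) h)) \<partial>lborel) * \<Gamma>
     = ennreal ((1 / sqrt \<Lambda>) ^ DIM('a ^ 'n) * (1 / sqrt c1) ^ DIM('a)) * gauss_const TYPE('a ^ 'n) * \<Gamma> * ennreal (exp (- c2 * (norm h)\<^sup>2 + 2 * inner 0 h))" for h
  proof -
    have "\<Gamma> * (\<integral>\<^sup>+z. ennreal (exp (- \<Lambda> * (norm z)\<^sup>2 + a * (norm (Hx z))\<^sup>2 - (norm h)\<^sup>2 + 2 * inner (sqrt b *\<^sub>R Hy z) h)) \<partial>lborel)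
      = (\<integral>\<^sup>+z. \<Gamma> * ennreal (exp ((- \<Lambda> * (norm z)\<^sup>2 - (norm h)\<^sup>2 + 2 * inner (sqrt b *\<^sub>R Hy z) h) + a * (norm (Hx z))\<^sup>2)) \<partial>lborel)"
      by (subst nn_integral_cmult[symmetric]) (auto intro!: borel_measurable_continuous_onI continuous_intros simp: algebra_simps)
    also have "\<dots> = (\<integral>\<^sup>+z. \<integral>\<^sup>+g. ennreal (exp (- \<Lambda> * (norm z)\<^sup>2 - (norm h)\<^sup>2 + 2 * inner (sqrt b *\<^sub>R Hy z) h - (norm g)\<^sup>2 + 2 * inner (sqrt a *\<^sub>R Hx z) g)) \<partial>lborel \<partial>lborel)"
      by (subst lin) (use ab in auto)
    also have "\<dots> = (\<integral>\<^sup>+g. \<integral>\<^sup>+z. ennreal (exp (- \<Lambda> * (norm z)\<^sup>2 - (norm h)\<^sup>2 + 2 * inner (sqrt b *\<^sub>R Hy z) h - (norm g)\<^sup>2 + 2 * inner (sqrt a *\<^sub>R Hx z) g)) \<partial>lborel \<partial>lborel)"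
      by (rule lborel_pair.Fubini', unfold case_prod_unfold, rule meas) (intro continuous_intros)
    also have "\<dots> = (\<integral>\<^sup>+g. (ennreal ((1 / sqrt \<Lambda>) ^ DIM('a ^ 'n) * exp ((b / \<Lambda> - 1) * (norm h)\<^sup>2)) * gauss_const TYPE('a ^ 'n)) *
        ennreal (exp (- c1 * (norm g)\<^sup>2 + 2 * inner ((sqrt (a * b) / \<Lambda>) *\<^sub>R mul H h) g)) \<partial>lborel)"
    proof (rule nn_integral_cong)
      fix g :: 'a
      \<comment> \<open>Collects both linear terms. In |v|^2 the points x and y interact only
        through \<open>inner (mul H h) g\<close>, which is why the answer depends on them through
        |H| alone.\<close>
      define v where "v = sqrt a *\<^sub>R lmul (cj g) x + sqrt b *\<^sub>R lmul (cj h) y"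
      have v: "inner (sqrt b *\<^sub>R Hy z) h + inner (sqrt a *\<^sub>R Hx z) g = inner v z" for z
        by (simp add: v_def Hx_def Hy_def inner_add_left inner_herm[symmetric] inner_commute[of _ g] inner_commute[of _ h])
      have nv: "(norm v)\<^sup>2 = a * (norm g)\<^sup>2 + b * (norm h)\<^sup>2 + 2 * sqrt (a * b) * inner (mul H h) g"
      proof -
        have "(norm v)\<^sup>2 = a * (norm (lmul (cj g) x))\<^sup>2 + b * (norm (lmul (cj h) y))\<^sup>2 + 2 * sqrt a * sqrt b * inner (lmul (cj g) x) (lmul (cj h) y)"
          using ab by (simp add: v_def power2_norm_eq_inner inner_add_left inner_add_right inner_commute flip: mult.assoc)
        then show ?thesis
          by (simp add: norm_lmul x norm_cj inner_lmul_lmul H_def real_sqrt_mult inner_commute)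
      qed
      have "(\<integral>\<^sup>+z. ennreal (exp (- \<Lambda> * (norm z)\<^sup>2 - (norm h)\<^sup>2 + 2 * inner (sqrt b *\<^sub>R Hy z) h - (norm g)\<^sup>2 + 2 * inner (sqrt a *\<^sub>R Hx z) g)) \<partial>lborel)
         = (\<integral>\<^sup>+z. ennreal (exp (- (norm h)\<^sup>2 - (norm g)\<^sup>2)) * ennreal (exp (- \<Lambda> * (norm z)\<^sup>2 + 2 * inner v z)) \<partial>lborel)"
        by (simp add: ennreal_mult'[symmetric] exp_add[symmetric] v[symmetric] algebra_simps)
      also have "\<dots> = ennreal (exp (- (norm h)\<^sup>2 - (norm g)\<^sup>2)) * (\<integral>\<^sup>+z. ennreal (exp (- \<Lambda> * (norm z)\<^sup>2 + 2 * inner v z)) \<partial>lborel)"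
        by (rule nn_integral_cmult) simp
      also have "\<dots> = ennreal ((1 / sqrt \<Lambda>) ^ DIM('a ^ 'n) * (exp (- (norm h)\<^sup>2 - (norm g)\<^sup>2) * exp ((norm v)\<^sup>2 / \<Lambda>))) * gauss_const TYPE('a ^ 'n)"
        using \<Lambda> by (subst nn_integral_gauss[OF \<Lambda>]) (simp add: ennreal_mult' mult_ac)
      also have "exp (- (norm h)\<^sup>2 - (norm g)\<^sup>2) * exp ((norm v)\<^sup>2 / \<Lambda>)
         = exp ((b / \<Lambda> - 1) * (norm h)\<^sup>2) * exp (- c1 * (norm g)\<^sup>2 + 2 * inner ((sqrt (a * b) / \<Lambda>) *\<^sub>R mul H h) g)"
        unfolding nv exp_add[symmetric] using \<Lambda> by (simp add: c1_def field_simps)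
      finally show "(\<integral>\<^sup>+z. ennreal (exp (- \<Lambda> * (norm z)\<^sup>2 - (norm h)\<^sup>2 + 2 * inner (sqrt b *\<^sub>R Hy z) h - (norm g)\<^sup>2 + 2 * inner (sqrt a *\<^sub>R Hx z) g)) \<partial>lborel)
        = (ennreal ((1 / sqrt \<Lambda>) ^ DIM('a ^ 'n) * exp ((b / \<Lambda> - 1) * (norm h)\<^sup>2)) * gauss_const TYPE('a ^ 'n)) *
        ennreal (exp (- c1 * (norm g)\<^sup>2 + 2 * inner ((sqrt (a * b) / \<Lambda>) *\<^sub>R mul H h) g))"
        using \<Lambda> by (simp add: ennreal_mult' mult_ac)
    qed
    also have "\<dots> = (ennreal ((1 / sqrt \<Lambda>) ^ DIM('a ^ 'n) * exp ((b / \<Lambda> - 1) * (norm h)\<^sup>2)) * gauss_const TYPE('a ^ 'n)) *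
        (\<integral>\<^sup>+g. ennreal (exp (- c1 * (norm g)\<^sup>2 + 2 * inner ((sqrt (a * b) / \<Lambda>) *\<^sub>R mul H h) g)) \<partial>lborel)"
      by (rule nn_integral_cmult) simp
    also have "\<dots> = ennreal ((1 / sqrt \<Lambda>) ^ DIM('a ^ 'n) * (1 / sqrt c1) ^ DIM('a) *
        (exp ((b / \<Lambda> - 1) * (norm h)\<^sup>2) * exp ((norm ((sqrt (a * b) / \<Lambda>) *\<^sub>R mul H h))\<^sup>2 / c1))) * gauss_const TYPE('a ^ 'n) * \<Gamma>"
      using c1 \<Lambda> by (subst nn_integral_gauss[OF c1]) (simp add: ennreal_mult' mult_ac \<Gamma>_def)
    also have "exp ((b / \<Lambda> - 1) * (norm h)\<^sup>2) * exp ((norm ((sqrt (a * b) / \<Lambda>) *\<^sub>R mul H h))\<^sup>2 / c1)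
       = exp (- c2 * (norm h)\<^sup>2 + 2 * inner 0 h)"
      unfolding exp_add[symmetric] using c1
      by (simp add: c2_def norm_mul power_mult_distrib u_def H_def[symmetric] field_simps)
    finally show ?thesis using c1 \<Lambda> by (simp add: ennreal_mult' mult_ac)
  qed
  have "\<Gamma> * (\<Gamma> * ?I) = (\<integral>\<^sup>+h. (\<integral>\<^sup>+z. ennreal (exp (- \<Lambda> * (norm z)\<^sup>2 + a * (norm (Hx z))\<^sup>2 - (norm h)\<^sup>2 + 2 * inner (sqrt b *\<^sub>R Hy z) h)) \<partial>lborel) * \<Gamma> \<partial>lborel)"
  proof -
    have "(\<lambda>h. \<integral>\<^sup>+z. ennreal (exp (- \<Lambda> * (norm z)\<^sup>2 + a * (norm (Hx z))\<^sup>2 - (norm h)\<^sup>2 + 2 * inner (sqrt b *\<^sub>R Hy z) h)) \<partial>lborel) \<in> borel_measurable (lborel :: 'a measure)"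
      by (intro lborel.borel_measurable_nn_integral, unfold case_prod_unfold, intro meas continuous_intros)
    from nn_integral_multc[OF this, of \<Gamma>] show ?thesis
      unfolding 1 by (simp add: mult.commute)
  qed
  also have "\<dots> = (\<integral>\<^sup>+h. ennreal ((1 / sqrt \<Lambda>) ^ DIM('a ^ 'n) * (1 / sqrt c1) ^ DIM('a)) * gauss_const TYPE('a ^ 'n) * \<Gamma> * ennreal (exp (- c2 * (norm h)\<^sup>2 + 2 * inner 0 h)) \<partial>(lborel :: 'a measure))"
    unfolding inner_z ..
  also have "\<dots> = ennreal ((1 / sqrt \<Lambda>) ^ DIM('a ^ 'n) * (1 / sqrt c1) ^ DIM('a)) * gauss_const TYPE('a ^ 'n) * \<Gamma> * (\<integral>\<^sup>+h. ennreal (exp (- c2 * (norm h)\<^sup>2 + 2 * inner 0 h)) \<partial>(lborel :: 'a measure))"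
    by (rule nn_integral_cmult) simp
  also have "\<dots> = \<Gamma> * (\<Gamma> * (ennreal ((1 / sqrt \<Lambda>) ^ DIM('a ^ 'n) * ((1 / sqrt c1) ^ DIM('a) * (1 / sqrt c2) ^ DIM('a))) * gauss_const TYPE('a ^ 'n)))"
    using c1 c2 \<Lambda> by (subst nn_integral_gauss[OF c2]) (simp add: ennreal_mult' mult_ac \<Gamma>_def)
  also have "(1 / sqrt c1) ^ DIM('a) * (1 / sqrt c2) ^ DIM('a) = (1 / sqrt c1 * (1 / sqrt c2)) ^ DIM('a)"
    by (rule power_mult_distrib[symmetric])
  finally have "?I = ennreal ((1 / sqrt \<Lambda>) ^ DIM('a ^ 'n) * (1 / sqrt c1 * (1 / sqrt c2)) ^ DIM('a)) * gauss_const TYPE('a ^ 'n)"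
    using \<Gamma> by (simp add: ennreal_mult_cancel_left)
  also have "1 / sqrt c1 * (1 / sqrt c2) = 1 / sqrt (c1 * c2)"
    by (simp add: real_sqrt_mult)
  also have "\<dots> = \<Lambda> / sqrt ((\<Lambda> - a) * (\<Lambda> - b) - a * b * u)"
    unfolding c12 using \<Lambda> by (simp add: real_sqrt_divide)
  finally show ?thesis unfolding Hx_def Hy_def .
qed

end

section \<open>The octonionic law\<close>

text \<open>Makes the two cross terms cancel when the norm of a Cayley-Dickson product is expanded;
  this is where associativity of the quaternions enters the multiplicativity of the octonion
  norm.\<close>

lemma inner_qmul_swap:
  "inner (qmul a c) (qmul (qcnj d) b) = inner (qmul d a) (qmul b (qcnj c))"
  by (simp add: qmul_def qcnj_def inner_prod_def inner_complex_def algebra_simps)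

lemma norm_omul: "norm (omul a b) = norm a * norm b"
proof -
  obtain a1 a2 b1 b2 where ab: "a = (a1, a2)" "b = (b1, b2)" by (cases a; cases b)
  have n: "(norm (qmul p q))\<^sup>2 = (norm p)\<^sup>2 * (norm q)\<^sup>2" for p q
    by (simp add: norm_qmul power_mult_distrib)
  have "(norm (omul a b))\<^sup>2 = (norm (qmul a1 b1 - qmul (qcnj b2) a2))\<^sup>2 + (norm (qmul b2 a1 + qmul a2 (qcnj b1)))\<^sup>2"
    by (simp add: ab omul_def norm_prod_def)
  also have "\<dots> = (norm (qmul a1 b1))\<^sup>2 + (norm (qmul (qcnj b2) a2))\<^sup>2 + (norm (qmul b2 a1))\<^sup>2 + (norm (qmul a2 (qcnj b1)))\<^sup>2
     - 2 * inner (qmul a1 b1) (qmul (qcnj b2) a2) + 2 * inner (qmul b2 a1) (qmul a2 (qcnj b1))"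
    by (simp add: power2_norm_eq_inner inner_diff_left inner_diff_right inner_add_left inner_add_right inner_commute)
  also have "\<dots> = ((norm a1)\<^sup>2 + (norm a2)\<^sup>2) * ((norm b1)\<^sup>2 + (norm b2)\<^sup>2)"
    unfolding inner_qmul_swap n by (simp add: norm_qcnj algebra_simps)
  also have "\<dots> = (norm a * norm b)\<^sup>2"
    by (simp add: ab norm_prod_def power_mult_distrib)
  finally show ?thesis by (simp add: power2_eq_iff_nonneg)
qed

text \<open>Together with its left counterpart and \<open>norm_omul\<close> this replaces
  associativity: in the octonionic integrals factors are only moved across the inner
  product.\<close>

lemma inner_omul_right: "inner (omul a b) c = inner a (omul c (ocnj b))"
  by (simp add: omul_def ocnj_def qmul_def qcnj_def inner_prod_def inner_complex_def algebra_simps)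

lemma inner_omul_left: "inner (omul a b) c = inner b (omul (ocnj a) c)"
  by (simp add: omul_def ocnj_def qmul_def qcnj_def inner_prod_def inner_complex_def algebra_simps)

lemma norm_ocnj: "norm (ocnj a) = norm a"
proof -
  have "norm (ocnj a) = sqrt ((norm (qcnj (fst a)))\<^sup>2 + (norm (snd a))\<^sup>2)"
    by (simp only: ocnj_def norm_prod_def[of "(qcnj (fst a), - snd a)"] fst_conv snd_conv norm_minus_cancel)
  also have "\<dots> = norm a" by (simp only: norm_qcnj norm_prod_def[of a])
  finally show ?thesis .
qed

lemma ore_omul: "ore (omul a b) = inner (ocnj a) b"
  by (simp add: ore_def omul_def ocnj_def qmul_def qcnj_def inner_prod_def inner_complex_def algebra_simps)

lemma ocnj_ocnj: "ocnj (ocnj a) = a"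
  by (simp add: ocnj_def qcnj_def)

lemma bounded_bilinear_omul: "bounded_bilinear omul"
proof -
  have "bilinear omul"
    unfolding bilinear_def linear_iff
    by (simp add: omul_def qmul_def qcnj_def algebra_simps)
  then show ?thesis by (simp add: bilinear_conv_bounded_bilinear)
qed

lemma bounded_linear_ocnj: "bounded_linear ocnj"
  unfolding linear_conv_bounded_linear[symmetric] linear_iff
  by (simp add: ocnj_def qcnj_def algebra_simps)

interpretation omul: bounded_bilinear omul by (rule bounded_bilinear_omul)

section \<open>Coordinates and the trace form on the Cayley plane\<close>

definition d1 :: "oct ^ 3 ^ 3 \<Rightarrow> real" where "d1 P = ore (P $ 1 $ 1)"
definition d2 :: "oct ^ 3 ^ 3 \<Rightarrow> real" where "d2 P = ore (P $ 2 $ 2)"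
definition d3 :: "oct ^ 3 ^ 3 \<Rightarrow> real" where "d3 P = ore (P $ 3 $ 3)"

text \<open>Compare entries in P P = P. The diagonal equations show each diagonal entry as a sum of
  squares; together with trace 1 they are linear in the three squared norms and can be solved for
  them. In the off-diagonal equations trace 1 isolates the product of two entries. These relations
  say that P has rank one.\<close>

lemma cayley_plane_relations:
  assumes P: "P \<in> cayley_plane"
  defines "p \<equiv> P $ 1 $ 2" and "q \<equiv> P $ 1 $ 3" and "g \<equiv> P $ 2 $ 3"
  shows "d1 P + d2 P + d3 P = 1"
    "0 \<le> d1 P" "0 \<le> d2 P" "0 \<le> d3 P"
    "(norm p)\<^sup>2 = d1 P * d2 P" "(norm q)\<^sup>2 = d1 P * d3 P" "(norm g)\<^sup>2 = d2 P * d3 P"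
    "omul q (ocnj g) = d3 P *\<^sub>R p" "omul p g = d2 P *\<^sub>R q" "omul (ocnj p) q = d1 P *\<^sub>R g"
    "P $ 1 $ 1 = oct_of_real (d1 P)" "P $ 2 $ 2 = oct_of_real (d2 P)" "P $ 3 $ 3 = oct_of_real (d3 P)"
    "P $ 2 $ 1 = ocnj p" "P $ 3 $ 1 = ocnj q" "P $ 3 $ 2 = ocnj g"
proof -
  have h: "P $ i $ j = ocnj (P $ j $ i)" for i j
    using P unfolding cayley_plane_def oct_hermitian_def by blast
  have real: "a = oct_of_real (ore a)" if "ocnj a = a" for a
    using that by (auto simp: ocnj_def qcnj_def oct_of_real_def ore_def prod_eq_iff complex_eq_iff)
  show diag: "P $ 1 $ 1 = oct_of_real (d1 P)" "P $ 2 $ 2 = oct_of_real (d2 P)" "P $ 3 $ 3 = oct_of_real (d3 P)"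
    unfolding d1_def d2_def d3_def by (intro real h[symmetric])+
  show off: "P $ 2 $ 1 = ocnj p" "P $ 3 $ 1 = ocnj q" "P $ 3 $ 2 = ocnj g"
    unfolding p_def q_def g_def by (intro h)+
  have "jordan_mul P P = oct_matrix_mul P P"
    by (simp add: jordan_mul_def scaleR_add_right flip: scaleR_add_left)
  then have "oct_matrix_mul P P = P" using P by (simp add: cayley_plane_def)
  then have e: "(\<Sum>k\<in>UNIV. omul (P $ i $ k) (P $ k $ j)) = P $ i $ j" for i j
  proof -
    have "oct_matrix_mul P P $ i $ j = P $ i $ j" using \<open>oct_matrix_mul P P = P\<close> by simp
    then show ?thesis by (simp add: oct_matrix_mul_def)
  qed
  have rr: "omul (oct_of_real r) a = r *\<^sub>R a" "omul a (oct_of_real r) = r *\<^sub>R a" for r a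
    by (simp_all add: omul_def oct_of_real_def qmul_def qcnj_def prod_eq_iff complex_eq_iff)
  have nn: "omul a (ocnj a) = oct_of_real ((norm a)\<^sup>2)" "omul (ocnj a) a = oct_of_real ((norm a)\<^sup>2)" for a
    unfolding power2_norm_eq_inner
    by (simp_all add: omul_def ocnj_def oct_of_real_def qmul_def qcnj_def prod_eq_iff complex_eq_iff inner_prod_def inner_complex_def algebra_simps)
  have oor: "oct_of_real r + oct_of_real s = oct_of_real (r + s)" "r *\<^sub>R oct_of_real s = oct_of_real (r * s)"
    "oct_of_real r = oct_of_real s \<longleftrightarrow> r = s" for r s
    by (auto simp: oct_of_real_def scaleR_conv_of_real)
  have pq: "P $ 1 $ 2 = p" "P $ 1 $ 3 = q" "P $ 2 $ 3 = g" by (simp_all add: p_def q_def g_def)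
  note e = e[unfolded sum_3]
  have "oct_trace P = oct_of_real 1" using P by (simp add: cayley_plane_def)
  then show tr: "d1 P + d2 P + d3 P = 1"
    by (simp add: oct_trace_def sum_3 diag oor)
  have D: "d1 P * d1 P + (norm p)\<^sup>2 + (norm q)\<^sup>2 = d1 P" "d2 P * d2 P + (norm p)\<^sup>2 + (norm g)\<^sup>2 = d2 P"
    "d3 P * d3 P + (norm q)\<^sup>2 + (norm g)\<^sup>2 = d3 P"
    using e[of 1 1] e[of 2 2] e[of 3 3] by (simp_all add: diag off pq rr nn oor add_ac)
  show "0 \<le> d1 P" "0 \<le> d2 P" "0 \<le> d3 P"
    by (subst D(1)[symmetric] D(2)[symmetric] D(3)[symmetric], simp)+
  have d: "d1 P = 1 - d2 P - d3 P" using tr by simp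
  show "(norm p)\<^sup>2 = d1 P * d2 P" "(norm q)\<^sup>2 = d1 P * d3 P" "(norm g)\<^sup>2 = d2 P * d3 P"
    by (insert D d, algebra)+
  have *: "X = d *\<^sub>R v" if "a *\<^sub>R v + b *\<^sub>R v + X = v" "a + b + d = 1" for X v :: oct and a b d
  proof -
    have "X = v - (a *\<^sub>R v + b *\<^sub>R v)" using that(1) by (metis add_diff_cancel_left')
    also have "\<dots> = (1 - (a + b)) *\<^sub>R v" by (simp add: scaleR_diff_left scaleR_add_left)
    also have "1 - (a + b) = d" using that(2) by simp
    finally show ?thesis .
  qed
  show "omul q (ocnj g) = d3 P *\<^sub>R p"
    by (rule *[of "d1 P" _ "d2 P"]) (use e[of 1 2] tr in \<open>simp_all add: diag off pq rr\<close>)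
  show "omul p g = d2 P *\<^sub>R q"
    by (rule *[of "d1 P" _ "d3 P"]) (use e[of 1 3] tr in \<open>simp_all add: diag off pq rr add_ac\<close>)
  show "omul (ocnj p) q = d1 P *\<^sub>R g"
    by (rule *[of "d2 P" _ "d3 P"]) (use e[of 2 3] tr in \<open>simp_all add: diag off pq rr add_ac\<close>)
qed

text \<open>The real number tr (P \<circ> Q), read off the diagonal and the upper triangle.\<close>

definition cinner :: "oct ^ 3 ^ 3 \<Rightarrow> oct ^ 3 ^ 3 \<Rightarrow> real" where
  "cinner P Q = d1 P * d1 Q + d2 P * d2 Q + d3 P * d3 Q
    + 2 * (inner (P $ 1 $ 2) (Q $ 1 $ 2) + inner (P $ 1 $ 3) (Q $ 1 $ 3) + inner (P $ 2 $ 3) (Q $ 2 $ 3))"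

lemma ore_trace_jordan_mul:
  assumes "P \<in> cayley_plane" "Q \<in> cayley_plane"
  shows "ore (oct_trace (jordan_mul P Q)) = cinner P Q"
proof -
  note r = cayley_plane_relations[OF assms(1)] cayley_plane_relations[OF assms(2)]
  have ore: "ore (a + b) = ore a + ore b" "ore (s *\<^sub>R a) = s * ore a" for a b s
    by (simp_all add: ore_def)
  have i: "inner (oct_of_real s) (oct_of_real s') = s * s'" "inner (ocnj a) (ocnj b) = inner a b" "ocnj (oct_of_real s) = oct_of_real s" for s s' a b
    by (simp_all add: oct_of_real_def ocnj_def qcnj_def inner_prod_def inner_complex_def)
  show ?thesis
    unfolding oct_trace_def jordan_mul_def oct_matrix_mul_def
    by (simp add: sum_3 ore ore_omul r i ocnj_ocnj inner_commute cinner_def field_simps)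
qed

text \<open>The left side is the squared Hilbert-Schmidt distance tr ((P - Q) \<circ> (P - Q)), and
  tr (P \<circ> P) = tr P = 1. Both the bound by 1 and its equality case are read off from
  it.\<close>

lemma cinner_dist:
  assumes "P \<in> cayley_plane" "Q \<in> cayley_plane"
  shows "(d1 P - d1 Q)\<^sup>2 + (d2 P - d2 Q)\<^sup>2 + (d3 P - d3 Q)\<^sup>2
    + 2 * ((norm (P $ 1 $ 2 - Q $ 1 $ 2))\<^sup>2 + (norm (P $ 1 $ 3 - Q $ 1 $ 3))\<^sup>2 + (norm (P $ 2 $ 3 - Q $ 2 $ 3))\<^sup>2)
    = 2 - 2 * cinner P Q"
proof -
  note r = cayley_plane_relations[OF assms(1)] and r' = cayley_plane_relations[OF assms(2)]
  have n: "(norm (v - w))\<^sup>2 = (norm v)\<^sup>2 + (norm w)\<^sup>2 - 2 * inner v w" for v w :: oct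
    by (simp only: power2_norm_eq_inner) (simp add: inner_diff_left inner_diff_right inner_commute)
  have d: "d1 P = 1 - d2 P - d3 P" "d1 Q = 1 - d2 Q - d3 Q" using r(1) r'(1) by simp_all
  show ?thesis
    unfolding n r(5-7) r'(5-7) cinner_def d by (simp add: power2_eq_square algebra_simps)
qed

lemma cinner_le_1:
  assumes "P \<in> cayley_plane" "Q \<in> cayley_plane"
  shows "cinner P Q \<le> 1"
proof -
  have "0 \<le> 2 - 2 * cinner P Q" unfolding cinner_dist[OF assms, symmetric] by simp
  then show ?thesis by simp
qed

lemma cinner_eq_1:
  assumes "P \<in> cayley_plane" "Q \<in> cayley_plane" "cinner P Q = 1"
  shows "P = Q"
proof -
  have "(d1 P - d1 Q)\<^sup>2 + (d2 P - d2 Q)\<^sup>2 + (d3 P - d3 Q)\<^sup>2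
    + 2 * ((norm (P $ 1 $ 2 - Q $ 1 $ 2))\<^sup>2 + (norm (P $ 1 $ 3 - Q $ 1 $ 3))\<^sup>2 + (norm (P $ 2 $ 3 - Q $ 2 $ 3))\<^sup>2) = 0"
    unfolding cinner_dist[OF assms(1,2)] by (simp add: assms(3))
  then have "d1 P = d1 Q" "d2 P = d2 Q" "d3 P = d3 Q" "P $ 1 $ 2 = Q $ 1 $ 2" "P $ 1 $ 3 = Q $ 1 $ 3" "P $ 2 $ 3 = Q $ 2 $ 3"
    by (simp_all add: add_nonneg_eq_0_iff)
  then show ?thesis
    using cayley_plane_relations(11-16)[OF assms(1)] cayley_plane_relations(11-16)[OF assms(2)]
    by (simp add: vec_eq_iff forall_3)
qed

lemma cinner_self: "P \<in> cayley_plane \<Longrightarrow> cinner P P = 1"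
  using cinner_dist[of P P] by simp

text \<open>The trace pairing of two Hermitian matrices: one has diagonal s1, s2, s3 and upper
  entries b, c, g; the other is the rank one matrix with first row (1, \<xi>, \<eta>) and
  (2,3)-entry conj(\<xi>) \<eta>. Normalising the first coordinate to 1 avoids ambiguous triple
  products.\<close>

definition oform :: "real \<Rightarrow> real \<Rightarrow> real \<Rightarrow> oct \<Rightarrow> oct \<Rightarrow> oct \<Rightarrow> oct \<Rightarrow> oct \<Rightarrow> real" where
  "oform s1 s2 s3 b c g \<xi> \<eta> = s1 + s2 * (norm \<xi>)\<^sup>2 + s3 * (norm \<eta>)\<^sup>2
     + 2 * inner b \<xi> + 2 * inner c \<eta> + 2 * inner (omul \<xi> g) \<eta>"

text \<open>Freudenthal's cubic determinant of the Hermitian octonionic matrix with these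
  entries.\<close>

definition odet :: "real \<Rightarrow> real \<Rightarrow> real \<Rightarrow> oct \<Rightarrow> oct \<Rightarrow> oct \<Rightarrow> real" where
  "odet s1 s2 s3 b c g = s1 * s2 * s3 - s1 * (norm g)\<^sup>2 - s2 * (norm c)\<^sup>2 - s3 * (norm b)\<^sup>2
     + 2 * inner b (omul c (ocnj g))"

text \<open>The determinant of \<Lambda> I + s P + t Q. As P and Q have rank one, everything of
  third order in s and t cancels. The mixed triple products are reduced by moving a factor across
  the inner product until two entries of the same idempotent meet, where the rank one relations
  apply.\<close>

lemma odet_pencil:
  assumes "P \<in> cayley_plane" "Q \<in> cayley_plane"
  shows "odet (\<Lambda> + s * d1 P + t * d1 Q) (\<Lambda> + s * d2 P + t * d2 Q) (\<Lambda> + s * d3 P + t * d3 Q)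
      (s *\<^sub>R P $ 1 $ 2 + t *\<^sub>R Q $ 1 $ 2) (s *\<^sub>R P $ 1 $ 3 + t *\<^sub>R Q $ 1 $ 3) (s *\<^sub>R P $ 2 $ 3 + t *\<^sub>R Q $ 2 $ 3)
    = \<Lambda> * ((\<Lambda> + s) * (\<Lambda> + t) - s * t * cinner P Q)"
proof -
  note r = cayley_plane_relations[OF assms(1)] and r' = cayley_plane_relations[OF assms(2)]
  define p q g p' q' g' where defs: "p = P $ 1 $ 2" "q = P $ 1 $ 3" "g = P $ 2 $ 3" "p' = Q $ 1 $ 2" "q' = Q $ 1 $ 3" "g' = Q $ 2 $ 3"
  note r = r[folded defs] and r' = r'[folded defs]
  define x2 x3 y2 y3 where d: "x2 = d2 P" "x3 = d3 P" "y2 = d2 Q" "y3 = d3 Q"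
  have x1: "d1 P = 1 - x2 - x3" "d1 Q = 1 - y2 - y3" using r(1) r'(1) by (simp_all add: d)
  have nsum: "(norm (s *\<^sub>R v + t *\<^sub>R w))\<^sup>2 = s\<^sup>2 * (norm v)\<^sup>2 + 2 * s * t * inner v w + t\<^sup>2 * (norm w)\<^sup>2" for v w :: oct
  proof -
    have "inner (s *\<^sub>R v + t *\<^sub>R w) (s *\<^sub>R v + t *\<^sub>R w) = s * s * inner v v + 2 * s * t * inner v w + t * t * inner w w"
      by (simp add: inner_add_left inner_add_right inner_commute algebra_simps)
    then show ?thesis by (simp only: power2_norm_eq_inner power2_eq_square[of s] power2_eq_square[of t])
  qed
  have oc: "ocnj (s *\<^sub>R v + t *\<^sub>R w) = s *\<^sub>R ocnj v + t *\<^sub>R ocnj w" for v w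
    by (simp add: linear_add linear_scale bounded_linear.linear[OF bounded_linear_ocnj])
  have tri: "inner (s *\<^sub>R p + t *\<^sub>R p') (omul (s *\<^sub>R q + t *\<^sub>R q') (ocnj (s *\<^sub>R g + t *\<^sub>R g')))
    = s ^ 3 * inner p (omul q (ocnj g)) + t ^ 3 * inner p' (omul q' (ocnj g'))
     + s\<^sup>2 * t * (inner p' (omul q (ocnj g)) + inner p (omul q' (ocnj g)) + inner p (omul q (ocnj g')))
     + s * t\<^sup>2 * (inner p (omul q' (ocnj g')) + inner p' (omul q (ocnj g')) + inner p' (omul q' (ocnj g)))"
    by (simp add: oc omul.add_left omul.add_right omul.scaleR_left omul.scaleR_right inner_add_left inner_add_right
        power2_eq_square power3_eq_cube algebra_simps)
  have t1: "inner p (omul q (ocnj g)) = x3 * (norm p)\<^sup>2" "inner p' (omul q' (ocnj g')) = y3 * (norm p')\<^sup>2"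
    "inner p' (omul q (ocnj g)) = x3 * inner p p'" "inner p (omul q' (ocnj g')) = y3 * inner p p'"
    by (simp_all add: r r' d power2_norm_eq_inner inner_commute)
  have t2: "inner p (omul q' (ocnj g)) = x2 * inner q q'" "inner p' (omul q (ocnj g')) = y2 * inner q q'"
    unfolding inner_omul_right[symmetric] by (simp_all add: r r' d inner_commute)
  have t3: "inner p (omul q (ocnj g')) = (1 - x2 - x3) * inner g g'" "inner p' (omul q' (ocnj g)) = (1 - y2 - y3) * inner g g'"
    unfolding inner_omul_right[symmetric] unfolding inner_omul_left by (simp_all add: r r' x1 inner_commute)
  have c: "cinner P Q = (1 - x2 - x3) * (1 - y2 - y3) + x2 * y2 + x3 * y3 + 2 * (inner p p' + inner q q' + inner g g')"
    unfolding cinner_def x1 d[symmetric] defs[symmetric] ..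
  show ?thesis
    unfolding defs[symmetric] odet_def nsum tri t1 t2 t3 c r(5-7) r'(5-7) x1 d[symmetric]
    by (simp add: algebra_simps power2_eq_square power3_eq_cube)
qed

lemma omul_right_norm: "(norm (v + omul \<xi> g))\<^sup>2 = (norm v)\<^sup>2 + 2 * inner (omul v (ocnj g)) \<xi> + (norm \<xi>)\<^sup>2 * (norm g)\<^sup>2"
proof -
  have "(norm (v + omul \<xi> g))\<^sup>2 = (norm v)\<^sup>2 + 2 * inner (omul \<xi> g) v + (norm (omul \<xi> g))\<^sup>2"
    by (simp add: power2_norm_eq_inner inner_add_left inner_add_right inner_commute)
  moreover have "inner (omul \<xi> g) v = inner (omul v (ocnj g)) \<xi>"
    by (simp only: inner_omul_right inner_commute[of \<xi>])
  ultimately show ?thesis by (simp only: norm_omul power_mult_distrib)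
qed

text \<open>Positivity of the lower right 2 by 2 block. Then \<eta> and \<xi> can be eliminated in
  turn: completing the square in \<eta> with pivot \<open>s3\<close> leaves \<open>s2'\<close> and
  \<open>b'\<close>, and completing it in \<xi> leaves the constant \<open>s1'\<close>.\<close>

locale oform_pos =
  fixes s1 s2 s3 :: real and b c g :: oct
  assumes s3: "0 < s3" and minor: "(norm g)\<^sup>2 < s2 * s3"
begin

definition "s2' = s2 - (norm g)\<^sup>2 / s3"
definition "b' = b - (1 / s3) *\<^sub>R omul c (ocnj g)"
definition "s1' = s1 - (norm c)\<^sup>2 / s3 - (norm b')\<^sup>2 / s2'"

lemma s2': "0 < s2'" using s3 minor by (simp add: s2'_def field_simps)

text \<open>The pivots multiply to the cubic determinant. Nonassociativity does no harm, since the
  elimination only meets norms and the single product paired with \<open>b\<close>.\<close>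

lemma det: "s1' * s2' * s3 = odet s1 s2 s3 b c g"
proof -
  have n: "(norm b')\<^sup>2 = (norm b)\<^sup>2 - 2 * inner b (omul c (ocnj g)) / s3 + (norm c)\<^sup>2 * (norm g)\<^sup>2 / s3\<^sup>2"
  proof -
    have "(norm b')\<^sup>2 = (norm b)\<^sup>2 - 2 * inner b ((1 / s3) *\<^sub>R omul c (ocnj g)) + (norm ((1 / s3) *\<^sub>R omul c (ocnj g)))\<^sup>2"
      unfolding b'_def by (simp only: power2_norm_eq_inner inner_diff_left inner_diff_right) (simp add: inner_commute)
    then show ?thesis by (simp add: norm_omul norm_ocnj power_mult_distrib power_divide)
  qed
  have "s1' * s2' * s3 = (s1 - (norm c)\<^sup>2 / s3) * (s2' * s3) - (norm b')\<^sup>2 * s3"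
    using s2' by (simp add: s1'_def field_simps)
  also have "s2' * s3 = s2 * s3 - (norm g)\<^sup>2" using s3 by (simp add: s2'_def field_simps)
  moreover have "(s1 - C / k) * (s2 * k - G) - (B - 2 * I / k + C * G / k\<^sup>2) * k = s1 * s2 * k - s1 * G - s2 * C - k * B + 2 * I"
    if "0 < k" for C G B I k :: real
    using that by (simp add: field_simps power2_eq_square)
  ultimately show ?thesis
    unfolding n odet_def using s3 by simp
qed

lemma complete_eta:
  "oform s1 s2 s3 b c g \<xi> \<eta> = s3 * (norm \<eta>)\<^sup>2 + 2 * inner (c + omul \<xi> g) \<eta> + (s1 + s2 * (norm \<xi>)\<^sup>2 + 2 * inner b \<xi>)"
  by (simp add: oform_def inner_add_left)

lemma complete_xi:
  "s1 + s2 * (norm \<xi>)\<^sup>2 + 2 * inner b \<xi> - (norm (c + omul \<xi> g))\<^sup>2 / s3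
    = s2' * (norm \<xi>)\<^sup>2 + 2 * inner b' \<xi> + (s1' + (norm b')\<^sup>2 / s2')"
proof -
  have *: "inner b' \<xi> = inner b \<xi> - inner (omul c (ocnj g)) \<xi> / s3"
    by (simp add: b'_def inner_diff_left)
  show ?thesis
    unfolding * omul_right_norm s2'_def s1'_def using s3 by (simp add: field_simps)
qed

lemma quadratic_nonneg:
  fixes v z :: "'b::real_inner"
  assumes "0 < k"
  shows "0 \<le> k * (norm z)\<^sup>2 + 2 * inner v z + (norm v)\<^sup>2 / k"
proof -
  have "k * (k * (norm z)\<^sup>2 + 2 * inner v z + (norm v)\<^sup>2 / k) = (norm (k *\<^sub>R z + v))\<^sup>2"
    using assms by (simp add: power2_norm_eq_inner inner_add_left inner_add_right inner_commute algebra_simps)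
  then show ?thesis using assms by (metis zero_le_power2 zero_le_mult_iff less_le_not_le)
qed

lemma oform_nonneg:
  assumes "0 \<le> odet s1 s2 s3 b c g"
  shows "0 \<le> oform s1 s2 s3 b c g \<xi> \<eta>"
proof -
  have "0 \<le> s1'" using assms s2' s3 unfolding det[symmetric]
    by (metis mult_pos_pos mult.assoc zero_le_mult_iff less_le_not_le)
  then show ?thesis
    using quadratic_nonneg[OF s3, of \<eta> "c + omul \<xi> g"] quadratic_nonneg[OF s2', of \<xi> b'] complete_xi[of \<xi>]
    unfolding complete_eta by simp
qed

text \<open>Gaussian integrals over \<eta> and then over \<xi>; in eight real dimensions each pivot
  enters with the power -8/2 = -4.\<close>

lemma nn_integral_oform:
  assumes r: "0 < r"
  shows "(\<integral>\<^sup>+\<xi>. \<integral>\<^sup>+\<eta>. ennreal (exp (- r * oform s1 s2 s3 b c g \<xi> \<eta>)) \<partial>lborel \<partial>lborel)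
    = ennreal (exp (- r * s1') * (1 / (r * s2')) ^ 4 * (1 / (r * s3)) ^ 4) * (gauss_const TYPE(oct))\<^sup>2"
proof -
  have D: "DIM(oct) = 8" by simp
  have sq8: "(1 / sqrt k) ^ 8 = (1 / k) ^ 4" if "0 < k" for k :: real
  proof -
    have "(1 / sqrt k) ^ 8 = ((1 / sqrt k)\<^sup>2) ^ 4" by (simp flip: power_mult)
    then show ?thesis using that by (simp add: power_divide)
  qed
  have eta: "(\<integral>\<^sup>+\<eta>. ennreal (exp (- r * oform s1 s2 s3 b c g \<xi> \<eta>)) \<partial>lborel)
    = ennreal (exp (- r * (s1' + (norm b')\<^sup>2 / s2')) * (1 / (r * s3)) ^ 4) * gauss_const TYPE(oct)
        * ennreal (exp (- (r * s2') * (norm \<xi>)\<^sup>2 + 2 * inner (- r *\<^sub>R b') \<xi>))" for \<xi>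
  proof -
    define A where "A = s1 + s2 * (norm \<xi>)\<^sup>2 + 2 * inner b \<xi>"
    define v where "v = c + omul \<xi> g"
    have "(\<integral>\<^sup>+\<eta>. ennreal (exp (- r * oform s1 s2 s3 b c g \<xi> \<eta>)) \<partial>lborel)
      = (\<integral>\<^sup>+\<eta>. ennreal (exp (- r * A)) * ennreal (exp (- (r * s3) * (norm \<eta>)\<^sup>2 + 2 * inner (- r *\<^sub>R v) \<eta>)) \<partial>lborel)"
    proof (rule nn_integral_cong)
      fix \<eta> :: oct
      have "- r * oform s1 s2 s3 b c g \<xi> \<eta> = - r * A + (- (r * s3) * (norm \<eta>)\<^sup>2 + 2 * inner (- r *\<^sub>R v) \<eta>)"
        unfolding complete_eta A_def[symmetric] v_def[symmetric] by (simp add: algebra_simps)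
      then show "ennreal (exp (- r * oform s1 s2 s3 b c g \<xi> \<eta>)) = ennreal (exp (- r * A)) * ennreal (exp (- (r * s3) * (norm \<eta>)\<^sup>2 + 2 * inner (- r *\<^sub>R v) \<eta>))"
        by (simp only: exp_add ennreal_mult'[OF exp_ge_zero])
    qed
    also have "\<dots> = ennreal (exp (- r * A)) * (\<integral>\<^sup>+\<eta>. ennreal (exp (- (r * s3) * (norm \<eta>)\<^sup>2 + 2 * inner (- r *\<^sub>R v) \<eta>)) \<partial>lborel)"
      by (rule nn_integral_cmult) simp
    also have "(\<integral>\<^sup>+\<eta>. ennreal (exp (- (r * s3) * (norm \<eta>)\<^sup>2 + 2 * inner (- r *\<^sub>R v) \<eta>)) \<partial>lborel)
      = ennreal ((1 / (r * s3)) ^ 4 * exp ((norm (- r *\<^sub>R v))\<^sup>2 / (r * s3))) * gauss_const TYPE(oct)"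
      using r s3 by (subst nn_integral_gauss) (simp_all only: D sq8 mult_pos_pos)
    also have "(norm (- r *\<^sub>R v))\<^sup>2 / (r * s3) = r * ((norm v)\<^sup>2 / s3)"
      using r by (simp add: power_mult_distrib power2_eq_square)
    also have "ennreal (exp (- r * A)) * (ennreal ((1 / (r * s3)) ^ 4 * exp (r * ((norm v)\<^sup>2 / s3))) * gauss_const TYPE(oct))
      = ennreal ((1 / (r * s3)) ^ 4 * exp (- r * (A - (norm v)\<^sup>2 / s3))) * gauss_const TYPE(oct)"
    proof -
      have "exp (- r * A) * ((1 / (r * s3)) ^ 4 * exp (r * ((norm v)\<^sup>2 / s3))) = (1 / (r * s3)) ^ 4 * exp (- r * (A - (norm v)\<^sup>2 / s3))"
        unfolding mult.left_commute[of "exp (- r * A)"] exp_add[symmetric] by (simp add: algebra_simps)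
      then show ?thesis by (metis ennreal_mult'[OF exp_ge_zero] mult.assoc)
    qed
    also have "A - (norm v)\<^sup>2 / s3 = s2' * (norm \<xi>)\<^sup>2 + 2 * inner b' \<xi> + (s1' + (norm b')\<^sup>2 / s2')"
      unfolding A_def v_def by (rule complete_xi)
    also have "exp (- r * (s2' * (norm \<xi>)\<^sup>2 + 2 * inner b' \<xi> + (s1' + (norm b')\<^sup>2 / s2')))
       = exp (- r * (s1' + (norm b')\<^sup>2 / s2')) * exp (- (r * s2') * (norm \<xi>)\<^sup>2 + 2 * inner (- r *\<^sub>R b') \<xi>)"
      unfolding exp_add[symmetric] by (simp add: algebra_simps)
    finally show ?thesis
      unfolding mult.assoc[symmetric] ennreal_mult''[OF exp_ge_zero] ennreal_mult'[OF exp_ge_zero] by (simp only: mult_ac)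
  qed
  have "(\<integral>\<^sup>+\<xi>. \<integral>\<^sup>+\<eta>. ennreal (exp (- r * oform s1 s2 s3 b c g \<xi> \<eta>)) \<partial>lborel \<partial>lborel)
    = ennreal (exp (- r * (s1' + (norm b')\<^sup>2 / s2')) * (1 / (r * s3)) ^ 4) * gauss_const TYPE(oct)
      * (\<integral>\<^sup>+\<xi>. ennreal (exp (- (r * s2') * (norm \<xi>)\<^sup>2 + 2 * inner (- r *\<^sub>R b') \<xi>)) \<partial>lborel)"
    unfolding eta by (rule nn_integral_cmult) simp
  also have "(\<integral>\<^sup>+\<xi>. ennreal (exp (- (r * s2') * (norm \<xi>)\<^sup>2 + 2 * inner (- r *\<^sub>R b') \<xi>)) \<partial>lborel)
      = ennreal ((1 / (r * s2')) ^ 4 * exp ((norm (- r *\<^sub>R b'))\<^sup>2 / (r * s2'))) * gauss_const TYPE(oct)"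
    using r s2' by (subst nn_integral_gauss) (simp_all only: D sq8 mult_pos_pos)
  also have "(norm (- r *\<^sub>R b'))\<^sup>2 / (r * s2') = r * ((norm b')\<^sup>2 / s2')"
    using r by (simp add: power_mult_distrib power2_eq_square)
  also have "ennreal (exp (- r * (s1' + (norm b')\<^sup>2 / s2')) * (1 / (r * s3)) ^ 4) * gauss_const TYPE(oct)
      * (ennreal ((1 / (r * s2')) ^ 4 * exp (r * ((norm b')\<^sup>2 / s2'))) * gauss_const TYPE(oct))
    = ennreal (exp (- r * s1') * (1 / (r * s2')) ^ 4 * (1 / (r * s3)) ^ 4) * (gauss_const TYPE(oct))\<^sup>2"
  proof -
    have "exp (- r * (s1' + (norm b')\<^sup>2 / s2')) * exp (r * ((norm b')\<^sup>2 / s2')) = exp (- r * s1')"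
      unfolding exp_add[symmetric] by (simp add: algebra_simps)
    then have e: "exp (- r * (s1' + (norm b')\<^sup>2 / s2')) * (1 / (r * s3)) ^ 4 * ((1 / (r * s2')) ^ 4 * exp (r * ((norm b')\<^sup>2 / s2')))
      = exp (- r * s1') * (1 / (r * s2')) ^ 4 * (1 / (r * s3)) ^ 4"
      by (simp only: mult_ac)
    have "0 \<le> exp (- r * (s1' + (norm b')\<^sup>2 / s2')) * (1 / (r * s3)) ^ 4" by simp
    note m = ennreal_mult'[OF this]
    show ?thesis
      unfolding e[symmetric] m power2_eq_square[of "gauss_const TYPE(oct)"] by (simp only: mult_ac)
  qed
  finally show ?thesis .
qed

end

section \<open>The octonionic analogue of the Gaussian vector\<close>

lemma nn_integral_power_exp:
  assumes c: "0 < c"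
  shows "(\<integral>\<^sup>+r. ennreal (indicator {0<..} r * r ^ k * exp (- c * r)) \<partial>lborel) = ennreal (fact k * (1 / c) ^ Suc k)"
proof -
  have "(\<integral>\<^sup>+r. ennreal (indicator {0<..} r * r ^ k * exp (- r)) \<partial>lborel) = (\<integral>\<^sup>+r. ennreal (r ^ k * exp (- r)) * indicator {0..} r \<partial>lborel)"
    by (rule nn_integral_cong_AE, rule AE_mp[OF AE_lborel_singleton[of 0]]) (auto simp: indicator_def)
  also have "\<dots> = ennreal (real_of_nat (fact k))" using nn_intergal_power_times_exp_Ici[of k] by simp
  finally have 1: "(\<integral>\<^sup>+r. ennreal (indicator {0<..} r * r ^ k * exp (- r)) \<partial>lborel) = ennreal (fact k)" by simp
  have "(\<integral>\<^sup>+r. ennreal (indicator {0<..} r * r ^ k * exp (- c * r)) \<partial>lborel)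
     = (\<integral>\<^sup>+r. ennreal ((1 / c) ^ k) * ennreal (indicator {0<..} (c *\<^sub>R r) * (c *\<^sub>R r) ^ k * exp (- (c *\<^sub>R r))) \<partial>lborel)"
    using c by (intro nn_integral_cong) (auto simp: ennreal_mult'[symmetric] indicator_def power_mult_distrib zero_less_mult_iff power_divide)
  also have "\<dots> = ennreal ((1 / c) ^ k) * (\<integral>\<^sup>+r. ennreal (indicator {0<..} (c *\<^sub>R r) * (c *\<^sub>R r) ^ k * exp (- (c *\<^sub>R r))) \<partial>lborel)"
    by (rule nn_integral_cmult) simp
  also have "(\<integral>\<^sup>+r. ennreal (indicator {0<..} (c *\<^sub>R r) * (c *\<^sub>R r) ^ k * exp (- (c *\<^sub>R r))) \<partial>lborel) = ennreal ((1 / c) ^ DIM(real)) * ennreal (fact k)"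
    unfolding 1[symmetric]
    by (rule nn_integral_lborel_scale[of "\<lambda>r. ennreal (indicator {0<..} r * r ^ k * exp (- r))"]) (use c in auto)
  finally show ?thesis using c by (simp add: ennreal_mult'[symmetric] mult_ac)
qed

text \<open>\<open>(r, \<xi>, \<eta>)\<close> stands for the multiple \<open>r z z\<^sup>*\<close> of an idempotent, where \<open>z = (1, \<xi>, \<eta>)\<close> is an affine
  coordinate; \<open>oct_T\<close> is its trace and \<open>oct_Q P\<close> its inner product with \<open>P\<close>.\<close>

definition oct_meas :: "(real \<times> oct \<times> oct) measure" where
  "oct_meas = density lborel (\<lambda>(r, \<xi>, \<eta>). ennreal (indicator {0<..} r * r ^ 11))"

definition oct_T :: "real \<times> oct \<times> oct \<Rightarrow> real" where
  "oct_T = (\<lambda>(r, \<xi>, \<eta>). \<bar>r\<bar> * (1 + (norm \<xi>)\<^sup>2 + (norm \<eta>)\<^sup>2))"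

definition oct_Q :: "oct ^ 3 ^ 3 \<Rightarrow> real \<times> oct \<times> oct \<Rightarrow> real" where
  "oct_Q P = (\<lambda>(r, \<xi>, \<eta>). \<bar>r\<bar> * oform (d1 P) (d2 P) (d3 P) (P $ 1 $ 2) (P $ 1 $ 3) (P $ 2 $ 3) \<xi> \<eta>)"

lemma abs_inner_off_diagonal:
  assumes "P \<in> cayley_plane" "Q \<in> cayley_plane"
  shows "2 * inner (P $ 2 $ 3) (Q $ 2 $ 3) \<le> d2 P * d3 Q + d3 P * d2 Q"
proof -
  note r = cayley_plane_relations[OF assms(1)] cayley_plane_relations[OF assms(2)]
  have "(norm (P $ 2 $ 3) * norm (Q $ 2 $ 3))\<^sup>2 = (sqrt (d2 P * d3 Q) * sqrt (d3 P * d2 Q))\<^sup>2"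
    using r by (simp add: power_mult_distrib)
  then have "norm (P $ 2 $ 3) * norm (Q $ 2 $ 3) = sqrt (d2 P * d3 Q) * sqrt (d3 P * d2 Q)"
    using r by (subst (asm) power2_eq_iff_nonneg) auto
  moreover have "2 * (sqrt (d2 P * d3 Q) * sqrt (d3 P * d2 Q)) \<le> d2 P * d3 Q + d3 P * d2 Q"
  proof -
    have "0 \<le> (sqrt (d2 P * d3 Q) - sqrt (d3 P * d2 Q))\<^sup>2" by simp
    then show ?thesis using r by (simp add: power2_diff)
  qed
  moreover have "inner (P $ 2 $ 3) (Q $ 2 $ 3) \<le> norm (P $ 2 $ 3) * norm (Q $ 2 $ 3)"
    by (rule norm_cauchy_schwarz)
  ultimately show ?thesis by simp
qed

text \<open>The nonnegative sign of s t allows the mixed term of the off-diagonal norm to be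
  estimated by Cauchy-Schwarz and the inequality of arithmetic and geometric means. After that the
  minor is affine in s and t.\<close>

lemma oform_pos_pencil:
  assumes P: "P \<in> cayley_plane" "Q \<in> cayley_plane"
    and \<Lambda>: "0 < \<Lambda>" "0 < \<Lambda> + s" "0 < \<Lambda> + t" "0 < \<Lambda> + s + t" and st: "0 \<le> s * t"
  shows "oform_pos (\<Lambda> + s * d2 P + t * d2 Q) (\<Lambda> + s * d3 P + t * d3 Q) (s *\<^sub>R P $ 2 $ 3 + t *\<^sub>R Q $ 2 $ 3)"
proof
  note r = cayley_plane_relations[OF P(1)] and r' = cayley_plane_relations[OF P(2)]
  have le: "d3 P \<le> 1" "d3 Q \<le> 1" "d2 P + d3 P \<le> 1" "d2 Q + d3 Q \<le> 1" using r(1-4) r'(1-4) by simp_all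
  \<comment> \<open>An affine function of (\<alpha>, \<beta>) on the unit square; the hypotheses say
    that it is positive at the four corners.\<close>
  have conv: "0 < \<Lambda> + s * \<alpha> + t * \<beta>" if "0 \<le> \<alpha>" "\<alpha> \<le> 1" "0 \<le> \<beta>" "\<beta> \<le> 1" for \<alpha> \<beta>
  proof -
    have "min 0 s \<le> s * \<alpha>" "min 0 t \<le> t * \<beta>"
      using that mult_left_mono_neg[of \<alpha> 1 s] mult_left_mono_neg[of \<beta> 1 t]
      by (auto simp: min_def mult_nonneg_nonneg not_le mult_nonpos_nonneg)
    then show ?thesis using \<Lambda>
      by (cases "0 \<le> s"; cases "0 \<le> t"; simp only: min_def if_True if_False; linarith)
  qed
  show "0 < \<Lambda> + s * d3 P + t * d3 Q" using le r r' by (intro conv)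
  have "(norm (s *\<^sub>R P $ 2 $ 3 + t *\<^sub>R Q $ 2 $ 3))\<^sup>2
     = s\<^sup>2 * (d2 P * d3 P) + t\<^sup>2 * (d2 Q * d3 Q) + s * t * (2 * inner (P $ 2 $ 3) (Q $ 2 $ 3))"
  proof -
    have "(norm (s *\<^sub>R P $ 2 $ 3 + t *\<^sub>R Q $ 2 $ 3))\<^sup>2 = s\<^sup>2 * (norm (P $ 2 $ 3))\<^sup>2 + t\<^sup>2 * (norm (Q $ 2 $ 3))\<^sup>2 + s * t * (2 * inner (P $ 2 $ 3) (Q $ 2 $ 3))"
      by (simp only: power2_norm_eq_inner power2_eq_square[of s] power2_eq_square[of t])
        (simp add: inner_add_left inner_add_right inner_commute algebra_simps)
    then show ?thesis by (simp add: r r')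
  qed
  also have "\<dots> \<le> s\<^sup>2 * (d2 P * d3 P) + t\<^sup>2 * (d2 Q * d3 Q) + s * t * (d2 P * d3 Q + d3 P * d2 Q)"
    using st abs_inner_off_diagonal[OF P] by (intro add_left_mono mult_left_mono)
  also have "\<dots> < (\<Lambda> + s * d2 P + t * d2 Q) * (\<Lambda> + s * d3 P + t * d3 Q)"
  proof -
    \<comment> \<open>This is what remains of the minor after all terms of second order in s and t
      have cancelled.\<close>
    have "0 < \<Lambda> * (\<Lambda> + s * (d2 P + d3 P) + t * (d2 Q + d3 Q))"
      using \<Lambda>(1) conv[of "d2 P + d3 P" "d2 Q + d3 Q"] le r r' by (intro mult_pos_pos) auto
    then show ?thesis by (simp add: algebra_simps power2_eq_square)
  qed
  finally show "(norm (s *\<^sub>R P $ 2 $ 3 + t *\<^sub>R Q $ 2 $ 3))\<^sup>2 < (\<Lambda> + s * d2 P + t * d2 Q) * (\<Lambda> + s * d3 P + t * d3 Q)" .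
qed

lemma oform_linear:
  "oform (\<Lambda> + s * x1 + t * y1) (\<Lambda> + s * x2 + t * y2) (\<Lambda> + s * x3 + t * y3)
     (s *\<^sub>R p + t *\<^sub>R p') (s *\<^sub>R q + t *\<^sub>R q') (s *\<^sub>R g + t *\<^sub>R g') \<xi> \<eta>
   = \<Lambda> * (1 + (norm \<xi>)\<^sup>2 + (norm \<eta>)\<^sup>2) + s * oform x1 x2 x3 p q g \<xi> \<eta> + t * oform y1 y2 y3 p' q' g' \<xi> \<eta>"
  by (simp add: oform_def inner_add_left omul.add_right omul.scaleR_right algebra_simps)

text \<open>Both bounds are limits of the nonnegativity of the form of \<Lambda> I + s P: let
  \<Lambda> decrease to 0 with s = 1, and to 1 with s = -1.\<close>

lemma oform_bounds:
  assumes P: "P \<in> cayley_plane"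
  shows "0 \<le> oform (d1 P) (d2 P) (d3 P) (P $ 1 $ 2) (P $ 1 $ 3) (P $ 2 $ 3) \<xi> \<eta>"
    "oform (d1 P) (d2 P) (d3 P) (P $ 1 $ 2) (P $ 1 $ 3) (P $ 2 $ 3) \<xi> \<eta> \<le> 1 + (norm \<xi>)\<^sup>2 + (norm \<eta>)\<^sup>2"
proof -
  let ?f = "oform (d1 P) (d2 P) (d3 P) (P $ 1 $ 2) (P $ 1 $ 3) (P $ 2 $ 3) \<xi> \<eta>"
  let ?N = "1 + (norm \<xi>)\<^sup>2 + (norm \<eta>)\<^sup>2"
  have *: "0 \<le> \<Lambda> * ?N + s * ?f" if \<Lambda>: "0 < \<Lambda>" "0 < \<Lambda> + s" for \<Lambda> s
  proof -
    \<comment> \<open>The second idempotent gets the coefficient 0, so that the lemmas on pencils of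
      two idempotents apply verbatim.\<close>
    interpret oform_pos "\<Lambda> + s * d1 P + 0 * d1 P" "\<Lambda> + s * d2 P + 0 * d2 P" "\<Lambda> + s * d3 P + 0 * d3 P"
      "s *\<^sub>R P $ 1 $ 2 + 0 *\<^sub>R P $ 1 $ 2" "s *\<^sub>R P $ 1 $ 3 + 0 *\<^sub>R P $ 1 $ 3" "s *\<^sub>R P $ 2 $ 3 + 0 *\<^sub>R P $ 2 $ 3"
      using oform_pos_pencil[OF P P, of \<Lambda> s 0] \<Lambda> by simp
    have "0 \<le> \<Lambda> * ((\<Lambda> + s) * (\<Lambda> + 0) - s * 0 * cinner P P)" using \<Lambda> by simp
    from oform_nonneg[OF this[unfolded odet_pencil[OF P P, symmetric]], of \<xi> \<eta>]
    show ?thesis unfolding oform_linear by simp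
  qed
  have N: "0 < ?N" by (simp add: add_pos_nonneg)
  show "0 \<le> ?f"
  proof (rule field_le_epsilon)
    fix e :: real assume "0 < e"
    with *[of "e / ?N" 1] N show "0 \<le> ?f + e" by (simp add: add_pos_nonneg)
  qed
  show "?f \<le> ?N"
  proof (rule field_le_epsilon)
    fix e :: real assume "0 < e"
    then have "0 < 1 + e / ?N" "0 < 1 + e / ?N + - 1" using N by (simp_all add: add_pos_nonneg)
    from *[OF this] N show "?f \<le> ?N + e" by (simp add: distrib_right)
  qed
qed

lemma continuous_oform [continuous_intros]:
  assumes "continuous_on S f" "continuous_on S h"
  shows "continuous_on S (\<lambda>v. oform s1 s2 s3 b c g (f v) (h v))"
  unfolding oform_def by (intro continuous_intros omul.continuous_on assms)

text \<open>\<open>oct_meas\<close> imitates a Gaussian triple (z1, z1 \<xi>, z1 \<eta>) with r =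
  |z1|^2: polar coordinates give r^3 dr and the scaling of two octonions gives r^8, hence the weight
  r^11. Integrating over \<xi> and \<eta> returns r^(-8), the remaining r^3 turns the constant
  \<open>s1'\<close> into a fourth power as well, and the three pivots combine to the determinant to
  the power -4. The factor 6 is \<open>fact 3\<close>.\<close>

lemma octonionic_law:
  assumes P: "P \<in> cayley_plane" "Q \<in> cayley_plane" and ab: "0 \<le> a" "0 \<le> b" "a + b < \<Lambda>"
  shows "(\<integral>\<^sup>+z. ennreal (exp (- \<Lambda> * oct_T z + a * oct_Q P z + b * oct_Q Q z)) \<partial>oct_meas)
    = ennreal ((1 / \<Lambda>) ^ 4 * (1 / ((\<Lambda> - a) * (\<Lambda> - b) - a * b * cinner P Q)) ^ 4) * (ennreal 6 * (gauss_const TYPE(oct))\<^sup>2)"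
proof -
  define s1 s2 s3 where s: "s1 = \<Lambda> + - a * d1 P + - b * d1 Q" "s2 = \<Lambda> + - a * d2 P + - b * d2 Q" "s3 = \<Lambda> + - a * d3 P + - b * d3 Q"
  define p q g where pqg: "p = - a *\<^sub>R P $ 1 $ 2 + - b *\<^sub>R Q $ 1 $ 2" "q = - a *\<^sub>R P $ 1 $ 3 + - b *\<^sub>R Q $ 1 $ 3" "g = - a *\<^sub>R P $ 2 $ 3 + - b *\<^sub>R Q $ 2 $ 3"
  interpret oform_pos s1 s2 s3 p q g
    unfolding s pqg by (rule oform_pos_pencil[OF P]) (use ab in auto)
  let ?D = "(\<Lambda> - a) * (\<Lambda> - b) - a * b * cinner P Q"
  have det': "s1' * s2' * s3 = \<Lambda> * ?D"
    unfolding det unfolding s pqg odet_pencil[OF P] by simp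
  have cs: "cinner P Q \<le> 1" by (rule cinner_le_1[OF P])
  have D: "0 < ?D"
  proof -
    have "a * b * cinner P Q \<le> a * b" using ab cs by (simp add: mult_left_le)
    moreover have "0 < \<Lambda> * (\<Lambda> - (a + b))" using ab by simp
    ultimately show ?thesis by (simp add: algebra_simps)
  qed
  have s1': "0 < s1'"
  proof -
    have "0 < s1' * (s2' * s3)" using det' D ab by (simp add: mult.assoc)
    moreover have "0 < s2' * s3" using s2' s3 by simp
    ultimately show ?thesis by (rule zero_less_mult_pos2)
  qed
  define G where "G = gauss_const TYPE(oct)"
  have meas: "(\<lambda>v. ennreal (f v)) \<in> borel_measurable (lborel \<Otimes>\<^sub>M lborel)" if "f \<in> borel_measurable borel" for f :: "'c::euclidean_space \<times> 'd::euclidean_space \<Rightarrow> real"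
    unfolding lborel_prod using that by simp
  have e: "- \<Lambda> * oct_T (r, \<xi>, \<eta>) + a * oct_Q P (r, \<xi>, \<eta>) + b * oct_Q Q (r, \<xi>, \<eta>) = - \<bar>r\<bar> * oform s1 s2 s3 p q g \<xi> \<eta>" for r \<xi> \<eta>
    unfolding s pqg oform_linear oct_T_def oct_Q_def by (simp add: algebra_simps)
  define f where "f = (\<lambda>(r, \<xi>, \<eta>). indicator {0<..} r * r ^ 11 * exp (- \<bar>r\<bar> * oform s1 s2 s3 p q g \<xi> \<eta>))"
  have [measurable]: "(\<lambda>v :: real \<times> oct \<times> oct. oform s1 s2 s3 p q g (fst (snd v)) (snd (snd v))) \<in> borel_measurable borel"
    "(\<lambda>v :: real \<times> oct \<times> oct. fst v) \<in> borel_measurable borel"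
    by (intro borel_measurable_continuous_onI continuous_intros)+
  have fm: "f \<in> borel_measurable borel"
    unfolding f_def case_prod_unfold by measurable
  have "(\<integral>\<^sup>+z. ennreal (exp (- \<Lambda> * oct_T z + a * oct_Q P z + b * oct_Q Q z)) \<partial>oct_meas)
     = (\<integral>\<^sup>+z. ennreal (f z) \<partial>lborel)"
  proof -
    have eq: "- \<Lambda> * oct_T z + a * oct_Q P z + b * oct_Q Q z = - \<bar>fst z\<bar> * oform s1 s2 s3 p q g (fst (snd z)) (snd (snd z))" for z
      using e[of "fst z" "fst (snd z)" "snd (snd z)"] by simp
    show ?thesis
      unfolding oct_meas_def eq
      by (subst nn_integral_density) (auto simp: f_def case_prod_unfold ennreal_mult''[symmetric])
  qed
  also have "\<dots> = (\<integral>\<^sup>+r. \<integral>\<^sup>+v. ennreal (f (r, v)) \<partial>lborel \<partial>lborel)"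
    using lborel.nn_integral_fst[OF meas[OF fm]] unfolding lborel_prod by simp
  also have "\<dots> = (\<integral>\<^sup>+r. \<integral>\<^sup>+\<xi>. \<integral>\<^sup>+\<eta>. ennreal (f (r, \<xi>, \<eta>)) \<partial>lborel \<partial>lborel \<partial>lborel)"
  proof (rule nn_integral_cong)
    fix r :: real
    have "(\<lambda>v. f (r, v)) \<in> borel_measurable borel"
    proof -
      have "(\<lambda>v :: oct \<times> oct. oform s1 s2 s3 p q g (fst v) (snd v)) \<in> borel_measurable borel"
        by (intro borel_measurable_continuous_onI continuous_intros)
      then show ?thesis unfolding f_def case_prod_unfold by simp
    qed
    from lborel.nn_integral_fst[OF meas[OF this]]
    show "(\<integral>\<^sup>+v. ennreal (f (r, v)) \<partial>lborel) = (\<integral>\<^sup>+\<xi>. \<integral>\<^sup>+\<eta>. ennreal (f (r, \<xi>, \<eta>)) \<partial>lborel \<partial>lborel)"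
      unfolding lborel_prod by simp
  qed
  also have "\<dots> = (\<integral>\<^sup>+r. ennreal ((1 / s2') ^ 4 * (1 / s3) ^ 4) * G\<^sup>2 * ennreal (indicator {0<..} r * r ^ 3 * exp (- s1' * r)) \<partial>lborel)"
  proof (rule nn_integral_cong)
    fix r :: real
    show "(\<integral>\<^sup>+\<xi>. \<integral>\<^sup>+\<eta>. ennreal (f (r, \<xi>, \<eta>)) \<partial>lborel \<partial>lborel) = ennreal ((1 / s2') ^ 4 * (1 / s3) ^ 4) * G\<^sup>2 * ennreal (indicator {0<..} r * r ^ 3 * exp (- s1' * r))"
    proof (cases "0 < r")
      case True
      have m2: "(\<lambda>v. ennreal (exp (- r * oform s1 s2 s3 p q g (fst v) (snd v)))) \<in> borel_measurable (lborel \<Otimes>\<^sub>M lborel)"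
        by (intro meas borel_measurable_continuous_onI continuous_intros)
      have "(\<integral>\<^sup>+\<xi>. \<integral>\<^sup>+\<eta>. ennreal (f (r, \<xi>, \<eta>)) \<partial>lborel \<partial>lborel)
         = (\<integral>\<^sup>+\<xi>. \<integral>\<^sup>+\<eta>. ennreal (r ^ 11) * ennreal (exp (- r * oform s1 s2 s3 p q g \<xi> \<eta>)) \<partial>lborel \<partial>lborel)"
        using True by (simp add: f_def ennreal_mult'[symmetric])
      also have "\<dots> = (\<integral>\<^sup>+\<xi>. ennreal (r ^ 11) * (\<integral>\<^sup>+\<eta>. ennreal (exp (- r * oform s1 s2 s3 p q g \<xi> \<eta>)) \<partial>lborel) \<partial>lborel)"
        by (intro nn_integral_cong nn_integral_cmult measurable_compose[OF _ measurable_ennreal])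
          (simp, intro borel_measurable_continuous_onI continuous_intros)
      also have "\<dots> = ennreal (r ^ 11) * (\<integral>\<^sup>+\<xi>. \<integral>\<^sup>+\<eta>. ennreal (exp (- r * oform s1 s2 s3 p q g \<xi> \<eta>)) \<partial>lborel \<partial>lborel)"
        using m2 by (intro nn_integral_cmult lborel.borel_measurable_nn_integral) (simp add: case_prod_unfold)
      also have "\<dots> = ennreal (r ^ 11 * (exp (- r * s1') * (1 / (r * s2')) ^ 4 * (1 / (r * s3)) ^ 4)) * G\<^sup>2"
        unfolding nn_integral_oform[OF True] G_def using True by (simp add: ennreal_mult' mult.assoc)
      also have "r ^ 11 * (exp (- r * s1') * (1 / (r * s2')) ^ 4 * (1 / (r * s3)) ^ 4) = (1 / s2') ^ 4 * (1 / s3) ^ 4 * (r ^ 3 * exp (- s1' * r))"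
      proof -
        have "r ^ 11 * ((1 / r) ^ 4 * (1 / r) ^ 4) = r ^ 3 * (r ^ 8 * (1 / r) ^ 8)"
          by (simp only: power_add[symmetric] mult.assoc[symmetric]) simp
        also have "r ^ 8 * (1 / r) ^ 8 = 1" using True by (simp only: power_mult_distrib[symmetric]) simp
        finally have e: "r ^ 11 * ((1 / r) ^ 4 * (1 / r) ^ 4) = r ^ 3" by simp
        have f: "(1 / (r * x)) ^ 4 = (1 / r) ^ 4 * (1 / x) ^ 4" for x
          by (simp add: power_mult_distrib power_divide)
        have "r ^ 11 * (exp (- r * s1') * (1 / (r * s2')) ^ 4 * (1 / (r * s3)) ^ 4)
          = r ^ 11 * ((1 / r) ^ 4 * (1 / r) ^ 4) * (exp (- r * s1') * (1 / s2') ^ 4 * (1 / s3) ^ 4)"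
          unfolding f by (simp only: mult_ac)
        then show ?thesis unfolding e by (simp add: mult_ac)
      qed
      finally show ?thesis using True s2' s3 by (simp add: ennreal_mult' mult_ac)
    next
      case False
      then show ?thesis by (simp add: f_def)
    qed
  qed
  also have "\<dots> = ennreal ((1 / s2') ^ 4 * (1 / s3) ^ 4) * G\<^sup>2 * ennreal (fact 3 * (1 / s1') ^ Suc 3)"
    by (subst nn_integral_cmult, simp, simp only: nn_integral_power_exp[OF s1'])
  also have "\<dots> = ennreal (((1 / s2') ^ 4 * (1 / s3) ^ 4 * (1 / s1') ^ 4)) * (ennreal 6 * G\<^sup>2)"
    using s1' s2' s3 by (simp add: ennreal_mult' mult_ac fact_numeral)
  also have "(1 / s2') ^ 4 * (1 / s3) ^ 4 * (1 / s1') ^ 4 = (1 / (s1' * s2' * s3)) ^ 4"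
    by (simp add: power_mult_distrib power_divide)
  also have "\<dots> = (1 / \<Lambda>) ^ 4 * (1 / ?D) ^ 4"
    unfolding det' by (simp add: power_mult_distrib power_divide)
  finally show ?thesis unfolding G_def .
qed

text \<open>If d1 Q is nonzero, Q is d1 Q times the rank one matrix of an affine point (\<xi>,
  \<eta>), so the pairing is a value of the nonnegative form of P. On the line at infinity the first
  row of Q vanishes and a 2 by 2 Cauchy-Schwarz estimate suffices.\<close>

lemma cinner_nonneg:
  assumes P: "P \<in> cayley_plane" and Q: "Q \<in> cayley_plane"
  shows "0 \<le> cinner P Q"
proof (cases "d1 Q = 0")
  case True
  note r = cayley_plane_relations[OF P] and r' = cayley_plane_relations[OF Q]
  have z: "Q $ 1 $ 2 = 0" "Q $ 1 $ 3 = 0" using r'(5,6) True by auto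
  have "- (2 * inner (P $ 2 $ 3) (Q $ 2 $ 3)) \<le> d2 P * d2 Q + d3 P * d3 Q"
  proof -
    have "(norm (P $ 2 $ 3) * norm (Q $ 2 $ 3))\<^sup>2 = (sqrt (d2 P * d2 Q) * sqrt (d3 P * d3 Q))\<^sup>2"
      using r r' by (simp add: power_mult_distrib)
    then have "norm (P $ 2 $ 3) * norm (Q $ 2 $ 3) = sqrt (d2 P * d2 Q) * sqrt (d3 P * d3 Q)"
      using r r' by (subst (asm) power2_eq_iff_nonneg) auto
    moreover have "2 * (sqrt (d2 P * d2 Q) * sqrt (d3 P * d3 Q)) \<le> d2 P * d2 Q + d3 P * d3 Q"
    proof -
      have "0 \<le> (sqrt (d2 P * d2 Q) - sqrt (d3 P * d3 Q))\<^sup>2" by simp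
      then show ?thesis using r r' by (simp add: power2_diff)
    qed
    moreover have "\<bar>inner (P $ 2 $ 3) (Q $ 2 $ 3)\<bar> \<le> norm (P $ 2 $ 3) * norm (Q $ 2 $ 3)"
      by (rule Cauchy_Schwarz_ineq2)
    ultimately show ?thesis by linarith
  qed
  then show ?thesis by (simp add: cinner_def True z)
next
  case False
  note r' = cayley_plane_relations[OF Q]
  have pos: "0 < d1 Q" using False r'(2) by simp
  define \<xi> \<eta> where "\<xi> = (1 / d1 Q) *\<^sub>R Q $ 1 $ 2" and "\<eta> = (1 / d1 Q) *\<^sub>R Q $ 1 $ 3"
  have n: "(norm \<xi>)\<^sup>2 = d2 Q / d1 Q" "(norm \<eta>)\<^sup>2 = d3 Q / d1 Q"
    using pos r'(5,6) by (simp_all add: \<xi>_def \<eta>_def power_mult_distrib power_divide power2_eq_square)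
  have "inner (omul \<xi> (P $ 2 $ 3)) \<eta> = inner (P $ 2 $ 3) (omul (ocnj \<xi>) \<eta>)"
    by (rule inner_omul_left)
  also have "omul (ocnj \<xi>) \<eta> = (1 / d1 Q) *\<^sub>R Q $ 2 $ 3"
    using pos r'(10) by (simp add: \<xi>_def \<eta>_def linear_scale[OF bounded_linear.linear[OF bounded_linear_ocnj]] omul.scaleR_left omul.scaleR_right)
  finally have "d1 Q * oform (d1 P) (d2 P) (d3 P) (P $ 1 $ 2) (P $ 1 $ 3) (P $ 2 $ 3) \<xi> \<eta> = cinner P Q"
    using pos unfolding oform_def n cinner_def by (simp add: \<xi>_def \<eta>_def field_simps)
  then show ?thesis using oform_bounds(1)[OF P, of \<xi> \<eta>] pos by (metis mult_nonneg_nonneg less_imp_le)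
qed

section \<open>The joint law in terms of angles\<close>

lemma nn_integral_Icc:
  fixes f :: "real \<Rightarrow> real"
  assumes "f \<in> borel_measurable borel" "\<And>x. x \<in> {a..b} \<Longrightarrow> 0 \<le> f x" "(f has_integral I) {a..b}"
  shows "(\<integral>\<^sup>+x. ennreal (indicator {a..b} x * f x) \<partial>lborel) = ennreal I"
proof (rule nn_integral_has_integral_lborel)
  show "(\<lambda>x. indicator {a..b} x * f x) \<in> borel_measurable borel" using assms(1) by measurable
  show "0 \<le> indicator {a..b} x * f x" for x using assms(2) by (auto simp: indicator_def)
  have *: "(\<lambda>x. indicator {a..b} x * f x) = (\<lambda>x. if x \<in> {a..b} then f x else 0)" by (auto simp: indicator_def)
  show "((\<lambda>x. indicator {a..b} x * f x) has_integral I) UNIV"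
    unfolding * has_integral_restrict_UNIV by (rule assms(3))
qed

definition beta_const :: "nat \<Rightarrow> nat \<Rightarrow> real" where
  "beta_const m n = integral {0..1} (\<lambda>R. R ^ m * (1 - R) ^ n)"

lemma beta_const_pos: "0 < beta_const m n"
proof -
  have c: "continuous_on {0..1} (\<lambda>R :: real. R ^ m * (1 - R) ^ n)" by (intro continuous_intros)
  have "beta_const m n \<noteq> 0"
  proof
    assume "beta_const m n = 0"
    then have "((\<lambda>R. R ^ m * (1 - R) ^ n) has_integral 0) (cbox 0 (1 :: real))"
      using integrable_integral[OF integrable_continuous_interval[OF c]] by (simp add: beta_const_def)
    from has_integral_0_cbox_imp_0[OF _ _ this, of "1/2"] c show False by (auto simp: box_real)
  qed
  moreover have "0 \<le> beta_const m n"
    unfolding beta_const_def by (intro integral_nonneg integrable_continuous_interval c) auto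
  ultimately show ?thesis by simp
qed

text \<open>Substitute \<open>t = R (\<Lambda> - E) / (\<Lambda> - R E)\<close>.\<close>

lemma beta_moebius:
  fixes E \<Lambda> :: real
  assumes E: "0 \<le> E" "E < \<Lambda>"
  shows "((\<lambda>R. R ^ m * (1 - R) ^ n * (1 / (\<Lambda> - R * E)) ^ (m + n + 2)) has_integral
    beta_const m n * (1 / \<Lambda>) ^ Suc n * (1 / (\<Lambda> - E)) ^ Suc m) {0..1}"
proof -
  define h where "h R = R * (\<Lambda> - E) / (\<Lambda> - R * E)" for R
  have pos: "0 < \<Lambda> - R * E" if "R \<in> {0..1}" for R
  proof -
    have "R * E \<le> E" using that E by (simp add: mult_left_le_one_le)
    then show ?thesis using E by simp
  qed
  have d: "(h has_real_derivative (\<Lambda> - E) * \<Lambda> / (\<Lambda> - R * E)\<^sup>2) (at R within {0..1})" if "R \<in> {0..1}" for R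
    unfolding h_def
    using pos[OF that] by (auto intro!: derivative_eq_intros simp: power2_eq_square field_simps)
  have sub: "h ` {0..1} \<subseteq> {0..1}"
  proof
    fix t assume "t \<in> h ` {0..1}"
    then obtain R where R: "R \<in> {0..1}" "t = h R" by auto
    have "R * \<Lambda> \<le> \<Lambda>" using R E by (simp add: mult_left_le_one_le)
    then have "R * (\<Lambda> - E) \<le> \<Lambda> - R * E" by (simp add: algebra_simps)
    then show "t \<in> {0..1}" using R E pos[OF R(1)] by (simp add: h_def divide_le_eq_1_pos)
  qed
  have c: "continuous_on {0..1} (\<lambda>t :: real. t ^ m * (1 - t) ^ n)" by (intro continuous_intros)
  have "((\<lambda>R. ((\<Lambda> - E) * \<Lambda> / (\<Lambda> - R * E)\<^sup>2) *\<^sub>R (h R ^ m * (1 - h R) ^ n)) has_integral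
     (integral {h 0..h 1} (\<lambda>t. t ^ m * (1 - t) ^ n))) {0..1}"
    by (rule has_integral_substitution[OF _ _ sub c d]) (use E in \<open>auto simp: h_def\<close>)
  then have "((\<lambda>R. ((\<Lambda> - E) * \<Lambda> / (\<Lambda> - R * E)\<^sup>2) * (h R ^ m * (1 - h R) ^ n)) has_integral beta_const m n) {0..1}"
    using E by (simp add: h_def beta_const_def)
  from has_integral_mult_right[OF this, of "(1 / \<Lambda>) ^ Suc n * (1 / (\<Lambda> - E)) ^ Suc m"]
  have "((\<lambda>R. (1 / \<Lambda>) ^ Suc n * (1 / (\<Lambda> - E)) ^ Suc m * (((\<Lambda> - E) * \<Lambda> / (\<Lambda> - R * E)\<^sup>2) * (h R ^ m * (1 - h R) ^ n)))
    has_integral beta_const m n * (1 / \<Lambda>) ^ Suc n * (1 / (\<Lambda> - E)) ^ Suc m) {0..1}"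
    by (simp add: mult_ac)
  then show ?thesis
  proof (rule has_integral_eq[rotated])
    fix R :: real assume R: "R \<in> {0..1}"
    define k where "k = \<Lambda> - R * E"
    have k: "0 < k" using pos[OF R] by (simp add: k_def)
    have h1: "1 - h R = (1 - R) * \<Lambda> / k" using k by (simp add: h_def k_def field_simps)
    have h0: "h R = R * (\<Lambda> - E) / k" by (simp add: h_def k_def)
    have "(1 / \<Lambda>) ^ Suc n * (1 / (\<Lambda> - E)) ^ Suc m * (((\<Lambda> - E) * \<Lambda> / k\<^sup>2) * ((R * (\<Lambda> - E) / k) ^ m * ((1 - R) * \<Lambda> / k) ^ n))
      = R ^ m * (1 - R) ^ n * (1 / k) ^ (m + n + 2)"
    proof -
      have *: "(1 / L) ^ Suc n * (1 / D) ^ Suc m * ((D * L / k\<^sup>2) * ((R * D / k) ^ m * (x * L / k) ^ n)) = R ^ m * x ^ n * (1 / k) ^ (m + n + 2)"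
        if "0 < L" "0 < D" for L D x :: real
      proof -
        have "(1 / L) ^ n * L ^ n = 1" "(1 / D) ^ m * D ^ m = 1"
          using that by (simp_all only: power_mult_distrib[symmetric]) simp_all
        moreover have "1 / L * L = 1" "1 / D * D = 1" using that by simp_all
        moreover have "(1 / L) ^ Suc n * (1 / D) ^ Suc m * ((D * L / k\<^sup>2) * ((R * D / k) ^ m * (x * L / k) ^ n))
          = ((1 / L) ^ n * L ^ n) * ((1 / D) ^ m * D ^ m) * (1 / L * L) * (1 / D * D) * (R ^ m * x ^ n * ((1 / k) ^ m * (1 / k) ^ n * (1 / k)\<^sup>2))"
          by (simp only: divide_inverse power_mult_distrib power_Suc power_inverse mult_1_left mult_ac)
        ultimately show ?thesis by (simp only: power_add mult_1_left mult_1_right mult.assoc)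
      qed
      show ?thesis by (rule *) (use E in simp_all)
    qed
    then show "(1 / \<Lambda>) ^ Suc n * (1 / (\<Lambda> - E)) ^ Suc m * (((\<Lambda> - E) * \<Lambda> / (\<Lambda> - R * E)\<^sup>2) * (h R ^ m * (1 - h R) ^ n))
      = R ^ m * (1 - R) ^ n * (1 / (\<Lambda> - R * E)) ^ (m + n + 2)"
      unfolding h1 unfolding h0 k_def[symmetric] .
  qed
qed

lemma nn_integral_periodic_shift:
  fixes h :: "real \<Rightarrow> ennreal"
  assumes [measurable]: "h \<in> borel_measurable borel" and per: "\<And>x. h (x + 2 * pi) = h x"
    and c: "0 \<le> c" "c \<le> 2 * pi"
  shows "(\<integral>\<^sup>+x. indicator {-pi..pi} x * h (x - c) \<partial>lborel) = (\<integral>\<^sup>+x. indicator {-pi..pi} x * h x \<partial>lborel)"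
proof -
  have "(\<integral>\<^sup>+x. indicator {-pi..pi} x * h (x - c) \<partial>lborel) = (\<integral>\<^sup>+x. indicator {-pi..pi} (c + x) * h (c + x - c) \<partial>lborel)"
    by (rule nn_integral_lborel_shift[symmetric, of "\<lambda>x. indicator {-pi..pi} x * h (x - c)"]) simp
  also have "\<dots> = (\<integral>\<^sup>+x. indicator {-pi-c..<-pi} x * h x + indicator {-pi..pi-c} x * h x \<partial>lborel)"
    using c by (intro nn_integral_cong) (auto simp: indicator_def)
  also have "\<dots> = (\<integral>\<^sup>+x. indicator {-pi-c..<-pi} x * h x \<partial>lborel) + (\<integral>\<^sup>+x. indicator {-pi..pi-c} x * h x \<partial>lborel)"
    by (rule nn_integral_add) auto
  also have "(\<integral>\<^sup>+x. indicator {-pi-c..<-pi} x * h x \<partial>lborel) = (\<integral>\<^sup>+x. indicator {-pi-c..<-pi} (-2*pi + x) * h (-2*pi + x) \<partial>lborel)"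
    by (rule nn_integral_lborel_shift[symmetric, of "\<lambda>x. indicator {-pi-c..<-pi} x * h x"]) simp
  also have "\<dots> = (\<integral>\<^sup>+x. indicator {pi-c..<pi} x * h x \<partial>lborel)"
  proof -
    have p: "h (-2*pi + x) = h x" for x
    proof -
      have "-2*pi + x + 2*pi = x" by simp
      from per[of "-2*pi + x", unfolded this] show ?thesis by (rule sym)
    qed
    show ?thesis unfolding p by (intro nn_integral_cong) (auto simp: indicator_def)
  qed
  also have "\<dots> + (\<integral>\<^sup>+x. indicator {-pi..pi-c} x * h x \<partial>lborel) = (\<integral>\<^sup>+x. indicator {pi-c..<pi} x * h x + indicator {-pi..pi-c} x * h x \<partial>lborel)"
    by (rule nn_integral_add[symmetric]) auto
  also have "\<dots> = (\<integral>\<^sup>+x. indicator {-pi..pi} x * h x \<partial>lborel)"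
  proof (rule nn_integral_cong_AE)
    from AE_lborel_singleton[of "pi - c"] AE_lborel_singleton[of pi]
    show "AE x in lborel. indicator {pi-c..<pi} x * h x + indicator {-pi..pi-c} x * h x = indicator {-pi..pi} x * h x"
      by eventually_elim (use c in \<open>auto simp: indicator_def\<close>)
  qed
  finally show ?thesis .
qed

text \<open>The inverse of \<theta> \<mapsto> cos^2 (\<theta>/2) on [0, \<pi>]; every distance in
  question is of this form.\<close>

definition arc_of :: "real \<Rightarrow> real" where "arc_of u = 2 * arccos (sqrt u)"

lemma arc_of_bounds:
  assumes "0 \<le> u" "u \<le> 1"
  shows "0 \<le> arc_of u" "arc_of u \<le> pi"
proof -
  have "-1 \<le> (0 :: real)" "0 \<le> sqrt u" using assms by auto
  then have "-1 \<le> sqrt u" by (rule order_trans)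
  then show "0 \<le> arc_of u" "arc_of u \<le> pi"
    using assms arccos_lbound[of "sqrt u"] arccos_le_pi2[of "sqrt u"] by (auto simp: arc_of_def)
qed

lemma cos_half_arc_of:
  assumes "0 \<le> u" "u \<le> 1"
  shows "cos (arc_of u / 2) = sqrt u"
proof -
  have "-1 \<le> (0 :: real)" "0 \<le> sqrt u" using assms by auto
  then have "-1 \<le> sqrt u" by (rule order_trans)
  then show ?thesis using assms by (simp add: arc_of_def cos_arccos)
qed

text \<open>Two shifted cosines add up to one cosine. The phase disappears in the integral over a
  full period, so only the amplitude matters, and the bound on it keeps the later denominators
  positive.\<close>

lemma phase_form:
  assumes ab: "0 \<le> a" "0 \<le> b"
  obtains \<omega>0 Y where "0 \<le> Y" "Y \<le> (a + b) / 2" "0 \<le> \<omega>0" "\<omega>0 \<le> 2 * pi"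
    "\<And>\<omega>. (a * cos (\<omega> - \<theta> / 2) + b * cos (\<omega> + \<theta> / 2)) / 2 = Y * cos (\<omega> - \<omega>0)"
    "Y\<^sup>2 = ((a + b) / 2)\<^sup>2 - a * b * (1 - (cos (\<theta> / 2))\<^sup>2)"
proof -
  define p where "p = (a + b) / 2 * cos (\<theta> / 2)"
  define p' where "p' = (a - b) / 2 * sin (\<theta> / 2)"
  define Y where "Y = sqrt (p\<^sup>2 + p'\<^sup>2)"
  have s: "(sin (\<theta> / 2))\<^sup>2 = 1 - (cos (\<theta> / 2))\<^sup>2" by (simp add: sin_squared_eq)
  have Y2: "Y\<^sup>2 = p\<^sup>2 + p'\<^sup>2" by (simp add: Y_def)
  also have "\<dots> = ((a + b) / 2)\<^sup>2 - a * b * (1 - (cos (\<theta> / 2))\<^sup>2)"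
    unfolding p_def p'_def power_mult_distrib s by (simp add: power2_eq_square field_simps)
  finally have Y2': "Y\<^sup>2 = ((a + b) / 2)\<^sup>2 - a * b * (1 - (cos (\<theta> / 2))\<^sup>2)" .
  have Y0: "0 \<le> Y" by (simp add: Y_def)
  have "Y\<^sup>2 \<le> ((a + b) / 2)\<^sup>2" unfolding Y2' s[symmetric] using ab by simp
  then have Y1: "Y \<le> (a + b) / 2" using ab by (meson power2_le_imp_le add_nonneg_nonneg divide_nonneg_nonneg zero_le_numeral)
  have "\<exists>\<omega>0\<ge>0. \<omega>0 \<le> 2 * pi \<and> p = Y * cos \<omega>0 \<and> p' = Y * sin \<omega>0"
  proof (cases "Y = 0")
    case True
    then have "p = 0" "p' = 0" using Y2 by (simp_all add: sum_power2_eq_zero_iff)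
    with True show ?thesis by (intro exI[of _ 0]) auto
  next
    case False
    then have "(p / Y)\<^sup>2 + (p' / Y)\<^sup>2 = 1" unfolding power_divide add_divide_distrib[symmetric] Y2[symmetric] by simp
    then obtain t where "0 \<le> t" "t < 2 * pi" "p / Y = cos t" "p' / Y = sin t" by (rule sincos_total_2pi)
    with False show ?thesis by (intro exI[of _ t]) (auto simp: field_simps)
  qed
  then obtain \<omega>0 where o: "0 \<le> \<omega>0" "\<omega>0 \<le> 2 * pi" "p = Y * cos \<omega>0" "p' = Y * sin \<omega>0" by blast
  have "(a * cos (\<omega> - \<theta> / 2) + b * cos (\<omega> + \<theta> / 2)) / 2 = p * cos \<omega> + p' * sin \<omega>" for \<omega>
    unfolding p_def p'_def cos_diff cos_add by (simp add: field_simps)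
  also have "p * cos \<omega> + p' * sin \<omega> = Y * cos (\<omega> - \<omega>0)" for \<omega>
    unfolding o by (simp add: cos_diff algebra_simps)
  finally show ?thesis using that[OF Y0 Y1 o(1,2) _ Y2'] by blast
qed

text \<open>The product of \<rho> and cos \<omega> plays the role of a coordinate on the projective
  line. \<open>circle\<close> prescribes its Stieltjes transform of order \<kappa>, which supplies
  the power -\<kappa>/2 in the joint law.\<close>

locale radial_law =
  fixes \<kappa> :: nat and W :: "real measure" and \<rho> :: "real \<Rightarrow> real" and C1 :: real
  assumes \<kappa>: "0 < \<kappa>"
    and W_finite: "finite_measure W" and W_sets [measurable_cong]: "sets W = sets borel"
    and \<rho>_meas [measurable]: "\<rho> \<in> borel_measurable borel"
    and \<rho>_nonneg: "0 \<le> \<rho> \<nu>" and \<rho>_le_1: "\<rho> \<nu> \<le> 1"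
    and C1: "0 < C1"
    and circle: "0 \<le> Y \<Longrightarrow> Y < c \<Longrightarrow>
      (\<integral>\<^sup>+\<nu>. \<integral>\<^sup>+\<omega>. ennreal (indicator {-pi..pi} \<omega> * (1 / (c - Y * \<rho> \<nu> * cos \<omega>)) ^ \<kappa>) \<partial>lborel \<partial>W)
      = ennreal (C1 * (1 / sqrt (c\<^sup>2 - Y\<^sup>2)) ^ \<kappa>)"
begin

sublocale W: finite_measure W by (rule W_finite)

definition rdens :: "nat \<Rightarrow> real \<Rightarrow> real" where
  "rdens q R = indicator {0..1} R * (R ^ (\<kappa> - 1) * (1 - R) ^ (q - 1))"

definition tdens :: "nat \<Rightarrow> real \<Rightarrow> real" where
  "tdens q \<tau> = indicator {0<..} \<tau> * \<tau> ^ (\<kappa> + q - 1) * exp (- \<tau>)"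

definition mdens :: "nat \<Rightarrow> real \<times> real \<times> real \<times> real \<Rightarrow> real" where
  "mdens q = (\<lambda>(\<nu>, \<omega>, R, \<tau>). indicator {-pi..pi} \<omega> * (rdens q R * tdens q \<tau>))"

text \<open>Unnormalised law of independent variables: \<nu> from \<open>W\<close>, a uniform angle
  \<omega>, a Beta (\<kappa>, q) variable R and a Gamma (\<kappa>+q) variable \<tau>. Here \<tau>
  stands for T, while \<open>bU \<theta>\<close> and \<open>bU (- \<theta>)\<close> stand for Q x /
  T and Q y / T.\<close>

definition model :: "nat \<Rightarrow> (real \<times> real \<times> real \<times> real) measure" where
  "model q = density (W \<Otimes>\<^sub>M lborel) (\<lambda>z. ennreal (mdens q z))"

definition bU :: "real \<Rightarrow> real \<Rightarrow> real \<Rightarrow> real \<Rightarrow> real" where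
  "bU \<theta> \<nu> \<omega> R = R * ((1 + \<rho> \<nu> * cos (\<omega> - \<theta> / 2)) / 2)"

lemma half_bounds: "0 \<le> (1 + \<rho> \<nu> * cos t) / 2" "(1 + \<rho> \<nu> * cos t) / 2 \<le> 1"
proof -
  have "\<bar>\<rho> \<nu> * cos t\<bar> \<le> 1 * 1"
    unfolding abs_mult using \<rho>_nonneg[of \<nu>] \<rho>_le_1[of \<nu>] by (intro mult_mono) auto
  then show "0 \<le> (1 + \<rho> \<nu> * cos t) / 2" "(1 + \<rho> \<nu> * cos t) / 2 \<le> 1" by auto
qed

lemma bU_bounds:
  assumes "R \<in> {0..1}"
  shows "0 \<le> bU \<theta> \<nu> \<omega> R" "bU \<theta> \<nu> \<omega> R \<le> 1"
proof -
  have R: "0 \<le> R" "R \<le> 1" using assms by auto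
  show "0 \<le> bU \<theta> \<nu> \<omega> R" unfolding bU_def by (rule mult_nonneg_nonneg[OF R(1) half_bounds(1)])
  show "bU \<theta> \<nu> \<omega> R \<le> 1" unfolding bU_def by (rule mult_le_one[OF R(2) half_bounds])
qed

lemma rdens_nonneg: "0 \<le> rdens q R" by (auto simp: rdens_def indicator_def)
lemma tdens_nonneg: "0 \<le> tdens q R" by (auto simp: tdens_def indicator_def)

lemma measurable_dens [measurable]:
  "rdens q \<in> borel_measurable borel" "tdens q \<in> borel_measurable borel"
  unfolding rdens_def[abs_def] tdens_def[abs_def] by measurable

lemma sets_base: "sets (W \<Otimes>\<^sub>M (lborel :: (real \<times> real \<times> real) measure)) = sets (borel \<Otimes>\<^sub>M (borel \<Otimes>\<^sub>M (borel \<Otimes>\<^sub>M borel)))"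
  by (rule sets_pair_measure_cong[OF W_sets]) (metis borel_prod sets_lborel)

lemma mdens_measurable: "mdens q \<in> borel_measurable (W \<Otimes>\<^sub>M lborel)"
  unfolding measurable_cong_sets[OF sets_base refl] mdens_def by measurable

lemma nn_integral_model:
  assumes F: "F \<in> borel_measurable (borel \<Otimes>\<^sub>M (borel \<Otimes>\<^sub>M (borel \<Otimes>\<^sub>M borel)))"
  shows "(\<integral>\<^sup>+z. F z \<partial>model q) = (\<integral>\<^sup>+\<nu>. \<integral>\<^sup>+\<omega>. \<integral>\<^sup>+R. \<integral>\<^sup>+\<tau>.
    ennreal (indicator {-pi..pi} \<omega> * (rdens q R * tdens q \<tau>)) * F (\<nu>, \<omega>, R, \<tau>) \<partial>lborel \<partial>lborel \<partial>lborel \<partial>W)"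
proof -
  have F': "F \<in> borel_measurable (W \<Otimes>\<^sub>M lborel)"
    using F by (subst measurable_cong_sets[OF sets_base refl])
  define G where "G z = ennreal (mdens q z) * F z" for z
  have [measurable]: "mdens q \<in> borel_measurable (borel \<Otimes>\<^sub>M (borel \<Otimes>\<^sub>M (borel \<Otimes>\<^sub>M borel)))"
    unfolding mdens_def by measurable
  note F[measurable]
  have G: "G \<in> borel_measurable (borel \<Otimes>\<^sub>M (borel \<Otimes>\<^sub>M (borel \<Otimes>\<^sub>M borel)))"
    unfolding G_def by measurable
  have G': "G \<in> borel_measurable (W \<Otimes>\<^sub>M lborel)"
    using G by (subst measurable_cong_sets[OF sets_base refl])
  have "(\<integral>\<^sup>+z. F z \<partial>model q) = (\<integral>\<^sup>+z. G z \<partial>(W \<Otimes>\<^sub>M lborel))"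
    unfolding model_def G_def using F' mdens_measurable[of q] by (subst nn_integral_density) auto
  also have "\<dots> = (\<integral>\<^sup>+\<nu>. \<integral>\<^sup>+v. G (\<nu>, v) \<partial>lborel \<partial>W)"
    by (rule lborel.nn_integral_fst[symmetric, OF G'])
  also have "\<dots> = (\<integral>\<^sup>+\<nu>. \<integral>\<^sup>+\<omega>. \<integral>\<^sup>+v. G (\<nu>, \<omega>, v) \<partial>lborel \<partial>lborel \<partial>W)"
  proof (rule nn_integral_cong)
    fix \<nu>
    have "(\<lambda>v. G (\<nu>, v)) \<in> borel_measurable (lborel \<Otimes>\<^sub>M lborel)"
      using G by (simp add: lborel_prod borel_prod)
    from lborel.nn_integral_fst[OF this]
    show "(\<integral>\<^sup>+v. G (\<nu>, v) \<partial>lborel) = (\<integral>\<^sup>+\<omega>. \<integral>\<^sup>+v. G (\<nu>, \<omega>, v) \<partial>lborel \<partial>lborel)"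
      unfolding lborel_prod by simp
  qed
  also have "\<dots> = (\<integral>\<^sup>+\<nu>. \<integral>\<^sup>+\<omega>. \<integral>\<^sup>+R. \<integral>\<^sup>+\<tau>. G (\<nu>, \<omega>, R, \<tau>) \<partial>lborel \<partial>lborel \<partial>lborel \<partial>W)"
  proof (intro nn_integral_cong)
    fix \<nu> \<omega>
    have "(\<lambda>v. G (\<nu>, \<omega>, v)) \<in> borel_measurable (lborel \<Otimes>\<^sub>M lborel)"
      using G by (simp add: lborel_prod borel_prod)
    from lborel.nn_integral_fst[OF this]
    show "(\<integral>\<^sup>+v. G (\<nu>, \<omega>, v) \<partial>lborel) = (\<integral>\<^sup>+R. \<integral>\<^sup>+\<tau>. G (\<nu>, \<omega>, R, \<tau>) \<partial>lborel \<partial>lborel)"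
      unfolding lborel_prod by simp
  qed
  finally show ?thesis by (simp add: G_def mdens_def)
qed

definition model_const :: "nat \<Rightarrow> real" where
  "model_const q = fact (\<kappa> + q - 1) * beta_const (\<kappa> - 1) (q - 1) * C1"

lemma model_const_pos: "0 < model_const q"
  by (simp add: model_const_def C1 beta_const_pos)

text \<open>Integrate \<tau> by the Gamma integral, R by \<open>beta_moebius\<close> and the angle
  by \<open>circle\<close> after a phase shift. Then \<Lambda>^(-q) comes from R and the remaining
  power from the circle, because c^2 - Y^2 = (\<Lambda> - a) (\<Lambda> - b) - a b u for c =
  \<Lambda> - (a + b)/2. The exponent carries \<Lambda> - 1 since the Gamma density already contains
  exp (-\<tau>).\<close>

lemma model_laplace:
  assumes q: "0 < q" and u: "0 \<le> u" "u \<le> 1" and ab: "0 \<le> a" "0 \<le> b" "a + b < \<Lambda>"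
  shows "(\<integral>\<^sup>+(\<nu>, \<omega>, R, \<tau>). ennreal (exp (- (\<Lambda> - 1) * \<tau> + a * (\<tau> * bU (arc_of u) \<nu> \<omega> R) + b * (\<tau> * bU (- arc_of u) \<nu> \<omega> R))) \<partial>model q)
    = ennreal (model_const q * ((1 / \<Lambda>) ^ q * (1 / sqrt ((\<Lambda> - a) * (\<Lambda> - b) - a * b * u)) ^ \<kappa>))"
proof -
  define \<theta> where "\<theta> = arc_of u"
  have cos2: "(cos (\<theta> / 2))\<^sup>2 = u" using u by (simp add: \<theta>_def cos_half_arc_of)
  obtain \<omega>0 Y where Y: "0 \<le> Y" "Y \<le> (a + b) / 2" and o: "0 \<le> \<omega>0" "\<omega>0 \<le> 2 * pi"
    and ph: "\<And>\<omega>. (a * cos (\<omega> - \<theta> / 2) + b * cos (\<omega> + \<theta> / 2)) / 2 = Y * cos (\<omega> - \<omega>0)"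
    and Y2: "Y\<^sup>2 = ((a + b) / 2)\<^sup>2 - a * b * (1 - (cos (\<theta> / 2))\<^sup>2)"
    by (rule phase_form[OF ab(1,2), of \<theta>], rule that)
  define c where "c = \<Lambda> - (a + b) / 2"
  have c: "Y < c" using Y(2) ab(3) unfolding c_def by (simp add: field_simps)
  define K where "K = fact (\<kappa> + q - 1) * (beta_const (\<kappa> - 1) (q - 1) * (1 / \<Lambda>) ^ q)"
  have K: "0 \<le> K" using ab by (simp add: K_def beta_const_pos less_imp_le)
  have inner: "(\<integral>\<^sup>+R. \<integral>\<^sup>+\<tau>. ennreal (indicator {-pi..pi} \<omega> * (rdens q R * tdens q \<tau>)) *
      ennreal (exp (- (\<Lambda> - 1) * \<tau> + a * (\<tau> * bU \<theta> \<nu> \<omega> R) + b * (\<tau> * bU (- \<theta>) \<nu> \<omega> R))) \<partial>lborel \<partial>lborel)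
    = ennreal K * ennreal (indicator {-pi..pi} \<omega> * (1 / (c - Y * \<rho> \<nu> * cos (\<omega> - \<omega>0))) ^ \<kappa>)" for \<nu> \<omega>
  proof -
    define E where "E = a * ((1 + \<rho> \<nu> * cos (\<omega> - \<theta> / 2)) / 2) + b * ((1 + \<rho> \<nu> * cos (\<omega> + \<theta> / 2)) / 2)"
    have E0: "0 \<le> E" unfolding E_def using ab half_bounds by (intro add_nonneg_nonneg mult_nonneg_nonneg) auto
    have "E \<le> a * 1 + b * 1" unfolding E_def using ab half_bounds by (intro add_mono mult_left_mono) auto
    then have E1: "E < \<Lambda>" using ab by simp
    have "E = (a + b) / 2 + \<rho> \<nu> * ((a * cos (\<omega> - \<theta> / 2) + b * cos (\<omega> + \<theta> / 2)) / 2)"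
      by (simp add: E_def field_simps)
    then have E2: "\<Lambda> - E = c - Y * \<rho> \<nu> * cos (\<omega> - \<omega>0)" unfolding ph by (simp add: c_def)
    have tau: "(\<integral>\<^sup>+\<tau>. ennreal (indicator {-pi..pi} \<omega> * (rdens q R * tdens q \<tau>)) *
        ennreal (exp (- (\<Lambda> - 1) * \<tau> + a * (\<tau> * bU \<theta> \<nu> \<omega> R) + b * (\<tau> * bU (- \<theta>) \<nu> \<omega> R))) \<partial>lborel)
      = ennreal (indicator {-pi..pi} \<omega> * fact (\<kappa> + q - 1)) * ennreal (indicator {0..1} R * (R ^ (\<kappa> - 1) * (1 - R) ^ (q - 1) * (1 / (\<Lambda> - R * E)) ^ (\<kappa> - 1 + (q - 1) + 2)))" for R
    proof (cases "R \<in> {0..1}")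
      case True
      then have "R * E \<le> E" using E0 by (simp add: mult_left_le_one_le)
      then have pos: "0 < \<Lambda> - R * E" using E1 by simp
      have "(\<integral>\<^sup>+\<tau>. ennreal (indicator {-pi..pi} \<omega> * (rdens q R * tdens q \<tau>)) *
          ennreal (exp (- (\<Lambda> - 1) * \<tau> + a * (\<tau> * bU \<theta> \<nu> \<omega> R) + b * (\<tau> * bU (- \<theta>) \<nu> \<omega> R))) \<partial>lborel)
        = (\<integral>\<^sup>+\<tau>. ennreal (indicator {-pi..pi} \<omega> * rdens q R) * ennreal (indicator {0<..} \<tau> * \<tau> ^ (\<kappa> + q - 1) * exp (- (\<Lambda> - R * E) * \<tau>)) \<partial>lborel)"
      proof (rule nn_integral_cong)
        fix \<tau> :: real
        have "exp (- \<tau>) * exp (- (\<Lambda> - 1) * \<tau> + a * (\<tau> * bU \<theta> \<nu> \<omega> R) + b * (\<tau> * bU (- \<theta>) \<nu> \<omega> R)) = exp (- (\<Lambda> - R * E) * \<tau>)"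
          unfolding exp_add[symmetric] by (simp add: bU_def E_def algebra_simps)
        note ex = this
        have req: "indicator {-pi..pi} \<omega> * (rdens q R * tdens q \<tau>) * exp (- (\<Lambda> - 1) * \<tau> + a * (\<tau> * bU \<theta> \<nu> \<omega> R) + b * (\<tau> * bU (- \<theta>) \<nu> \<omega> R))
          = indicator {-pi..pi} \<omega> * rdens q R * (indicator {0<..} \<tau> * \<tau> ^ (\<kappa> + q - 1) * exp (- (\<Lambda> - R * E) * \<tau>))"
          unfolding tdens_def ex[symmetric] by (simp only: mult_ac)
        have n: "0 \<le> indicator {-pi..pi} \<omega> * (rdens q R * tdens q \<tau>)" "0 \<le> indicator {-pi..pi} \<omega> * rdens q R"
          by (simp_all add: rdens_nonneg tdens_nonneg)
        show "ennreal (indicator {-pi..pi} \<omega> * (rdens q R * tdens q \<tau>)) *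
          ennreal (exp (- (\<Lambda> - 1) * \<tau> + a * (\<tau> * bU \<theta> \<nu> \<omega> R) + b * (\<tau> * bU (- \<theta>) \<nu> \<omega> R)))
          = ennreal (indicator {-pi..pi} \<omega> * rdens q R) * ennreal (indicator {0<..} \<tau> * \<tau> ^ (\<kappa> + q - 1) * exp (- (\<Lambda> - R * E) * \<tau>))"
          unfolding ennreal_mult'[OF n(1), symmetric] ennreal_mult'[OF n(2), symmetric] req ..
      qed
      also have "\<dots> = ennreal (indicator {-pi..pi} \<omega> * rdens q R) * ennreal (fact (\<kappa> + q - 1) * (1 / (\<Lambda> - R * E)) ^ Suc (\<kappa> + q - 1))"
        by (subst nn_integral_cmult, simp, simp only: nn_integral_power_exp[OF pos])
      \<comment> \<open>Brings the exponent into the shape m + n + 2 of \<open>beta_moebius\<close>,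
        with m = \<kappa> - 1 and n = q - 1.\<close>
      also have "Suc (\<kappa> + q - 1) = \<kappa> - 1 + (q - 1) + 2" using \<kappa> q by simp
      finally have fin: "(\<integral>\<^sup>+\<tau>. ennreal (indicator {-pi..pi} \<omega> * (rdens q R * tdens q \<tau>)) *
          ennreal (exp (- (\<Lambda> - 1) * \<tau> + a * (\<tau> * bU \<theta> \<nu> \<omega> R) + b * (\<tau> * bU (- \<theta>) \<nu> \<omega> R))) \<partial>lborel)
        = ennreal (indicator {-pi..pi} \<omega> * rdens q R) * ennreal (fact (\<kappa> + q - 1) * (1 / (\<Lambda> - R * E)) ^ (\<kappa> - 1 + (q - 1) + 2))" .
      have n: "0 \<le> indicator {-pi..pi} \<omega> * rdens q R" "0 \<le> (indicator {-pi..pi} \<omega> * fact (\<kappa> + q - 1) :: real)"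
        by (simp_all add: rdens_nonneg)
      show ?thesis
        unfolding fin unfolding ennreal_mult'[OF n(1), symmetric] ennreal_mult'[OF n(2), symmetric] unfolding rdens_def by (simp only: mult_ac)
    next
      case False
      then show ?thesis by (simp add: rdens_def)
    qed
    have "(\<integral>\<^sup>+R. \<integral>\<^sup>+\<tau>. ennreal (indicator {-pi..pi} \<omega> * (rdens q R * tdens q \<tau>)) *
      ennreal (exp (- (\<Lambda> - 1) * \<tau> + a * (\<tau> * bU \<theta> \<nu> \<omega> R) + b * (\<tau> * bU (- \<theta>) \<nu> \<omega> R))) \<partial>lborel \<partial>lborel)
      = ennreal (indicator {-pi..pi} \<omega> * fact (\<kappa> + q - 1)) *
        (\<integral>\<^sup>+R. ennreal (indicator {0..1} R * (R ^ (\<kappa> - 1) * (1 - R) ^ (q - 1) * (1 / (\<Lambda> - R * E)) ^ (\<kappa> - 1 + (q - 1) + 2))) \<partial>lborel)"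
      unfolding tau by (rule nn_integral_cmult) simp
    also have "(\<integral>\<^sup>+R. ennreal (indicator {0..1} R * (R ^ (\<kappa> - 1) * (1 - R) ^ (q - 1) * (1 / (\<Lambda> - R * E)) ^ (\<kappa> - 1 + (q - 1) + 2))) \<partial>lborel)
      = ennreal (beta_const (\<kappa> - 1) (q - 1) * (1 / \<Lambda>) ^ Suc (q - 1) * (1 / (\<Lambda> - E)) ^ Suc (\<kappa> - 1))"
    proof (rule nn_integral_Icc[OF _ _ beta_moebius[OF E0 E1]])
      fix R :: real assume R: "R \<in> {0..1}"
      then have "R * E \<le> E" using E0 by (simp add: mult_left_le_one_le)
      then show "0 \<le> R ^ (\<kappa> - 1) * (1 - R) ^ (q - 1) * (1 / (\<Lambda> - R * E)) ^ (\<kappa> - 1 + (q - 1) + 2)" using R E1 by simp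
    qed measurable
    also have "Suc (q - 1) = q" using q by simp
    also have "Suc (\<kappa> - 1) = \<kappa>" using \<kappa> by simp
    also have "ennreal (indicator {-pi..pi} \<omega> * fact (\<kappa> + q - 1)) * ennreal (beta_const (\<kappa> - 1) (q - 1) * (1 / \<Lambda>) ^ q * (1 / (\<Lambda> - E)) ^ \<kappa>)
      = ennreal (K * (indicator {-pi..pi} \<omega> * (1 / (\<Lambda> - E)) ^ \<kappa>))"
    proof -
      have "0 \<le> (indicator {-pi..pi} \<omega> * fact (\<kappa> + q - 1) :: real)" by simp
      note m = ennreal_mult'[OF this]
      show ?thesis unfolding m[symmetric] K_def by (simp only: mult_ac)
    qed
    also have "\<dots> = ennreal K * ennreal (indicator {-pi..pi} \<omega> * (1 / (\<Lambda> - E)) ^ \<kappa>)"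
      using K by (rule ennreal_mult')
    finally show ?thesis unfolding E2 .
  qed
  have "(\<integral>\<^sup>+(\<nu>, \<omega>, R, \<tau>). ennreal (exp (- (\<Lambda> - 1) * \<tau> + a * (\<tau> * bU \<theta> \<nu> \<omega> R) + b * (\<tau> * bU (- \<theta>) \<nu> \<omega> R))) \<partial>model q)
    = (\<integral>\<^sup>+\<nu>. \<integral>\<^sup>+\<omega>. \<integral>\<^sup>+R. \<integral>\<^sup>+\<tau>. ennreal (indicator {-pi..pi} \<omega> * (rdens q R * tdens q \<tau>)) *
      ennreal (exp (- (\<Lambda> - 1) * \<tau> + a * (\<tau> * bU \<theta> \<nu> \<omega> R) + b * (\<tau> * bU (- \<theta>) \<nu> \<omega> R))) \<partial>lborel \<partial>lborel \<partial>lborel \<partial>W)"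
  proof (subst nn_integral_model)
    show "(\<lambda>(\<nu>, \<omega>, R, \<tau>). ennreal (exp (- (\<Lambda> - 1) * \<tau> + a * (\<tau> * bU \<theta> \<nu> \<omega> R) + b * (\<tau> * bU (- \<theta>) \<nu> \<omega> R))))
      \<in> borel_measurable (borel \<Otimes>\<^sub>M (borel \<Otimes>\<^sub>M (borel \<Otimes>\<^sub>M borel)))"
      unfolding bU_def by measurable
  qed simp
  also have "\<dots> = (\<integral>\<^sup>+\<nu>. ennreal K * (\<integral>\<^sup>+\<omega>. ennreal (indicator {-pi..pi} \<omega> * (1 / (c - Y * \<rho> \<nu> * cos \<omega>)) ^ \<kappa>) \<partial>lborel) \<partial>W)"
  proof (rule nn_integral_cong)
    fix \<nu>
    have "(\<integral>\<^sup>+\<omega>. \<integral>\<^sup>+R. \<integral>\<^sup>+\<tau>. ennreal (indicator {-pi..pi} \<omega> * (rdens q R * tdens q \<tau>)) *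
      ennreal (exp (- (\<Lambda> - 1) * \<tau> + a * (\<tau> * bU \<theta> \<nu> \<omega> R) + b * (\<tau> * bU (- \<theta>) \<nu> \<omega> R))) \<partial>lborel \<partial>lborel \<partial>lborel)
      = ennreal K * (\<integral>\<^sup>+\<omega>. ennreal (indicator {-pi..pi} \<omega> * (1 / (c - Y * \<rho> \<nu> * cos (\<omega> - \<omega>0))) ^ \<kappa>) \<partial>lborel)"
      unfolding inner by (rule nn_integral_cmult) measurable
    also have "(\<integral>\<^sup>+\<omega>. ennreal (indicator {-pi..pi} \<omega> * (1 / (c - Y * \<rho> \<nu> * cos (\<omega> - \<omega>0))) ^ \<kappa>) \<partial>lborel)
      = (\<integral>\<^sup>+\<omega>. indicator {-pi..pi} \<omega> * ennreal ((1 / (c - Y * \<rho> \<nu> * cos (\<omega> - \<omega>0))) ^ \<kappa>) \<partial>lborel)"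
      by (intro nn_integral_cong) (auto simp: indicator_def)
    also have "\<dots> = (\<integral>\<^sup>+\<omega>. indicator {-pi..pi} \<omega> * ennreal ((1 / (c - Y * \<rho> \<nu> * cos \<omega>)) ^ \<kappa>) \<partial>lborel)"
      by (rule nn_integral_periodic_shift[where h = "\<lambda>\<omega>. ennreal ((1 / (c - Y * \<rho> \<nu> * cos \<omega>)) ^ \<kappa>)"]) (use o in auto)
    also have "\<dots> = (\<integral>\<^sup>+\<omega>. ennreal (indicator {-pi..pi} \<omega> * (1 / (c - Y * \<rho> \<nu> * cos \<omega>)) ^ \<kappa>) \<partial>lborel)"
      by (intro nn_integral_cong) (auto simp: indicator_def)
    finally show "(\<integral>\<^sup>+\<omega>. \<integral>\<^sup>+R. \<integral>\<^sup>+\<tau>. ennreal (indicator {-pi..pi} \<omega> * (rdens q R * tdens q \<tau>)) *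
      ennreal (exp (- (\<Lambda> - 1) * \<tau> + a * (\<tau> * bU \<theta> \<nu> \<omega> R) + b * (\<tau> * bU (- \<theta>) \<nu> \<omega> R))) \<partial>lborel \<partial>lborel \<partial>lborel)
      = ennreal K * (\<integral>\<^sup>+\<omega>. ennreal (indicator {-pi..pi} \<omega> * (1 / (c - Y * \<rho> \<nu> * cos \<omega>)) ^ \<kappa>) \<partial>lborel)" .
  qed
  also have "\<dots> = ennreal K * ennreal (C1 * (1 / sqrt (c\<^sup>2 - Y\<^sup>2)) ^ \<kappa>)"
  proof -
    have "(\<lambda>\<nu>. \<integral>\<^sup>+\<omega>. ennreal (indicator {-pi..pi} \<omega> * (1 / (c - Y * \<rho> \<nu> * cos \<omega>)) ^ \<kappa>) \<partial>lborel) \<in> borel_measurable W"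
      by measurable
    then show ?thesis by (simp add: nn_integral_cmult circle[OF Y(1) c])
  qed
  also have "\<dots> = ennreal (K * (C1 * (1 / sqrt (c\<^sup>2 - Y\<^sup>2)) ^ \<kappa>))" using K by (rule ennreal_mult'[symmetric])
  also have "c\<^sup>2 - Y\<^sup>2 = (\<Lambda> - a) * (\<Lambda> - b) - a * b * u"
  proof -
    have "(\<Lambda> - s / 2)\<^sup>2 - ((s / 2)\<^sup>2 - d) = \<Lambda> * \<Lambda> - \<Lambda> * s + d" for s d :: real
      unfolding power2_diff by (simp add: power2_eq_square)
    from this[of "a + b" "a * b * (1 - u)"] show ?thesis
      unfolding Y2 cos2 c_def by (simp add: algebra_simps)
  qed
  also have "K * (C1 * (1 / sqrt ((\<Lambda> - a) * (\<Lambda> - b) - a * b * u)) ^ \<kappa>) = model_const q * ((1 / \<Lambda>) ^ q * (1 / sqrt ((\<Lambda> - a) * (\<Lambda> - b) - a * b * u)) ^ \<kappa>)"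
    by (simp only: K_def model_const_def mult_ac)
  finally show ?thesis unfolding \<theta>_def .
qed

end

section \<open>Kernels of the form E N (min U V)\<close>

definition psd :: "nat \<Rightarrow> (nat \<Rightarrow> nat \<Rightarrow> real) \<Rightarrow> bool" where
  "psd n A \<longleftrightarrow> (\<forall>c. 0 \<le> (\<Sum>i<n. \<Sum>j<n. c i * A i j * c j))"

lemma integral_enn2real:
  assumes "f \<in> borel_measurable M" "(\<integral>\<^sup>+x. f x \<partial>M) < \<infinity>"
  shows "integrable M (\<lambda>x. enn2real (f x))" "(\<integral>x. enn2real (f x) \<partial>M) = enn2real (\<integral>\<^sup>+x. f x \<partial>M)"
proof -
  have "AE x in M. f x \<noteq> \<infinity>" using assms by (intro nn_integral_noteq_infinite) auto
  then have eq: "(\<integral>\<^sup>+x. ennreal (enn2real (f x)) \<partial>M) = (\<integral>\<^sup>+x. f x \<partial>M)"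
    by (intro nn_integral_cong_AE) (auto elim!: eventually_mono simp: less_top)
  show "integrable M (\<lambda>x. enn2real (f x))"
    using assms by (intro integrableI_nonneg) (auto simp: eq)
  show "(\<integral>x. enn2real (f x) \<partial>M) = enn2real (\<integral>\<^sup>+x. f x \<partial>M)"
    using assms(1) by (subst integral_eq_nn_integral) (auto simp: eq)
qed

lemma psd_integral:
  assumes meas: "\<And>i j. i < n \<Longrightarrow> j < n \<Longrightarrow> f i j \<in> borel_measurable M"
    and fin: "\<And>i j. i < n \<Longrightarrow> j < n \<Longrightarrow> (\<integral>\<^sup>+x. f i j x \<partial>M) < \<infinity>"
    and psd: "AE x in M. psd n (\<lambda>i j. enn2real (f i j x))"
  shows "psd n (\<lambda>i j. enn2real (\<integral>\<^sup>+x. f i j x \<partial>M))"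
  unfolding psd_def
proof
  fix c :: "nat \<Rightarrow> real"
  note int = integral_enn2real[OF meas fin]
  have "(\<Sum>i<n. \<Sum>j<n. c i * enn2real (\<integral>\<^sup>+x. f i j x \<partial>M) * c j) = (\<Sum>i<n. \<Sum>j<n. (\<integral>x. c i * enn2real (f i j x) * c j \<partial>M))"
    using int by (intro sum.cong refl) simp
  also have "\<dots> = (\<integral>x. (\<Sum>i<n. \<Sum>j<n. c i * enn2real (f i j x) * c j) \<partial>M)"
    using int by (subst Bochner_Integration.integral_sum, (intro Bochner_Integration.integrable_sum; simp), intro sum.cong refl)
      (subst Bochner_Integration.integral_sum; simp)
  also have "\<dots> \<ge> 0"
    using psd by (intro integral_nonneg_AE) (auto simp: psd_def elim!: eventually_mono)
  finally show "0 \<le> (\<Sum>i<n. \<Sum>j<n. c i * enn2real (\<integral>\<^sup>+x. f i j x \<partial>M) * c j)" .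
qed

text \<open>\<open>min (a i) (a j)\<close> is the measure of the intersection of two initial segments.\<close>

lemma psd_min:
  assumes a: "\<And>i. i < n \<Longrightarrow> 0 \<le> a i"
  shows "psd n (\<lambda>i j. min (a i) (a j))"
proof -
  define f where "f i j x = ennreal (indicator {0..a i} x * indicator {0..a j} x)" for i j and x :: real
  have "f i j = indicator {0..min (a i) (a j)}" for i j
    by (auto simp: fun_eq_iff f_def indicator_def)
  then have I: "(\<integral>\<^sup>+x. f i j x \<partial>lborel) = ennreal (min (a i) (a j))" if "i < n" "j < n" for i j
    using a that by simp
  have "psd n (\<lambda>i j. enn2real (\<integral>\<^sup>+x. f i j x \<partial>lborel))"
  proof (rule psd_integral)
    show "f i j \<in> borel_measurable lborel" for i j unfolding f_def by measurable
    show "(\<integral>\<^sup>+x. f i j x \<partial>lborel) < \<infinity>" if "i < n" "j < n" for i j by (simp add: I[OF that])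
    show "AE x in lborel. psd n (\<lambda>i j. enn2real (f i j x))"
    proof (rule AE_I2)
      fix x :: real
      define g :: "nat \<Rightarrow> real" where "g i = indicator {0..a i} x" for i
      have "enn2real (f i j x) = g i * g j" for i j by (simp add: f_def g_def)
      then have "(\<Sum>i<n. \<Sum>j<n. c i * enn2real (f i j x) * c j) = (\<Sum>i<n. c i * g i)\<^sup>2" for c :: "nat \<Rightarrow> real"
        by (simp add: power2_eq_square sum_product mult_ac)
      then show "psd n (\<lambda>i j. enn2real (f i j x))" unfolding psd_def by simp
    qed
  qed
  then show ?thesis using a unfolding psd_def by (simp add: I)
qed

text \<open>The uniqueness theorem handles the nonnegative quantities t - t a and t - t b; this
  recovers the minimum from them.\<close>

lemma one_minus_max_divide:
  assumes "0 < (t :: real)"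
  shows "1 - max (t - t * a) (t - t * b) / t = min a b"
proof -
  have "max (t - t * a) (t - t * b) = t - t * min a b"
    using assms by (auto simp: max_def min_def)
  then show ?thesis using assms by (simp add: diff_divide_distrib)
qed

lemma min_affine:
  assumes "0 \<le> (R :: real)" "0 \<le> r"
  shows "min (R * ((1 + r * a) / 2)) (R * ((1 + r * b) / 2)) = R * ((1 + r * min a b) / 2)"
proof -
  have *: "R * ((1 + r * a) / 2) \<le> R * ((1 + r * b) / 2)" if "a \<le> b" for a b
  proof (rule mult_left_mono[OF _ assms(1)])
    have "r * a \<le> r * b" using that assms(2) by (rule mult_left_mono)
    then show "(1 + r * a) / 2 \<le> (1 + r * b) / 2" by simp
  qed
  show ?thesis
  proof (cases "a \<le> b")
    case True
    then show ?thesis using *[OF True] by (simp only: min_absorb1)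
  next
    case False
    then have "b \<le> a" by simp
    then show ?thesis using *[of b a] by (simp only: min_absorb2)
  qed
qed

text \<open>The two cosines differ by 2 sin \<omega> sin (\<theta>/2), whose sign is decided by that
  of \<omega>.\<close>

lemma min_cos_shift:
  assumes "\<omega> \<in> {-pi..pi}" "0 \<le> \<theta>" "\<theta> \<le> pi"
  shows "min (cos (\<omega> - \<theta> / 2)) (cos (\<omega> + \<theta> / 2)) = cos (\<bar>\<omega>\<bar> + \<theta> / 2)"
proof -
  have s: "0 \<le> sin (\<theta> / 2)" using assms by (intro sin_ge_zero) auto
  have d: "cos (\<omega> - \<theta> / 2) - cos (\<omega> + \<theta> / 2) = 2 * (sin \<omega> * sin (\<theta> / 2))" for \<omega>
    by (simp add: cos_diff cos_add)
  show ?thesis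
  proof (cases "0 \<le> \<omega>")
    case True
    then have "0 \<le> sin \<omega> * sin (\<theta> / 2)" using assms s by (intro mult_nonneg_nonneg sin_ge_zero) auto
    with d[of \<omega>] True show ?thesis by (simp add: min_def)
  next
    case False
    then have "0 \<le> sin (- \<omega>) * sin (\<theta> / 2)" using assms s by (intro mult_nonneg_nonneg sin_ge_zero) auto
    then have "cos (\<omega> - \<theta> / 2) \<le> cos (\<omega> + \<theta> / 2)" using d[of \<omega>] by simp
    moreover have "cos (\<bar>\<omega>\<bar> + \<theta> / 2) = cos (\<omega> - \<theta> / 2)"
      using False cos_minus[of "\<omega> - \<theta> / 2"] by (simp add: algebra_simps)
    ultimately show ?thesis by (simp add: min_def)
  qed
qed

context radial_law begin

text \<open>The model expectation of N (min U V), with \<tau> integrated out up to a factorial and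
  the minimum already evaluated.\<close>

definition kern :: "nat \<Rightarrow> (real \<Rightarrow> ennreal) \<Rightarrow> real \<Rightarrow> ennreal" where
  "kern q N u = (\<integral>\<^sup>+\<nu>. \<integral>\<^sup>+\<omega>. \<integral>\<^sup>+R. ennreal (indicator {-pi..pi} \<omega> * rdens q R) *
    N (R * ((1 + \<rho> \<nu> * cos (\<bar>\<omega>\<bar> + arc_of u / 2)) / 2)) \<partial>lborel \<partial>lborel \<partial>W)"

lemma model_kern:
  assumes q: "0 < q" and u: "0 \<le> u" "u \<le> 1" and N[measurable]: "N \<in> borel_measurable borel"
  shows "(\<integral>\<^sup>+(\<nu>, \<omega>, R, \<tau>). N (1 - max (\<tau> - \<tau> * bU (arc_of u) \<nu> \<omega> R) (\<tau> - \<tau> * bU (- arc_of u) \<nu> \<omega> R) / \<tau>) \<partial>model q)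
    = ennreal (fact (\<kappa> + q - 1)) * kern q N u"
proof -
  define \<theta> where "\<theta> = arc_of u"
  have th: "0 \<le> \<theta>" "\<theta> \<le> pi" using arc_of_bounds[OF u] by (simp_all add: \<theta>_def)
  have tau: "(\<integral>\<^sup>+\<tau>. ennreal (indicator {-pi..pi} \<omega> * (rdens q R * tdens q \<tau>)) *
      N (1 - max (\<tau> - \<tau> * bU \<theta> \<nu> \<omega> R) (\<tau> - \<tau> * bU (- \<theta>) \<nu> \<omega> R) / \<tau>) \<partial>lborel)
    = ennreal (fact (\<kappa> + q - 1)) * (ennreal (indicator {-pi..pi} \<omega> * rdens q R) * N (R * ((1 + \<rho> \<nu> * cos (\<bar>\<omega>\<bar> + \<theta> / 2)) / 2)))" for \<nu> \<omega> R
  proof -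
    have t1: "(\<integral>\<^sup>+\<tau>. ennreal (tdens q \<tau>) \<partial>lborel) = ennreal (fact (\<kappa> + q - 1))"
      using nn_integral_power_exp[of 1 "\<kappa> + q - 1"] by (simp add: tdens_def[abs_def])
    have "(\<integral>\<^sup>+\<tau>. ennreal (indicator {-pi..pi} \<omega> * (rdens q R * tdens q \<tau>)) *
      N (1 - max (\<tau> - \<tau> * bU \<theta> \<nu> \<omega> R) (\<tau> - \<tau> * bU (- \<theta>) \<nu> \<omega> R) / \<tau>) \<partial>lborel)
      = (\<integral>\<^sup>+\<tau>. (ennreal (indicator {-pi..pi} \<omega> * rdens q R) * N (R * ((1 + \<rho> \<nu> * cos (\<bar>\<omega>\<bar> + \<theta> / 2)) / 2))) * ennreal (tdens q \<tau>) \<partial>lborel)"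
    proof (rule nn_integral_cong)
      fix \<tau> :: real
      show "ennreal (indicator {-pi..pi} \<omega> * (rdens q R * tdens q \<tau>)) *
      N (1 - max (\<tau> - \<tau> * bU \<theta> \<nu> \<omega> R) (\<tau> - \<tau> * bU (- \<theta>) \<nu> \<omega> R) / \<tau>)
       = (ennreal (indicator {-pi..pi} \<omega> * rdens q R) * N (R * ((1 + \<rho> \<nu> * cos (\<bar>\<omega>\<bar> + \<theta> / 2)) / 2))) * ennreal (tdens q \<tau>)"
      proof (cases "0 < \<tau> \<and> \<omega> \<in> {-pi..pi} \<and> R \<in> {0..1}")
        case True
        have "1 - max (\<tau> - \<tau> * bU \<theta> \<nu> \<omega> R) (\<tau> - \<tau> * bU (- \<theta>) \<nu> \<omega> R) / \<tau> = min (bU \<theta> \<nu> \<omega> R) (bU (- \<theta>) \<nu> \<omega> R)"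
          unfolding bU_def using True by (subst one_minus_max_divide) auto
        also have "\<dots> = R * ((1 + \<rho> \<nu> * min (cos (\<omega> - \<theta> / 2)) (cos (\<omega> + \<theta> / 2))) / 2)"
          unfolding bU_def using True \<rho>_nonneg[of \<nu>] by (subst min_affine) auto
        also have "\<dots> = R * ((1 + \<rho> \<nu> * cos (\<bar>\<omega>\<bar> + \<theta> / 2)) / 2)"
          using True th by (subst min_cos_shift) auto
        finally have *: "1 - max (\<tau> - \<tau> * bU \<theta> \<nu> \<omega> R) (\<tau> - \<tau> * bU (- \<theta>) \<nu> \<omega> R) / \<tau> = R * ((1 + \<rho> \<nu> * cos (\<bar>\<omega>\<bar> + \<theta> / 2)) / 2)" .
        have n: "0 \<le> indicator {-pi..pi} \<omega> * rdens q R" by (simp add: rdens_nonneg)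
        show ?thesis unfolding * mult.assoc[symmetric] unfolding ennreal_mult'[OF n] by (simp only: mult_ac)
      next
        case False
        then show ?thesis by (auto simp: rdens_def tdens_def)
      qed
    qed
    also have "\<dots> = (ennreal (indicator {-pi..pi} \<omega> * rdens q R) * N (R * ((1 + \<rho> \<nu> * cos (\<bar>\<omega>\<bar> + \<theta> / 2)) / 2))) * ennreal (fact (\<kappa> + q - 1))"
      unfolding t1[symmetric] by (rule nn_integral_cmult) measurable
    finally show ?thesis by (simp only: mult_ac)
  qed
  have "(\<integral>\<^sup>+(\<nu>, \<omega>, R, \<tau>). N (1 - max (\<tau> - \<tau> * bU \<theta> \<nu> \<omega> R) (\<tau> - \<tau> * bU (- \<theta>) \<nu> \<omega> R) / \<tau>) \<partial>model q)
    = (\<integral>\<^sup>+\<nu>. \<integral>\<^sup>+\<omega>. \<integral>\<^sup>+R. \<integral>\<^sup>+\<tau>. ennreal (indicator {-pi..pi} \<omega> * (rdens q R * tdens q \<tau>)) *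
      N (1 - max (\<tau> - \<tau> * bU \<theta> \<nu> \<omega> R) (\<tau> - \<tau> * bU (- \<theta>) \<nu> \<omega> R) / \<tau>) \<partial>lborel \<partial>lborel \<partial>lborel \<partial>W)"
  proof (subst nn_integral_model)
    show "(\<lambda>(\<nu>, \<omega>, R, \<tau>). N (1 - max (\<tau> - \<tau> * bU \<theta> \<nu> \<omega> R) (\<tau> - \<tau> * bU (- \<theta>) \<nu> \<omega> R) / \<tau>))
      \<in> borel_measurable (borel \<Otimes>\<^sub>M (borel \<Otimes>\<^sub>M (borel \<Otimes>\<^sub>M borel)))"
      unfolding bU_def by measurable
  qed simp
  also have "\<dots> = ennreal (fact (\<kappa> + q - 1)) * kern q N u"
    unfolding tau unfolding kern_def \<theta>_def
    by (simp add: nn_integral_cmult)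
  finally show ?thesis unfolding \<theta>_def .
qed

text \<open>Integrating over the angle turns \<open>N (min U V)\<close> into an integral over \<open>[\<theta>, \<pi>]\<close>.\<close>

lemma kern_integral:
  assumes u: "0 \<le> u" "u \<le> 1" and N[measurable]: "N \<in> borel_measurable borel"
    and N0: "\<And>y. y \<le> 1 / 2 \<Longrightarrow> N y = 0"
  shows "kern q N u = (\<integral>\<^sup>+\<phi>. indicator {arc_of u..pi} \<phi> *
    (\<integral>\<^sup>+\<nu>. \<integral>\<^sup>+R. ennreal (rdens q R) * N (R * ((1 + \<rho> \<nu> * cos (\<phi> / 2)) / 2)) \<partial>lborel \<partial>W) \<partial>lborel)"
proof -
  define \<theta> where "\<theta> = arc_of u"
  have th: "0 \<le> \<theta>" "\<theta> \<le> pi" using arc_of_bounds[OF u] by (simp_all add: \<theta>_def)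
  interpret pair_sigma_finite lborel W by unfold_locales
  define H where "H c = (\<integral>\<^sup>+\<nu>. \<integral>\<^sup>+R. ennreal (rdens q R) * N (R * ((1 + \<rho> \<nu> * c) / 2)) \<partial>lborel \<partial>W)" for c
  have [measurable]: "H \<in> borel_measurable borel" unfolding H_def[abs_def] by measurable
  \<comment> \<open>Where the cosine is nonpositive, R (1 + \<rho> c) / 2 is at most 1/2 and
    \<open>N\<close> vanishes. This is what cuts the angular integral off at a limit independent of
    \<theta>.\<close>
  have H0: "H c = 0" if c: "c \<le> 0" for c
  proof -
    have "ennreal (rdens q R) * N (R * ((1 + \<rho> \<nu> * c) / 2)) = 0" for R \<nu>
    proof (cases "R \<in> {0..1}")
      case True
      have "\<rho> \<nu> * c \<le> 0" using \<rho>_nonneg[of \<nu>] c by (simp add: mult_nonneg_nonpos)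
      then have "1 + \<rho> \<nu> * c \<le> 1" by simp
      then have "(1 + \<rho> \<nu> * c) / 2 \<le> 1 / 2" by (rule divide_right_mono) simp
      then have "R * ((1 + \<rho> \<nu> * c) / 2) \<le> R * (1 / 2)" by (rule mult_left_mono) (use True in simp)
      also have "\<dots> \<le> 1 / 2" using True by simp
      finally show ?thesis by (simp add: N0)
    qed (simp add: rdens_def)
    note z = this
    show ?thesis unfolding H_def z by simp
  qed
  have "kern q N u = (\<integral>\<^sup>+\<nu>. \<integral>\<^sup>+\<omega>. ennreal (indicator {-pi..pi} \<omega>) * (\<integral>\<^sup>+R. ennreal (rdens q R) *
    N (R * ((1 + \<rho> \<nu> * cos (\<bar>\<omega>\<bar> + \<theta> / 2)) / 2)) \<partial>lborel) \<partial>lborel \<partial>W)"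
    unfolding kern_def \<theta>_def
    by (intro nn_integral_cong) (simp add: ennreal_mult' mult.assoc nn_integral_cmult)
  also have "\<dots> = (\<integral>\<^sup>+\<omega>. \<integral>\<^sup>+\<nu>. ennreal (indicator {-pi..pi} \<omega>) * (\<integral>\<^sup>+R. ennreal (rdens q R) *
    N (R * ((1 + \<rho> \<nu> * cos (\<bar>\<omega>\<bar> + \<theta> / 2)) / 2)) \<partial>lborel) \<partial>W \<partial>lborel)"
    by (rule Fubini') measurable
  also have "\<dots> = (\<integral>\<^sup>+\<omega>. indicator {-pi..pi} \<omega> * H (cos (\<bar>\<omega>\<bar> + \<theta> / 2)) \<partial>lborel)"
    unfolding H_def by (intro nn_integral_cong) (simp add: nn_integral_cmult indicator_def)
  also have "\<dots> = (\<integral>\<^sup>+\<omega>. indicator {0..pi} \<omega> * H (cos (\<omega> + \<theta> / 2)) + indicator {-pi..<0} \<omega> * H (cos (- \<omega> + \<theta> / 2)) \<partial>lborel)"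
    by (intro nn_integral_cong) (auto simp: indicator_def)
  also have "\<dots> = (\<integral>\<^sup>+\<omega>. indicator {0..pi} \<omega> * H (cos (\<omega> + \<theta> / 2)) \<partial>lborel) + (\<integral>\<^sup>+\<omega>. indicator {-pi..<0} \<omega> * H (cos (- \<omega> + \<theta> / 2)) \<partial>lborel)"
    by (rule nn_integral_add) measurable
  also have "(\<integral>\<^sup>+\<omega>. indicator {-pi..<0} \<omega> * H (cos (- \<omega> + \<theta> / 2)) \<partial>lborel) = (\<integral>\<^sup>+\<omega>. indicator {-pi..<0} (- \<omega>) * H (cos (\<omega> + \<theta> / 2)) \<partial>lborel)"
  proof -
    have "(\<integral>\<^sup>+\<omega>. indicator {-pi..<0} \<omega> * H (cos (- \<omega> + \<theta> / 2)) \<partial>distr lborel borel uminus) = (\<integral>\<^sup>+\<omega>. indicator {-pi..<0} (- \<omega>) * H (cos (\<omega> + \<theta> / 2)) \<partial>lborel)"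
      by (subst nn_integral_distr) auto
    then show ?thesis by (simp add: lborel_distr_uminus)
  qed
  also have "\<dots> = (\<integral>\<^sup>+\<omega>. indicator {0..pi} \<omega> * H (cos (\<omega> + \<theta> / 2)) \<partial>lborel)"
  proof (rule nn_integral_cong_AE)
    from AE_lborel_singleton[of 0]
    show "AE \<omega> in lborel. indicator {-pi..<0} (- \<omega>) * H (cos (\<omega> + \<theta> / 2)) = indicator {0..pi} \<omega> * H (cos (\<omega> + \<theta> / 2))"
      by eventually_elim (auto simp: indicator_def)
  qed
  also have "(\<integral>\<^sup>+\<omega>. indicator {0..pi} \<omega> * H (cos (\<omega> + \<theta> / 2)) \<partial>lborel) + (\<integral>\<^sup>+\<omega>. indicator {0..pi} \<omega> * H (cos (\<omega> + \<theta> / 2)) \<partial>lborel)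
    = 2 * (\<integral>\<^sup>+\<omega>. indicator {0..pi} \<omega> * H (cos (\<omega> + \<theta> / 2)) \<partial>lborel)"
    by (simp add: mult_2)
  also have "(\<integral>\<^sup>+\<omega>. indicator {0..pi} \<omega> * H (cos (\<omega> + \<theta> / 2)) \<partial>lborel) = (\<integral>\<^sup>+\<omega>. indicator {\<theta> / 2..pi / 2} \<omega> * H (cos \<omega>) \<partial>lborel)"
  proof -
    have "(\<integral>\<^sup>+\<omega>. indicator {0..pi} (- (\<theta> / 2) + (\<theta> / 2 + \<omega>)) * H (cos (\<theta> / 2 + \<omega>)) \<partial>lborel) = (\<integral>\<^sup>+\<omega>. indicator {0..pi} (- (\<theta> / 2) + \<omega>) * H (cos \<omega>) \<partial>lborel)"
      by (rule nn_integral_lborel_shift[of "\<lambda>\<omega>. indicator {0..pi} (- (\<theta> / 2) + \<omega>) * H (cos \<omega>)"]) simp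
    also have "\<dots> = (\<integral>\<^sup>+\<omega>. indicator {\<theta> / 2..pi / 2} \<omega> * H (cos \<omega>) \<partial>lborel)"
    proof (rule nn_integral_cong)
      fix \<omega> :: real
      show "indicator {0..pi} (- (\<theta> / 2) + \<omega>) * H (cos \<omega>) = indicator {\<theta> / 2..pi / 2} \<omega> * H (cos \<omega>)"
      \<comment> \<open>After the shift the angle runs up to \<pi> + \<theta>/2, which is at most 3
        \<pi>/2; beyond \<pi>/2 the cosine is therefore nonpositive.\<close>
      proof (cases "\<omega> \<in> {pi / 2<..pi + \<theta> / 2}")
        case True
        have "0 \<le> cos (\<omega> - pi)" using True th by (intro cos_ge_zero) (auto simp: field_simps)
        then have "cos \<omega> \<le> 0" by (simp add: cos_diff)
        then show ?thesis by (simp add: H0)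
      next
        case False
        have "- (\<theta> / 2) + \<omega> \<in> {0..pi} \<longleftrightarrow> \<omega> \<in> {\<theta> / 2..pi / 2}"
        proof -
          have "\<theta> / 2 \<le> pi / 2" using th by simp
          then show ?thesis using False th pi_gt_zero unfolding atLeastAtMost_iff greaterThanAtMost_iff by linarith
        qed
        then show ?thesis by (simp add: indicator_def)
      qed
    qed
    finally show ?thesis by (simp add: add.commute)
  qed
  also have "2 * \<dots> = (\<integral>\<^sup>+\<phi>. indicator {\<theta>..pi} \<phi> * H (cos (\<phi> / 2)) \<partial>lborel)"
  proof -
    have "(\<integral>\<^sup>+\<phi>. indicator {\<theta> / 2..pi / 2} ((1 / 2) *\<^sub>R \<phi>) * H (cos ((1 / 2) *\<^sub>R \<phi>)) \<partial>lborel) = ennreal ((1 / (1 / 2)) ^ DIM(real)) * (\<integral>\<^sup>+\<omega>. indicator {\<theta> / 2..pi / 2} \<omega> * H (cos \<omega>) \<partial>lborel)"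
      by (rule nn_integral_lborel_scale[of "\<lambda>\<omega>. indicator {\<theta> / 2..pi / 2} \<omega> * H (cos \<omega>)"]) auto
    moreover have "(\<integral>\<^sup>+\<phi>. indicator {\<theta> / 2..pi / 2} ((1 / 2) *\<^sub>R \<phi>) * H (cos ((1 / 2) *\<^sub>R \<phi>)) \<partial>lborel) = (\<integral>\<^sup>+\<phi>. indicator {\<theta>..pi} \<phi> * H (cos (\<phi> / 2)) \<partial>lborel)"
      by (intro nn_integral_cong) (auto simp: indicator_def)
    ultimately show ?thesis by simp
  qed
  finally show ?thesis unfolding \<theta>_def H_def .
qed

end

text \<open>The interface between geometry and the model: two points enter the joint law of T, Q x
  and Q y only through \<open>u x y\<close>. Gaussian vectors and \<open>oct_meas\<close> provide
  the instances.\<close>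

locale point_law = radial_law +
  fixes M :: "'z measure" and T :: "'z \<Rightarrow> real" and Q :: "'p \<Rightarrow> 'z \<Rightarrow> real"
    and X :: "'p set" and u :: "'p \<Rightarrow> 'p \<Rightarrow> real" and q :: nat and C :: real
  assumes q: "0 < q" and C: "0 < C"
    and T_meas [measurable]: "T \<in> borel_measurable M"
    and Q_meas: "x \<in> X \<Longrightarrow> Q x \<in> borel_measurable M"
    and Q_le: "x \<in> X \<Longrightarrow> Q x z \<le> T z" and T_nonneg: "0 \<le> T z"
    and u_nonneg: "x \<in> X \<Longrightarrow> y \<in> X \<Longrightarrow> 0 \<le> u x y" and u_le_1: "x \<in> X \<Longrightarrow> y \<in> X \<Longrightarrow> u x y \<le> 1"
    and law: "x \<in> X \<Longrightarrow> y \<in> X \<Longrightarrow> 0 \<le> a \<Longrightarrow> 0 \<le> b \<Longrightarrow> a + b < \<Lambda> \<Longrightarrow>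
      (\<integral>\<^sup>+z. ennreal (exp (- \<Lambda> * T z + a * Q x z + b * Q y z)) \<partial>M)
      = ennreal (C * ((1 / \<Lambda>) ^ q * (1 / sqrt ((\<Lambda> - a) * (\<Lambda> - b) - a * b * u x y)) ^ \<kappa>))"
begin

text \<open>The quotient Q x / T, expressed by the nonnegative quantity T - Q x to suit the
  uniqueness theorem. Where T = 0 the value is 1, as division by zero gives 0.\<close>

definition point_U :: "'p \<Rightarrow> 'z \<Rightarrow> real" where "point_U x z = 1 - (T z - Q x z) / T z"

lemma point_U_bounds: "x \<in> X \<Longrightarrow> point_U x z \<le> 1"
  using Q_le[of x z] T_nonneg[of z] by (simp add: point_U_def)

lemma min_point_U: "1 - max (T z - Q x z) (T z - Q y z) / T z = min (point_U x z) (point_U y z)"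
proof (cases "T z = 0")
  case False
  then have t: "0 < T z" using T_nonneg[of z] by simp
  have "T z - Q x z = T z - T z * point_U x z" for x
  proof -
    have "d = t' - t' * (1 - d / t')" if "0 < t'" for d t' :: real
      using that by (simp add: right_diff_distrib)
    from this[OF t, of "T z - Q x z"] show ?thesis unfolding point_U_def .
  qed
  then show ?thesis using one_minus_max_divide[OF t] by simp
qed (simp add: point_U_def)

text \<open>The weight exp (-T) makes the measure finite. At \<Lambda> = 1 + i + j + k, a = j and b
  = k the law yields the Laplace transform of (T, T - Q x, T - Q y) at integer points, and
  \<open>model_laplace\<close> yields the same numbers; the constant \<open>m\<close> equalises the
  total masses.\<close>

lemma law_kern:
  assumes xy: "x \<in> X" "y \<in> X" and N[measurable]: "N \<in> borel_measurable borel"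
  shows "(\<integral>\<^sup>+z. ennreal (exp (- T z)) * N (min (point_U x z) (point_U y z)) \<partial>M)
    = ennreal (C / model_const q * fact (\<kappa> + q - 1)) * kern q N (u x y)"
proof -
  note [measurable] = Q_meas[OF xy(1)] Q_meas[OF xy(2)]
  have [measurable]: "point_U x \<in> borel_measurable M" "point_U y \<in> borel_measurable M"
    unfolding point_U_def[abs_def] by measurable
  note u = u_nonneg[OF xy] u_le_1[OF xy]
  define m where "m = model_const q / C"
  have m: "0 < m" using model_const_pos C by (simp add: m_def)
  define M1 where "M1 = density M (\<lambda>z. ennreal (exp (- T z) * m))"
  have e: "(\<integral>\<^sup>+z. f z \<partial>M1) = ennreal m * (\<integral>\<^sup>+z. ennreal (exp (- T z)) * f z \<partial>M)" if [measurable]: "f \<in> borel_measurable M" for f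
    unfolding M1_def using m
    by (subst nn_integral_density) (simp_all add: ennreal_mult' mult_ac nn_integral_cmult)
  let ?A = "\<lambda>(\<nu>, \<omega>, R, \<tau>). \<tau> - \<tau> * bU (arc_of (u x y)) \<nu> \<omega> R"
  let ?B = "\<lambda>(\<nu>, \<omega>, R, \<tau>). \<tau> - \<tau> * bU (- arc_of (u x y)) \<nu> \<omega> R"
  let ?T = "\<lambda>(\<nu>, \<omega>, R, \<tau>). \<tau>"
  let ?N0 = "borel \<Otimes>\<^sub>M (borel \<Otimes>\<^sub>M (borel \<Otimes>\<^sub>M borel)) :: (real \<times> real \<times> real \<times> real) measure"
  have sets_model: "sets (model q) = sets ?N0" unfolding model_def sets_density by (rule sets_base)
  have mm: "?T \<in> borel_measurable (model q)" "?A \<in> borel_measurable (model q)" "?B \<in> borel_measurable (model q)"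
    unfolding measurable_cong_sets[OF sets_model refl] bU_def by measurable
  have lap1: "(\<integral>\<^sup>+z. ennreal (exp (- (real i * T z + real j * (T z - Q x z) + real k * (T z - Q y z)))) \<partial>M1)
    = ennreal (model_const q * ((1 / (1 + real i + real j + real k)) ^ q * (1 / sqrt (((1 + real i + real j + real k) - real j) * ((1 + real i + real j + real k) - real k) - real j * real k * u x y)) ^ \<kappa>))" for i j k :: nat
  proof -
    have "(\<integral>\<^sup>+z. ennreal (exp (- (real i * T z + real j * (T z - Q x z) + real k * (T z - Q y z)))) \<partial>M1)
      = ennreal m * (\<integral>\<^sup>+z. ennreal (exp (- (1 + real i + real j + real k) * T z + real j * Q x z + real k * Q y z)) \<partial>M)"
      by (subst e) (auto simp: ennreal_mult''[symmetric] exp_add[symmetric] algebra_simps)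
    also have "(\<integral>\<^sup>+z. ennreal (exp (- (1 + real i + real j + real k) * T z + real j * Q x z + real k * Q y z)) \<partial>M)
      = ennreal (C * ((1 / (1 + real i + real j + real k)) ^ q * (1 / sqrt (((1 + real i + real j + real k) - real j) * ((1 + real i + real j + real k) - real k) - real j * real k * u x y)) ^ \<kappa>))"
      by (rule law[OF xy]) auto
    also have "ennreal m * ennreal (C * t) = ennreal (model_const q * t)" for t
    proof -
      have "m * (C * t) = model_const q * t" using C by (simp add: m_def)
      then show ?thesis using m by (metis ennreal_mult' less_imp_le)
    qed
    finally show ?thesis .
  qed
  have lap2: "(\<integral>\<^sup>+z. ennreal (exp (- (real i * ?T z + real j * ?A z + real k * ?B z))) \<partial>model q)
    = ennreal (model_const q * ((1 / (1 + real i + real j + real k)) ^ q * (1 / sqrt (((1 + real i + real j + real k) - real j) * ((1 + real i + real j + real k) - real k) - real j * real k * u x y)) ^ \<kappa>))" for i j k :: nat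
  proof -
    have "(\<integral>\<^sup>+z. ennreal (exp (- (real i * ?T z + real j * ?A z + real k * ?B z))) \<partial>model q)
      = (\<integral>\<^sup>+(\<nu>, \<omega>, R, \<tau>). ennreal (exp (- ((1 + real i + real j + real k) - 1) * \<tau> + real j * (\<tau> * bU (arc_of (u x y)) \<nu> \<omega> R) + real k * (\<tau> * bU (- arc_of (u x y)) \<nu> \<omega> R))) \<partial>model q)"
      by (intro nn_integral_cong) (auto simp: algebra_simps)
    also have "\<dots> = ennreal (model_const q * ((1 / (1 + real i + real j + real k)) ^ q * (1 / sqrt (((1 + real i + real j + real k) - real j) * ((1 + real i + real j + real k) - real k) - real j * real k * u x y)) ^ \<kappa>))"
      by (rule model_laplace[OF q u]) auto
    finally show ?thesis .
  qed
  have "(\<integral>\<^sup>+z. (\<lambda>(t, a, b). N (1 - max a b / t)) (T z, T z - Q x z, T z - Q y z) \<partial>M1)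
    = (\<integral>\<^sup>+z. (\<lambda>(t, a, b). N (1 - max a b / t)) (?T z, ?A z, ?B z) \<partial>model q)"
  proof (rule nn_integral_eqI_laplace)
    show "finite_measure M1"
    proof (rule finite_measureI)
      have "emeasure M1 (space M1) = (\<integral>\<^sup>+z. ennreal (exp (- (real 0 * T z + real 0 * (T z - Q x z) + real 0 * (T z - Q y z)))) \<partial>M1)"
        by simp
      then show "emeasure M1 (space M1) \<noteq> \<infinity>" unfolding lap1 by simp
    qed
    show "finite_measure (model q)"
    proof (rule finite_measureI)
      have "emeasure (model q) (space (model q)) = (\<integral>\<^sup>+z. ennreal (exp (- (real 0 * ?T z + real 0 * ?A z + real 0 * ?B z))) \<partial>model q)"
        by simp
      then show "emeasure (model q) (space (model q)) \<noteq> \<infinity>" unfolding lap2 by simp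
    qed
    show "AE z in M1. 0 \<le> T z \<and> 0 \<le> T z - Q x z \<and> 0 \<le> T z - Q y z"
      using T_nonneg Q_le[OF xy(1)] Q_le[OF xy(2)] by simp
    have mdm: "(\<lambda>z. ennreal (mdens q z)) \<in> borel_measurable (W \<Otimes>\<^sub>M lborel)" using mdens_measurable[of q] by simp
    show "AE z in model q. 0 \<le> ?T z \<and> 0 \<le> ?A z \<and> 0 \<le> ?B z"
      unfolding model_def AE_density[OF mdm]
    proof (rule AE_I2, rule impI)
      fix z assume "0 < ennreal (mdens q z)"
      obtain \<nu> \<omega> R \<tau> where z: "z = (\<nu>, \<omega>, R, \<tau>)" by (cases z) auto
      have "0 < \<tau> \<and> R \<in> {0..1}"
      proof (rule ccontr)
        assume "\<not> (0 < \<tau> \<and> R \<in> {0..1})"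
        then have "mdens q z = 0" by (auto simp: z mdens_def rdens_def tdens_def)
        with \<open>0 < ennreal (mdens q z)\<close> show False by simp
      qed
      then have t: "0 \<le> \<tau>" "R \<in> {0..1}" by auto
      have "\<tau> * bU s \<nu> \<omega> R \<le> \<tau> * 1" for s using t by (intro mult_left_mono bU_bounds)
      then show "0 \<le> ?T z \<and> 0 \<le> ?A z \<and> 0 \<le> ?B z" using t by (auto simp: z)
    qed
    have "(\<lambda>v :: real \<times> real \<times> real. N (1 - max (fst (snd v)) (snd (snd v)) / fst v)) \<in> borel_measurable (borel \<Otimes>\<^sub>M (borel \<Otimes>\<^sub>M borel))"
      by measurable
    then show "(\<lambda>(t, a, b). N (1 - max a b / t)) \<in> borel_measurable borel"
      unfolding borel_prod by (simp add: case_prod_unfold)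
    show "T \<in> borel_measurable M1" "(\<lambda>z. T z - Q x z) \<in> borel_measurable M1" "(\<lambda>z. T z - Q y z) \<in> borel_measurable M1"
      unfolding M1_def by simp_all
  qed (use mm lap1 lap2 in auto)
  then have "ennreal m * (\<integral>\<^sup>+z. ennreal (exp (- T z)) * N (min (point_U x z) (point_U y z)) \<partial>M)
    = ennreal (fact (\<kappa> + q - 1)) * kern q N (u x y)"
    unfolding model_kern[OF q u N, symmetric]
    by (subst (asm) e) (simp_all add: min_point_U case_prod_unfold)
  then have "ennreal (1 / m) * (ennreal m * (\<integral>\<^sup>+z. ennreal (exp (- T z)) * N (min (point_U x z) (point_U y z)) \<partial>M))
    = ennreal (1 / m) * (ennreal (fact (\<kappa> + q - 1)) * kern q N (u x y))" by simp
  then show ?thesis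
    using m C model_const_pos[of q] unfolding mult.assoc[symmetric]
    by (simp add: ennreal_mult'[symmetric] m_def)
qed

end

section \<open>Cosine kernels and monotone functions\<close>

definition cosK :: "real \<Rightarrow> real poly \<Rightarrow> real \<Rightarrow> ennreal" where
  "cosK a E \<theta> = (\<integral>\<^sup>+\<phi>. indicator {\<theta>..pi} \<phi> * ennreal (tr a E (cos (\<phi> / 2))) \<partial>lborel)"

lemma tr_measurable [measurable]: "tr a E \<in> borel_measurable borel"
  unfolding tr_def[abs_def]
  by (intro measurable_If borel_measurable_continuous_onI continuous_intros) auto

lemma cosK_finite:
  assumes "nonneg_poly E" "0 \<le> \<theta>"
  shows "cosK a E \<theta> < \<infinity>"
proof -
  have "cosK a E \<theta> \<le> (\<integral>\<^sup>+\<phi>. ennreal (tr a E 1) * indicator {0..pi} \<phi> \<partial>lborel)"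
    unfolding cosK_def
  proof (rule nn_integral_mono)
    fix \<phi> :: real
    have "tr a E (cos (\<phi> / 2)) \<le> tr a E 1" by (rule tr_mono[OF assms(1)]) simp
    then show "indicator {\<theta>..pi} \<phi> * ennreal (tr a E (cos (\<phi> / 2))) \<le> ennreal (tr a E 1) * indicator {0..pi} \<phi>"
      using assms(2) by (auto simp: indicator_def intro: ennreal_leI)
  qed
  also have "\<dots> < \<infinity>" by (simp add: nn_integral_cmult_indicator ennreal_mult_less_top)
  finally show ?thesis .
qed

lemma psd_scale: "psd n A \<Longrightarrow> 0 \<le> c \<Longrightarrow> psd n (\<lambda>i j. c * A i j)"
proof -
  assume A: "psd n A" and c: "0 \<le> c"
  have "(\<Sum>i<n. \<Sum>j<n. k i * (c * A i j) * k j) = c * (\<Sum>i<n. \<Sum>j<n. k i * A i j * k j)" for k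
    by (simp add: sum_distrib_left mult_ac)
  then show ?thesis using A c by (simp add: psd_def)
qed

lemma psd_cong: "psd n A \<Longrightarrow> (\<And>i j. i < n \<Longrightarrow> j < n \<Longrightarrow> A i j = B i j) \<Longrightarrow> psd n B"
  by (simp add: psd_def)

context point_law begin

text \<open>A monotone \<open>N\<close> commutes with the minimum, so for every fixed
  \<open>z\<close> the integrand is a matrix of the kind treated by \<open>psd_min\<close>.\<close>

lemma psd_kern:
  assumes x: "\<And>i. i < n \<Longrightarrow> x i \<in> X" and N: "mono N" "\<And>y. 0 \<le> N y"
  shows "psd n (\<lambda>i j. enn2real (kern q (\<lambda>y. ennreal (N y)) (u (x i) (x j))))"
proof -
  have Nm [measurable]: "N \<in> borel_measurable borel" using N(1) by (rule borel_measurable_mono)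
  have "point_U (x i) \<in> borel_measurable M" if "i < n" for i
    using Q_meas[OF x[OF that]] unfolding point_U_def[abs_def] by measurable
  note Um = this
  define f where "f i j z = ennreal (exp (- T z)) * ennreal (N (min (point_U (x i) z) (point_U (x j) z)))" for i j z
  define c where "c = C / model_const q * fact (\<kappa> + q - 1)"
  have c: "0 < c" using C model_const_pos[of q] by (simp add: c_def)
  have L: "(\<integral>\<^sup>+z. f i j z \<partial>M) = ennreal c * kern q (\<lambda>y. ennreal (N y)) (u (x i) (x j))" if "i < n" "j < n" for i j
    unfolding f_def c_def using law_kern[OF x[OF that(1)] x[OF that(2)], of "\<lambda>y. ennreal (N y)"] by simp
  have "psd n (\<lambda>i j. enn2real (\<integral>\<^sup>+z. f i j z \<partial>M))"
  proof (rule psd_integral)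
    fix i j assume ij: "i < n" "j < n"
    note [measurable] = Um[OF ij(1)] Um[OF ij(2)]
    show "f i j \<in> borel_measurable M" unfolding f_def by measurable
    have "(\<integral>\<^sup>+z. f i j z \<partial>M) \<le> (\<integral>\<^sup>+z. ennreal (N 1) * ennreal (exp (- 1 * T z + 0 * Q (x i) z + 0 * Q (x i) z)) \<partial>M)"
    proof (rule nn_integral_mono)
      fix z
      have "N (min (point_U (x i) z) (point_U (x j) z)) \<le> N 1"
        using point_U_bounds[OF x[OF ij(1)], of z] by (intro monoD[OF N(1)]) auto
      then show "f i j z \<le> ennreal (N 1) * ennreal (exp (- 1 * T z + 0 * Q (x i) z + 0 * Q (x i) z))"
        unfolding f_def by (simp add: mult.commute[of "ennreal (N 1)"] mult_left_mono ennreal_leI)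
    qed
    also have "\<dots> = ennreal (N 1) * (\<integral>\<^sup>+z. ennreal (exp (- 1 * T z + 0 * Q (x i) z + 0 * Q (x i) z)) \<partial>M)"
      by (rule nn_integral_cmult) (use Q_meas[OF x[OF ij(1)]] in measurable)
    also have "\<dots> < \<infinity>"
      by (subst law[OF x[OF ij(1)] x[OF ij(1)]]) (auto simp: ennreal_mult_less_top)
    finally show "(\<integral>\<^sup>+z. f i j z \<partial>M) < \<infinity>" .
  next
    show "AE z in M. psd n (\<lambda>i j. enn2real (f i j z))"
    proof (rule AE_I2)
      fix z
      have "enn2real (f i j z) = exp (- T z) * min (N (point_U (x i) z)) (N (point_U (x j) z))" for i j
        unfolding f_def using N by (simp add: ennreal_mult''[symmetric] min_of_mono)
      then show "psd n (\<lambda>i j. enn2real (f i j z))"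
        using psd_scale[OF psd_min, of n "\<lambda>i. N (point_U (x i) z)" "exp (- T z)"] N(2) by simp
    qed
  qed
  then have "psd n (\<lambda>i j. 1 / c * enn2real (\<integral>\<^sup>+z. f i j z \<partial>M))"
    by (rule psd_scale) (use c in simp)
  then show ?thesis
    by (rule psd_cong) (use c in \<open>simp add: L enn2real_mult\<close>)
qed

end

section \<open>Functions that undo the average over R\<close>

definition dilate :: "real \<Rightarrow> real poly \<Rightarrow> real poly" where
  "dilate c G = pcompose G [:0, c:]"

lemma coeff_dilate: "coeff (dilate c G) i = c ^ i * coeff G i"
  by (simp add: dilate_def coeff_pcompose_linear)

lemma degree_dilate: "degree (dilate c G) \<le> degree G"
  by (rule degree_le) (simp add: coeff_dilate coeff_eq_0)

lemma poly_dilate: "poly (dilate c G) x = poly G (c * x)"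
  by (simp add: dilate_def poly_pcompose mult.commute)

lemma degree_beta_inv: "degree (beta_inv A b E i) \<le> degree E"
  by (induction i) (auto intro: order_trans[OF degree_euler])

text \<open>The affine map y \<mapsto> s (2 y - 1) sends (1 + \<rho> w)/2 to s \<rho> w and the
  truncation point (1 + a/s)/2 to a, and it stretches by 2 s. So after averaging over R one is left
  with \<open>tr a G\<close> at s \<rho> w. For s \<le> 0 that argument is nonpositive on the
  relevant range and the truncated function is 0.\<close>

definition Nfun :: "nat \<Rightarrow> nat \<Rightarrow> real \<Rightarrow> real poly \<Rightarrow> real \<Rightarrow> real \<Rightarrow> real" where
  "Nfun A q a G s y = (if 0 < s then tr ((1 + a / s) / 2) (beta_inv A ((1 + a / s) / 2) (dilate (2 * s) G) q) y else 0)"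

context
  fixes A q :: nat and a :: real and G :: "real poly"
  assumes a: "0 \<le> a" and G: "nonneg_poly G" "vanishes q G" and q: "0 < q"
begin

lemma nonneg_dilate: "0 < s \<Longrightarrow> nonneg_poly (dilate (2 * s) G)"
  using G(1) by (simp add: nonneg_poly_def coeff_dilate)

lemma vanishes_dilate: "vanishes q (dilate (2 * s) G)"
  using G(2) by (simp add: vanishes_def coeff_dilate)

lemma nonneg_Nfun_poly: "0 < s \<Longrightarrow> nonneg_poly (beta_inv A ((1 + a / s) / 2) (dilate (2 * s) G) q)"
  using a by (intro nonneg_beta_inv nonneg_dilate) auto

lemma Nfun_nonneg: "0 \<le> Nfun A q a G s y"
  by (simp add: Nfun_def tr_nonneg nonneg_Nfun_poly)

lemma Nfun_mono: "mono (Nfun A q a G s)"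
  by (auto simp: mono_def Nfun_def intro: tr_mono nonneg_Nfun_poly)

lemma Nfun_zero: "y \<le> 1 / 2 \<Longrightarrow> Nfun A q a G s y = 0"
proof -
  assume y: "y \<le> 1 / 2"
  have "y \<le> (1 + a / s) / 2" if "0 < s"
  proof -
    have "0 \<le> a / s" using a that by simp
    then have "1 / 2 \<le> (1 + a / s) / 2" by simp
    with y show ?thesis by (rule order_trans)
  qed
  then show ?thesis by (auto simp: Nfun_def tr_def)
qed

text \<open>The polynomial varies with s. Its coefficients are measurable in s and its degree is
  bounded by that of \<open>G\<close>, so evaluation is a sum over a fixed range.\<close>

lemma Nfun_measurable [measurable]: "(\<lambda>(s, y). Nfun A q a G s y) \<in> borel_measurable (borel \<Otimes>\<^sub>M borel)"
proof -
  have c [measurable]: "(\<lambda>s. coeff (beta_inv A ((1 + a / s) / 2) (dilate (2 * s) G) i) l) \<in> borel_measurable borel" for i l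
  proof (induction i arbitrary: l)
    case 0
    then show ?case by (simp add: coeff_dilate)
  next
    case (Suc i)
    note [measurable] = Suc.IH[of l] Suc.IH[of "Suc l"]
    show ?case unfolding beta_inv.simps coeff_euler by measurable
  qed
  have p: "poly (beta_inv A b (dilate s G) q) x = (\<Sum>i\<le>degree G. coeff (beta_inv A b (dilate s G) q) i * x ^ i)" for b s x
  proof -
    have d: "degree (beta_inv A b (dilate s G) q) \<le> degree G"
      by (rule order_trans[OF degree_beta_inv degree_dilate])
    show ?thesis unfolding poly_altdef
      by (rule sum.mono_neutral_left) (use d in \<open>auto simp: coeff_eq_0\<close>)
  qed
  show ?thesis unfolding Nfun_def tr_def p case_prod_unfold by measurable
qed

lemma Nfun_integral:
  assumes y: "1 / 2 \<le> y"
  shows "(\<integral>\<^sup>+R. ennreal (indicator {0..1} R * (R ^ A * (1 - R) ^ (q - 1))) * ennreal (Nfun A q a G s (R * y)) \<partial>lborel)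
    = ennreal (fact (q - 1) * tr a G (s * (2 * y - 1)))"
proof (cases "0 < s")
  case True
  define b where "b = (1 + a / s) / 2"
  obtain i where i: "q = Suc i" using q by (cases q) auto
  have tr_eq: "tr b (dilate (2 * s) G) y = tr a G (s * (2 * y - 1))"
  proof -
    have "2 * s * (y - b) = s * (2 * y - 1) - a" using True by (simp add: b_def field_simps)
    moreover have "b < y \<longleftrightarrow> a < s * (2 * y - 1)" using True by (simp add: b_def field_simps)
    ultimately show ?thesis by (simp add: tr_def poly_dilate)
  qed
  have "(\<integral>\<^sup>+R. ennreal (indicator {0..1} R * (R ^ A * (1 - R) ^ i * tr b (beta_inv A b (dilate (2 * s) G) (Suc i)) (R * y))) \<partial>lborel)
    = ennreal (fact i * tr b (dilate (2 * s) G) y)"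
  proof (rule nn_integral_Icc)
    show "((\<lambda>R. R ^ A * (1 - R) ^ i * tr b (beta_inv A b (dilate (2 * s) G) (Suc i)) (R * y)) has_integral fact i * tr b (dilate (2 * s) G) y) {0..1}"
      by (rule beta_average) (use y vanishes_dilate[of s] i in auto)
    fix R :: real assume "R \<in> {0..1}"
    then show "0 \<le> R ^ A * (1 - R) ^ i * tr b (beta_inv A b (dilate (2 * s) G) (Suc i)) (R * y)"
      using nonneg_Nfun_poly[OF True] unfolding i b_def by (intro mult_nonneg_nonneg tr_nonneg) auto
  qed measurable
  also have "(\<integral>\<^sup>+R. ennreal (indicator {0..1} R * (R ^ A * (1 - R) ^ i * tr b (beta_inv A b (dilate (2 * s) G) (Suc i)) (R * y))) \<partial>lborel)
    = (\<integral>\<^sup>+R. ennreal (indicator {0..1} R * (R ^ A * (1 - R) ^ (q - 1))) * ennreal (Nfun A q a G s (R * y)) \<partial>lborel)"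
    using Nfun_nonneg[of s] unfolding Nfun_def b_def[symmetric] i
    by (intro nn_integral_cong) (use True in \<open>simp add: ennreal_mult''[symmetric] mult.assoc\<close>)
  finally show ?thesis unfolding tr_eq by (simp add: i)
next
  case False
  then have "s * (2 * y - 1) \<le> 0" using y by (intro mult_nonpos_nonneg) auto
  then have "tr a G (s * (2 * y - 1)) = 0" using a by (simp add: tr_def)
  then show ?thesis using False by (simp add: Nfun_def)
qed

end

text \<open>The second randomisation: \<open>N\<close> may depend on s, and positive
  semidefiniteness survives the average over s. \<open>inverse\<close> asks that the product of
  \<open>sf s\<close> and \<rho> have a law whose average can be undone while nonnegative
  coefficients are kept, at a cost of r orders of vanishing.\<close>

locale radial_inverse = radial_law +
  fixes S :: "real measure" and sf :: "real \<Rightarrow> real" and r :: nat and C3 :: real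
  assumes S_finite: "finite_measure S" and S_sets [measurable_cong]: "sets S = sets borel"
    and sf_meas [measurable]: "sf \<in> borel_measurable borel" and C3: "0 < C3"
    and inverse: "nonneg_poly E \<Longrightarrow> vanishes (Suc q + r) E \<Longrightarrow> 0 \<le> a \<Longrightarrow> \<exists>G. nonneg_poly G \<and> vanishes (Suc q) G \<and>
      (\<forall>w. 0 < w \<longrightarrow> w \<le> 1 \<longrightarrow> (\<integral>\<^sup>+s. \<integral>\<^sup>+\<nu>. ennreal (tr a G (sf s * (\<rho> \<nu> * w))) \<partial>W \<partial>S) = ennreal (C3 * tr a E w))"

locale inverse_point_law = point_law + radial_inverse
begin

text \<open>Average the kernels of the monotone functions \<open>N s\<close> over s. For fixed
  \<phi> the average over R is undone by \<open>Nfun\<close>, then that over s and \<nu> by the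
  choice of \<open>G\<close>.\<close>

lemma psd_cosK:
  assumes x: "\<And>i. i < n \<Longrightarrow> x i \<in> X"
    and E: "nonneg_poly E" "vanishes (q + r) E" and a: "0 \<le> a"
  shows "psd n (\<lambda>i j. enn2real (cosK a E (arc_of (u (x i) (x j)))))"
proof -
  interpret S: finite_measure S by (rule S_finite)
  obtain q' where q': "q = Suc q'" using q by (cases q) auto
  obtain G where G: "nonneg_poly G" "vanishes q G"
    and inv: "\<And>w. 0 < w \<Longrightarrow> w \<le> 1 \<Longrightarrow> (\<integral>\<^sup>+s. \<integral>\<^sup>+\<nu>. ennreal (tr a G (sf s * (\<rho> \<nu> * w))) \<partial>W \<partial>S) = ennreal (C3 * tr a E w)"
    using inverse[OF E(1) E(2)[unfolded q'] a] unfolding q' by blast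
  define N where "N s y = Nfun (\<kappa> - 1) q a G (sf s) y" for s y
  note Nm = Nfun_measurable[OF a G q, of "\<kappa> - 1", measurable]
  have Nm' [measurable]: "(\<lambda>(s, y). N s y) \<in> borel_measurable (borel \<Otimes>\<^sub>M borel)"
    unfolding N_def by measurable
  have Nm1 [measurable]: "N s \<in> borel_measurable borel" for s
    using Nfun_mono[OF a G q] unfolding N_def by (intro borel_measurable_mono)
  have N0: "ennreal (N s y) = 0" if "y \<le> 1 / 2" for s y
    using Nfun_zero[OF a G q that] by (simp add: N_def)
  have I: "(\<integral>\<^sup>+s. kern q (\<lambda>y. ennreal (N s y)) v \<partial>S) = ennreal (fact (q - 1) * C3) * cosK a E (arc_of v)"
    if v: "0 \<le> v" "v \<le> 1" for v
  proof -
    interpret P: pair_sigma_finite S lborel by unfold_locales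
    note b = arc_of_bounds[OF v]
    define h where "h s \<phi> = (\<integral>\<^sup>+\<nu>. \<integral>\<^sup>+R. ennreal (rdens q R) * ennreal (N s (R * ((1 + \<rho> \<nu> * cos (\<phi> / 2)) / 2))) \<partial>lborel \<partial>W)" for s \<phi>
    have [measurable]: "(\<lambda>(s, \<phi>). h s \<phi>) \<in> borel_measurable (borel \<Otimes>\<^sub>M borel)"
      unfolding h_def by measurable
    have "(\<integral>\<^sup>+s. kern q (\<lambda>y. ennreal (N s y)) v \<partial>S) = (\<integral>\<^sup>+s. \<integral>\<^sup>+\<phi>. indicator {arc_of v..pi} \<phi> * h s \<phi> \<partial>lborel \<partial>S)"
      unfolding h_def by (intro nn_integral_cong kern_integral[OF v] N0) measurable
    also have "\<dots> = (\<integral>\<^sup>+\<phi>. \<integral>\<^sup>+s. indicator {arc_of v..pi} \<phi> * h s \<phi> \<partial>S \<partial>lborel)"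
      by (rule P.Fubini'[symmetric]) measurable
    also have "\<dots> = (\<integral>\<^sup>+\<phi>. indicator {arc_of v..pi} \<phi> * (\<integral>\<^sup>+s. h s \<phi> \<partial>S) \<partial>lborel)"
      by (intro nn_integral_cong nn_integral_cmult) measurable
    also have "\<dots> = (\<integral>\<^sup>+\<phi>. ennreal (fact (q - 1) * C3) * (indicator {arc_of v..pi} \<phi> * ennreal (tr a E (cos (\<phi> / 2)))) \<partial>lborel)"
    proof (rule nn_integral_cong_AE)
      \<comment> \<open>At \<phi> = \<pi> the cosine is 0, whereas the inversion formula is
        available for w > 0.\<close>
      from AE_lborel_singleton[of pi]
      show "AE \<phi> in lborel. indicator {arc_of v..pi} \<phi> * (\<integral>\<^sup>+s. h s \<phi> \<partial>S) = ennreal (fact (q - 1) * C3) * (indicator {arc_of v..pi} \<phi> * ennreal (tr a E (cos (\<phi> / 2))))"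
      proof eventually_elim
        case (elim \<phi>)
        show ?case
        proof (cases "\<phi> \<in> {arc_of v..pi}")
          case True
          define w where "w = cos (\<phi> / 2)"
          have w: "0 < w" "w \<le> 1" using True elim b by (auto simp: w_def intro!: cos_gt_zero_pi)
          have "h s \<phi> = (\<integral>\<^sup>+\<nu>. ennreal (fact (q - 1)) * ennreal (tr a G (sf s * (\<rho> \<nu> * w))) \<partial>W)" for s
          proof -
            have "(\<integral>\<^sup>+R. ennreal (rdens q R) * ennreal (N s (R * ((1 + \<rho> \<nu> * w) / 2))) \<partial>lborel) = ennreal (fact (q - 1)) * ennreal (tr a G (sf s * (\<rho> \<nu> * w)))" for \<nu>
            proof -
              have "0 \<le> \<rho> \<nu> * w" using \<rho>_nonneg[of \<nu>] w by simp
              then have "1 / 2 \<le> (1 + \<rho> \<nu> * w) / 2" by simp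
              from Nfun_integral[OF a G q this, of "\<kappa> - 1" "sf s"]
              have "(\<integral>\<^sup>+R. ennreal (rdens q R) * ennreal (N s (R * ((1 + \<rho> \<nu> * w) / 2))) \<partial>lborel) = ennreal (fact (q - 1) * tr a G (sf s * (2 * ((1 + \<rho> \<nu> * w) / 2) - 1)))"
                unfolding rdens_def N_def .
              also have "2 * ((1 + \<rho> \<nu> * w) / 2) - 1 = \<rho> \<nu> * w" by (simp add: field_simps)
              finally show ?thesis by (simp add: ennreal_mult')
            qed
            then show ?thesis unfolding h_def w_def[symmetric] by simp
          qed
          then have "(\<integral>\<^sup>+s. h s \<phi> \<partial>S) = (\<integral>\<^sup>+s. ennreal (fact (q - 1)) * (\<integral>\<^sup>+\<nu>. ennreal (tr a G (sf s * (\<rho> \<nu> * w))) \<partial>W) \<partial>S)"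
            by (simp add: nn_integral_cmult)
          also have "\<dots> = ennreal (fact (q - 1)) * ennreal (C3 * tr a E w)"
            unfolding inv[OF w, symmetric] by (rule nn_integral_cmult) measurable
          also have "\<dots> = ennreal (fact (q - 1) * C3) * ennreal (tr a E w)"
            using C3 by (simp add: ennreal_mult' mult.assoc)
          finally show ?thesis using True by (simp add: w_def)
        qed simp
      qed
    qed
    also have "\<dots> = ennreal (fact (q - 1) * C3) * cosK a E (arc_of v)"
      unfolding cosK_def by (rule nn_integral_cmult) measurable
    finally show ?thesis .
  qed
  have uij: "0 \<le> u (x i) (x j)" "u (x i) (x j) \<le> 1" if "i < n" "j < n" for i j
    using u_nonneg u_le_1 x that by auto
  have "psd n (\<lambda>i j. enn2real (\<integral>\<^sup>+s. kern q (\<lambda>y. ennreal (N s y)) (u (x i) (x j)) \<partial>S))"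
  proof (rule psd_integral)
    fix i j assume ij: "i < n" "j < n"
    show "(\<lambda>s. kern q (\<lambda>y. ennreal (N s y)) (u (x i) (x j))) \<in> borel_measurable S"
      unfolding kern_def by measurable
    show "(\<integral>\<^sup>+s. kern q (\<lambda>y. ennreal (N s y)) (u (x i) (x j)) \<partial>S) < \<infinity>"
      unfolding I[OF uij[OF ij]] using cosK_finite[OF E(1) arc_of_bounds(1)[OF uij[OF ij]]]
      by (simp add: ennreal_mult_less_top)
  next
    show "AE s in S. psd n (\<lambda>i j. enn2real (kern q (\<lambda>y. ennreal (N s y)) (u (x i) (x j))))"
      by (intro AE_I2 psd_kern x) (auto simp: N_def Nfun_mono[OF a G q] Nfun_nonneg[OF a G q])
  qed
  then have "psd n (\<lambda>i j. 1 / (fact (q - 1) * C3) * enn2real (\<integral>\<^sup>+s. kern q (\<lambda>y. ennreal (N s y)) (u (x i) (x j)) \<partial>S))"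
    by (rule psd_scale) (use C3 in simp)
  then show ?thesis
    by (rule psd_cong) (use C3 in \<open>simp add: I uij enn2real_mult\<close>)
qed

end

section \<open>Averages over circles and spheres\<close>

text \<open>With s = sqrt (c^2 - Y^2) and \<beta> = Y / (c + s), the integrand is 1/s times the
  Poisson kernel (1 - \<beta>^2) / (1 + \<beta>^2 - 2 \<beta> cos \<omega>). Its antiderivative
  \<omega> + 2 arctan (\<beta> sin \<omega> / (1 - \<beta> cos \<omega>)) is smooth over the whole
  period, unlike the one from the half-angle substitution.\<close>

lemma circle_integral:
  fixes c Y :: real
  assumes "0 \<le> Y" "Y < c"
  shows "((\<lambda>\<omega>. 1 / (c - Y * cos \<omega>)) has_integral 2 * pi / sqrt (c\<^sup>2 - Y\<^sup>2)) {-pi..pi}"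
proof -
  define s where "s = sqrt (c\<^sup>2 - Y\<^sup>2)"
  define \<beta> where "\<beta> = Y / (c + s)"
  have c: "0 < c" using assms by simp
  have cY: "Y\<^sup>2 < c\<^sup>2" using assms by (simp add: power_strict_mono)
  have s: "0 < s" "s\<^sup>2 = c\<^sup>2 - Y\<^sup>2" using cY by (auto simp: s_def)
  have b: "0 \<le> \<beta>" "\<beta> < 1" using assms s by (auto simp: \<beta>_def field_simps)
  define g where "g \<omega> = (\<beta> * cos \<omega> - \<beta>\<^sup>2) / (1 - \<beta> * cos \<omega>)\<^sup>2 / (1 + (\<beta> * sin \<omega> / (1 - \<beta> * cos \<omega>))\<^sup>2)" for \<omega>
  have pos: "0 < 1 - \<beta> * cos \<omega>" for \<omega>
  proof -
    have "\<beta> * cos \<omega> \<le> \<beta> * 1" using b by (intro mult_left_mono) auto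
    with b show ?thesis by simp
  qed
  have der: "((\<lambda>\<omega>. (\<omega> + 2 * arctan (\<beta> * sin \<omega> / (1 - \<beta> * cos \<omega>))) / s) has_real_derivative 1 / (c - Y * cos \<omega>)) (at \<omega> within {-pi..pi})" for \<omega>
  proof -
    have p2: "(1 - \<beta> * cos \<omega>)\<^sup>2 + (\<beta> * sin \<omega>)\<^sup>2 = 1 + \<beta>\<^sup>2 - 2 * \<beta> * cos \<omega>"
    proof -
      have "(\<beta> * sin \<omega>)\<^sup>2 = \<beta>\<^sup>2 * (1 - (cos \<omega>)\<^sup>2)" by (simp add: power_mult_distrib sin_squared_eq)
      then show ?thesis by (simp add: power2_eq_square algebra_simps)
    qed
    have pp: "0 < 1 + \<beta>\<^sup>2 - 2 * \<beta> * cos \<omega>" unfolding p2[symmetric] using pos[of \<omega>] by (intro add_pos_nonneg) auto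
    have n: "1 - \<beta> * cos \<omega> \<noteq> 0" using pos[of \<omega>] by simp
    have d1: "((\<lambda>\<omega>. \<beta> * sin \<omega> / (1 - \<beta> * cos \<omega>)) has_real_derivative (\<beta> * cos \<omega> - \<beta>\<^sup>2) / (1 - \<beta> * cos \<omega>)\<^sup>2) (at \<omega> within {-pi..pi})"
    proof -
      have e: "\<beta> * cos \<omega> * (1 - \<beta> * cos \<omega>) - \<beta> * sin \<omega> * (\<beta> * sin \<omega>) = \<beta> * cos \<omega> - \<beta>\<^sup>2"
      proof -
        have "\<beta> * sin \<omega> * (\<beta> * sin \<omega>) = \<beta>\<^sup>2 * (1 - (cos \<omega>)\<^sup>2)" by (simp add: power2_eq_square[symmetric] power_mult_distrib sin_squared_eq)
        then show ?thesis by (simp add: power2_eq_square algebra_simps)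
      qed
      have "((\<lambda>\<omega>. \<beta> * sin \<omega>) has_real_derivative \<beta> * cos \<omega>) (at \<omega> within {-pi..pi})"
        "((\<lambda>\<omega>. 1 - \<beta> * cos \<omega>) has_real_derivative \<beta> * sin \<omega>) (at \<omega> within {-pi..pi})"
        by (auto intro!: derivative_eq_intros)
      from DERIV_divide[OF this n] show ?thesis unfolding e by (simp only: power2_eq_square)
    qed
    have "((\<lambda>\<omega>. (\<omega> + 2 * arctan (\<beta> * sin \<omega> / (1 - \<beta> * cos \<omega>))) / s) has_real_derivative (1 + 2 * g \<omega>) / s) (at \<omega> within {-pi..pi})"
      unfolding g_def by (rule derivative_eq_intros d1 refl)+ (use s in \<open>auto simp: field_simps\<close>)
    moreover have "(1 + 2 * g \<omega>) / s = 1 / (c - Y * cos \<omega>)"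
    proof -
      have "g \<omega> = (\<beta> * cos \<omega> - \<beta>\<^sup>2) / (1 + \<beta>\<^sup>2 - 2 * \<beta> * cos \<omega>)"
      proof -
        have "N / D\<^sup>2 / (1 + (S / D)\<^sup>2) = N / (D\<^sup>2 + S\<^sup>2)" if "D \<noteq> 0" for N D S :: real
        proof -
          have "1 + (S / D)\<^sup>2 = (D\<^sup>2 + S\<^sup>2) / D\<^sup>2" using that by (simp add: power_divide add_divide_distrib)
          then show ?thesis using that by simp
        qed
        then show ?thesis unfolding g_def p2[symmetric] using n .
      qed
      then have "1 + 2 * g \<omega> = (1 - \<beta>\<^sup>2) / (1 + \<beta>\<^sup>2 - 2 * \<beta> * cos \<omega>)" using pp by (simp add: field_simps)
      moreover have "1 - \<beta>\<^sup>2 = 2 * s / (c + s)"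
      proof -
        have "(c + s)\<^sup>2 - Y\<^sup>2 = 2 * s * (c + s)" using s(2) by (simp add: power2_eq_square algebra_simps)
        moreover have "1 - \<beta>\<^sup>2 = ((c + s)\<^sup>2 - Y\<^sup>2) / (c + s)\<^sup>2" using c s by (simp add: \<beta>_def power_divide diff_divide_distrib)
        ultimately show ?thesis using c s by (simp add: power2_eq_square)
      qed
      moreover have "1 + \<beta>\<^sup>2 - 2 * \<beta> * cos \<omega> = 2 * (c - Y * cos \<omega>) / (c + s)"
      proof -
        have "(c + s)\<^sup>2 + Y\<^sup>2 = 2 * c * (c + s)" using s(2) by (simp add: power2_eq_square algebra_simps)
        moreover have "1 + \<beta>\<^sup>2 = ((c + s)\<^sup>2 + Y\<^sup>2) / (c + s)\<^sup>2" using c s by (simp add: \<beta>_def power_divide add_divide_distrib)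
        ultimately have "1 + \<beta>\<^sup>2 = 2 * c / (c + s)" using c s by (simp add: power2_eq_square)
        then show ?thesis by (simp add: \<beta>_def diff_divide_distrib right_diff_distrib)
      qed
      moreover have "2 * s / k / (2 * x / k) / s = 1 / x" if "0 < k" for k x
        using s that by (cases "x = 0") (auto simp: field_simps)
      ultimately show ?thesis using c s by (simp only: add_pos_pos)
    qed
    ultimately show ?thesis by simp
  qed
  have "((\<lambda>\<omega>. 1 / (c - Y * cos \<omega>)) has_integral (pi + 2 * arctan (\<beta> * sin pi / (1 - \<beta> * cos pi))) / s
      - (- pi + 2 * arctan (\<beta> * sin (- pi) / (1 - \<beta> * cos (- pi)))) / s) {-pi..pi}"
    by (rule fundamental_theorem_of_calculus) (use der in \<open>auto simp: has_real_derivative_iff_has_vector_derivative[symmetric]\<close>)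
  then show ?thesis unfolding s_def by (simp add: diff_divide_distrib[symmetric])
qed

text \<open>Over the reals the projective line is a circle: \<rho> is 1, both auxiliary laws are
  point masses and \<open>E\<close> itself serves as \<open>G\<close>.\<close>

lemma real_radial_inverse: "radial_inverse 1 (return borel 0) (\<lambda>_. 1) (2 * pi) (return borel 0) (\<lambda>_. 1) 0 1"
proof (intro radial_inverse.intro radial_law.intro radial_inverse_axioms.intro)
  fix Y c :: real assume Y: "0 \<le> Y" "Y < c"
  then have pos: "0 < c - Y * cos \<omega>" for \<omega>
    using mult_left_mono[OF cos_le_one Y(1), of \<omega>] by simp
  have "(\<integral>\<^sup>+\<omega>. ennreal (indicator {-pi..pi} \<omega> * (1 / (c - Y * cos \<omega>))) \<partial>lborel) = ennreal (2 * pi / sqrt (c\<^sup>2 - Y\<^sup>2))"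
    by (rule nn_integral_Icc[OF _ _ circle_integral[OF Y]]) (use pos in \<open>auto simp: less_imp_le\<close>)
  then show "(\<integral>\<^sup>+\<nu>. \<integral>\<^sup>+\<omega>. ennreal (indicator {-pi..pi} \<omega> * (1 / (c - Y * 1 * cos \<omega>)) ^ 1) \<partial>lborel \<partial>return borel (0::real))
    = ennreal (2 * pi * (1 / sqrt (c\<^sup>2 - Y\<^sup>2)) ^ 1)"
    by (simp add: nn_integral_return)
next
  fix E :: "real poly" and q :: nat and a :: real
  assume "nonneg_poly E" "vanishes (Suc q + 0) E"
  then show "\<exists>G. nonneg_poly G \<and> vanishes (Suc q) G \<and>
    (\<forall>w. 0 < w \<longrightarrow> w \<le> 1 \<longrightarrow> (\<integral>\<^sup>+s. \<integral>\<^sup>+\<nu>. ennreal (tr a G (1 * (1 * w))) \<partial>return borel (0::real) \<partial>return borel (0::real)) = ennreal (1 * tr a E w))"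
    by (intro exI[of _ E]) (simp add: nn_integral_return)
next
  show "finite_measure (return borel (0::real))" "finite_measure (return borel (0::real))"
    by (simp_all add: prob_space.axioms(1) prob_space_return)
qed simp_all

section \<open>Moments of a coordinate on an even-dimensional sphere\<close>

context
  fixes l :: nat
begin

definition cmom :: "nat \<Rightarrow> real" where "cmom m = integral {-pi..pi} (\<lambda>\<omega>. cos \<omega> ^ m)"
definition smom :: "nat \<Rightarrow> real" where "smom m = integral {0..pi/2} (\<lambda>\<nu>. sin \<nu> * cos \<nu> ^ (2 * l) * sin \<nu> ^ m)"
definition dmom :: "nat \<Rightarrow> real" where "dmom m = integral {-1..1} (\<lambda>v. (1 - v\<^sup>2) ^ l * v ^ m)"

lemma cmom_step: "(real m + 2) * cmom (Suc (Suc m)) = (real m + 1) * cmom m"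
proof -
  have "((\<lambda>\<omega>. (real m + 2) * cos \<omega> ^ Suc (Suc m) - (real m + 1) * cos \<omega> ^ m) has_integral
      sin pi * cos pi ^ Suc m - sin (- pi) * cos (- pi) ^ Suc m) {-pi..pi}"
  proof (rule fundamental_theorem_of_calculus)
    fix x :: real
    have s: "sin x * sin x = 1 - cos x * cos x" using sin_squared_eq[of x] by (simp add: power2_eq_square)
    have "((\<lambda>\<omega>. sin \<omega> * cos \<omega> ^ Suc m) has_real_derivative cos x * cos x ^ Suc m + (real (Suc m) * cos x ^ m * - sin x) * sin x) (at x within {-pi..pi})"
      by (rule DERIV_cong, (rule derivative_eq_intros refl)+, simp add: mult_ac del: power_Suc)
    also have "cos x * cos x ^ Suc m + (real (Suc m) * cos x ^ m * - sin x) * sin x = cos x ^ Suc (Suc m) - real (Suc m) * cos x ^ m * (sin x * sin x)"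
      by simp
    also have "\<dots> = (real m + 2) * cos x ^ Suc (Suc m) - (real m + 1) * cos x ^ m"
      unfolding s by (simp add: algebra_simps)
    finally show "((\<lambda>\<omega>. sin \<omega> * cos \<omega> ^ Suc m) has_vector_derivative (real m + 2) * cos x ^ Suc (Suc m) - (real m + 1) * cos x ^ m) (at x within {-pi..pi})"
      unfolding has_real_derivative_iff_has_vector_derivative .
  qed simp
  then have z: "((\<lambda>\<omega>. (real m + 2) * cos \<omega> ^ Suc (Suc m) - (real m + 1) * cos \<omega> ^ m) has_integral 0) {-pi..pi}" by simp
  have i: "((\<lambda>\<omega>. (real m + 2) * cos \<omega> ^ Suc (Suc m) - (real m + 1) * cos \<omega> ^ m) has_integral
      (real m + 2) * cmom (Suc (Suc m)) - (real m + 1) * cmom m) {-pi..pi}"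
    unfolding cmom_def
    by (intro has_integral_diff has_integral_mult_right integrable_integral integrable_continuous_interval continuous_intros)
  show ?thesis by (rule has_integral_unique[OF i z, unfolded right_minus_eq])
qed

lemma smom_step: "(real m + 2 * real l + 3) * smom (Suc (Suc m)) = (real m + 2) * smom m"
proof -
  let ?f = "\<lambda>\<nu>::real. (real m + 2 * real l + 3) * (sin \<nu> * cos \<nu> ^ (2 * l) * sin \<nu> ^ Suc (Suc m)) - (real m + 2) * (sin \<nu> * cos \<nu> ^ (2 * l) * sin \<nu> ^ m)"
  have "(?f has_integral - (sin (pi/2) ^ Suc (Suc m) * cos (pi/2) ^ Suc (2 * l)) - - (sin 0 ^ Suc (Suc m) * cos 0 ^ Suc (2 * l))) {0..pi/2}"
  proof (rule fundamental_theorem_of_calculus)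
    fix x :: real
    have s: "cos x * cos x = 1 - sin x * sin x" using sin_squared_eq[of x] by (simp add: power2_eq_square)
    have "((\<lambda>x. - (sin x ^ Suc (Suc m) * cos x ^ Suc (2 * l))) has_real_derivative
       - ((real (Suc (Suc m)) * sin x ^ Suc m * cos x) * cos x ^ Suc (2 * l) + (real (Suc (2 * l)) * cos x ^ (2 * l) * - sin x) * sin x ^ Suc (Suc m))) (at x within {0..pi/2})"
      by (rule DERIV_cong, (rule derivative_eq_intros refl)+, simp add: mult_ac del: power_Suc)
    also have "- ((real (Suc (Suc m)) * sin x ^ Suc m * cos x) * cos x ^ Suc (2 * l) + (real (Suc (2 * l)) * cos x ^ (2 * l) * - sin x) * sin x ^ Suc (Suc m))
      = real (Suc (2 * l)) * cos x ^ (2 * l) * sin x * sin x ^ Suc (Suc m) - real (Suc (Suc m)) * sin x ^ Suc m * cos x ^ (2 * l) * (cos x * cos x)"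
      by (simp add: algebra_simps)
    also have "\<dots> = ?f x" unfolding s by (simp add: algebra_simps)
    finally show "((\<lambda>x. - (sin x ^ Suc (Suc m) * cos x ^ Suc (2 * l))) has_vector_derivative ?f x) (at x within {0..pi/2})"
      unfolding has_real_derivative_iff_has_vector_derivative .
  qed simp
  then have z: "(?f has_integral 0) {0..pi/2}" by simp
  have i: "(?f has_integral (real m + 2 * real l + 3) * smom (Suc (Suc m)) - (real m + 2) * smom m) {0..pi/2}"
    unfolding smom_def
    by (intro has_integral_diff has_integral_mult_right integrable_integral integrable_continuous_interval continuous_intros)
  show ?thesis by (rule has_integral_unique[OF i z, unfolded right_minus_eq])
qed

lemma dmom_step: "(real m + 2 * real l + 3) * dmom (Suc (Suc m)) = (real m + 1) * dmom m"
proof -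
  let ?f = "\<lambda>v::real. (real m + 1) * ((1 - v\<^sup>2) ^ l * v ^ m) - (real m + 2 * real l + 3) * ((1 - v\<^sup>2) ^ l * v ^ Suc (Suc m))"
  have "(?f has_integral 1 ^ Suc m * (1 - 1\<^sup>2) ^ Suc l - (-1) ^ Suc m * (1 - (-1)\<^sup>2) ^ Suc l) {-1..1}"
  proof (rule fundamental_theorem_of_calculus)
    fix x :: real
    have "((\<lambda>x. x ^ Suc m * (1 - x\<^sup>2) ^ Suc l) has_real_derivative
       (real (Suc m) * x ^ m) * (1 - x\<^sup>2) ^ Suc l + (real (Suc l) * (1 - x\<^sup>2) ^ l * - (2 * x)) * x ^ Suc m) (at x within {-1..1})"
      by (rule DERIV_cong, (rule derivative_eq_intros refl)+, simp add: mult_ac del: power_Suc)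
    also have "(real (Suc m) * x ^ m) * (1 - x\<^sup>2) ^ Suc l + (real (Suc l) * (1 - x\<^sup>2) ^ l * - (2 * x)) * x ^ Suc m = ?f x"
    proof -
      have "(real (Suc m) * x ^ m) * (q * (1 - x\<^sup>2)) + (real (Suc l) * q * - (2 * x)) * x ^ Suc m
        = (real m + 1) * (q * x ^ m) - (real m + 2 * real l + 3) * (q * x ^ Suc (Suc m))" for q
        by (simp add: algebra_simps power2_eq_square)
      then show ?thesis unfolding power_Suc2[of "1 - x\<^sup>2"] .
    qed
    finally show "((\<lambda>x. x ^ Suc m * (1 - x\<^sup>2) ^ Suc l) has_vector_derivative ?f x) (at x within {-1..1})"
      unfolding has_real_derivative_iff_has_vector_derivative .
  qed simp
  then have z: "(?f has_integral 0) {-1..1}" by simp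
  have i: "(?f has_integral (real m + 1) * dmom m - (real m + 2 * real l + 3) * dmom (Suc (Suc m))) {-1..1}"
    unfolding dmom_def
    by (intro has_integral_diff has_integral_mult_right integrable_integral integrable_continuous_interval continuous_intros)
  show ?thesis by (rule has_integral_unique[OF i z, unfolded right_minus_eq, symmetric])
qed

lemma cmom_0: "cmom 0 = 2 * pi"
  by (simp add: cmom_def)

lemma cmom_1: "cmom (Suc 0) = 0"
proof -
  have "(cos has_integral sin pi - sin (- pi)) {-pi..pi}"
    by (rule fundamental_theorem_of_calculus)
      (auto simp: has_real_derivative_iff_has_vector_derivative[symmetric] intro!: derivative_eq_intros)
  then show ?thesis unfolding cmom_def by (simp add: integral_unique)
qed

lemma dmom_1: "dmom (Suc 0) = 0"
proof -
  have "((\<lambda>v. - 2 * (real l + 1) * ((1 - v\<^sup>2) ^ l * v)) has_integral (1 - 1\<^sup>2) ^ Suc l - (1 - (-1)\<^sup>2) ^ Suc l) {-1..1::real}"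
  proof (rule fundamental_theorem_of_calculus)
    fix x :: real
    have "((\<lambda>x. (1 - x\<^sup>2) ^ Suc l) has_real_derivative real (Suc l) * (1 - x\<^sup>2) ^ l * - (2 * x)) (at x within {-1..1})"
      by (rule DERIV_cong, (rule derivative_eq_intros refl)+, simp add: mult_ac del: power_Suc)
    then show "((\<lambda>x. (1 - x\<^sup>2) ^ Suc l) has_vector_derivative - 2 * (real l + 1) * ((1 - x\<^sup>2) ^ l * x)) (at x within {-1..1})"
      unfolding has_real_derivative_iff_has_vector_derivative by (simp add: algebra_simps)
  qed simp
  moreover have "((\<lambda>v. - 2 * (real l + 1) * ((1 - v\<^sup>2) ^ l * v)) has_integral - 2 * (real l + 1) * dmom (Suc 0)) {-1..1}"
    unfolding dmom_def power_Suc0_right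
    by (intro has_integral_mult_right integrable_integral integrable_continuous_interval continuous_intros)
  ultimately have "- 2 * (real l + 1) * dmom (Suc 0) = (1 - 1\<^sup>2) ^ Suc l - (1 - (-1)\<^sup>2) ^ Suc l"
    by (rule has_integral_unique[symmetric])
  then show ?thesis by simp
qed

lemma smom_0_pos: "0 < smom 0"
proof -
  have "((\<lambda>v. - (2 * real l + 1) * (sin v * cos v ^ (2 * l) * sin v ^ 0)) has_integral cos (pi/2) ^ Suc (2 * l) - cos 0 ^ Suc (2 * l)) {0..pi/2}"
  proof (rule fundamental_theorem_of_calculus)
    fix x :: real
    have "((\<lambda>x. cos x ^ Suc (2 * l)) has_real_derivative real (Suc (2 * l)) * cos x ^ (2 * l) * - sin x) (at x within {0..pi/2})"
      by (rule DERIV_cong, (rule derivative_eq_intros refl)+, simp add: mult_ac del: power_Suc)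
    then show "((\<lambda>x. cos x ^ Suc (2 * l)) has_vector_derivative - (2 * real l + 1) * (sin x * cos x ^ (2 * l) * sin x ^ 0)) (at x within {0..pi/2})"
      unfolding has_real_derivative_iff_has_vector_derivative by (simp add: algebra_simps)
  qed simp
  moreover have "((\<lambda>v. - (2 * real l + 1) * (sin v * cos v ^ (2 * l) * sin v ^ 0)) has_integral - (2 * real l + 1) * smom 0) {0..pi/2}"
    unfolding smom_def
    by (intro has_integral_mult_right integrable_integral integrable_continuous_interval continuous_intros)
  ultimately have "- (2 * real l + 1) * smom 0 = cos (pi/2) ^ Suc (2 * l) - cos 0 ^ Suc (2 * l)"
    by (rule has_integral_unique[symmetric])
  then have "- (2 * real l + 1) * smom 0 = - 1" by simp
  then have "(2 * real l + 1) * smom 0 = 1" by (simp only: mult_minus_left neg_equal_iff_equal)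
  moreover have "0 < 2 * real l + 1" by simp
  ultimately show ?thesis by (metis zero_less_mult_pos zero_less_one)
qed

lemma dmom_0_pos: "0 < dmom 0"
proof -
  have n: "0 \<le> (1 - v\<^sup>2) ^ l * v ^ 0" if "v \<in> {-1..1}" for v :: real
  proof -
    have "\<bar>v\<bar> \<le> 1" using that by (simp add: abs_le_iff)
    then have "v\<^sup>2 \<le> 1" by (simp only: abs_square_le_1)
    then show ?thesis by simp
  qed
  have hi: "((\<lambda>v. (1 - v\<^sup>2) ^ l * v ^ 0) has_integral dmom 0) {-1..1}" unfolding dmom_def
    by (intro integrable_integral integrable_continuous_interval continuous_intros)
  have "0 \<le> dmom 0" by (rule has_integral_nonneg[OF hi n])
  moreover have "dmom 0 \<noteq> 0"
  proof
    assume "dmom 0 = 0"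
    with hi have hi0: "((\<lambda>v. (1 - v\<^sup>2) ^ l * v ^ 0) has_integral 0) (cbox (- 1) (1::real))" by (simp only: cbox_interval)
    have ct: "continuous_on (cbox (- 1) 1) (\<lambda>v::real. (1 - v\<^sup>2) ^ l * v ^ 0)" by (intro continuous_intros)
    have "(1 - 0\<^sup>2) ^ l * 0 ^ 0 = (0::real)"
      by (rule has_integral_0_cbox_imp_0[OF ct _ hi0]) (use n in \<open>simp_all add: cbox_interval\<close>)
    then show False by simp
  qed
  ultimately show ?thesis by simp
qed

definition sphere_const :: real where "sphere_const = cmom 0 * smom 0 / dmom 0"

lemma sphere_const_pos: "0 < sphere_const"
  using smom_0_pos dmom_0_pos by (simp add: sphere_const_def cmom_0)

text \<open>From m to m + 2 the angular moments gain the factor (m+1)/(m+2) and the radial ones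
  (m+2)/(m+2l+3); their product (m+1)/(m+2l+3) is the factor for the sphere. Odd moments vanish on
  both sides, and \<open>sphere_const\<close> settles m = 0.\<close>

lemma moments: "cmom m * smom m = sphere_const * dmom m"
proof (induction m rule: induct_nat_012)
  case 0 show ?case using dmom_0_pos by (simp add: sphere_const_def)
next
  case 1 show ?case by (simp add: cmom_1 dmom_1)
next
  case (ge2 m)
  have "(real m + 2) * (real m + 2 * real l + 3) * (cmom (Suc (Suc m)) * smom (Suc (Suc m)))
    = ((real m + 2) * cmom (Suc (Suc m))) * ((real m + 2 * real l + 3) * smom (Suc (Suc m)))" by (simp only: mult_ac)
  also have "\<dots> = (real m + 2) * (real m + 1) * (cmom m * smom m)" unfolding cmom_step smom_step by (simp only: mult_ac)
  also have "\<dots> = (real m + 2) * (sphere_const * ((real m + 1) * dmom m))" unfolding ge2 by (simp only: mult_ac)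
  also have "\<dots> = (real m + 2) * (real m + 2 * real l + 3) * (sphere_const * dmom (Suc (Suc m)))" unfolding dmom_step[symmetric] by (simp only: mult_ac)
  finally have "(real m + 2) * (real m + 2 * real l + 3) * (cmom (Suc (Suc m)) * smom (Suc (Suc m)) - sphere_const * dmom (Suc (Suc m))) = 0"
    by (simp only: right_diff_distrib diff_self)
  moreover have "0 < real m + 2" "0 < real m + 2 * real l + 3" by simp_all
  ultimately show ?case by simp
qed

end

section \<open>Sphere coordinates as radius times cosine\<close>

definition Icc_measure :: "real \<Rightarrow> real \<Rightarrow> (real \<Rightarrow> real) \<Rightarrow> real measure" where
  "Icc_measure a b g = density lborel (\<lambda>x. ennreal (indicator {a..b} x * g x))"

lemma sets_Icc_measure [measurable_cong, simp]: "sets (Icc_measure a b g) = sets borel"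
  by (simp add: Icc_measure_def)

lemma nn_integral_Icc_measure:
  assumes [measurable]: "g \<in> borel_measurable borel" "f \<in> borel_measurable borel"
  shows "(\<integral>\<^sup>+x. f x \<partial>Icc_measure a b g) = (\<integral>\<^sup>+x. ennreal (indicator {a..b} x * g x) * f x \<partial>lborel)"
  unfolding Icc_measure_def by (rule nn_integral_density) measurable

lemma AE_Icc_measure:
  assumes [measurable]: "g \<in> borel_measurable borel"
  shows "AE x in Icc_measure a b g. x \<in> {a..b}"
  unfolding Icc_measure_def by (subst AE_density) (auto simp: indicator_def)

lemma
  assumes g: "continuous_on UNIV g" "\<And>x. x \<in> {a..b} \<Longrightarrow> 0 \<le> g x"
  shows finite_Icc_measure: "finite_measure (Icc_measure a b g)"
    and integral_Icc_measure: "continuous_on UNIV f \<Longrightarrow> (\<integral>x. f x \<partial>Icc_measure a b g) = integral {a..b} (\<lambda>x. g x * f x)"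
proof -
  have gm [measurable]: "g \<in> borel_measurable borel" using g(1) by (rule borel_measurable_continuous_onI)
  have "(\<integral>\<^sup>+x. 1 \<partial>Icc_measure a b g) = (\<integral>\<^sup>+x. ennreal (indicator {a..b} x * g x) \<partial>lborel)"
    by (subst nn_integral_Icc_measure) simp_all
  also have "\<dots> = ennreal (integral {a..b} g)"
    by (rule nn_integral_Icc[OF gm g(2)])
      (auto intro!: integrable_integral integrable_continuous_interval continuous_on_subset[OF g(1)])
  finally show "finite_measure (Icc_measure a b g)" by (intro finite_measureI) simp
  assume f: "continuous_on UNIV f"
  then have [measurable]: "f \<in> borel_measurable borel" by (rule borel_measurable_continuous_onI)
  have "(\<integral>x. f x \<partial>Icc_measure a b g) = (\<integral>x. (indicator {a..b} x * g x) *\<^sub>R f x \<partial>lborel)"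
    unfolding Icc_measure_def
    by (rule integral_density) (use g(2) in \<open>auto simp: indicator_def\<close>)
  also have "\<dots> = (LINT x:{a..b}|lborel. g x * f x)"
    by (simp add: set_lebesgue_integral_def mult.assoc)
  also have "\<dots> = integral {a..b} (\<lambda>x. g x * f x)"
    by (intro set_borel_integral_eq_integral borel_integrable_atLeastAtMost' continuous_intros
      continuous_on_subset[OF g(1)] continuous_on_subset[OF f]) auto
  finally show "(\<integral>x. f x \<partial>Icc_measure a b g) = integral {a..b} (\<lambda>x. g x * f x)" .
qed

lemma integral_product_bounded:
  fixes f :: "'a \<Rightarrow> real" and g :: "'b \<Rightarrow> real"
  assumes "finite_measure M" "finite_measure N"
    and [measurable]: "f \<in> borel_measurable M" "g \<in> borel_measurable N"
    and b: "\<And>x. \<bar>f x\<bar> \<le> 1" "\<And>x. \<bar>g x\<bar> \<le> 1"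
  shows "(\<integral>(x, y). f x * g y \<partial>(M \<Otimes>\<^sub>M N)) = (\<integral>x. f x \<partial>M) * (\<integral>y. g y \<partial>N)"
proof -
  interpret M: finite_measure M by fact
  interpret N: finite_measure N by fact
  interpret pair_sigma_finite M N ..
  interpret P: finite_measure "M \<Otimes>\<^sub>M N" by (rule finite_measure_pair_measure; fact)
  have "integrable (M \<Otimes>\<^sub>M N) (\<lambda>(x, y). f x * g y)"
    by (rule P.integrable_const_bound[of _ 1])
      (auto simp: abs_mult intro!: AE_I2 mult_le_one b)
  from integral_fst'[OF this] show ?thesis by simp
qed

lemma abs_sin_cos_le_1: "\<bar>\<bar>sin \<nu>\<bar> * cos \<omega>\<bar> \<le> (1::real)"
  by (simp add: abs_mult mult_le_one)

text \<open>Up to a constant, |sin \<nu>| under this measure is the length of the projection to a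
  plane of a uniform point on the sphere of dimension 2 l + 2.\<close>

definition rad_measure :: "nat \<Rightarrow> real measure" where
  "rad_measure l = Icc_measure 0 (pi / 2) (\<lambda>\<nu>. sin \<nu> * cos \<nu> ^ (2 * l))"
definition arc_measure :: "real measure" where
  "arc_measure = Icc_measure (- pi) pi (\<lambda>_. 1)"
definition ball_measure :: "nat \<Rightarrow> real measure" where
  "ball_measure l = Icc_measure (- 1) 1 (\<lambda>v. (1 - v\<^sup>2) ^ l)"

lemma one_minus_square_nonneg: "v \<in> {-1..1} \<Longrightarrow> 0 \<le> (1 - v\<^sup>2) ^ l" for v :: real
proof -
  assume "v \<in> {-1..1}"
  then have "\<bar>v\<bar> \<le> 1" by (simp add: abs_le_iff)
  then have "v\<^sup>2 \<le> 1" by (simp only: abs_square_le_1)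
  then show ?thesis by simp
qed

lemma sets_sphere_measures [measurable_cong, simp]:
  "sets (rad_measure l) = sets borel" "sets arc_measure = sets borel" "sets (ball_measure l) = sets borel"
  by (simp_all add: rad_measure_def arc_measure_def ball_measure_def)

lemma finite_sphere_measures:
  "finite_measure (rad_measure l)" "finite_measure arc_measure" "finite_measure (ball_measure l)"
  unfolding rad_measure_def arc_measure_def ball_measure_def
  by (rule finite_Icc_measure; auto intro!: continuous_intros mult_nonneg_nonneg sin_ge_zero one_minus_square_nonneg)+

text \<open>Both sides give the law of a coordinate of a uniform random point of the unit sphere of dimension \<open>2 l + 2\<close>.\<close>

lemma spherical_average:
  fixes h :: "real \<Rightarrow> ennreal"
  assumes [measurable]: "h \<in> borel_measurable borel"
  shows "(\<integral>\<^sup>+\<nu>. \<integral>\<^sup>+\<omega>. h (\<bar>sin \<nu>\<bar> * cos \<omega>) \<partial>arc_measure \<partial>rad_measure l) = ennreal (sphere_const l) * (\<integral>\<^sup>+v. h v \<partial>ball_measure l)"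
proof -
  interpret R: finite_measure "rad_measure l" by (rule finite_sphere_measures)
  interpret A: finite_measure arc_measure by (rule finite_sphere_measures)
  interpret pair_sigma_finite "rad_measure l" arc_measure ..
  define c where "c = sphere_const l"
  have c: "0 < c" by (simp add: c_def sphere_const_pos)
  define B where "B = Icc_measure (- 1) 1 (\<lambda>v. c * (1 - v\<^sup>2) ^ l)"
  have Bfin: "finite_measure B" unfolding B_def
    by (rule finite_Icc_measure) (use c in \<open>auto intro!: continuous_intros mult_nonneg_nonneg one_minus_square_nonneg\<close>)
  have [measurable_cong]: "sets B = sets borel" by (simp add: B_def)
  interpret P: finite_measure "rad_measure l \<Otimes>\<^sub>M arc_measure" by (rule finite_measure_pair_measure; rule finite_sphere_measures)
  interpret B: finite_measure B by (rule Bfin)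
  \<comment> \<open>Padding with zeros brings the one-dimensional laws into the range of the
    uniqueness theorem on the three-dimensional cube.\<close>
  define p where "p = (\<lambda>(\<nu> :: real, \<omega> :: real). (\<bar>sin \<nu>\<bar> * cos \<omega>, 0 :: real, 0 :: real))"
  define r :: "real \<Rightarrow> real \<times> real \<times> real" where "r v = (v, 0, 0)" for v
  have [measurable]: "p \<in> rad_measure l \<Otimes>\<^sub>M arc_measure \<rightarrow>\<^sub>M borel" "r \<in> B \<rightarrow>\<^sub>M borel"
    unfolding p_def r_def borel_prod[symmetric] by measurable
  have eq: "distr (rad_measure l \<Otimes>\<^sub>M arc_measure) borel p = distr B borel r"
  proof (rule measure_eqI_moments)
    show "finite_measure (distr (rad_measure l \<Otimes>\<^sub>M arc_measure) borel p)" "finite_measure (distr B borel r)"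
      by (rule P.finite_measure_distr B.finite_measure_distr, measurable)+
    have [measurable]: "cube \<in> sets borel" by (intro borel_closed closed_Times closed_atLeastAtMost)
    show "AE v in distr (rad_measure l \<Otimes>\<^sub>M arc_measure) borel p. v \<in> cube"
      using abs_sin_cos_le_1 by (subst AE_distr_iff) (auto simp: p_def abs_le_iff minus_le_iff)
    show "AE v in distr B borel r. v \<in> cube"
      unfolding B_def using AE_Icc_measure[of "\<lambda>v. c * (1 - v\<^sup>2) ^ l" "-1" 1]
      by (subst AE_distr_iff) (auto simp: r_def B_def[symmetric])
    fix i j k :: nat
    have M: "(\<lambda>(x, y, z). x ^ i * y ^ j * z ^ k) \<in> borel_measurable (borel :: (real \<times> real \<times> real) measure)"
      by (intro borel_measurable_continuous_onI poly3_continuous poly3.mono)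
    show "(\<integral>(x, y, z). x ^ i * y ^ j * z ^ k \<partial>distr (rad_measure l \<Otimes>\<^sub>M arc_measure) borel p) = (\<integral>(x, y, z). x ^ i * y ^ j * z ^ k \<partial>distr B borel r)"
    proof (cases "j = 0 \<and> k = 0")
      case True
      have "(\<integral>(x, y, z). x ^ i * y ^ j * z ^ k \<partial>distr (rad_measure l \<Otimes>\<^sub>M arc_measure) borel p)
        = (\<integral>(\<nu>, \<omega>). \<bar>sin \<nu>\<bar> ^ i * cos \<omega> ^ i \<partial>(rad_measure l \<Otimes>\<^sub>M arc_measure))"
        using True by (subst integral_distr[OF _ M]) (auto simp: p_def case_prod_unfold power_mult_distrib)
      also have "\<dots> = (\<integral>\<nu>. \<bar>sin \<nu>\<bar> ^ i \<partial>rad_measure l) * (\<integral>\<omega>. cos \<omega> ^ i \<partial>arc_measure)"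
        by (rule integral_product_bounded[OF finite_sphere_measures(1,2)]) (auto simp: power_abs intro!: power_le_one)
      also have "(\<integral>\<omega>. cos \<omega> ^ i \<partial>arc_measure) = cmom i"
        unfolding arc_measure_def cmom_def by (subst integral_Icc_measure) (auto intro!: continuous_intros)
      also have "(\<integral>\<nu>. \<bar>sin \<nu>\<bar> ^ i \<partial>rad_measure l) = smom l i"
        unfolding rad_measure_def smom_def
      proof (subst integral_Icc_measure)
        show "integral {0..pi/2} (\<lambda>x. sin x * cos x ^ (2 * l) * \<bar>sin x\<bar> ^ i) = integral {0..pi/2} (\<lambda>x. sin x * cos x ^ (2 * l) * sin x ^ i)"
        proof (rule integral_cong)
          fix x :: real assume "x \<in> {0..pi/2}"
          then have "0 \<le> sin x" by (intro sin_ge_zero) auto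
          then show "sin x * cos x ^ (2 * l) * \<bar>sin x\<bar> ^ i = sin x * cos x ^ (2 * l) * sin x ^ i" by simp
        qed
      qed (auto intro!: continuous_intros mult_nonneg_nonneg sin_ge_zero)
      also have "smom l i * cmom i = c * dmom l i" using moments[of i l] by (simp add: c_def mult.commute)
      also have "\<dots> = (\<integral>v. v ^ i \<partial>B)"
      proof -
        have "(\<integral>v. v ^ i \<partial>B) = integral {-1..1} (\<lambda>v. c * ((1 - v\<^sup>2) ^ l * v ^ i))"
          unfolding B_def by (subst integral_Icc_measure)
            (use c in \<open>auto intro!: continuous_intros mult_nonneg_nonneg one_minus_square_nonneg simp: mult.assoc\<close>)
        then show ?thesis by (simp add: dmom_def)
      qed
      also have "\<dots> = (\<integral>(x, y, z). x ^ i * y ^ j * z ^ k \<partial>distr B borel r)"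
        using True by (subst integral_distr[OF _ M]) (auto simp: r_def)
      finally show ?thesis .
    next
      case False
      then show ?thesis
        by (subst (1 2) integral_distr[OF _ M]) (auto simp: p_def r_def case_prod_unfold)
    qed
  qed simp_all
  have m1: "(\<lambda>z. h (fst (p z))) \<in> borel_measurable (rad_measure l \<Otimes>\<^sub>M arc_measure)"
    unfolding p_def case_prod_unfold fst_conv by measurable
  have "(\<lambda>v. fst v) \<in> borel_measurable (borel :: (real \<times> real \<times> real) measure)"
    by (intro borel_measurable_continuous_onI continuous_intros)
  then have m2: "(\<lambda>v. h (fst v)) \<in> borel_measurable (borel :: (real \<times> real \<times> real) measure)"
    by (rule measurable_compose) measurable
  have "(\<integral>\<^sup>+\<nu>. \<integral>\<^sup>+\<omega>. h (\<bar>sin \<nu>\<bar> * cos \<omega>) \<partial>arc_measure \<partial>rad_measure l) = (\<integral>\<^sup>+z. h (fst (p z)) \<partial>(rad_measure l \<Otimes>\<^sub>M arc_measure))"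
    unfolding A.nn_integral_fst[OF m1, symmetric] by (simp add: p_def)
  also have "\<dots> = (\<integral>\<^sup>+v. h (fst v) \<partial>distr (rad_measure l \<Otimes>\<^sub>M arc_measure) borel p)"
    by (subst nn_integral_distr) (simp_all add: m2)
  also have "\<dots> = (\<integral>\<^sup>+v. h v \<partial>B)"
    unfolding eq by (subst nn_integral_distr) (simp_all add: m2 r_def)
  also have "\<dots> = (\<integral>\<^sup>+v. ennreal c * (ennreal (indicator {-1..1} v * (1 - v\<^sup>2) ^ l) * h v) \<partial>lborel)"
  proof -
    have "ennreal (indicator {-1..1} v * (c * (1 - v\<^sup>2) ^ l)) = ennreal c * ennreal (indicator {-1..1} v * (1 - v\<^sup>2) ^ l)" for v
      using c by (subst ennreal_mult'[symmetric]) (simp_all add: mult_ac)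
    then show ?thesis unfolding B_def by (subst nn_integral_Icc_measure) (simp_all add: mult.assoc)
  qed
  also have "\<dots> = ennreal c * (\<integral>\<^sup>+v. h v \<partial>ball_measure l)"
    unfolding ball_measure_def by (subst nn_integral_Icc_measure) (auto simp: nn_integral_cmult)
  finally show ?thesis unfolding c_def .
qed

text \<open>The substitution R = (1 + v)/2 leads to \<open>beta_moebius\<close> with E = 2 Y and
  \<Lambda> = c + Y, where \<Lambda> - E = c - Y. The powers of 4 stem from 1 - v^2 = 4 R (1 -
  R).\<close>

lemma ball_integral:
  fixes c Y :: real
  assumes Y: "0 \<le> Y" "Y < c"
  shows "(\<integral>\<^sup>+v. ennreal ((1 / (c - Y * v)) ^ (2 * Suc l)) \<partial>ball_measure l)
    = ennreal (2 * 4 ^ l * beta_const l l * (1 / sqrt (c\<^sup>2 - Y\<^sup>2)) ^ (2 * Suc l))"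
proof -
  have "((\<lambda>R. R ^ l * (1 - R) ^ l * (1 / (c + Y - R * (2 * Y))) ^ (l + l + 2)) has_integral
    beta_const l l * (1 / (c + Y)) ^ Suc l * (1 / (c + Y - 2 * Y)) ^ Suc l) (cbox 0 1)"
    using beta_moebius[of "2 * Y" "c + Y" l l] Y by (simp add: cbox_interval)
  from has_integral_affinity'[OF this, of "1 / 2" "1 / 2"]
  have "((\<lambda>v. (v / 2 + 1 / 2) ^ l * (1 - (v / 2 + 1 / 2)) ^ l * (1 / (c + Y - (v / 2 + 1 / 2) * (2 * Y))) ^ (l + l + 2)) has_integral
    2 * (beta_const l l * (1 / (c + Y)) ^ Suc l * (1 / (c + Y - 2 * Y)) ^ Suc l)) {-1..1}"
    by (simp add: cbox_interval)
  from has_integral_mult_right[OF this, of "4 ^ l"]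
  have "((\<lambda>v. 4 ^ l * ((v / 2 + 1 / 2) ^ l * (1 - (v / 2 + 1 / 2)) ^ l * (1 / (c + Y - (v / 2 + 1 / 2) * (2 * Y))) ^ (l + l + 2))) has_integral
    4 ^ l * (2 * (beta_const l l * (1 / (c + Y)) ^ Suc l * (1 / (c + Y - 2 * Y)) ^ Suc l))) {-1..1}" .
  moreover have "4 ^ l * ((v / 2 + 1 / 2) ^ l * (1 - (v / 2 + 1 / 2)) ^ l * (1 / (c + Y - (v / 2 + 1 / 2) * (2 * Y))) ^ (l + l + 2))
    = (1 - v\<^sup>2) ^ l * (1 / (c - Y * v)) ^ (2 * Suc l)" for v
  proof -
    have "4 * ((v / 2 + 1 / 2) * (1 - (v / 2 + 1 / 2))) = 1 - v\<^sup>2" by (simp add: field_simps power2_eq_square)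
    moreover have "c + Y - (v / 2 + 1 / 2) * (2 * Y) = c - Y * v" by (simp add: field_simps)
    moreover have "l + l + 2 = 2 * Suc l" by simp
    ultimately show ?thesis by (simp only: power_mult_distrib[symmetric] mult.assoc[symmetric])
  qed
  moreover have "4 ^ l * (2 * (beta_const l l * (1 / (c + Y)) ^ Suc l * (1 / (c + Y - 2 * Y)) ^ Suc l))
    = 2 * 4 ^ l * beta_const l l * (1 / sqrt (c\<^sup>2 - Y\<^sup>2)) ^ (2 * Suc l)"
  proof -
    have "0 \<le> c\<^sup>2 - Y\<^sup>2" using Y by (simp add: power_mono)
    then have "(1 / sqrt (c\<^sup>2 - Y\<^sup>2)) ^ 2 = 1 / (c\<^sup>2 - Y\<^sup>2)" by (simp add: power_divide)
    also have "\<dots> = 1 / (c + Y) * (1 / (c + Y - 2 * Y))" by (simp add: power2_eq_square algebra_simps)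
    finally show ?thesis unfolding power_mult by (simp only: power_mult_distrib mult_ac)
  qed
  ultimately have hi: "((\<lambda>v. (1 - v\<^sup>2) ^ l * (1 / (c - Y * v)) ^ (2 * Suc l)) has_integral
    2 * 4 ^ l * beta_const l l * (1 / sqrt (c\<^sup>2 - Y\<^sup>2)) ^ (2 * Suc l)) {-1..1}" by (simp only:)
  have pos: "0 \<le> (1 / (c - Y * v)) ^ (2 * Suc l)" for v by (simp add: power_mult)
  have "(\<integral>\<^sup>+v. ennreal ((1 / (c - Y * v)) ^ (2 * Suc l)) \<partial>ball_measure l)
    = (\<integral>\<^sup>+v. ennreal (indicator {-1..1} v * ((1 - v\<^sup>2) ^ l * (1 / (c - Y * v)) ^ (2 * Suc l))) \<partial>lborel)"
    unfolding ball_measure_def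
    by (subst nn_integral_Icc_measure, measurable, simp only: ennreal_mult''[OF pos, symmetric] mult.assoc)
  also have "\<dots> = ennreal (2 * 4 ^ l * beta_const l l * (1 / sqrt (c\<^sup>2 - Y\<^sup>2)) ^ (2 * Suc l))"
  proof (rule nn_integral_Icc[OF _ _ hi])
    show "0 \<le> (1 - v\<^sup>2) ^ l * (1 / (c - Y * v)) ^ (2 * Suc l)" if "v \<in> {-1..1}" for v
      by (rule mult_nonneg_nonneg[OF one_minus_square_nonneg[OF that] pos])
  qed measurable
  finally show ?thesis .
qed

text \<open>Both halves rest on \<open>spherical_average\<close>. With the angle \<omega> it gives
  the transform demanded by \<open>circle\<close>; with the independent angle s it turns the product
  of cos s and |sin \<nu>| into a variable of density (1 - v^2)^l, whose integer exponent is undone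
  by l + 1 Euler operators. The absolute value keeps \<rho> nonnegative on the whole real
  line.\<close>

lemma even_radial_inverse:
  "radial_inverse (2 * Suc l) (rad_measure l) (\<lambda>\<nu>. \<bar>sin \<nu>\<bar>) (sphere_const l * (2 * 4 ^ l * beta_const l l))
    arc_measure cos (Suc l) (sphere_const l * (2 ^ l * fact l))"
proof (intro radial_inverse.intro radial_law.intro radial_inverse_axioms.intro)
  interpret R: finite_measure "rad_measure l" by (rule finite_sphere_measures)
  interpret A: finite_measure arc_measure by (rule finite_sphere_measures)
  interpret pair_sigma_finite arc_measure "rad_measure l" ..
  {
    fix Y c :: real assume Y: "0 \<le> Y" "Y < c"
    have "(\<integral>\<^sup>+\<nu>. \<integral>\<^sup>+\<omega>. ennreal (indicator {-pi..pi} \<omega> * (1 / (c - Y * \<bar>sin \<nu>\<bar> * cos \<omega>)) ^ (2 * Suc l)) \<partial>lborel \<partial>rad_measure l)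
      = (\<integral>\<^sup>+\<nu>. \<integral>\<^sup>+\<omega>. ennreal ((1 / (c - Y * (\<bar>sin \<nu>\<bar> * cos \<omega>))) ^ (2 * Suc l)) \<partial>arc_measure \<partial>rad_measure l)"
      unfolding arc_measure_def
      by (subst nn_integral_Icc_measure) (auto simp: ennreal_mult' mult.assoc simp del: power_Suc)
    also have "\<dots> = ennreal (sphere_const l * (2 * 4 ^ l * beta_const l l * (1 / sqrt (c\<^sup>2 - Y\<^sup>2)) ^ (2 * Suc l)))"
      using sphere_const_pos[of l]
      by (subst spherical_average[where h = "\<lambda>v. ennreal ((1 / (c - Y * v)) ^ (2 * Suc l))"], measurable)
        (simp only: ball_integral[OF Y] ennreal_mult'[OF less_imp_le])
    finally show "(\<integral>\<^sup>+\<nu>. \<integral>\<^sup>+\<omega>. ennreal (indicator {-pi..pi} \<omega> * (1 / (c - Y * \<bar>sin \<nu>\<bar> * cos \<omega>)) ^ (2 * Suc l)) \<partial>lborel \<partial>rad_measure l)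
      = ennreal (sphere_const l * (2 * 4 ^ l * beta_const l l) * (1 / sqrt (c\<^sup>2 - Y\<^sup>2)) ^ (2 * Suc l))"
      by (simp only: mult.assoc)
  next
    fix E :: "real poly" and q :: nat and a :: real
    assume E: "nonneg_poly E" "vanishes (Suc q + Suc l) E" and a: "0 \<le> a"
    define G where "G = sphere_inv a E (Suc l)"
    have G: "nonneg_poly G" unfolding G_def by (rule nonneg_sphere_inv[OF E(1) a])
    show "\<exists>G. nonneg_poly G \<and> vanishes (Suc q) G \<and>
      (\<forall>w. 0 < w \<longrightarrow> w \<le> 1 \<longrightarrow> (\<integral>\<^sup>+s. \<integral>\<^sup>+\<nu>. ennreal (tr a G (cos s * (\<bar>sin \<nu>\<bar> * w))) \<partial>rad_measure l \<partial>arc_measure)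
        = ennreal (sphere_const l * (2 ^ l * fact l) * tr a E w))"
    proof (intro exI[of _ G] conjI allI impI)
      show "vanishes (Suc q) G" unfolding G_def by (rule vanishes_sphere_inv[OF E(2)])
      fix w :: real assume w: "0 < w" "w \<le> 1"
      have v: "vanishes (Suc l) E" using E(2) by (simp add: vanishes_def)
      have "(\<integral>\<^sup>+s. \<integral>\<^sup>+\<nu>. ennreal (tr a G (cos s * (\<bar>sin \<nu>\<bar> * w))) \<partial>rad_measure l \<partial>arc_measure)
        = (\<integral>\<^sup>+\<nu>. \<integral>\<^sup>+s. ennreal (tr a G (cos s * (\<bar>sin \<nu>\<bar> * w))) \<partial>arc_measure \<partial>rad_measure l)"
        by (rule Fubini'[symmetric]) measurable
      also have "\<dots> = (\<integral>\<^sup>+\<nu>. \<integral>\<^sup>+s. ennreal (tr a G (\<bar>sin \<nu>\<bar> * cos s * w)) \<partial>arc_measure \<partial>rad_measure l)"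
        by (simp only: mult_ac)
      also have "\<dots> = ennreal (sphere_const l) * (\<integral>\<^sup>+v. ennreal (tr a G (v * w)) \<partial>ball_measure l)"
        by (rule spherical_average[where h = "\<lambda>v. ennreal (tr a G (v * w))"]) measurable
      also have "(\<integral>\<^sup>+v. ennreal (tr a G (v * w)) \<partial>ball_measure l) = (\<integral>\<^sup>+v. ennreal (indicator {0..1} v * ((1 - v\<^sup>2) ^ l * tr a G (v * w))) \<partial>lborel)"
      proof -
        \<comment> \<open>Since a \<ge> 0 the half v < 0 contributes nothing, which leaves the
          interval [0, 1] of \<open>sphere_average\<close>.\<close>
        have z: "tr a G (v * w) = 0" if "v < 0" for v
        proof -
          have "v * w < 0" using that w(1) by (rule mult_neg_pos)
          then show ?thesis using a by (simp add: tr_def)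
        qed
        have "ennreal (indicator {-1..1} v * (1 - v\<^sup>2) ^ l) * ennreal (tr a G (v * w)) = ennreal (indicator {0..1} v * ((1 - v\<^sup>2) ^ l * tr a G (v * w)))" for v
        proof (cases "v < 0")
          case False
          then show ?thesis by (simp add: ennreal_mult''[OF tr_nonneg[OF G], symmetric] indicator_def)
        qed (simp add: z)
        then show ?thesis unfolding ball_measure_def by (subst nn_integral_Icc_measure) simp_all
      qed
      also have "\<dots> = ennreal (2 ^ l * fact l * tr a E w)"
        by (rule nn_integral_Icc[OF _ _ sphere_average[OF v w(1), of a, folded G_def]])
          (auto intro!: mult_nonneg_nonneg one_minus_square_nonneg tr_nonneg[OF G])
      also have "ennreal (sphere_const l) * \<dots> = ennreal (sphere_const l * (2 ^ l * fact l) * tr a E w)"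
        using sphere_const_pos[of l] by (simp add: ennreal_mult' mult.assoc)
      finally show "(\<integral>\<^sup>+s. \<integral>\<^sup>+\<nu>. ennreal (tr a G (cos s * (\<bar>sin \<nu>\<bar> * w))) \<partial>rad_measure l \<partial>arc_measure)
        = ennreal (sphere_const l * (2 ^ l * fact l) * tr a E w)" .
    qed (rule G)
  }
qed (auto simp: sphere_const_pos beta_const_pos finite_sphere_measures)

section \<open>Strictness\<close>

definition strictly_psd :: "nat \<Rightarrow> (nat \<Rightarrow> nat \<Rightarrow> real) \<Rightarrow> bool" where
  "strictly_psd n A \<longleftrightarrow> (\<forall>c. (\<exists>i<n. c i \<noteq> 0) \<longrightarrow> 0 < (\<Sum>i<n. \<Sum>j<n. c i * A i j * c j))"

text \<open>A mixture of positive semidefinite matrices is strictly positive definite as soon as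
  a nonnegligible part of them is diagonal with positive diagonal.\<close>

lemma strictly_psd_integral:
  assumes meas: "\<And>i j. i < n \<Longrightarrow> j < n \<Longrightarrow> f i j \<in> borel_measurable M"
    and fin: "\<And>i j. i < n \<Longrightarrow> j < n \<Longrightarrow> (\<integral>\<^sup>+x. f i j x \<partial>M) < \<infinity>"
    and psd: "AE x in M. psd n (\<lambda>i j. enn2real (f i j x))"
    and S: "S \<in> sets M" "0 < emeasure M S"
    and diag: "\<And>i j x. i < n \<Longrightarrow> j < n \<Longrightarrow> i \<noteq> j \<Longrightarrow> x \<in> S \<Longrightarrow> f i j x = 0"
      "\<And>i x. i < n \<Longrightarrow> x \<in> S \<Longrightarrow> 0 < enn2real (f i i x)"
  shows "strictly_psd n (\<lambda>i j. enn2real (\<integral>\<^sup>+x. f i j x \<partial>M))"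
  unfolding strictly_psd_def
proof (intro allI impI)
  fix c :: "nat \<Rightarrow> real"
  assume c: "\<exists>i<n. c i \<noteq> 0"
  note int = integral_enn2real[OF meas fin]
  define g where "g x = (\<Sum>i<n. \<Sum>j<n. c i * enn2real (f i j x) * c j)" for x
  have gi: "integrable M g" unfolding g_def using int by (intro Bochner_Integration.integrable_sum) simp
  have "(\<Sum>i<n. \<Sum>j<n. c i * enn2real (\<integral>\<^sup>+x. f i j x \<partial>M) * c j) = (\<Sum>i<n. \<Sum>j<n. (\<integral>x. c i * enn2real (f i j x) * c j \<partial>M))"
    using int by (intro sum.cong refl) simp
  also have "\<dots> = (\<integral>x. g x \<partial>M)"
    unfolding g_def
    using int by (subst Bochner_Integration.integral_sum, (intro Bochner_Integration.integrable_sum; simp), intro sum.cong refl)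
      (subst Bochner_Integration.integral_sum; simp)
  finally have eq: "(\<Sum>i<n. \<Sum>j<n. c i * enn2real (\<integral>\<^sup>+x. f i j x \<partial>M) * c j) = (\<integral>x. g x \<partial>M)" .
  have g0: "AE x in M. 0 \<le> g x"
    using psd by eventually_elim (simp add: psd_def g_def)
  have gS: "0 < g x" if "x \<in> S" for x
  proof -
    have "g x = (\<Sum>i<n. c i * enn2real (f i i x) * c i)"
      unfolding g_def
    proof (rule sum.cong[OF refl])
      fix i assume i: "i \<in> {..<n}"
      have "(\<Sum>j<n. c i * enn2real (f i j x) * c j) = (\<Sum>j<n. if i = j then c i * enn2real (f i i x) * c i else 0)"
        using i that diag(1) by (intro sum.cong refl) auto
      also have "\<dots> = c i * enn2real (f i i x) * c i" using i by simp
      finally show "(\<Sum>j<n. c i * enn2real (f i j x) * c j) = c i * enn2real (f i i x) * c i" .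
    qed
    also have "\<dots> = (\<Sum>i<n. enn2real (f i i x) * (c i)\<^sup>2)" by (simp add: power2_eq_square mult_ac)
    also have "\<dots> > 0"
    proof -
      obtain i where i: "i < n" "c i \<noteq> 0" using c by blast
      show ?thesis
      proof (rule sum_pos2)
        show "i \<in> {..<n}" using i by simp
        show "0 < enn2real (f i i x) * (c i)\<^sup>2" using i diag(2)[OF i(1) that] by simp
      qed simp_all
    qed
    finally show ?thesis .
  qed
  have "(\<integral>x. g x \<partial>M) \<noteq> 0"
  proof
    assume "(\<integral>x. g x \<partial>M) = 0"
    then have "AE x in M. g x = 0" using integral_nonneg_eq_0_iff_AE[OF gi g0] by simp
    then have "AE x in M. x \<notin> S" by eventually_elim (use gS in force)
    then have "emeasure M {x \<in> space M. x \<in> S} = 0" using S(1) by (subst (asm) AE_iff_measurable[OF _ refl]) auto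
    moreover have "{x \<in> space M. x \<in> S} = S" using sets.sets_into_space[OF S(1)] by auto
    ultimately show False using S(2) by simp
  qed
  moreover have "0 \<le> (\<integral>x. g x \<partial>M)" using g0 by (rule integral_nonneg_AE)
  ultimately show "0 < (\<Sum>i<n. \<Sum>j<n. c i * enn2real (\<integral>\<^sup>+x. f i j x \<partial>M) * c j)" unfolding eq by simp
qed

lemma strictly_psd_scale: "strictly_psd n A \<Longrightarrow> 0 < c \<Longrightarrow> strictly_psd n (\<lambda>i j. c * A i j)"
proof -
  assume A: "strictly_psd n A" and c: "0 < c"
  have "(\<Sum>i<n. \<Sum>j<n. k i * (c * A i j) * k j) = c * (\<Sum>i<n. \<Sum>j<n. k i * A i j * k j)" for k
    by (simp add: sum_distrib_left mult_ac)
  then show ?thesis using A c by (simp add: strictly_psd_def)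
qed

lemma strictly_psd_cong:
  "strictly_psd n A \<Longrightarrow> (\<And>i j. i < n \<Longrightarrow> j < n \<Longrightarrow> A i j = B i j) \<Longrightarrow> strictly_psd n B"
  by (simp add: strictly_psd_def)

lemma strictly_psd_imp_psd:
  assumes "strictly_psd n A"
  shows "psd n A"
  unfolding psd_def
proof
  fix c :: "nat \<Rightarrow> real"
  show "0 \<le> (\<Sum>i<n. \<Sum>j<n. c i * A i j * c j)"
  proof (cases "\<exists>i<n. c i \<noteq> 0")
    case True
    then show ?thesis using assms unfolding strictly_psd_def by (meson less_imp_le)
  next
    case False
    then show ?thesis by simp
  qed
qed

text \<open>Strictness may be lost in a limit. It is saved by a strictly positive definite minorant
  \<open>B\<close> that does not depend on the index.\<close>

lemma strictly_psd_limit: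
  assumes A: "\<And>i j. i < n \<Longrightarrow> j < n \<Longrightarrow> (\<lambda>l. A l i j) \<longlonglongrightarrow> L i j"
    and P: "\<And>l. psd n (\<lambda>i j. A l i j - B i j)" and B: "strictly_psd n B"
  shows "strictly_psd n L"
  unfolding strictly_psd_def
proof (intro allI impI)
  fix c :: "nat \<Rightarrow> real"
  assume c: "\<exists>i<n. c i \<noteq> 0"
  have "(\<Sum>i<n. \<Sum>j<n. c i * B i j * c j) \<le> (\<Sum>i<n. \<Sum>j<n. c i * L i j * c j)"
  proof (rule tendsto_lowerbound)
    show "(\<lambda>l. \<Sum>i<n. \<Sum>j<n. c i * A l i j * c j) \<longlonglongrightarrow> (\<Sum>i<n. \<Sum>j<n. c i * L i j * c j)"
      by (intro tendsto_sum tendsto_mult tendsto_const A) auto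
    have "(\<Sum>i<n. \<Sum>j<n. c i * B i j * c j) \<le> (\<Sum>i<n. \<Sum>j<n. c i * A l i j * c j)" for l
      using P[of l, unfolded psd_def, rule_format, of c]
      by (simp add: right_diff_distrib left_diff_distrib sum_subtractf)
    then show "\<forall>\<^sub>F l in sequentially. (\<Sum>i<n. \<Sum>j<n. c i * B i j * c j) \<le> (\<Sum>i<n. \<Sum>j<n. c i * A l i j * c j)" by simp
  qed simp
  moreover have "0 < (\<Sum>i<n. \<Sum>j<n. c i * B i j * c j)" using B c unfolding strictly_psd_def by blast
  ultimately show "0 < (\<Sum>i<n. \<Sum>j<n. c i * L i j * c j)" by simp
qed

text \<open>The Taylor coefficient (2i choose i) / (4^i (2i+1)) of arcsin, in the form delivered by
  the binomial series of (1 - x^2)^(-1/2).\<close>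

definition arcsin_coeff :: "nat \<Rightarrow> real" where
  "arcsin_coeff i = (-1) ^ i * ((-1/2) gchoose i) / (2 * real i + 1)"

lemma arcsin_coeff_nonneg: "0 \<le> arcsin_coeff i"
proof -
  have "0 \<le> (-1) ^ i * ((-1/2 :: real) gchoose i)"
    by (simp add: gbinomial_pochhammer pochhammer_nonneg power_mult_distrib[symmetric] mult.assoc[symmetric])
  then show ?thesis unfolding arcsin_coeff_def by (intro divide_nonneg_nonneg) auto
qed

lemma arcsin_coeff_0: "arcsin_coeff 0 = 1" and arcsin_coeff_1: "arcsin_coeff 1 = 1 / 6"
  by (simp_all add: arcsin_coeff_def)

lemma arcsin_deriv_sums:
  fixes x :: real
  assumes "\<bar>x\<bar> < 1"
  shows "(\<lambda>i. arcsin_coeff i * (2 * real i + 1) * x ^ (2 * i)) sums (1 / sqrt (1 - x\<^sup>2))"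
proof -
  have "x\<^sup>2 < 1" using assms by (simp add: abs_square_less_1)
  then have "\<bar>- x\<^sup>2\<bar> < 1" by simp
  from gen_binomial_real[OF this, of "-1/2"]
  have "(\<lambda>i. ((-1/2) gchoose i) * (- x\<^sup>2) ^ i) sums (1 + - x\<^sup>2) powr (-1/2)" .
  moreover have "((-1/2) gchoose i) * (- x\<^sup>2) ^ i = arcsin_coeff i * (2 * real i + 1) * x ^ (2 * i)" for i
  proof -
    have "(- x\<^sup>2) ^ i = (-1) ^ i * x ^ (2 * i)" by (simp add: power_minus[of "x\<^sup>2"] power_mult)
    then show ?thesis by (simp add: arcsin_coeff_def)
  qed
  moreover have "(1 + - x\<^sup>2) powr (-1/2) = 1 / sqrt (1 - x\<^sup>2)"
    using \<open>x\<^sup>2 < 1\<close> by (simp add: powr_minus_divide powr_half_sqrt)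
  ultimately show ?thesis by simp
qed

section \<open>The arcsine series\<close>

text \<open>Integrate the binomial series of the derivative term by term: the power series and
  arcsin have the same derivative on (-1, 1) and agree at 0.\<close>

lemma arcsin_sums:
  fixes x :: real
  assumes x: "0 \<le> x" "x < 1"
  shows "(\<lambda>i. arcsin_coeff i * x ^ (2 * i + 1)) sums arcsin x"
proof -
  \<comment> \<open>Differentiation of power series is stated for all exponents, so zeros are
    interleaved.\<close>
  define f where "f n = (if even n then arcsin_coeff (n div 2) else 0)" for n
  define A where "A y = (\<Sum>n. f n * y ^ Suc n)" for y
  have sm: "strict_mono (\<lambda>i::nat. 2 * i)" by (simp add: strict_mono_def)
  have out: "f n = 0" if "n \<notin> range (\<lambda>i::nat. 2 * i)" for n
    using that by (auto simp: f_def elim!: evenE)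
  have S: "(\<lambda>n. f n * real (Suc n) * y ^ n) sums (1 / sqrt (1 - y\<^sup>2))" if "\<bar>y\<bar> < 1" for y
  proof (subst sums_mono_reindex[OF sm, symmetric])
    show "f n * real (Suc n) * y ^ n = 0" if "n \<notin> range (\<lambda>i::nat. 2 * i)" for n using out[OF that] by simp
    show "(\<lambda>i. f (2 * i) * real (Suc (2 * i)) * y ^ (2 * i)) sums (1 / sqrt (1 - y\<^sup>2))"
      using arcsin_deriv_sums[OF that] by (simp add: f_def add.commute)
  qed
  have D: "DERIV A y :> 1 / sqrt (1 - y\<^sup>2)" if "y \<in> {-1<..<1}" for y
  proof -
    have "DERIV (\<lambda>x. \<Sum>n. f n * x ^ Suc n) y :> (\<Sum>n. f n * real (Suc n) * y ^ n)"
      by (rule DERIV_power_series'[of 1]) (use that in \<open>auto intro!: sums_summable[OF S] simp: abs_less_iff simp del: of_nat_Suc\<close>)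
    then show ?thesis unfolding A_def using sums_unique[OF S, of y] that by (simp add: abs_less_iff del: of_nat_Suc)
  qed
  have "A x - arcsin x = A 0 - arcsin 0"
  proof (rule DERIV_isconst3[of "-1" 1 x 0 "\<lambda>y. A y - arcsin y"])
    fix y :: real assume y: "y \<in> {-1<..<1}"
    have "DERIV (\<lambda>y. A y - arcsin y) y :> 1 / sqrt (1 - y\<^sup>2) - inverse (sqrt (1 - y\<^sup>2))"
      by (rule DERIV_diff[OF D[OF y] DERIV_arcsin]) (use y in auto)
    then show "DERIV (\<lambda>y. A y - arcsin y) y :> 0" by (simp add: inverse_eq_divide)
  qed (use x in auto)
  then have Ax: "A x = arcsin x" by (simp add: A_def)
  have sx: "summable (\<lambda>i. arcsin_coeff i * x ^ (2 * i + 1))"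
  proof (rule summable_comparison_test'[where N = 0])
    show "summable (\<lambda>i. arcsin_coeff i * (2 * real i + 1) * x ^ (2 * i))"
      by (rule sums_summable[OF arcsin_deriv_sums]) (use x in simp)
    fix i :: nat
    have "x * 1 \<le> 1 * (2 * real i + 1)" using x by (intro mult_mono) auto
    then have "(arcsin_coeff i * x ^ (2 * i)) * x \<le> (arcsin_coeff i * x ^ (2 * i)) * (2 * real i + 1)"
      using arcsin_coeff_nonneg[of i] x by (intro mult_left_mono) auto
    then show "norm (arcsin_coeff i * x ^ (2 * i + 1)) \<le> arcsin_coeff i * (2 * real i + 1) * x ^ (2 * i)"
      using arcsin_coeff_nonneg[of i] x by (simp add: abs_mult mult_ac)
  qed
  have "(\<lambda>n. f n * x ^ Suc n) sums (\<Sum>i. arcsin_coeff i * x ^ (2 * i + 1))"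
  proof (subst sums_mono_reindex[OF sm, symmetric])
    show "f n * x ^ Suc n = 0" if "n \<notin> range (\<lambda>i::nat. 2 * i)" for n using out[OF that] by simp
    show "(\<lambda>i. f (2 * i) * x ^ Suc (2 * i)) sums (\<Sum>i. arcsin_coeff i * x ^ (2 * i + 1))"
      using summable_sums[OF sx] by (simp add: f_def)
  qed
  from sums_unique[OF this] have "(\<Sum>i. arcsin_coeff i * x ^ (2 * i + 1)) = arcsin x"
    unfolding Ax[symmetric] A_def by simp
  with summable_sums[OF sx] show ?thesis by simp
qed

lemma nonneg_poly_add: "nonneg_poly p \<Longrightarrow> nonneg_poly q \<Longrightarrow> nonneg_poly (p + q)"
  and nonneg_poly_smult: "nonneg_poly p \<Longrightarrow> 0 \<le> c \<Longrightarrow> nonneg_poly (smult c p)"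
  and nonneg_poly_monom: "0 \<le> c \<Longrightarrow> nonneg_poly (monom c m)"
  by (simp_all add: nonneg_poly_def)

lemma nonneg_poly_mult: "nonneg_poly p \<Longrightarrow> nonneg_poly q \<Longrightarrow> nonneg_poly (p * q)"
  by (simp add: nonneg_poly_def coeff_mult sum_nonneg)

lemma nonneg_poly_power: "nonneg_poly p \<Longrightarrow> nonneg_poly (p ^ m)"
  by (induction m) (auto intro: nonneg_poly_mult simp: nonneg_poly_def[of 1] coeff_1)

lemma nonneg_poly_sum: "(\<And>i. i \<in> S \<Longrightarrow> nonneg_poly (f i)) \<Longrightarrow> nonneg_poly (sum f S)"
  by (simp add: nonneg_poly_def coeff_sum sum_nonneg)

lemma vanishes_power:
  assumes "vanishes 1 p"
  shows "vanishes m (p ^ m)"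
proof -
  obtain p' where "p = pCons 0 p'" using assms by (cases p) (auto simp: vanishes_def)
  then have "p = monom 1 1 * p'" by (simp add: monom_altdef)
  then have "p ^ m = monom 1 m * p' ^ m" by (simp add: power_mult_distrib monom_power)
  then show ?thesis by (simp add: vanishes_def coeff_monom_mult)
qed

text \<open>Partial sums of the expansion of \<open>arcsin (a + h) - arcsin a\<close> in powers of \<open>h\<close>.\<close>

definition arcsin_poly :: "real \<Rightarrow> nat \<Rightarrow> real poly" where
  "arcsin_poly a n = (\<Sum>i<n + 2. smult (arcsin_coeff i) ([:a, 1:] ^ (2 * i + 1) - [:a ^ (2 * i + 1):]))"

lemma poly_arcsin_poly:
  "poly (arcsin_poly a n) h = (\<Sum>i<n + 2. arcsin_coeff i * (a + h) ^ (2 * i + 1)) - (\<Sum>i<n + 2. arcsin_coeff i * a ^ (2 * i + 1))"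
  by (simp add: arcsin_poly_def poly_sum poly_power sum_subtractf algebra_simps del: sum.lessThan_Suc)

lemma vanishes_arcsin_poly: "vanishes 1 (arcsin_poly a n)"
proof -
  have "coeff (arcsin_poly a n) 0 = 0" unfolding poly_0_coeff_0[symmetric] poly_arcsin_poly by simp
  then show ?thesis by (simp add: vanishes_def)
qed

context
  fixes a :: real
  assumes a: "0 \<le> a"
begin

lemma nonneg_linear_power: "nonneg_poly ([:a, 1:] ^ k - [:a ^ k:])"
proof -
  have n: "nonneg_poly ([:a, 1:] ^ k)"
    by (rule nonneg_poly_power) (use a in \<open>auto simp: nonneg_poly_def coeff_pCons split: nat.split\<close>)
  have "coeff ([:a, 1:] ^ k) 0 = a ^ k" unfolding poly_0_coeff_0[symmetric] by (simp add: poly_power)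
  with n show ?thesis unfolding nonneg_poly_def by (auto simp: coeff_pCons split: nat.split)
qed

text \<open>The range n + 2 always includes the terms i = 0, equal to h, and i = 1, equal to h^3/6
  plus lower terms with nonnegative coefficients. Hence both lower bounds are uniform in n and in a
  \<ge> 0.\<close>

lemma arcsin_poly_bounds:
  shows "nonneg_poly (arcsin_poly a n)" "nonneg_poly (arcsin_poly a n - monom 1 1)" "nonneg_poly (arcsin_poly a n - monom (1 / 6) 3)"
proof -
  define R where "R = (\<Sum>i<n. smult (arcsin_coeff (Suc (Suc i))) ([:a, 1:] ^ (2 * Suc (Suc i) + 1) - [:a ^ (2 * Suc (Suc i) + 1):]))"
  have R: "nonneg_poly R" unfolding R_def
    by (intro nonneg_poly_sum nonneg_poly_smult nonneg_linear_power arcsin_coeff_nonneg)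
  have 0: "smult (arcsin_coeff 0) ([:a, 1:] ^ (2 * 0 + 1) - [:a ^ (2 * 0 + 1):]) = monom 1 1"
    by (simp add: arcsin_coeff_0 monom_altdef)
  have 1: "smult (arcsin_coeff (Suc 0)) ([:a, 1:] ^ (2 * Suc 0 + 1) - [:a ^ (2 * Suc 0 + 1):]) = monom (1 / 6) 3 + [:0, a\<^sup>2 / 2, a / 2:]"
    using arcsin_coeff_1 by (simp add: monom_altdef numeral_3_eq_3 power2_eq_square field_simps)
  have eq: "arcsin_poly a n = monom 1 1 + (monom (1 / 6) 3 + [:0, a\<^sup>2 / 2, a / 2:] + R)"
    unfolding arcsin_poly_def R_def 0[symmetric] 1[symmetric]
    by (simp only: add_2_eq_Suc' sum.lessThan_Suc_shift add.assoc)
  have Q: "nonneg_poly [:0, a\<^sup>2 / 2, a / 2:]" using a by (auto simp: nonneg_poly_def coeff_pCons split: nat.split)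
  have M: "nonneg_poly (monom 1 1)" "nonneg_poly (monom (1 / 6) 3)" by (simp_all add: nonneg_poly_monom)
  show "nonneg_poly (arcsin_poly a n)" unfolding eq by (intro nonneg_poly_add R Q M)
  have "arcsin_poly a n - monom 1 1 = monom (1 / 6) 3 + [:0, a\<^sup>2 / 2, a / 2:] + R" unfolding eq by simp
  then show "nonneg_poly (arcsin_poly a n - monom 1 1)" by (simp only:) (intro nonneg_poly_add R Q M)
  have "arcsin_poly a n - monom (1 / 6) 3 = monom 1 1 + [:0, a\<^sup>2 / 2, a / 2:] + R" unfolding eq by simp
  then show "nonneg_poly (arcsin_poly a n - monom (1 / 6) 3)" by (simp only:) (intro nonneg_poly_add R Q M)
qed

text \<open>The higher order term of the expansion that is responsible for strictness.\<close>

lemma arcsin_poly_power_bound: "nonneg_poly (arcsin_poly a n ^ Suc m - monom (1 / 6) (m + 3))"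
proof (induction m)
  case 0
  then show ?case using arcsin_poly_bounds(3) by simp
next
  case (Suc m)
  let ?p = "arcsin_poly a n"
  have "?p ^ Suc (Suc m) - monom (1 / 6) (Suc m + 3) = ?p * (?p ^ Suc m - monom (1 / 6) (m + 3)) + (?p - monom 1 1) * monom (1 / 6) (m + 3)"
    by (simp add: algebra_simps mult_monom)
  also have "nonneg_poly \<dots>"
    by (intro nonneg_poly_add nonneg_poly_mult arcsin_poly_bounds Suc.IH nonneg_poly_monom) simp
  finally show ?case .
qed

end

section \<open>Truncated powers as mixtures over the truncation point\<close>

lemma tr_add: "tr a (E + F) x = tr a E x + tr a F x"
  by (simp add: tr_def)

lemma cosK_add:
  assumes "nonneg_poly E" "nonneg_poly F"
  shows "cosK a (E + F) \<theta> = cosK a E \<theta> + cosK a F \<theta>"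
  unfolding cosK_def
  by (subst nn_integral_add[symmetric])
    (auto simp: tr_add ennreal_plus tr_nonneg assms distrib_left)

lemma tr_monom: "tr a (monom c m) x = (if a < x then c * (x - a) ^ m else 0)"
  by (simp add: tr_def poly_monom)

text \<open>The integral of (x - a) (w - x)^m over [a, w] equals (w - a)^(m+2) / ((m+1) (m+2)).
  Because w \<le> 1, the mixing interval (a, 1) can be chosen independently of w.\<close>

lemma tr_monom_mixture:
  assumes "w \<le> 1" and c: "0 \<le> c"
  shows "(\<integral>\<^sup>+x. ennreal (indicator {a<..<1} x * (c * ((real m + 1) * (real m + 2)) * (x - a))) * ennreal (tr x (monom 1 m) w) \<partial>lborel)
    = ennreal (tr a (monom c (m + 2)) w)"
proof (cases "a < w")
  case True
  let ?f = "\<lambda>x. c * ((real m + 1) * (real m + 2)) * (x - a) * (w - x) ^ m"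
  have hi: "(?f has_integral - c * ((real m + 2) * (w - a) * (w - w) ^ Suc m + (w - w) ^ Suc (Suc m))
      - - c * ((real m + 2) * (a - a) * (w - a) ^ Suc m + (w - a) ^ Suc (Suc m))) {a..w}"
  proof (rule fundamental_theorem_of_calculus)
    show "a \<le> w" using True by simp
    fix x
    have "((\<lambda>x. - c * ((real m + 2) * (x - a) * (w - x) ^ Suc m + (w - x) ^ Suc (Suc m))) has_real_derivative
      - c * ((real m + 2) * (w - x) ^ Suc m + (real m + 2) * (x - a) * (real (Suc m) * (w - x) ^ m * - 1) + real (Suc (Suc m)) * (w - x) ^ Suc m * - 1)) (at x within {a..w})"
      by (rule DERIV_cong, (rule derivative_eq_intros refl)+, simp add: algebra_simps del: power_Suc)
    also have "- c * ((real m + 2) * (w - x) ^ Suc m + (real m + 2) * (x - a) * (real (Suc m) * (w - x) ^ m * - 1) + real (Suc (Suc m)) * (w - x) ^ Suc m * - 1) = ?f x"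
    proof -
      have "- c * (p * z + p * y * (r * v * - 1) + p * z * - 1) = c * (r * p) * y * v" for c p y z r v :: real
        by (simp add: algebra_simps)
      from this[of c "real m + 2" "(w - x) ^ Suc m" "x - a" "real m + 1" "(w - x) ^ m"]
      show ?thesis by (simp only: of_nat_Suc add.assoc one_add_one)  (simp add: add_ac)
    qed
    finally show "((\<lambda>x. - c * ((real m + 2) * (x - a) * (w - x) ^ Suc m + (w - x) ^ Suc (Suc m))) has_vector_derivative ?f x) (at x within {a..w})"
      unfolding has_real_derivative_iff_has_vector_derivative .
  qed
  have "(\<integral>\<^sup>+x. ennreal (indicator {a<..<1} x * (c * ((real m + 1) * (real m + 2)) * (x - a))) * ennreal (tr x (monom 1 m) w) \<partial>lborel)
    = (\<integral>\<^sup>+x. ennreal (indicator {a..w} x * ?f x) \<partial>lborel)"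
  proof (rule nn_integral_cong_AE)
    have "AE x in lborel. x \<noteq> a \<and> x \<noteq> w" by (intro AE_conjI AE_lborel_singleton)
    then show "AE x in lborel. ennreal (indicator {a<..<1} x * (c * ((real m + 1) * (real m + 2)) * (x - a))) * ennreal (tr x (monom 1 m) w)
      = ennreal (indicator {a..w} x * ?f x)"
    proof eventually_elim
      case (elim x)
      show ?case
      proof (cases "a < x \<and> x < w")
        case True
        then have "0 \<le> (w - x) ^ m" by simp
        then show ?thesis using True assms(1)
          by (simp add: tr_monom indicator_def ennreal_mult''[symmetric])
      next
        case False
        then show ?thesis using elim by (auto simp: tr_monom indicator_def)
      qed
    qed
  qed
  also have "\<dots> = ennreal (c * (w - a) ^ Suc (Suc m))"
  proof -
    have "?f \<in> borel_measurable borel" by measurable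
    moreover have "0 \<le> ?f x" if "x \<in> {a..w}" for x using that c by (auto intro!: mult_nonneg_nonneg)
    ultimately show ?thesis using nn_integral_Icc[OF _ _ hi] by simp
  qed
  finally show ?thesis using True by (simp add: tr_monom)
next
  case False
  have "ennreal (indicator {a<..<1} x * (c * ((real m + 1) * (real m + 2)) * (x - a))) * ennreal (tr x (monom 1 m) w) = 0" for x
    using False by (cases "a < x") (auto simp: tr_monom)
  note z = this
  show ?thesis unfolding z using False by (simp add: tr_monom)
qed

lemma tr_monom_measurable [measurable]: "(\<lambda>(x, w). tr x (monom c m) w) \<in> borel_measurable (borel \<Otimes>\<^sub>M borel)"
  unfolding tr_monom by measurable

lemma cosK_measurable [measurable]: "(\<lambda>x. cosK x (monom c m) \<theta>) \<in> borel_measurable borel"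
  unfolding cosK_def by measurable

lemma cosK_mixture:
  assumes "0 \<le> c"
  shows "cosK a (monom c (m + 2)) \<theta>
    = (\<integral>\<^sup>+x. ennreal (indicator {a<..<1} x * (c * ((real m + 1) * (real m + 2)) * (x - a))) * cosK x (monom 1 m) \<theta> \<partial>lborel)"
proof -
  have "cosK a (monom c (m + 2)) \<theta> = (\<integral>\<^sup>+\<phi>. \<integral>\<^sup>+x. indicator {\<theta>..pi} \<phi> *
    (ennreal (indicator {a<..<1} x * (c * ((real m + 1) * (real m + 2)) * (x - a))) * ennreal (tr x (monom 1 m) (cos (\<phi> / 2)))) \<partial>lborel \<partial>lborel)"
    unfolding cosK_def by (subst nn_integral_cmult) (simp_all add: tr_monom_mixture assms)
  also have "\<dots> = (\<integral>\<^sup>+x. \<integral>\<^sup>+\<phi>. indicator {\<theta>..pi} \<phi> *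
    (ennreal (indicator {a<..<1} x * (c * ((real m + 1) * (real m + 2)) * (x - a))) * ennreal (tr x (monom 1 m) (cos (\<phi> / 2)))) \<partial>lborel \<partial>lborel)"
    by (rule lborel_pair.Fubini') measurable
  also have "\<dots> = (\<integral>\<^sup>+x. ennreal (indicator {a<..<1} x * (c * ((real m + 1) * (real m + 2)) * (x - a))) * cosK x (monom 1 m) \<theta> \<partial>lborel)"
  proof (rule nn_integral_cong)
    fix x
    have "(\<integral>\<^sup>+\<phi>. indicator {\<theta>..pi} \<phi> * (W * ennreal (tr x (monom 1 m) (cos (\<phi> / 2)))) \<partial>lborel) = W * cosK x (monom 1 m) \<theta>" for W
      unfolding cosK_def by (subst nn_integral_cmult[symmetric]) (simp_all add: mult_ac)
    then show "(\<integral>\<^sup>+\<phi>. indicator {\<theta>..pi} \<phi> *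
      (ennreal (indicator {a<..<1} x * (c * ((real m + 1) * (real m + 2)) * (x - a))) * ennreal (tr x (monom 1 m) (cos (\<phi> / 2)))) \<partial>lborel)
      = ennreal (indicator {a<..<1} x * (c * ((real m + 1) * (real m + 2)) * (x - a))) * cosK x (monom 1 m) \<theta>" .
  qed
  finally show ?thesis .
qed

text \<open>The cosine decreases, so on [\<theta>, \<pi>] it stays below the truncation point. This
  annihilates the off-diagonal entries in the strictness argument.\<close>

lemma cosK_zero:
  assumes "0 \<le> \<theta>" "\<theta> \<le> pi" "cos (\<theta> / 2) \<le> x"
  shows "cosK x E \<theta> = 0"
proof -
  have "indicator {\<theta>..pi} \<phi> * ennreal (tr x E (cos (\<phi> / 2))) = 0" for \<phi>
  proof (cases "\<phi> \<in> {\<theta>..pi}")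
    case True
    then have "cos (\<phi> / 2) \<le> cos (\<theta> / 2)" using assms by (intro cos_monotone_0_pi_le) auto
    then show ?thesis using assms(3) by (simp add: tr_def)
  qed simp
  note z = this
  show ?thesis unfolding cosK_def z by simp
qed

lemma cosK_pos:
  assumes "0 \<le> x" "x < 1"
  shows "0 < cosK x (monom 1 m) 0"
proof -
  \<comment> \<open>For \<phi> in [0, y] the cosine of \<phi>/2 is at least the midpoint of x and 1,
    so the integrand is at least ((1 - x)/2)^m there.\<close>
  define y where "y = arccos ((1 + x) / 2)"
  have y: "0 < y" "y \<le> pi / 2" unfolding y_def using assms arccos_lt_bounded[of "(1 + x) / 2"] arccos_le_pi2[of "(1 + x) / 2"]
    by simp_all
  have cy: "cos y = (1 + x) / 2" unfolding y_def using assms by (intro cos_arccos) auto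
  have "0 < ennreal (((1 - x) / 2) ^ m) * ennreal y" using assms y by (simp add: ennreal_zero_less_mult_iff)
  also have "ennreal (((1 - x) / 2) ^ m) * ennreal y = (\<integral>\<^sup>+\<phi>. ennreal (((1 - x) / 2) ^ m) * indicator {0..y} \<phi> \<partial>lborel)"
    using y by (subst nn_integral_cmult_indicator) auto
  also have "\<dots> \<le> cosK x (monom 1 m) 0"
    unfolding cosK_def
  proof (rule nn_integral_mono)
    fix \<phi> :: real
    show "ennreal (((1 - x) / 2) ^ m) * indicator {0..y} \<phi> \<le> indicator {0..pi} \<phi> * ennreal (tr x (monom 1 m) (cos (\<phi> / 2)))"
    proof (cases "\<phi> \<in> {0..y}")
      case True
      have "cos y \<le> cos (\<phi> / 2)" using True y by (intro cos_monotone_0_pi_le) auto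
      then have h: "(1 - x) / 2 \<le> cos (\<phi> / 2) - x" unfolding cy by (simp add: field_simps)
      moreover have p: "0 < (1 - x) / 2" using assms by simp
      ultimately have "x < cos (\<phi> / 2)" by linarith
      moreover have "((1 - x) / 2) ^ m \<le> (cos (\<phi> / 2) - x) ^ m" using h p by (intro power_mono) auto
      ultimately show ?thesis using True y pi_gt_zero by (auto simp: tr_monom intro!: ennreal_leI)
    qed simp
  qed
  finally show ?thesis .
qed

lemma arcsin_poly_tendsto:
  assumes a: "0 \<le> a" "a \<le> w" "w < 1"
  shows "(\<lambda>n. poly (arcsin_poly a n) (w - a)) \<longlonglongrightarrow> arcsin w - arcsin a" (is ?lim)
    and "poly (arcsin_poly a n) (w - a) \<le> arcsin w - arcsin a"
proof -
  have "(\<lambda>n. \<Sum>i<n + 2. arcsin_coeff i * x ^ (2 * i + 1)) \<longlonglongrightarrow> arcsin x" if "0 \<le> x" "x < 1" for x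
    using LIMSEQ_ignore_initial_segment[OF arcsin_sums[OF that, unfolded sums_def]] .
  from tendsto_diff[OF this[of w] this[of a]] show L: ?lim
    unfolding poly_arcsin_poly using a by simp
  have "incseq (\<lambda>n. poly (arcsin_poly a n) (w - a))"
  proof (rule incseq_SucI)
    fix n
    have "0 \<le> arcsin_coeff (n + 2) * (w ^ (2 * (n + 2) + 1) - a ^ (2 * (n + 2) + 1))"
      by (intro mult_nonneg_nonneg arcsin_coeff_nonneg) (simp only: diff_ge_0_iff_ge power_mono[OF a(2,1)])
    then show "poly (arcsin_poly a n) (w - a) \<le> poly (arcsin_poly a (Suc n)) (w - a)"
      unfolding poly_arcsin_poly by (simp add: right_diff_distrib)
  qed
  from incseq_le[OF this L] show "poly (arcsin_poly a n) (w - a) \<le> arcsin w - arcsin a" .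
qed

text \<open>As cos (\<phi>/2) = sin (\<pi>/2 - \<phi>/2), the difference of the two arcsines is (t -
  \<phi>)/2. The value \<phi> = 0 is excluded to keep w < 1, where \<open>arcsin_sums\<close>
  applies.\<close>

lemma tr_arcsin_poly:
  assumes t: "0 < t" "t \<le> pi" and \<phi>: "0 < \<phi>" "\<phi> \<le> pi" and m: "0 < m"
  shows "(\<lambda>n. tr (cos (t / 2)) (arcsin_poly (cos (t / 2)) n ^ m) (cos (\<phi> / 2))) \<longlonglongrightarrow> max 0 ((t - \<phi>) / 2) ^ m" (is ?lim)
    and "tr (cos (t / 2)) (arcsin_poly (cos (t / 2)) n ^ m) (cos (\<phi> / 2)) \<le> max 0 ((t - \<phi>) / 2) ^ m" (is ?bound)
proof -
  define a w where "a = cos (t / 2)" and "w = cos (\<phi> / 2)"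
  have a: "0 \<le> a" unfolding a_def using t by (intro cos_ge_zero) auto
  have aw: "a < w \<longleftrightarrow> \<phi> < t" unfolding a_def w_def using t \<phi> by (subst cos_mono_less_eq) auto
  have "?lim \<and> ?bound"
  proof (cases "\<phi> < t")
    case True
    have w: "w < 1" unfolding w_def using \<phi> cos_monotone_0_pi[of 0 "\<phi> / 2"] by simp
    have as: "arcsin (cos (x / 2)) = pi / 2 - x / 2" if "0 \<le> x" "x \<le> pi" for x
    proof -
      have "cos (x / 2) = sin (pi / 2 - x / 2)" by (simp add: sin_diff)
      then show ?thesis by (simp only:) (rule arcsin_sin; use that in \<open>simp add: field_simps\<close>)
    qed
    have d: "arcsin w - arcsin a = (t - \<phi>) / 2"
      unfolding a_def w_def using as[of t] as[of \<phi>] t \<phi> by (simp add: diff_divide_distrib)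
    have e: "tr a (arcsin_poly a n ^ m) w = poly (arcsin_poly a n) (w - a) ^ m" for n
      using True aw by (simp add: tr_def poly_power)
    note l = arcsin_poly_tendsto[OF a, of w, unfolded d]
    have n: "0 \<le> poly (arcsin_poly a n) (w - a)" for n
      using True aw by (intro nonneg_poly_poly_nonneg arcsin_poly_bounds(1) a) auto
    have "max 0 ((t - \<phi>) / 2) = (t - \<phi>) / 2" using True by simp
    then show ?thesis unfolding a_def[symmetric] w_def[symmetric] e
      using True aw w by (auto intro!: tendsto_power l power_mono n)
  next
    case False
    then have "max 0 ((t - \<phi>) / 2) = 0" by simp
    moreover have "tr a (arcsin_poly a n ^ m) w = 0" for n using False aw by (simp add: tr_def)
    ultimately show ?thesis unfolding a_def[symmetric] w_def[symmetric] using m by (simp add: zero_power)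
  qed
  then show ?lim ?bound by auto
qed

lemma nn_integral_trunc_power:
  assumes m: "0 < m" and "0 \<le> \<theta>" "t \<le> pi"
  shows "(\<integral>\<^sup>+\<phi>. indicator {\<theta>..pi} \<phi> * ennreal (max 0 ((t - \<phi>) / 2) ^ m) \<partial>lborel)
    = ennreal (1 / (2 ^ m * real (Suc m)) * max 0 (t - \<theta>) ^ Suc m)"
proof (cases "\<theta> < t")
  case True
  define K where "K = 1 / (2 ^ m * real (Suc m))"
  have hi: "((\<lambda>\<phi>. ((t - \<phi>) / 2) ^ m) has_integral - K * (t - t) ^ Suc m - - K * (t - \<theta>) ^ Suc m) {\<theta>..t}"
  proof (rule fundamental_theorem_of_calculus)
    fix x
    have "((\<lambda>x. - K * (t - x) ^ Suc m) has_real_derivative - K * (real (Suc m) * (t - x) ^ m * - 1)) (at x within {\<theta>..t})"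
      by (rule DERIV_cong, (rule derivative_eq_intros refl)+, simp)
    also have "- K * (real (Suc m) * (t - x) ^ m * - 1) = ((t - x) / 2) ^ m" by (simp add: K_def power_divide)
    finally show "((\<lambda>x. - K * (t - x) ^ Suc m) has_vector_derivative ((t - x) / 2) ^ m) (at x within {\<theta>..t})"
      unfolding has_real_derivative_iff_has_vector_derivative .
  qed (use True in simp)
  have "(\<integral>\<^sup>+\<phi>. indicator {\<theta>..pi} \<phi> * ennreal (max 0 ((t - \<phi>) / 2) ^ m) \<partial>lborel)
    = (\<integral>\<^sup>+\<phi>. ennreal (indicator {\<theta>..t} \<phi> * ((t - \<phi>) / 2) ^ m) \<partial>lborel)"
  proof (rule nn_integral_cong)
    fix \<phi>
    show "indicator {\<theta>..pi} \<phi> * ennreal (max 0 ((t - \<phi>) / 2) ^ m) = ennreal (indicator {\<theta>..t} \<phi> * ((t - \<phi>) / 2) ^ m)"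
    proof (cases "\<phi> \<le> t")
      case True
      then have "max 0 ((t - \<phi>) / 2) = (t - \<phi>) / 2" by simp
      then show ?thesis using True assms by (auto simp: indicator_def)
    next
      case False
      then have "max 0 ((t - \<phi>) / 2) = 0" by simp
      then show ?thesis using False m by (simp add: indicator_def)
    qed
  qed
  also have "\<dots> = ennreal (1 / (2 ^ m * real (Suc m)) * (t - \<theta>) ^ Suc m)"
    using True by (subst nn_integral_Icc[OF _ _ hi]) (simp_all add: K_def)
  finally show ?thesis using True by simp
next
  case False
  have "indicator {\<theta>..pi} \<phi> * ennreal (max 0 ((t - \<phi>) / 2) ^ m) = 0" for \<phi>
  proof (cases "\<theta> \<le> \<phi>")
    case True
    then have "max 0 ((t - \<phi>) / 2) = 0" using False by simp
    then show ?thesis using m by simp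
  qed simp
  note z = this
  show ?thesis unfolding z using False by simp
qed

lemma trunc_power_nat: "0 < k \<Longrightarrow> trunc_power t (real k) \<theta> = max 0 (t - \<theta>) ^ k"
  by (cases "\<theta> < t") (auto simp: trunc_power_def powr_realpow)

lemma cosK_arcsin_poly_tendsto:
  assumes t: "0 < t" "t \<le> pi" and \<theta>: "0 \<le> \<theta>" "\<theta> \<le> pi" and m: "0 < m"
  shows "(\<lambda>n. enn2real (cosK (cos (t / 2)) (arcsin_poly (cos (t / 2)) n ^ m) \<theta>))
    \<longlonglongrightarrow> 1 / (2 ^ m * real (Suc m)) * trunc_power t (real (Suc m)) \<theta>"
proof -
  let ?H = "\<lambda>\<phi>. indicator {\<theta>..pi} \<phi> * ennreal (max 0 ((t - \<phi>) / 2) ^ m)"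
  have I: "(\<integral>\<^sup>+\<phi>. ?H \<phi> \<partial>lborel) = ennreal (1 / (2 ^ m * real (Suc m)) * max 0 (t - \<theta>) ^ Suc m)"
    by (rule nn_integral_trunc_power[OF m \<theta>(1) t(2)])
  have ae: "AE \<phi> in lborel. \<phi> \<noteq> (0::real)" by (rule AE_lborel_singleton)
  have "(\<lambda>n. cosK (cos (t / 2)) (arcsin_poly (cos (t / 2)) n ^ m) \<theta>) \<longlonglongrightarrow> (\<integral>\<^sup>+\<phi>. ?H \<phi> \<partial>lborel)"
    unfolding cosK_def
  proof (rule nn_integral_dominated_convergence[where w = ?H])
    show "(\<integral>\<^sup>+\<phi>. ?H \<phi> \<partial>lborel) < \<infinity>" unfolding I by simp
    show "AE \<phi> in lborel. indicator {\<theta>..pi} \<phi> * ennreal (tr (cos (t / 2)) (arcsin_poly (cos (t / 2)) n ^ m) (cos (\<phi> / 2))) \<le> ?H \<phi>" for n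
      using ae
    proof eventually_elim
      case (elim \<phi>)
      then show ?case using \<theta> tr_arcsin_poly(2)[OF t _ _ m, of \<phi> n] by (auto simp: indicator_def intro!: ennreal_leI)
    qed
    show "AE \<phi> in lborel. (\<lambda>n. indicator {\<theta>..pi} \<phi> * ennreal (tr (cos (t / 2)) (arcsin_poly (cos (t / 2)) n ^ m) (cos (\<phi> / 2)))) \<longlonglongrightarrow> ?H \<phi>"
      using ae
    proof eventually_elim
      case (elim \<phi>)
      then show ?case using \<theta> tr_arcsin_poly(1)[OF t _ _ m, of \<phi>] by (auto simp: indicator_def intro!: tendsto_ennrealI)
    qed
  qed measurable
  from tendsto_enn2real[OF this[unfolded I]] show ?thesis
    unfolding trunc_power_nat[OF zero_less_Suc] by simp
qed

lemma arc_of_1: "arc_of 1 = 0" and arc_of_pos: "0 \<le> v \<Longrightarrow> v < 1 \<Longrightarrow> 0 < arc_of v"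
proof -
  show "arc_of 1 = 0" by (simp add: arc_of_def)
  assume "0 \<le> v" "v < 1"
  then show "0 < arc_of v" unfolding arc_of_def
    using arccos_lt_bounded[of "sqrt v"] less_le_trans[of "-1" 0 "sqrt v"] by simp
qed

section \<open>Strict positive definiteness at the critical exponent\<close>

context inverse_point_law begin

context
  fixes n :: nat and x :: "nat \<Rightarrow> 'b"
  assumes x: "\<And>i. i < n \<Longrightarrow> x i \<in> X"
    and diag: "\<And>i. i < n \<Longrightarrow> u (x i) (x i) = 1"
    and offdiag: "\<And>i j. i < n \<Longrightarrow> j < n \<Longrightarrow> i \<noteq> j \<Longrightarrow> u (x i) (x j) < 1"
begin

definition arc_mat :: "nat \<Rightarrow> nat \<Rightarrow> real" where "arc_mat i j = arc_of (u (x i) (x j))"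

lemma arc_mat_bounds: "i < n \<Longrightarrow> j < n \<Longrightarrow> 0 \<le> arc_mat i j" "i < n \<Longrightarrow> j < n \<Longrightarrow> arc_mat i j \<le> pi"
  unfolding arc_mat_def
  by (rule arc_of_bounds[OF u_nonneg[OF x x] u_le_1[OF x x]]; assumption)+

lemma arc_mat_diag: "i < n \<Longrightarrow> arc_mat i i = 0"
  by (simp add: arc_mat_def diag arc_of_1)

lemma arc_mat_separated: "\<exists>s>0. \<forall>i<n. \<forall>j<n. i \<noteq> j \<longrightarrow> s \<le> arc_mat i j"
proof -
  define A where "A = insert 1 ((\<lambda>(i, j). arc_mat i j) ` {p \<in> {..<n} \<times> {..<n}. fst p \<noteq> snd p})"
  have "finite A" "A \<noteq> {}" by (auto simp: A_def)
  have p: "0 < arc_mat i j" if "i < n" "j < n" "i \<noteq> j" for i j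
    unfolding arc_mat_def by (rule arc_of_pos[OF u_nonneg[OF x x] offdiag]; rule that)
  have "0 < y" if "y \<in> A" for y using that p unfolding A_def by auto
  then have "0 < Min A" using \<open>finite A\<close> \<open>A \<noteq> {}\<close> by simp
  moreover have "Min A \<le> arc_mat i j" if "i < n" "j < n" "i \<noteq> j" for i j
  proof (rule Min_le[OF \<open>finite A\<close>])
    show "arc_mat i j \<in> A" unfolding A_def using that by (intro insertI2 image_eqI[of _ _ "(i, j)"]) simp_all
  qed
  ultimately show ?thesis by (intro exI[of _ "Min A"] conjI allI impI)
qed

lemma strictly_psd_cosK_monom:
  assumes a: "0 \<le> a" "a < 1" and c: "0 < c"
  shows "strictly_psd n (\<lambda>i j. enn2real (cosK a (monom c (q + r + 2)) (arc_mat i j)))"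
proof -
  obtain s where s: "0 < s" "\<And>i j. i < n \<Longrightarrow> j < n \<Longrightarrow> i \<noteq> j \<Longrightarrow> s \<le> arc_mat i j"
    using arc_mat_separated by blast
  \<comment> \<open>For n \<le> 1 nothing bounds \<open>s\<close> from above; the cap keeps s'/2
    where the cosine is monotone.\<close>
  define s' where "s' = min s pi"
  have s': "0 < s'" "s' \<le> pi" using s by (auto simp: s'_def)
  define m where "m = q + r"
  define wt where "wt y = c * ((real m + 1) * (real m + 2)) * (y - a)" for y
  define f where "f i j y = ennreal (indicator {a<..<1} y * wt y) * cosK y (monom 1 m) (arc_mat i j)" for i j y
  define B where "B = max a (cos (s' / 2))"
  have cs: "cos (s' / 2) < 1" using s' cos_monotone_0_pi[of 0 "s' / 2"] by simp
  have B: "a \<le> B" "B < 1" "cos (s' / 2) \<le> B" using a cs by (auto simp: B_def)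
  have I: "(\<integral>\<^sup>+y. f i j y \<partial>lborel) = cosK a (monom c (m + 2)) (arc_mat i j)" for i j
    unfolding f_def wt_def using cosK_mixture[of c a m "arc_mat i j"] c by simp
  have wt: "0 < wt y" if "a < y" for y using that c by (simp add: wt_def)
  have "strictly_psd n (\<lambda>i j. enn2real (\<integral>\<^sup>+y. f i j y \<partial>lborel))"
  proof (rule strictly_psd_integral[where S = "{B<..<1}"])
    show "f i j \<in> borel_measurable lborel" for i j unfolding f_def wt_def by measurable
    show "(\<integral>\<^sup>+y. f i j y \<partial>lborel) < \<infinity>" if "i < n" "j < n" for i j
      unfolding I using c by (intro cosK_finite nonneg_poly_monom arc_mat_bounds that) simp
    show "AE y in lborel. psd n (\<lambda>i j. enn2real (f i j y))"
    proof (rule AE_I2)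
      fix y
      show "psd n (\<lambda>i j. enn2real (f i j y))"
      proof (cases "a < y \<and> y < 1")
        case True
        have "psd n (\<lambda>i j. enn2real (cosK y (monom 1 m) (arc_mat i j)))"
          unfolding arc_mat_def using True a
          by (intro psd_cosK x nonneg_poly_monom) (auto simp: vanishes_def m_def)
        from psd_scale[OF this less_imp_le[OF wt]] show ?thesis
          using True wt[of y] by (simp add: f_def enn2real_mult less_imp_le)
      next
        case False
        then have "f i j y = 0" for i j by (auto simp: f_def)
        then show ?thesis by (simp add: psd_def)
      qed
    qed
    show "{B<..<1} \<in> sets lborel" by simp
    show "0 < emeasure lborel {B<..<1}" using B by simp
  next
    fix i j y assume "i < n" "j < n" "i \<noteq> j" "y \<in> {B<..<1}"
    moreover have "cos (arc_mat i j / 2) \<le> cos (s' / 2)" if "i < n" "j < n" "i \<noteq> j"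
      using s(2)[OF that] arc_mat_bounds[OF that(1,2)] s' by (intro cos_monotone_0_pi_le) (auto simp: s'_def)
    ultimately show "f i j y = 0"
      using B arc_mat_bounds[of i j] by (simp add: f_def cosK_zero)
  next
    fix i y assume i: "i < n" "y \<in> {B<..<1}"
    then have y: "a < y" "0 \<le> y" "y < 1" using B a by auto
    have "0 < enn2real (cosK y (monom 1 m) 0)"
      using cosK_pos[OF y(2,3), of m] cosK_finite[of "monom 1 m" 0 y] nonneg_poly_monom[of 1 m]
      by (simp add: enn2real_positive_iff)
    then show "0 < enn2real (f i i y)"
      using wt[OF y(1)] y i by (simp add: f_def arc_mat_diag enn2real_mult)
  qed
  then show ?thesis unfolding I m_def .
qed

text \<open>Removing h^(m+2)/6 from the m-th power of the arcsine polynomial leaves nonnegative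
  coefficients and vanishing of order m, hence a positive semidefinite kernel; the removed part is
  the fixed minorant that keeps the limit strict. Degree m + 1 would not serve for t = \<pi>: there
  a = 0, the arcsine is odd, and only the degrees m, m + 2, ... occur.\<close>

lemma strictly_psd_trunc_power_nat:
  assumes t: "0 < t" "t \<le> pi"
  shows "strictly_psd n (\<lambda>i j. trunc_power t (real (Suc (q + r))) (arc_mat i j))"
proof -
  define a where "a = cos (t / 2)"
  have a: "0 \<le> a" "a < 1" unfolding a_def using t cos_monotone_0_pi[of 0 "t / 2"] by (auto intro!: cos_ge_zero)
  define m where "m = q + r"
  have m: "0 < m" using q by (simp add: m_def)
  define D where "D = 2 ^ m * real (Suc m)"
  have D: "0 < D" by (simp add: D_def)
  have "strictly_psd n (\<lambda>i j. 1 / D * trunc_power t (real (Suc m)) (arc_mat i j))"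
  proof (rule strictly_psd_limit)
    show "(\<lambda>l. enn2real (cosK a (arcsin_poly a l ^ m) (arc_mat i j))) \<longlonglongrightarrow> 1 / D * trunc_power t (real (Suc m)) (arc_mat i j)"
      if "i < n" "j < n" for i j
      unfolding a_def D_def by (rule cosK_arcsin_poly_tendsto[OF t arc_mat_bounds[OF that] m])
    show "strictly_psd n (\<lambda>i j. enn2real (cosK a (monom (1 / 6) (m + 2)) (arc_mat i j)))"
      unfolding m_def by (rule strictly_psd_cosK_monom[OF a]) simp
    fix l
    define E where "E = arcsin_poly a l ^ m - monom (1 / 6) (m + 2)"
    have E: "nonneg_poly E"
    proof -
      obtain m' where m': "m = Suc m'" using m by (cases m) auto
      have "m + 2 = m' + 3" by (simp add: m')
      then show ?thesis unfolding E_def m' using arcsin_poly_power_bound[OF a(1), of l m'] by (simp only: m')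
    qed
    have vE: "vanishes m E"
      using vanishes_power[OF vanishes_arcsin_poly, of m a l] by (simp add: E_def vanishes_def)
    have M: "nonneg_poly (monom (1 / 6) (m + 2))" by (simp add: nonneg_poly_monom)
    have "arcsin_poly a l ^ m = E + monom (1 / 6) (m + 2)" by (simp add: E_def)
    then have "cosK a (arcsin_poly a l ^ m) (arc_mat i j) = cosK a E (arc_mat i j) + cosK a (monom (1 / 6) (m + 2)) (arc_mat i j)" for i j
      using cosK_add[OF E M] by simp
    then have "enn2real (cosK a (arcsin_poly a l ^ m) (arc_mat i j)) - enn2real (cosK a (monom (1 / 6) (m + 2)) (arc_mat i j)) = enn2real (cosK a E (arc_mat i j))"
      if "i < n" "j < n" for i j
      using cosK_finite[OF E arc_mat_bounds(1)[OF that]] cosK_finite[OF M arc_mat_bounds(1)[OF that]]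
      by (simp add: enn2real_plus)
    moreover have "psd n (\<lambda>i j. enn2real (cosK a E (arc_mat i j)))"
      unfolding arc_mat_def using E vE a by (intro psd_cosK x) (simp_all add: m_def)
    ultimately show "psd n (\<lambda>i j. enn2real (cosK a (arcsin_poly a l ^ m) (arc_mat i j)) - enn2real (cosK a (monom (1 / 6) (m + 2)) (arc_mat i j)))"
      by (rule_tac psd_cong) auto
  qed
  from strictly_psd_scale[OF this D] show ?thesis using D unfolding m_def by simp
qed

end

end

section \<open>Real exponents and the Cayley plane\<close>

text \<open>The substitution s = \<theta> + (t - \<theta>) v turns this into a Beta integral; the
  powers of t - \<theta> add up to \<delta>.\<close>

lemma trunc_power_mixture:
  assumes k: "0 < k" "real k < \<delta>" and \<theta>: "0 \<le> \<theta>"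
  shows "(\<integral>\<^sup>+s. ennreal (indicator {0<..<t} s * (t - s) powr (\<delta> - real k - 1)) * ennreal (trunc_power s (real k) \<theta>) \<partial>lborel)
    = ennreal (Beta (real k + 1) (\<delta> - real k) * trunc_power t \<delta> \<theta>)"
proof (cases "\<theta> < t")
  case True
  define d where "d = t - \<theta>"
  have d: "0 < d" using True by (simp add: d_def)
  define \<beta> where "\<beta> = \<delta> - real k"
  have \<beta>: "0 < \<beta>" using k by (simp add: \<beta>_def)
  define g where "g v = v powr real k * (1 - v) powr (\<beta> - 1)" for v :: real
  have [measurable]: "g \<in> borel_measurable borel" unfolding g_def[abs_def] by measurable
  have hi: "(g has_integral Beta (real k + 1) \<beta>) {0..1}"
    using has_integral_Beta_real[of "real k + 1" \<beta>] \<beta> by (simp add: g_def[abs_def])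
  have "(\<integral>\<^sup>+s. ennreal (indicator {0<..<t} s * (t - s) powr (\<delta> - real k - 1)) * ennreal (trunc_power s (real k) \<theta>) \<partial>lborel)
    = ennreal \<bar>d\<bar> * (\<integral>\<^sup>+v. ennreal (indicator {0<..<t} (\<theta> + d * v) * (t - (\<theta> + d * v)) powr (\<delta> - real k - 1)) * ennreal (trunc_power (\<theta> + d * v) (real k) \<theta>) \<partial>lborel)"
    unfolding trunc_power_def by (rule nn_integral_real_affine) (use d in auto)
  also have "(\<integral>\<^sup>+v. ennreal (indicator {0<..<t} (\<theta> + d * v) * (t - (\<theta> + d * v)) powr (\<delta> - real k - 1)) * ennreal (trunc_power (\<theta> + d * v) (real k) \<theta>) \<partial>lborel)
    = (\<integral>\<^sup>+v. ennreal (d powr (\<delta> - 1)) * ennreal (indicator {0..1} v * g v) \<partial>lborel)"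
  proof (rule nn_integral_cong_AE)
    have "AE v in lborel. v \<noteq> 0 \<and> v \<noteq> (1::real)" by (intro AE_conjI AE_lborel_singleton)
    then show "AE v in lborel. ennreal (indicator {0<..<t} (\<theta> + d * v) * (t - (\<theta> + d * v)) powr (\<delta> - real k - 1)) * ennreal (trunc_power (\<theta> + d * v) (real k) \<theta>)
      = ennreal (d powr (\<delta> - 1)) * ennreal (indicator {0..1} v * g v)"
    proof eventually_elim
      case (elim v)
      show ?case
      proof (cases "0 < v")
        case True
        have lt: "\<theta> + d * v < t \<longleftrightarrow> v < 1" 
        proof -
          have "t - (\<theta> + d * v) = d * (1 - v)" by (simp add: d_def algebra_simps)
          then have "\<theta> + d * v < t \<longleftrightarrow> 0 < d * (1 - v)" by linarith
          then show ?thesis using d by (simp add: zero_less_mult_iff)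
        qed
        have pos: "0 < \<theta> + d * v" using True d \<theta> by (simp add: add_nonneg_pos)
        have tp: "trunc_power (\<theta> + d * v) (real k) \<theta> = d powr real k * v powr real k"
          using True d by (simp add: trunc_power_def powr_mult)
        show ?thesis
        proof (cases "v < 1")
          case True
          have "t - (\<theta> + d * v) = d * (1 - v)" by (simp add: d_def algebra_simps)
          then have e: "(t - (\<theta> + d * v)) powr (\<delta> - real k - 1) = d powr (\<beta> - 1) * (1 - v) powr (\<beta> - 1)"
            using True d by (simp add: powr_mult \<beta>_def)
          have "d powr (\<beta> - 1) * d powr real k = d powr (\<delta> - 1)" by (simp add: powr_add[symmetric] \<beta>_def)
          then have "d powr (\<beta> - 1) * (1 - v) powr (\<beta> - 1) * (d powr real k * v powr real k) = d powr (\<delta> - 1) * g v"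
            unfolding g_def by (metis mult.assoc mult.left_commute mult.commute)
          then show ?thesis unfolding e tp using True \<open>0 < v\<close> lt pos
            by (simp add: ennreal_mult'[symmetric])
        qed (use lt elim in simp)
      next
        case False
        then have "d * v < 0" using d elim by (simp add: mult_pos_neg)
        then show ?thesis using False elim by (auto simp: trunc_power_def)
      qed
    qed
  qed
  also have "\<dots> = ennreal (d powr (\<delta> - 1)) * ennreal (Beta (real k + 1) \<beta>)"
    by (subst nn_integral_cmult, measurable, subst nn_integral_Icc[OF _ _ hi]) (auto simp: g_def)
  also have "ennreal \<bar>d\<bar> * \<dots> = ennreal (Beta (real k + 1) \<beta> * trunc_power t \<delta> \<theta>)"
  proof -
    have p: "d * d powr (\<delta> - 1) = d powr \<delta>" using powr_mult_base[of d "\<delta> - 1"] d by simp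
    have "ennreal \<bar>d\<bar> * (ennreal (d powr (\<delta> - 1)) * ennreal B) = ennreal (B * d powr \<delta>)" for B
      using d unfolding p[symmetric] by (simp add: ennreal_mult'' ennreal_mult' mult_ac)
    moreover have "trunc_power t \<delta> \<theta> = d powr \<delta>" using True by (simp add: trunc_power_def d_def)
    ultimately show ?thesis by simp
  qed
  finally show ?thesis by (simp add: \<beta>_def)
next
  case False
  have "ennreal (indicator {0<..<t} s * (t - s) powr (\<delta> - real k - 1)) * ennreal (trunc_power s (real k) \<theta>) = 0" for s
    using False by (cases "s < t") (auto simp: trunc_power_def)
  note z = this
  show ?thesis unfolding z using False by (auto simp: trunc_power_def)
qed

text \<open>For s below the smallest distance the matrix of exponent k is s^k times the identity, so
  a part of the mixture of positive measure is diagonal with positive diagonal.\<close>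

lemma strictly_psd_trunc_power_real:
  assumes k: "0 < k" "real k < \<delta>" and t: "0 < t"
    and psd: "\<And>s. 0 < s \<Longrightarrow> s \<le> t \<Longrightarrow> psd n (\<lambda>i j. trunc_power s (real k) (\<theta> i j))"
    and \<theta>: "\<And>i j. i < n \<Longrightarrow> j < n \<Longrightarrow> 0 \<le> \<theta> i j" "\<And>i. i < n \<Longrightarrow> \<theta> i i = 0"
    and sep: "0 < s0" "\<And>i j. i < n \<Longrightarrow> j < n \<Longrightarrow> i \<noteq> j \<Longrightarrow> s0 \<le> \<theta> i j"
  shows "strictly_psd n (\<lambda>i j. trunc_power t \<delta> (\<theta> i j))"
proof -
  define wt where "wt s = indicator {0<..<t} s * (t - s) powr (\<delta> - real k - 1)" for s
  define f where "f i j s = ennreal (wt s) * ennreal (trunc_power s (real k) (\<theta> i j))" for i j s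
  define B where "B = Beta (real k + 1) (\<delta> - real k)"
  have B: "0 < B" unfolding B_def Beta_def using k by (intro divide_pos_pos mult_pos_pos Gamma_real_pos) auto
  have wt0: "0 \<le> wt s" for s by (simp add: wt_def)
  have tp0: "0 \<le> trunc_power s (real k) r" for s r by (simp add: trunc_power_def)
  have I: "(\<integral>\<^sup>+s. f i j s \<partial>lborel) = ennreal (B * trunc_power t \<delta> (\<theta> i j))" if "i < n" "j < n" for i j
    unfolding f_def wt_def B_def by (rule trunc_power_mixture[OF k \<theta>(1)[OF that]])
  have e: "enn2real (f i j s) = wt s * trunc_power s (real k) (\<theta> i j)" for i j s
    by (simp add: f_def enn2real_mult wt0 tp0)
  have "strictly_psd n (\<lambda>i j. enn2real (\<integral>\<^sup>+s. f i j s \<partial>lborel))"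
  proof (rule strictly_psd_integral[where S = "{0<..<min s0 t}"])
    show "f i j \<in> borel_measurable lborel" for i j
      unfolding f_def wt_def trunc_power_def by measurable
    show "(\<integral>\<^sup>+s. f i j s \<partial>lborel) < \<infinity>" if "i < n" "j < n" for i j by (simp add: I[OF that])
    show "AE s in lborel. psd n (\<lambda>i j. enn2real (f i j s))"
    proof (rule AE_I2)
      fix s
      show "psd n (\<lambda>i j. enn2real (f i j s))"
      proof (cases "0 < s \<and> s < t")
        case True
        then show ?thesis unfolding e by (intro psd_scale psd wt0) auto
      next
        case False
        then have "wt s = 0" by (simp add: wt_def)
        then show ?thesis unfolding e by (simp add: psd_def)
      qed
    qed
    show "0 < emeasure lborel {0<..<min s0 t}" using sep t by simp
  next
    fix i j s assume ij: "i < n" "j < n" "i \<noteq> j" and s: "s \<in> {0<..<min s0 t}"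
    then have "s < \<theta> i j" using sep(2)[OF ij] by simp
    then show "f i j s = 0" by (simp add: f_def trunc_power_def)
  next
    fix i s assume "i < n" "s \<in> {0<..<min s0 t}"
    then show "0 < enn2real (f i i s)" unfolding e by (simp add: \<theta>(2) wt_def trunc_power_def)
  qed simp
  then have "strictly_psd n (\<lambda>i j. B * trunc_power t \<delta> (\<theta> i j))"
    by (rule strictly_psd_cong) (simp add: I B less_imp_le trunc_power_def)
  from strictly_psd_scale[OF this, of "1 / B"] B show ?thesis by simp
qed

lemma continuous_trunc_power: "0 < \<delta> \<Longrightarrow> continuous_on S (trunc_power t \<delta>)"
proof -
  assume d: "0 < \<delta>"
  have "trunc_power t \<delta> = (\<lambda>\<theta>. max 0 (t - \<theta>) powr \<delta>)"
    by (auto simp: trunc_power_def fun_eq_iff max_def)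
  moreover have "continuous_on S (\<lambda>\<theta>. max 0 (t - \<theta>) powr \<delta>)"
    by (rule continuous_on_powr') (use d in \<open>auto intro!: continuous_intros\<close>)
  ultimately show ?thesis by simp
qed

text \<open>\<open>rep\<close> passes from the points of a space to the index set of the law: a unit
  vector on a line for the projective spaces, the identity for the Cayley plane.\<close>

lemma (in inverse_point_law) strictly_pos_def_trunc_power:
  assumes rep: "\<And>y. y \<in> Y \<Longrightarrow> rep y \<in> X"
    and D: "\<And>y z. y \<in> Y \<Longrightarrow> z \<in> Y \<Longrightarrow> ds y z = arc_of (u (rep y) (rep z))"
    and sym: "\<And>y z. y \<in> Y \<Longrightarrow> z \<in> Y \<Longrightarrow> u (rep y) (rep z) = u (rep z) (rep y)"
    and one: "\<And>y. y \<in> Y \<Longrightarrow> u (rep y) (rep y) = 1"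
    and less: "\<And>y z. y \<in> Y \<Longrightarrow> z \<in> Y \<Longrightarrow> y \<noteq> z \<Longrightarrow> u (rep y) (rep z) < 1"
    and t: "0 < t" "t \<le> pi" and \<delta>: "real (Suc (q + r)) \<le> \<delta>"
  shows "strictly_pos_def_on Y ds (trunc_power t \<delta>)"
  unfolding strictly_pos_def_on_def
proof (intro conjI allI impI)
  show "continuous_on {0..pi} (trunc_power t \<delta>)" by (rule continuous_trunc_power) (use \<delta> in simp)
  fix n :: nat and y assume y: "y ` {..<n} \<subseteq> Y \<and> inj_on y {..<n}"
  define x where "x i = rep (y i)" for i
  have yY: "y i \<in> Y" if "i < n" for i using y that by auto
  have ne: "y i \<noteq> y j" if "i < n" "j < n" "i \<noteq> j" for i j using y that by (auto simp: inj_on_def)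
  have x: "\<And>i. i < n \<Longrightarrow> x i \<in> X" "\<And>i. i < n \<Longrightarrow> u (x i) (x i) = 1"
    "\<And>i j. i < n \<Longrightarrow> j < n \<Longrightarrow> i \<noteq> j \<Longrightarrow> u (x i) (x j) < 1"
    unfolding x_def using rep[OF yY] one[OF yY] less[OF yY yY ne] by simp_all
  have am: "arc_mat x i j = arc_of (u (x i) (x j))" for i j
    by (rule arc_mat_def[where n = n]; rule x; assumption)
  have nat: "strictly_psd n (\<lambda>i j. trunc_power s (real (Suc (q + r))) (arc_of (u (x i) (x j))))" if "0 < s" "s \<le> pi" for s
    unfolding am[symmetric] by (rule strictly_psd_trunc_power_nat; (rule that | rule x; assumption))
  have "strictly_psd n (\<lambda>i j. trunc_power t \<delta> (arc_of (u (x i) (x j))))"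
  proof (cases "\<delta> = real (Suc (q + r))")
    case True
    then show ?thesis using nat[OF t] by simp
  next
    case False
    obtain s0 where s0: "0 < s0" "\<And>i j. i < n \<Longrightarrow> j < n \<Longrightarrow> i \<noteq> j \<Longrightarrow> s0 \<le> arc_of (u (x i) (x j))"
          proof -
      have "\<exists>s>0. \<forall>i<n. \<forall>j<n. i \<noteq> j \<longrightarrow> s \<le> arc_of (u (x i) (x j))"
        unfolding am[symmetric] by (rule arc_mat_separated; rule x; assumption)
      then show ?thesis by (elim exE conjE) (rule that; blast)
    qed
    show ?thesis
    proof (rule strictly_psd_trunc_power_real[where k = "Suc (q + r)" and ?s0.0 = s0])
      show "psd n (\<lambda>i j. trunc_power s (real (Suc (q + r))) (arc_of (u (x i) (x j))))" if "0 < s" "s \<le> t" for s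
        by (rule strictly_psd_imp_psd[OF nat]) (use that t in auto)
      show "0 \<le> arc_of (u (x i) (x j))" if "i < n" "j < n" for i j
        unfolding am[symmetric] by (rule arc_mat_bounds(1)[where n = n]; (rule that | rule x; assumption))
      show "arc_of (u (x i) (x i)) = 0" if "i < n" for i
        unfolding am[symmetric] by (rule arc_mat_diag[where n = n]; (rule that | rule x; assumption))
    qed (use False \<delta> t s0 in auto)
  qed
  then have "strictly_psd n (\<lambda>i j. trunc_power t \<delta> (ds (y i) (y j)))"
    by (rule strictly_psd_cong) (simp add: x_def D yY)
  then show "pos_def_matrix n (\<lambda>i j. trunc_power t \<delta> (ds (y i) (y j)))"
    unfolding pos_def_matrix_def strictly_psd_def by (auto simp: D yY sym)
qed

text \<open>Here \<kappa> = 8, and \<open>octonionic_law\<close> has q = 4. Undoing the sphere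
  average costs r = 4 derivatives, so the threshold is 4 + 4 + 1 = 9.\<close>

lemma cayley_strictly_pos_def:
  assumes t: "0 < t" "t \<le> pi" and \<delta>: "9 \<le> \<delta>"
  shows "strictly_pos_def_on cayley_plane cayley_dist (trunc_power t \<delta>)"
proof -
  define C where "C = 6 * (sqrt pi ^ DIM(oct))\<^sup>2"
  have C: "0 < C" by (simp add: C_def)
  have norm_meas: "(\<lambda>(r, \<xi>, \<eta>). f r \<xi> \<eta>) \<in> borel_measurable oct_meas"
    if "continuous_on UNIV (\<lambda>(r :: real, \<xi> :: oct, \<eta> :: oct). f r \<xi> \<eta> :: real)" for f
    using borel_measurable_continuous_onI[OF that] by (simp add: oct_meas_def)
  have R: "radial_inverse (2 * Suc 3) (rad_measure 3) (\<lambda>\<nu>. \<bar>sin \<nu>\<bar>) (sphere_const 3 * (2 * 4 ^ 3 * beta_const 3 3))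
    arc_measure cos (Suc 3) (sphere_const 3 * (2 ^ 3 * fact 3))" by (rule even_radial_inverse)
  interpret inverse_point_law "2 * Suc 3" "rad_measure 3" "\<lambda>\<nu>. \<bar>sin \<nu>\<bar>" "sphere_const 3 * (2 * 4 ^ 3 * beta_const 3 3)"
    oct_meas oct_T oct_Q cayley_plane cinner 4 C arc_measure cos "Suc 3" "sphere_const 3 * (2 ^ 3 * fact 3)"
  proof (rule inverse_point_law.intro[OF point_law.intro[OF radial_inverse.axioms(1)[OF R] point_law_axioms.intro] R])
    show "0 < C" by (rule C)
    show "oct_T \<in> borel_measurable oct_meas" unfolding oct_T_def
      by (rule norm_meas) (auto simp: case_prod_unfold intro!: continuous_intros)
    show "oct_Q P \<in> borel_measurable oct_meas" for P
      unfolding oct_Q_def oform_def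
      by (rule norm_meas) (auto simp: case_prod_unfold intro!: continuous_intros omul.continuous_on)
    show "oct_Q P z \<le> oct_T z" if "P \<in> cayley_plane" for P z
      using oform_bounds[OF that, of "fst (snd z)" "snd (snd z)"]
      by (simp add: oct_Q_def oct_T_def case_prod_unfold mult_left_mono)
    show "0 \<le> oct_T z" for z by (simp add: oct_T_def case_prod_unfold)
    fix P Q :: "oct ^ 3 ^ 3" and a b \<Lambda> :: real
    assume P: "P \<in> cayley_plane" and Q: "Q \<in> cayley_plane"
    show "0 \<le> cinner P Q" "cinner P Q \<le> 1" using cinner_nonneg[OF P Q] cinner_le_1[OF P Q] .
    assume ab: "0 \<le> a" "0 \<le> b" "a + b < \<Lambda>"
    have pos: "0 \<le> (\<Lambda> - a) * (\<Lambda> - b) - a * b * cinner P Q"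
    proof -
      have "a * b * cinner P Q \<le> b * a" using ab cinner_le_1[OF P Q] cinner_nonneg[OF P Q] by (simp add: mult_left_le mult.commute)
      also have "b * a \<le> (\<Lambda> - a) * (\<Lambda> - b)" using ab by (intro mult_mono) auto
      finally show ?thesis by simp
    qed
    have "(1 / sqrt d) ^ (2 * Suc 3) = (1 / d) ^ 4" if "0 \<le> d" for d
    proof -
      have "(1 / sqrt d)\<^sup>2 = 1 / d" using that by (simp add: power_divide)
      then show ?thesis unfolding power_mult by simp
    qed
    note s = this[OF pos]
    show "(\<integral>\<^sup>+z. ennreal (exp (- \<Lambda> * oct_T z + a * oct_Q P z + b * oct_Q Q z)) \<partial>oct_meas)
      = ennreal (C * ((1 / \<Lambda>) ^ 4 * (1 / sqrt ((\<Lambda> - a) * (\<Lambda> - b) - a * b * cinner P Q)) ^ (2 * Suc 3)))"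
      unfolding octonionic_law[OF P Q ab] s C_def gauss_const_eq
      using ab by (subst ennreal_power, simp) (simp add: ennreal_mult'' ennreal_numeral[symmetric] mult.commute del: ennreal_numeral)
  qed simp
  show ?thesis
  proof (rule strictly_pos_def_trunc_power[where Y = cayley_plane and ds = cayley_dist and rep = "\<lambda>P. P"])
    show "cayley_dist P Q = arc_of (cinner P Q)" if "P \<in> cayley_plane" "Q \<in> cayley_plane" for P Q
      by (simp add: cayley_dist_def arc_of_def ore_trace_jordan_mul[OF that])
    show "cinner P Q < 1" if "P \<in> cayley_plane" "Q \<in> cayley_plane" "P \<noteq> Q" for P Q
      using cinner_le_1[OF that(1,2)] cinner_eq_1[OF that(1,2)] that(3) by (auto simp: order_less_le)
    show "cinner P Q = cinner Q P" for P Q by (simp add: cinner_def inner_commute mult.commute)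
  qed (use t \<delta> cinner_self in auto)
qed

section \<open>Projective spaces\<close>

context hermitian_scalars begin

interpretation mul: bounded_bilinear mul by (rule bil)
interpretation cj: bounded_linear cj by (rule lin_cj)

lemma cj_e: "cj e = e"
proof -
  have "mul a (cj e) = a" for a
  proof -
    have "mul a (cj e) = cj (mul e (cj a))" by (simp only: cj_mul cj_cj)
    then show ?thesis by (simp only: one cj_cj)
  qed
  from this[of e] show ?thesis by (simp add: one)
qed

lemma norm_e: "norm e = 1"
proof -
  obtain b :: 'a where "b \<in> Basis" using nonempty_Basis by blast
  then have "norm b = 1" by (rule norm_Basis)
  then show ?thesis using norm_mul[of e b] by (simp add: one)
qed

lemma cj_herm: "cj (herm mul cj x y) = herm mul cj y x"
  by (simp add: herm_def cj.sum cj_mul cj_cj)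

lemma inner_self_herm: "inner e (herm mul cj x x) = (norm x)\<^sup>2"
  unfolding inner_herm cj_e by (simp add: lmul_def one vec_nth_inverse power2_norm_eq_inner vec_lambda_eta)

text \<open>Pythagoras: the subtracted vector is the projection of x to the line of y. This gives
  both the Cauchy-Schwarz bound over the scalars and its equality case, by which distinct lines are
  told apart.\<close>

lemma norm_diff_herm:
  assumes "norm x = 1" "norm y = 1"
  shows "(norm (x - lmul (herm mul cj x y) y))\<^sup>2 = 1 - (norm (herm mul cj x y))\<^sup>2"
proof -
  define h where "h = herm mul cj x y"
  have "inner (lmul h y) x = inner (cj h) (herm mul cj y x)" by (simp add: inner_herm cj_cj)
  also have "\<dots> = (norm h)\<^sup>2" 
  proof -
    have "herm mul cj y x = cj h" by (simp add: h_def cj_herm)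
    then show ?thesis by (simp add: power2_norm_eq_inner[symmetric] norm_cj)
  qed
  finally have i: "inner x (lmul h y) = (norm h)\<^sup>2" by (simp add: inner_commute)
  have "(norm (x - lmul h y))\<^sup>2 = (norm x)\<^sup>2 + (norm (lmul h y))\<^sup>2 - 2 * inner x (lmul h y)"
    by (simp add: power2_norm_eq_inner inner_diff_left inner_diff_right inner_commute)
  then show ?thesis unfolding i norm_lmul using assms by (simp add: h_def)
qed

lemma norm_herm_le_1:
  assumes "norm x = 1" "norm y = 1"
  shows "norm (herm mul cj x y) \<le> 1"
proof -
  have "0 \<le> 1 - (norm (herm mul cj x y))\<^sup>2" unfolding norm_diff_herm[OF assms, symmetric] by simp
  then have "(norm (herm mul cj x y))\<^sup>2 \<le> 1" by simp
  then show ?thesis by (simp add: abs_square_le_1)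
qed

lemma norm_herm_self: "norm x = 1 \<Longrightarrow> norm (herm mul cj x x) = 1"
  using norm_herm_le_1[of x x] Cauchy_Schwarz_ineq2[of e "herm mul cj x x"]
  by (simp add: inner_self_herm norm_e)

lemma herm_scaleR: "herm mul cj x (c *\<^sub>R z) = c *\<^sub>R herm mul cj x z"
  by (simp add: herm_def cj.scaleR mul.scaleR_right scaleR_sum_right)

lemma norm_herm_le:
  assumes "norm x = 1"
  shows "norm (herm mul cj x z) \<le> norm z"
proof (cases "z = 0")
  case True
  then show ?thesis using herm_scaleR[of x 0 z] by simp
next
  case False
  then have "norm (herm mul cj x ((1 / norm z) *\<^sub>R z)) \<le> 1" by (intro norm_herm_le_1 assms) simp
  then show ?thesis using False by (simp add: herm_scaleR field_simps)
qed

lemma lmul_lmul: "lmul a (lmul b x) = lmul (mul a b) x"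
  by (simp add: lmul_def assoc)

lemma line_eq: "line mul x = range (\<lambda>c. lmul c x)"
  by (simp add: line_def lmul_def)

text \<open>Right multiplication by a nonzero scalar is injective because norms multiply, hence
  surjective in finite dimension, so \<open>c\<close> has a left inverse.\<close>

lemma line_lmul:
  assumes "c \<noteq> 0"
  shows "line mul (lmul c x) = line mul x"
proof -
  have "linear (\<lambda>d. mul d c)" by (rule bounded_linear.linear[OF mul.bounded_linear_left])
  moreover have "inj (\<lambda>d. mul d c)"
  proof (rule injI)
    fix a b assume "mul a c = mul b c"
    then have "mul (a - b) c = 0" by (simp add: mul.diff_left)
    then have "norm (a - b) * norm c = 0" by (simp flip: norm_mul)
    then show "a = b" using assms by simp
  qed
  ultimately have "surj (\<lambda>d. mul d c)" by (simp add: linear_injective_imp_surjective)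
  then obtain d where d: "mul d c = e" by (metis surjD)
  have "lmul k x = lmul (mul k d) (lmul c x)" for k
  proof -
    \<comment> \<open>The locale postulates a left unit; conjugating twice shows that
      \<open>e\<close> is a right unit too.\<close>
    have "mul (mul k d) c = mul k (cj (cj e))" by (simp add: assoc d cj_cj)
    also have "\<dots> = cj (mul (cj e) (cj k))" by (simp add: cj_mul cj_cj)
    also have "\<dots> = k" by (simp add: cj_e one cj_cj)
    finally show ?thesis by (simp add: lmul_lmul)
  qed
  then show ?thesis unfolding line_eq by (auto simp: lmul_lmul)
qed

definition unit_rep :: "('a ^ 'n) set \<Rightarrow> 'a ^ 'n" where
  "unit_rep L = (SOME x. x \<in> L \<and> norm x = 1)"

lemma unit_rep:
  assumes "L \<in> proj_space mul"
  shows "norm (unit_rep L) = 1" "line mul (unit_rep L) = L"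
proof -
  obtain x where x: "L = line mul x" "x \<noteq> 0" using assms by (auto simp: proj_space_def)
  define c where "c = (1 / norm x) *\<^sub>R e"
  have "norm (lmul c x) = 1" using x(2) by (simp add: norm_lmul c_def norm_e)
  moreover have "lmul c x \<in> L" by (simp add: x(1) line_eq)
  ultimately have "\<exists>y. y \<in> L \<and> norm y = 1" by blast
  from someI_ex[OF this] have r: "unit_rep L \<in> L" "norm (unit_rep L) = 1" by (simp_all add: unit_rep_def)
  show "norm (unit_rep L) = 1" by (rule r)
  obtain k where k: "unit_rep L = lmul k x" using r(1) by (auto simp: x(1) line_eq)
  have "k \<noteq> 0"
  proof
    assume "k = 0"
    then have "norm (unit_rep L) = 0" by (simp add: k norm_lmul)
    then show False using r(2) by simp
  qed
  then have "line mul (unit_rep L) = line mul x" unfolding k by (rule line_lmul)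
  then show "line mul (unit_rep L) = L" using x(1)[symmetric] by (rule trans)
qed

lemma line_eqI:
  assumes "norm x = 1" "norm y = 1" "norm (herm mul cj x y) = 1"
  shows "line mul x = line mul y"
proof -
  have "(norm (x - lmul (herm mul cj x y) y))\<^sup>2 = 0" unfolding norm_diff_herm[OF assms(1,2)] by (simp add: assms(3))
  then have "x = lmul (herm mul cj x y) y" by simp
  moreover have "herm mul cj x y \<noteq> 0" using assms(3) by auto
  ultimately show ?thesis using line_lmul by metis
qed

definition coherence :: "'a ^ 'n \<Rightarrow> 'a ^ 'n \<Rightarrow> real" where
  "coherence x y = (norm (herm mul cj x y))\<^sup>2"

lemma coherence_le_1: "norm x = 1 \<Longrightarrow> norm y = 1 \<Longrightarrow> coherence x y \<le> 1"
  using norm_herm_le_1[of x y] by (simp add: coherence_def power_le_one)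

lemma proj_strictly_pos_def:
  assumes "inverse_point_law \<kappa> W \<rho> C1 M T Q {x :: 'a ^ 'n. norm x = 1} coherence q C S sf r C3"
    and t: "0 < t" "t \<le> pi" and \<delta>: "real (Suc (q + r)) \<le> \<delta>"
  shows "strictly_pos_def_on (proj_space mul :: ('a ^ 'n) set set) (proj_dist mul cj) (trunc_power t \<delta>)"
proof (rule inverse_point_law.strictly_pos_def_trunc_power[OF assms(1), of _ unit_rep])
  fix L L' :: "('a ^ 'n) set"
  assume L: "L \<in> proj_space mul" and L': "L' \<in> proj_space mul"
  note u = unit_rep[OF L] unit_rep[OF L']
  show "unit_rep L \<in> {x. norm x = 1}" by (simp add: u)
  show "proj_dist mul cj L L' = arc_of (coherence (unit_rep L) (unit_rep L'))"
    by (simp add: proj_dist_def unit_rep_def arc_of_def coherence_def Let_def)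
  show "coherence (unit_rep L) (unit_rep L') = coherence (unit_rep L') (unit_rep L)"
    using norm_cj[of "herm mul cj (unit_rep L) (unit_rep L')"] by (simp add: coherence_def cj_herm)
  show "coherence (unit_rep L) (unit_rep L) = 1" by (simp add: coherence_def norm_herm_self u)
  assume "L \<noteq> L'"
  then have "norm (herm mul cj (unit_rep L) (unit_rep L')) \<noteq> 1" using line_eqI[OF u(1,3)] u(2,4) by metis
  then have "norm (herm mul cj (unit_rep L) (unit_rep L')) < 1" using norm_herm_le_1[OF u(1,3)] by simp
  then show "coherence (unit_rep L) (unit_rep L') < 1" by (simp add: coherence_def power_less_one_iff)
qed (use t \<delta> in auto)

lemma sqrt_power_split:
  assumes "0 < (\<Lambda>::real)"
  shows "(1 / sqrt \<Lambda>) ^ (2 * \<kappa> + 2 * q) * (\<Lambda> * s) ^ \<kappa> = (1 / \<Lambda>) ^ q * s ^ \<kappa>"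
proof -
  have "(1 / sqrt \<Lambda>)\<^sup>2 = 1 / \<Lambda>" using assms by (simp add: power_divide)
  then have "(1 / sqrt \<Lambda>) ^ (2 * \<kappa> + 2 * q) = (1 / \<Lambda>) ^ \<kappa> * (1 / \<Lambda>) ^ q"
    by (simp only: power_add power_mult)
  then show ?thesis using assms by (simp add: power_mult_distrib power_one_over)
qed

text \<open>The two directions x and y account for 2 \<kappa> real dimensions of the Gaussian
  vector, and the other 2 q contribute \<Lambda>^(-q).\<close>

lemma inverse_point_law_even:
  assumes R: "radial_inverse DIM('a) W \<rho> C1 S sf r C3"
    and q: "0 < q" and dim: "CARD('n) * DIM('a) = 2 * DIM('a) + 2 * q"
  shows "inverse_point_law DIM('a) W \<rho> C1 (lborel :: ('a ^ 'n) measure) (\<lambda>z. (norm z)\<^sup>2) (\<lambda>x z. (norm (herm mul cj x z))\<^sup>2)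
    {x. norm x = 1} coherence q (sqrt pi ^ DIM('a ^ 'n)) S sf r C3"
proof (rule inverse_point_law.intro[OF point_law.intro[OF radial_inverse.axioms(1)[OF R] point_law_axioms.intro] R])
  fix x y :: "'a ^ 'n" and a b \<Lambda> :: real
  assume x: "x \<in> {x. norm x = 1}"
  show "(\<lambda>z. (norm (herm mul cj x z))\<^sup>2) \<in> borel_measurable lborel"
    by (simp, intro borel_measurable_continuous_onI continuous_intros)
  show "(norm (herm mul cj x z))\<^sup>2 \<le> (norm z)\<^sup>2" for z using norm_herm_le[of x z] x by (simp add: power_mono)
  assume y: "y \<in> {x. norm x = 1}"
  show "coherence x y \<le> 1" using x y by (simp add: coherence_le_1)
  assume ab: "0 \<le> a" "0 \<le> b" "a + b < \<Lambda>"
  have L: "0 < \<Lambda>" using ab by simp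
  have D: "DIM('a ^ 'n) = 2 * DIM('a) + 2 * q" using dim by simp
  show "(\<integral>\<^sup>+z. ennreal (exp (- \<Lambda> * (norm z)\<^sup>2 + a * (norm (herm mul cj x z))\<^sup>2 + b * (norm (herm mul cj y z))\<^sup>2)) \<partial>lborel)
    = ennreal (sqrt pi ^ DIM('a ^ 'n) * ((1 / \<Lambda>) ^ q * (1 / sqrt ((\<Lambda> - a) * (\<Lambda> - b) - a * b * coherence x y)) ^ DIM('a)))"
    using gaussian_law[of x y a b \<Lambda>] x y ab sqrt_power_split[OF L, of "DIM('a)" q "1 / sqrt ((\<Lambda> - a) * (\<Lambda> - b) - a * b * coherence x y)"]
    unfolding D gauss_const_eq coherence_def
    by (simp add: ennreal_mult''[symmetric] ennreal_mult'[symmetric] mult.commute)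
qed (use q in \<open>auto simp: coherence_def\<close>)

text \<open>If \<open>DIM('a ^ 'n)\<close> is odd, an independent real Gaussian variable makes the exponent \<open>q\<close> an integer.\<close>

lemma inverse_point_law_odd:
  assumes R: "radial_inverse DIM('a) W \<rho> C1 S sf r C3"
    and q: "0 < q" and dim: "CARD('n) * DIM('a) + 1 = 2 * DIM('a) + 2 * q"
  shows "inverse_point_law DIM('a) W \<rho> C1 (lborel :: (('a ^ 'n) \<times> real) measure) (\<lambda>z. (norm z)\<^sup>2) (\<lambda>x z. (norm (herm mul cj x (fst z)))\<^sup>2)
    {x. norm x = 1} coherence q (sqrt pi ^ (DIM('a ^ 'n) + 1)) S sf r C3"
proof (rule inverse_point_law.intro[OF point_law.intro[OF radial_inverse.axioms(1)[OF R] point_law_axioms.intro] R])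
  have m: "(\<lambda>z. (norm (herm mul cj x (fst z)))\<^sup>2) \<in> borel_measurable (borel :: (('a ^ 'n) \<times> real) measure)" for x :: "'a ^ 'n"
    by (intro borel_measurable_continuous_onI continuous_intros)
  fix x y :: "'a ^ 'n" and a b \<Lambda> :: real
  assume x: "x \<in> {x. norm x = 1}"
  show "(\<lambda>z. (norm (herm mul cj x (fst z)))\<^sup>2) \<in> borel_measurable (lborel :: (('a ^ 'n) \<times> real) measure)" using m by simp
  show "(norm (herm mul cj x (fst z)))\<^sup>2 \<le> (norm z)\<^sup>2" for z :: "('a ^ 'n) \<times> real"
    using norm_herm_le[of x "fst z"] norm_fst_le[of "fst z" "snd z"] x by (intro power_mono) (simp_all)
  assume y: "y \<in> {x. norm x = 1}"
  show "coherence x y \<le> 1" using x y by (simp add: coherence_le_1)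
  assume ab: "0 \<le> a" "0 \<le> b" "a + b < \<Lambda>"
  have L: "0 < \<Lambda>" using ab by simp
  have D: "DIM('a ^ 'n) + 1 = 2 * DIM('a) + 2 * q" using dim by simp
  define K where "K = (\<Lambda> / sqrt ((\<Lambda> - a) * (\<Lambda> - b) - a * b * coherence x y)) ^ DIM('a)"
  have m1: "(\<lambda>z. ennreal (exp (- \<Lambda> * (norm z)\<^sup>2 + a * (norm (herm mul cj x z))\<^sup>2 + b * (norm (herm mul cj y z))\<^sup>2))) \<in> borel_measurable lborel"
    unfolding measurable_lborel2
    by (intro measurable_compose[OF _ measurable_ennreal] borel_measurable_continuous_onI continuous_intros)
  have "(\<integral>\<^sup>+z. ennreal (exp (- \<Lambda> * (norm z)\<^sup>2 + a * (norm (herm mul cj x (fst z)))\<^sup>2 + b * (norm (herm mul cj y (fst z)))\<^sup>2)) \<partial>(lborel :: (('a ^ 'n) \<times> real) measure))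
    = (\<integral>\<^sup>+z. ennreal (exp (- \<Lambda> * (norm z)\<^sup>2 + a * (norm (herm mul cj x (fst z)))\<^sup>2 + b * (norm (herm mul cj y (fst z)))\<^sup>2)) \<partial>((lborel :: ('a ^ 'n) measure) \<Otimes>\<^sub>M (lborel :: real measure)))"
    by (simp only: lborel_prod)
  also have "\<dots> = (\<integral>\<^sup>+z. \<integral>\<^sup>+s. ennreal (exp (- \<Lambda> * (norm (z, s))\<^sup>2 + a * (norm (herm mul cj x z))\<^sup>2 + b * (norm (herm mul cj y z))\<^sup>2)) \<partial>(lborel :: real measure) \<partial>lborel)"
  proof (subst lborel.nn_integral_fst[symmetric])
    have "(\<lambda>z. ennreal (exp (- \<Lambda> * (norm z)\<^sup>2 + a * (norm (herm mul cj x (fst z)))\<^sup>2 + b * (norm (herm mul cj y (fst z)))\<^sup>2))) \<in> borel_measurable (borel :: (('a ^ 'n) \<times> real) measure)"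
      by (intro measurable_compose[OF _ measurable_ennreal] borel_measurable_continuous_onI continuous_intros)
    then show "(\<lambda>z. ennreal (exp (- \<Lambda> * (norm z)\<^sup>2 + a * (norm (herm mul cj x (fst z)))\<^sup>2 + b * (norm (herm mul cj y (fst z)))\<^sup>2))) \<in> borel_measurable ((lborel :: ('a ^ 'n) measure) \<Otimes>\<^sub>M (lborel :: real measure))"
      by (simp add: lborel_prod)
  qed simp
  also have "\<dots> = (\<integral>\<^sup>+z. ennreal (exp (- \<Lambda> * (norm z)\<^sup>2 + a * (norm (herm mul cj x z))\<^sup>2 + b * (norm (herm mul cj y z))\<^sup>2)) * (ennreal (1 / sqrt \<Lambda>) * gauss_const TYPE(real)) \<partial>lborel)"
  proof (rule nn_integral_cong)
    fix z :: "'a ^ 'n"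
    have "exp (- \<Lambda> * (norm (z, s))\<^sup>2 + A + B) = exp (- \<Lambda> * (norm z)\<^sup>2 + A + B) * exp (- \<Lambda> * (norm s)\<^sup>2 + 2 * inner 0 s)" for s A B :: real
      by (simp add: norm_Pair exp_add[symmetric] algebra_simps)
    then have "(\<integral>\<^sup>+s. ennreal (exp (- \<Lambda> * (norm (z, s))\<^sup>2 + A + B)) \<partial>(lborel :: real measure))
      = ennreal (exp (- \<Lambda> * (norm z)\<^sup>2 + A + B)) * (\<integral>\<^sup>+s. ennreal (exp (- \<Lambda> * (norm s)\<^sup>2 + 2 * inner 0 s)) \<partial>(lborel :: real measure))" for A B
      by (simp only: ennreal_mult'[OF exp_ge_zero]) (rule nn_integral_cmult, simp)
    then show "(\<integral>\<^sup>+s. ennreal (exp (- \<Lambda> * (norm (z, s))\<^sup>2 + a * (norm (herm mul cj x z))\<^sup>2 + b * (norm (herm mul cj y z))\<^sup>2)) \<partial>(lborel :: real measure))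
      = ennreal (exp (- \<Lambda> * (norm z)\<^sup>2 + a * (norm (herm mul cj x z))\<^sup>2 + b * (norm (herm mul cj y z))\<^sup>2)) * (ennreal (1 / sqrt \<Lambda>) * gauss_const TYPE(real))"
      unfolding nn_integral_gauss[OF L] by simp
  qed
  also have "\<dots> = ennreal ((1 / sqrt \<Lambda>) ^ DIM('a ^ 'n) * K) * gauss_const TYPE('a ^ 'n) * (ennreal (1 / sqrt \<Lambda>) * gauss_const TYPE(real))"
    using m1 x y unfolding K_def coherence_def by (subst nn_integral_multc) (simp_all only: gaussian_law ab mem_Collect_eq)
  also have "\<dots> = ennreal (sqrt pi ^ (DIM('a ^ 'n) + 1) * ((1 / sqrt \<Lambda>) ^ (DIM('a ^ 'n) + 1) * K))"
    unfolding gauss_const_eq using L by (simp add: ennreal_mult''[symmetric] ennreal_mult'[symmetric] mult_ac del: DIM_cart)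
  also have "(1 / sqrt \<Lambda>) ^ (DIM('a ^ 'n) + 1) * K = (1 / \<Lambda>) ^ q * (1 / sqrt ((\<Lambda> - a) * (\<Lambda> - b) - a * b * coherence x y)) ^ DIM('a)"
    unfolding D K_def using sqrt_power_split[OF L, of "DIM('a)" q "1 / sqrt ((\<Lambda> - a) * (\<Lambda> - b) - a * b * coherence x y)"] by simp
  finally show "(\<integral>\<^sup>+z. ennreal (exp (- \<Lambda> * (norm z)\<^sup>2 + a * (norm (herm mul cj x (fst z)))\<^sup>2 + b * (norm (herm mul cj y (fst z)))\<^sup>2)) \<partial>(lborel :: (('a ^ 'n) \<times> real) measure))
    = ennreal (sqrt pi ^ (DIM('a ^ 'n) + 1) * ((1 / \<Lambda>) ^ q * (1 / sqrt ((\<Lambda> - a) * (\<Lambda> - b) - a * b * coherence x y)) ^ DIM('a)))" .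
qed (use q in \<open>auto simp: coherence_def\<close>)

end

section \<open>The three scalar algebras and the four families of spaces\<close>

lemma hermitian_scalars_real: "hermitian_scalars (*) (\<lambda>a. a) (1 :: real)"
  by (intro hermitian_scalars.intro) (auto simp: bounded_bilinear_mult bounded_linear_ident abs_mult)

lemma hermitian_scalars_complex: "hermitian_scalars (*) cnj 1"
  by (intro hermitian_scalars.intro)
    (auto simp: bounded_bilinear_mult bounded_linear_cnj norm_mult inner_complex_def algebra_simps)

lemma hermitian_scalars_quat: "hermitian_scalars qmul qcnj (1, 0)"
proof (intro hermitian_scalars.intro)
  show "bounded_linear qcnj"
    by (rule linear_conv_bounded_linear[THEN iffD1]) (auto intro!: linearI simp: qcnj_def)
  show "inner a (qmul b (qcnj c)) = inner (qmul (qcnj a) b) c" for a b c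
    by (simp add: qmul_def qcnj_def inner_prod_def inner_complex_def algebra_simps)
  show "qcnj (qcnj a) = a" for a by (simp add: qcnj_def)
  show "qmul (1, 0) a = a" for a by (simp add: qmul_def)
qed (fact bounded_bilinear_qmul qmul_assoc qcnj_qmul norm_qmul norm_qcnj)+

lemma ceiling_half_odd: "odd d \<Longrightarrow> \<lceil>(real d + 1) / 2\<rceil> = int ((d + 1) div 2)"
  and ceiling_half_even: "even d \<Longrightarrow> \<lceil>(real d + 1) / 2\<rceil> = int (d div 2 + 1)"
proof -
  show "\<lceil>(real d + 1) / 2\<rceil> = int ((d + 1) div 2)" if "odd d"
    using that by (intro ceiling_unique) (auto elim!: oddE)
  show "\<lceil>(real d + 1) / 2\<rceil> = int (d div 2 + 1)" if "even d"
    using that by (intro ceiling_unique) (auto elim!: evenE)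
qed

theorem theorem2p4:
  fixes t \<delta> :: real
  assumes "0 < t" and "t \<le> pi"
  shows "(\<forall>d. 3 \<le> d \<and> CARD('n::finite) = d + 1 \<and> \<delta> \<ge> of_int \<lceil>(real d + 1) / 2\<rceil> \<longrightarrow>
            strictly_pos_def_on (real_proj_space :: (real ^ 'n) set set) real_proj_dist
              (trunc_power t \<delta>)) \<and>
         (\<forall>d. 4 \<le> d \<and> even d \<and> CARD('m::finite) = d div 2 + 1 \<and> \<delta> \<ge> of_int \<lceil>(real d + 1) / 2\<rceil> \<longrightarrow>
            strictly_pos_def_on (complex_proj_space :: (complex ^ 'm) set set) complex_proj_dist
              (trunc_power t \<delta>)) \<and>
         (\<forall>d. 8 \<le> d \<and> 4 dvd d \<and> CARD('k::finite) = d div 4 + 1 \<and> \<delta> \<ge> of_int \<lceil>(real d + 1) / 2\<rceil> \<longrightarrow>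
            strictly_pos_def_on (quat_proj_space :: (quat ^ 'k) set set) quat_proj_dist
              (trunc_power t \<delta>)) \<and>
         (\<delta> \<ge> 9 \<longrightarrow> strictly_pos_def_on cayley_plane cayley_dist (trunc_power t \<delta>))"
proof (intro conjI allI impI; (elim conjE)?)
  fix d assume d: "3 \<le> d" "CARD('n) = d + 1" and \<delta>: "of_int \<lceil>(real d + 1) / 2\<rceil> \<le> \<delta>"
  interpret hermitian_scalars "(*)" "\<lambda>a. a" "1 :: real" by (rule hermitian_scalars_real)
  have R: "radial_inverse DIM(real) (return borel 0) (\<lambda>_. 1) (2 * pi) (return borel 0) (\<lambda>_. 1) 0 1"
    using real_radial_inverse by simp
  show "strictly_pos_def_on (real_proj_space :: (real ^ 'n) set set) real_proj_dist (trunc_power t \<delta>)"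
  \<comment> \<open>The real dimension of the vectors is d + 1. For odd d it is even and q =
    (d-1)/2; for even d the extra Gaussian variable gives q = d/2. As r = 0, the threshold q + 1 is
    the stated ceiling in both cases.\<close>
  proof (cases "odd d")
    case True
    then obtain k where k: "d = 2 * k + 1" by (rule oddE)
    show ?thesis
    proof (rule proj_strictly_pos_def[OF inverse_point_law_even[OF R] assms])
      show "0 < k" using d k by simp
      show "CARD('n) * DIM(real) = 2 * DIM(real) + 2 * k" using d k by simp
      show "real (Suc (k + 0)) \<le> \<delta>" using \<delta> unfolding ceiling_half_odd[OF True] by (simp add: k)
    qed
  next
    case False
    then have ev: "even d" by simp
    then obtain k where k: "d = 2 * k" by (rule evenE)
    show ?thesis
    proof (rule proj_strictly_pos_def[OF inverse_point_law_odd[OF R] assms])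
      show "0 < k" using d k by simp
      show "CARD('n) * DIM(real) + 1 = 2 * DIM(real) + 2 * k" using d k by simp
      show "real (Suc (k + 0)) \<le> \<delta>" using \<delta> unfolding ceiling_half_even[OF ev] by (simp add: k)
    qed
  qed
next
  fix d assume d: "4 \<le> d" "even d" "CARD('m) = d div 2 + 1" and \<delta>: "of_int \<lceil>(real d + 1) / 2\<rceil> \<le> \<delta>"
  interpret hermitian_scalars "(*)" cnj "1" by (rule hermitian_scalars_complex)
  have R: "radial_inverse DIM(complex) (rad_measure 0) (\<lambda>\<nu>. \<bar>sin \<nu>\<bar>) (sphere_const 0 * (2 * 4 ^ 0 * beta_const 0 0))
    arc_measure cos (Suc 0) (sphere_const 0 * (2 ^ 0 * fact 0))"
    using even_radial_inverse[of 0] by simp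
  obtain k where k: "d = 2 * k" using d(2) by (rule evenE)
  show "strictly_pos_def_on (complex_proj_space :: (complex ^ 'm) set set) complex_proj_dist (trunc_power t \<delta>)"
  \<comment> \<open>Here \<kappa> = 2, q = d/2 - 1 and r = 1, so the threshold is d/2 + 1.\<close>
  proof (rule proj_strictly_pos_def[OF inverse_point_law_even[OF R] assms])
    show "0 < k - 1" using d k by simp
    show "CARD('m) * DIM(complex) = 2 * DIM(complex) + 2 * (k - 1)" using d k by simp
    show "real (Suc (k - 1 + Suc 0)) \<le> \<delta>" using \<delta> d unfolding ceiling_half_even[OF d(2)] by (simp add: k)
  qed
next
  fix d assume d: "8 \<le> d" "4 dvd d" "CARD('k) = d div 4 + 1" and \<delta>: "of_int \<lceil>(real d + 1) / 2\<rceil> \<le> \<delta>"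
  interpret hermitian_scalars qmul qcnj "(1, 0)" by (rule hermitian_scalars_quat)
  have R: "radial_inverse DIM(quat) (rad_measure 1) (\<lambda>\<nu>. \<bar>sin \<nu>\<bar>) (sphere_const 1 * (2 * 4 ^ 1 * beta_const 1 1))
    arc_measure cos (Suc 1) (sphere_const 1 * (2 ^ 1 * fact 1))"
    using even_radial_inverse[of 1] by simp
  obtain k where k: "d = 4 * k" using d(2) by (rule dvdE)
  have ev: "even d" by (simp add: k)
  show "strictly_pos_def_on (quat_proj_space :: (quat ^ 'k) set set) quat_proj_dist (trunc_power t \<delta>)"
  \<comment> \<open>Here \<kappa> = 4, q = d/2 - 2 and r = 2, so the threshold is again d/2 +
    1.\<close>
  proof (rule proj_strictly_pos_def[OF inverse_point_law_even[OF R] assms])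
    show "0 < 2 * (k - 1)" using d k by simp
    show "CARD('k) * DIM(quat) = 2 * DIM(quat) + 2 * (2 * (k - 1))" using d k by simp
    show "real (Suc (2 * (k - 1) + Suc 1)) \<le> \<delta>" using \<delta> d unfolding ceiling_half_even[OF ev] by (simp add: k)
  qed
next
  assume "9 \<le> \<delta>"
  then show "strictly_pos_def_on cayley_plane cayley_dist (trunc_power t \<delta>)"
    by (rule cayley_strictly_pos_def[OF assms])
qed

end
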